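(* Let $q\in[0,1]$, let $\hat u\in\mathbb H^{0;q}_{\omega,m}$ and $\hat w\in\mathbb W^{1,1;-q}_{\omega,m}$ (spaces as in the context), and let $a(r,\theta)=a_1(r,\theta)a_2(r,\theta)$ for some nonnegative functions $a_1,a_2$ (not necessarily continuous). With $W$ the microlocal commutator of the context, $$\sum_{m\in\mathbb Z}\int_{\mathbb R}\int_0^\pi\int_{r_+}^\infty a^2\big|W(\hat w*\hat u)-\hat w*W\hat u\big|^2\sin\theta\,dr\,d\theta\,d\omega\ \lesssim\ \sup_{(r,\theta)}\Big(a_1^2\|\hat w\|^2_{\mathbb W^{1,1;-q}_{\omega,m}}\Big)\cdot\int_0^\pi\int_{r_+}^\infty a_2^2\,\|\hat u\|^2_{\mathbb H^{0;q}_{\omega,m}}\sin\theta\,dr\,d\theta ,$$ where the implicit constant depends only on the Kerr parameters (denoted $M$ and $a$ in the context; not to be confused with the weight $a(r,\theta)$).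
   Context: **Kerr.** $0<a<M$ (standing assumption), $r_+=M+\sqrt{M^2-a^2}$, $\Delta=r^2-2Mr+a^2$, $v=\Delta^{1/2}/(r^2+a^2)$, $v_0=\sup_{r>r_+}v=v(r_0)$; $h_0$ is the increasing function of $r$ with $h_0^2=1-v_0^{-2}v^2$; $R^\star=\frac\Delta{r^2+a^2}\partial_r$, also denoted by $'$. $\mathcal R=\mathbb R_t\times(r_+,\infty)_r\times\mathbb S^2_{\theta,\phi}$. For $u$ on $\mathcal R$, $\hat u(\omega,r,\theta,m)=(2\pi)^{-1}\int_{\mathbb R}\int_0^{2\pi}e^{i(\omega t-m\phi)}u\,d\phi\,dt$, $(\omega,m)\in\mathbb R\times\mathbb Z$. Convolution: $(\hat f*\hat g)(\omega,m,r,\theta)=\sum_{m'}\int_{\mathbb R}\hat f(\omega',m',r,\theta)\hat g(\omega-\omega',m-m',r,\theta)\,d\omega'$. $\omega_r=\frac{am}{r^2+a^2}$, $\omega_+=\frac{am}{r_+^2+a^2}$. **Frequency constants** (fixed once and for all, depending only on the Kerr parameters). For $\omega\ne0$, $m\omega\notin(0,m\omega_+]$, $r_\natural=r_\natural(\omega,m)\in(r_+,\infty)$ is the unique zero of $R^\star((\omega-\omega_r)^2/v^2)$. Positive constants $\xi_\ell,\xi_r,\delta^\sharp$ (suitably small) and $r_+<\underline r^\sharp<\overline r^\sharp<\infty$ are fixed such that in particular $\xi_\ell=\frac1{8\overline r^\sharp}$; $r_\natural<\underline r^\sharp$ for $m\omega\in(m\omega_+,m\omega_++\xi_rm^2)$;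 $r_\natural<\overline r^\sharp$ for $m\omega\in(-\xi_\ell m^2,-\frac12\xi_\ell m^2]$; and $\xi_r<\frac{a((\underline r^\sharp)^2-r_+^2)}{((\underline r^\sharp)^2+a^2)(r_+^2+a^2)}$. Define $\mathcal G=\{(\omega,m):m\omega\in(-\xi_\ell m^2,m\omega_++\xi_rm^2)\}$, $\mathcal G'=\{(\omega,m):m\omega\notin(-\frac12\xi_\ell m^2,m\omega_++\frac12\xi_rm^2)\}$ (containing all $m=0$). On $\mathcal G$: $R^\sharp=\overline r^\sharp$ if $-\xi_\ell m^2<m\omega\le\frac{am^2}{(\overline r^\sharp)^2+a^2}$; $R^\sharp=\underline r^\sharp$ if $\frac{am^2}{(\underline r^\sharp)^2+a^2}\le m\omega<m\omega_++\xi_rm^2$; in between $R^\sharp=r^\sharp$, the radius where $\omega-\omega_r=0$. $R^{\sharp\sharp}$ is a smooth function on $\mathcal G$, homogeneous of degree $0$ in $(\omega,m)$ (i.e. a smooth function of $\omega/m$), with $R^\sharp\le R^{\sharp\sharp}<R^\sharp+\frac14\delta^\sharp$. **Cut-offs.** $\tilde\chi_i=\chi_i(\omega/m)$ for $m\ne0$, $\tilde\chi_i=1$ for $m=0$ ($i=1,2$), where $\chi_1,\chi_2$ are smooth with values in $[0,1]$; $\chi_1(y)=1$ for $y\le-\xi_\ell$ or $y\ge\frac a{r_+^2+a^2}+\xi_r$, $\chi_1=0$ for $-\frac34\xi_\ell\le y\le\frac a{r_+^2+a^2}+\frac34\xi_r$; $\chi_2(y)=1$ for $y\le-\frac34\xi_\ell$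 or $y\ge\frac a{r_+^2+a^2}+\frac34\xi_r$, $\chi_2=0$ for $-\frac12\xi_\ell\le y\le\frac a{r_+^2+a^2}+\frac12\xi_r$. On $\mathcal G$, $\chi_\sharp$ is smooth with values in $[0,1]$, homogeneous of degree $0$ in $(\omega,m)$, $\chi_\sharp=0$ for $r\le R^{\sharp\sharp}+\frac14\delta^\sharp$, $\chi_\sharp=1$ for $r\ge R^{\sharp\sharp}+\frac12\delta^\sharp$, $0\le\chi_\sharp'\le C$ uniformly (a fixed profile in $r-R^{\sharp\sharp}$). $\chi_{\overline r^\sharp}$ is a smooth nonnegative function of $r$ only, $=1$ for $r<\overline r^\sharp+\frac78\delta^\sharp$, $=0$ for $r>\overline r^\sharp+\delta^\sharp$. **Commutator.** On $\mathcal G'\setminus\{(0,0)\}$: $f_\natural=\mp\big(\frac{(\omega-\omega_r)^2}{\omega^2v^2}-\inf_{r>r_+}\frac{(\omega-\omega_r)^2}{\omega^2v^2}\big)^{1/2}$ with sign $-$ for $r<r_\natural$ and $+$ for $r\ge r_\natural$; $h_\natural=\frac{\omega vf_\natural}{\omega-\omega_r}$. On $\mathcal G$: $h_\sharp=1$ if $(\omega,m)\notin\mathcal G'$; $h_\sharp=\big(1-\tilde\chi_2\frac{v^2}{(\omega-\omega_r)^2}\inf_{r>r_+}\frac{(\omega-\omega_r)^2}{v^2}\big)^{1/2}$ if $(\omega,m)\in\mathcal G'$ and $\tilde\chi_2<1$; $h_\sharp=h_\natural$ if $(\omega,m)\in\mathcal G'$ and $\tilde\chi_2=1$. $W^\natural=v^{-1}R^\star-i\omega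 f_\natural$, $W^\sharp=v^{-1}(R^\star-i(\omega-\omega_r)h_\sharp)$, $W=\tilde\chi_1W^\natural+(1-\tilde\chi_1)\chi_\sharp W^\sharp$, and $W_0\hat u=v^{-1}(R^\star\hat u-ih_0(\omega-\omega_r)\hat u)$. **Norms** (evaluated at each $(r,\theta)$). $\|\hat w\|_{\mathbb W^{1,1;-q}_{\omega,m}}=\|\omega\hat w\|_{\ell^1_mL^1_\omega}+\|m\hat w\|_{\ell^1_mL^1_\omega}+\|v^{-q}W_0\hat w\|_{\ell^1_mL^1_\omega}$ and $\|\hat u\|_{\mathbb H^{0;q}_{\omega,m}}=\|v^q\hat u\|_{\ell^2_mL^2_\omega}+\Big\|\chi_{\overline r^\sharp}^{1/2}\frac{W_0\hat u}{\max(|m|,|\omega|,1)}\Big\|_{\ell^2_mL^2_\omega}$; the corresponding spaces are the closures of $\{\hat u:u\in C_0^\infty(\mathcal R)\}$ under these norms.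
   Formalization: The function R^{♯♯} is assumed smooth in ω/m up to the end points of the interval defining G (it extends smoothly to the whole line); with mere smoothness on the open set G it could oscillate so wildly at the ends that no finite constant exists. *)

theory Defs
  imports "HOL-Analysis.Analysis"
begin

section \<open>Smooth functions\<close>

primrec Ck :: "nat \<Rightarrow> ('a::euclidean_space \<Rightarrow> 'b::real_normed_vector) \<Rightarrow> bool" where
  "Ck 0 f = continuous_on UNIV f"
| "Ck (Suc k) f = ((\<forall>x. f differentiable (at x)) \<and>
     (\<forall>e. Ck k (\<lambda>x. frechet_derivative f (at x) e)))"

definition smooth :: "('a::euclidean_space \<Rightarrow> 'b::real_normed_vector) \<Rightarrow> bool" where
  "smooth f \<longleftrightarrow> (\<forall>k. Ck k f)"

section \<open>Kerr parameters and the objects fixed once and for all\<close>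

text \<open>
  The record collects \<open>M\<close>, \<open>a\<close> and everything that is fixed depending only on them:
  the constants \<open>\<xi>\<^sub>\<ell>\<close>, \<open>\<xi>\<^sub>r\<close>, \<open>\<delta>\<close>-sharp; the radii \<open>r_lo < r_hi\<close> (lower and upper
  \<open>r\<close>-sharp); the function \<open>h\<^sub>0\<close>; the cut-offs \<open>\<chi>\<^sub>1, \<chi>\<^sub>2\<close> (functions of \<open>y = \<omega>/m\<close>);
  \<open>psi\<close>, the profile of \<open>\<chi>\<close>-sharp, as a function of \<open>r - R\<close>-double-sharp; \<open>chi_hi\<close>, the cut-off
  in \<open>r\<close> attached to \<open>r_hi\<close>; and \<open>Rss\<close>, which is \<open>R\<close>-double-sharp as a function of
  \<open>y = \<omega>/m\<close>.  Which data are admissible is said in \<open>kerr_setup\<close> below.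
\<close>

record kerr_data =
  Mass :: real
  Spin :: real
  xi_l :: real
  xi_r :: real
  del :: real
  r_lo :: real
  r_hi :: real
  h0 :: "real \<Rightarrow> real"
  chi1 :: "real \<Rightarrow> real"
  chi2 :: "real \<Rightarrow> real"
  psi :: "real \<Rightarrow> real"
  chi_hi :: "real \<Rightarrow> real"
  Rss :: "real \<Rightarrow> real"

definition rp :: "kerr_data \<Rightarrow> real" where
  "rp P = Mass P + sqrt ((Mass P)\<^sup>2 - (Spin P)\<^sup>2)"

definition Delta :: "kerr_data \<Rightarrow> real \<Rightarrow> real" where
  "Delta P r = r\<^sup>2 - 2 * Mass P * r + (Spin P)\<^sup>2"

definition vel :: "kerr_data \<Rightarrow> real \<Rightarrow> real" where
  "vel P r = sqrt (Delta P r) / (r\<^sup>2 + (Spin P)\<^sup>2)"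

definition vel0 :: "kerr_data \<Rightarrow> real" where
  "vel0 P = (SUP r\<in>{rp P<..}. vel P r)"

definition Rstar :: "kerr_data \<Rightarrow> (real \<Rightarrow> 'b::real_normed_vector) \<Rightarrow> real \<Rightarrow> 'b" where
  "Rstar P f r = (Delta P r / (r\<^sup>2 + (Spin P)\<^sup>2)) *\<^sub>R vector_derivative f (at r)"

definition om_r :: "kerr_data \<Rightarrow> int \<Rightarrow> real \<Rightarrow> real" where
  "om_r P m r = Spin P * of_int m / (r\<^sup>2 + (Spin P)\<^sup>2)"

definition om_plus :: "kerr_data \<Rightarrow> int \<Rightarrow> real" where
  "om_plus P m = Spin P * of_int m / ((rp P)\<^sup>2 + (Spin P)\<^sup>2)"

section \<open>Frequency regimes\<close>

definition r_nat :: "kerr_data \<Rightarrow> real \<Rightarrow> int \<Rightarrow> real" where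
  "r_nat P \<omega> m = (THE r. rp P < r \<and> Rstar P (\<lambda>s. (\<omega> - om_r P m s)\<^sup>2 / (vel P s)\<^sup>2) r = 0)"

definition G_set :: "kerr_data \<Rightarrow> (real \<times> int) set" where
  "G_set P = {(\<omega>, m). - xi_l P * (of_int m)\<^sup>2 < of_int m * \<omega> \<and>
      of_int m * \<omega> < of_int m * om_plus P m + xi_r P * (of_int m)\<^sup>2}"

definition G'_set :: "kerr_data \<Rightarrow> (real \<times> int) set" where
  "G'_set P = {(\<omega>, m). \<not> (- (1/2) * xi_l P * (of_int m)\<^sup>2 < of_int m * \<omega> \<and>
      of_int m * \<omega> < of_int m * om_plus P m + (1/2) * xi_r P * (of_int m)\<^sup>2)}"

definition R_sharp :: "kerr_data \<Rightarrow> real \<Rightarrow> int \<Rightarrow> real" where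
  "R_sharp P \<omega> m =
    (if of_int m * \<omega> \<le> Spin P * (of_int m)\<^sup>2 / ((r_hi P)\<^sup>2 + (Spin P)\<^sup>2) then r_hi P
     else if Spin P * (of_int m)\<^sup>2 / ((r_lo P)\<^sup>2 + (Spin P)\<^sup>2) \<le> of_int m * \<omega> then r_lo P
     else (THE r. rp P < r \<and> \<omega> - om_r P m r = 0))"

definition tchi1 :: "kerr_data \<Rightarrow> real \<Rightarrow> int \<Rightarrow> real" where
  "tchi1 P \<omega> m = (if m = 0 then 1 else chi1 P (\<omega> / of_int m))"

definition tchi2 :: "kerr_data \<Rightarrow> real \<Rightarrow> int \<Rightarrow> real" where
  "tchi2 P \<omega> m = (if m = 0 then 1 else chi2 P (\<omega> / of_int m))"

definition chi_sharp :: "kerr_data \<Rightarrow> real \<Rightarrow> int \<Rightarrow> real \<Rightarrow> real" where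
  "chi_sharp P \<omega> m r = psi P (r - Rss P (\<omega> / of_int m))"

text \<open>
  \<open>Rss\<close> is smooth on all of \<open>\<real>\<close> but constrained only for \<open>(\<omega>, m)\<close> in \<open>G_set\<close>: on \<open>G_set\<close>,
  \<open>R\<close>-double-sharp is smooth in \<open>\<omega>/m\<close> up to the two end points of the interval.
  The uniform bound on the \<open>r\<close>-derivative of \<open>\<chi>\<close>-sharp is automatic, because it is a single
  profile with derivative supported in a compact interval.
\<close>

definition kerr_setup :: "kerr_data \<Rightarrow> bool" where
  "kerr_setup P \<longleftrightarrow>
     0 < Spin P \<and> Spin P < Mass P \<and>
     mono_on {rp P<..} (h0 P) \<and>
     (\<forall>r>rp P. (h0 P r)\<^sup>2 = 1 - (vel P r)\<^sup>2 / (vel0 P)\<^sup>2) \<and>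
     0 < xi_l P \<and> 0 < xi_r P \<and> 0 < del P \<and>
     rp P < r_lo P \<and> r_lo P < r_hi P \<and>
     xi_l P = 1 / (8 * r_hi P) \<and>
     (\<forall>\<omega> m. of_int m * om_plus P m < of_int m * \<omega> \<and>
        of_int m * \<omega> < of_int m * om_plus P m + xi_r P * (of_int m)\<^sup>2 \<longrightarrow> r_nat P \<omega> m < r_lo P) \<and>
     (\<forall>\<omega> m. - xi_l P * (of_int m)\<^sup>2 < of_int m * \<omega> \<and>
        of_int m * \<omega> \<le> - (1/2) * xi_l P * (of_int m)\<^sup>2 \<longrightarrow> r_nat P \<omega> m < r_hi P) \<and>
     xi_r P < Spin P * ((r_lo P)\<^sup>2 - (rp P)\<^sup>2) /
        (((r_lo P)\<^sup>2 + (Spin P)\<^sup>2) * ((rp P)\<^sup>2 + (Spin P)\<^sup>2)) \<and>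
     smooth (Rss P) \<and>
     (\<forall>(\<omega>, m)\<in>G_set P. R_sharp P \<omega> m \<le> Rss P (\<omega> / of_int m) \<and>
        Rss P (\<omega> / of_int m) < R_sharp P \<omega> m + del P / 4) \<and>
     smooth (chi1 P) \<and> (\<forall>y. 0 \<le> chi1 P y \<and> chi1 P y \<le> 1) \<and>
     (\<forall>y. y \<le> - xi_l P \<or> Spin P / ((rp P)\<^sup>2 + (Spin P)\<^sup>2) + xi_r P \<le> y \<longrightarrow> chi1 P y = 1) \<and>
     (\<forall>y. - (3/4) * xi_l P \<le> y \<and> y \<le> Spin P / ((rp P)\<^sup>2 + (Spin P)\<^sup>2) + (3/4) * xi_r P
        \<longrightarrow> chi1 P y = 0) \<and>
     smooth (chi2 P) \<and> (\<forall>y. 0 \<le> chi2 P y \<and> chi2 P y \<le> 1) \<and>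
     (\<forall>y. y \<le> - (3/4) * xi_l P \<or> Spin P / ((rp P)\<^sup>2 + (Spin P)\<^sup>2) + (3/4) * xi_r P \<le> y
        \<longrightarrow> chi2 P y = 1) \<and>
     (\<forall>y. - (1/2) * xi_l P \<le> y \<and> y \<le> Spin P / ((rp P)\<^sup>2 + (Spin P)\<^sup>2) + (1/2) * xi_r P
        \<longrightarrow> chi2 P y = 0) \<and>
     smooth (psi P) \<and> (\<forall>x. 0 \<le> psi P x \<and> psi P x \<le> 1) \<and>
     (\<forall>x. x \<le> del P / 4 \<longrightarrow> psi P x = 0) \<and> (\<forall>x. del P / 2 \<le> x \<longrightarrow> psi P x = 1) \<and>
     (\<forall>x. 0 \<le> deriv (psi P) x) \<and>
     smooth (chi_hi P) \<and> (\<forall>r. 0 \<le> chi_hi P r) \<and>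
     (\<forall>r. r < r_hi P + (7/8) * del P \<longrightarrow> chi_hi P r = 1) \<and>
     (\<forall>r. r_hi P + del P < r \<longrightarrow> chi_hi P r = 0)"

section \<open>The microlocal commutator\<close>

text \<open>Functions of \<open>(\<omega>, m, r, \<theta>)\<close>, in this order.\<close>

type_synonym fld = "real \<Rightarrow> int \<Rightarrow> real \<Rightarrow> real \<Rightarrow> complex"

definition f_nat :: "kerr_data \<Rightarrow> real \<Rightarrow> int \<Rightarrow> real \<Rightarrow> real" where
  "f_nat P \<omega> m r = (if r < r_nat P \<omega> m then - 1 else 1) *
     sqrt ((\<omega> - om_r P m r)\<^sup>2 / (\<omega>\<^sup>2 * (vel P r)\<^sup>2)
        - (INF s\<in>{rp P<..}. (\<omega> - om_r P m s)\<^sup>2 / (\<omega>\<^sup>2 * (vel P s)\<^sup>2)))"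

definition h_nat :: "kerr_data \<Rightarrow> real \<Rightarrow> int \<Rightarrow> real \<Rightarrow> real" where
  "h_nat P \<omega> m r = \<omega> * vel P r * f_nat P \<omega> m r / (\<omega> - om_r P m r)"

definition h_sharp :: "kerr_data \<Rightarrow> real \<Rightarrow> int \<Rightarrow> real \<Rightarrow> real" where
  "h_sharp P \<omega> m r =
    (if (\<omega>, m) \<notin> G'_set P then 1
     else if tchi2 P \<omega> m < 1 then
       sqrt (1 - tchi2 P \<omega> m * ((vel P r)\<^sup>2 / (\<omega> - om_r P m r)\<^sup>2) *
          (INF s\<in>{rp P<..}. (\<omega> - om_r P m s)\<^sup>2 / (vel P s)\<^sup>2))
     else h_nat P \<omega> m r)"

definition W_nat :: "kerr_data \<Rightarrow> fld \<Rightarrow> fld" where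
  "W_nat P f \<omega> m r \<theta> =
     of_real (1 / vel P r) * Rstar P (\<lambda>s. f \<omega> m s \<theta>) r
     - \<i> * of_real (\<omega> * f_nat P \<omega> m r) * f \<omega> m r \<theta>"

definition W_sharp :: "kerr_data \<Rightarrow> fld \<Rightarrow> fld" where
  "W_sharp P f \<omega> m r \<theta> =
     of_real (1 / vel P r) *
       (Rstar P (\<lambda>s. f \<omega> m s \<theta>) r
        - \<i> * of_real ((\<omega> - om_r P m r) * h_sharp P \<omega> m r) * f \<omega> m r \<theta>)"

text \<open>
  Outside \<open>G'_set\<close>, where \<open>f_nat\<close> is meaningless, \<open>tchi1\<close> vanishes; outside \<open>G_set\<close>, where
  \<open>chi_sharp\<close> and \<open>h_sharp\<close> are meaningless, \<open>1 - tchi1\<close> vanishes.  The junk value of \<open>f_nat\<close> at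
  \<open>\<omega> = m = 0\<close> is harmless, since this is a null set of frequencies.
\<close>

definition W_op :: "kerr_data \<Rightarrow> fld \<Rightarrow> fld" where
  "W_op P f \<omega> m r \<theta> =
     of_real (tchi1 P \<omega> m) * W_nat P f \<omega> m r \<theta>
     + of_real ((1 - tchi1 P \<omega> m) * chi_sharp P \<omega> m r) * W_sharp P f \<omega> m r \<theta>"

definition W0_op :: "kerr_data \<Rightarrow> fld \<Rightarrow> fld" where
  "W0_op P f \<omega> m r \<theta> =
     of_real (1 / vel P r) *
       (Rstar P (\<lambda>s. f \<omega> m s \<theta>) r
        - \<i> * of_real (h0 P r * (\<omega> - om_r P m r)) * f \<omega> m r \<theta>)"

definition conv :: "fld \<Rightarrow> fld \<Rightarrow> fld" where
  "conv f g \<omega> m r \<theta> =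
     (LINT m'|count_space UNIV. LINT \<omega>'|lborel.
        f \<omega>' m' r \<theta> * g (\<omega> - \<omega>') (m - m') r \<theta>)"

definition commutator :: "kerr_data \<Rightarrow> fld \<Rightarrow> fld \<Rightarrow> fld" where
  "commutator P w u \<omega> m r \<theta> =
     W_op P (conv w u) \<omega> m r \<theta> - conv w (W_op P u) \<omega> m r \<theta>"

section \<open>Test functions and their Fourier transforms\<close>

definition sph :: "real \<Rightarrow> real \<Rightarrow> real ^ 3" where
  "sph \<theta> \<phi> = vector [sin \<theta> * cos \<phi>, sin \<theta> * sin \<phi>, cos \<theta>]"

text \<open>
  The manifold with coordinates \<open>(t, r, \<theta>, \<phi>)\<close> is identified, by the diffeomorphism
  \<open>(t, r, \<sigma>) \<mapsto> (t, r \<sigma>)\<close> with \<open>\<sigma>\<close> in the unit sphere, with the open subset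
  \<open>{(t, x). rp P < norm x}\<close> of four-dimensional Euclidean space.
\<close>

definition test_funs :: "kerr_data \<Rightarrow> (real \<times> (real ^ 3) \<Rightarrow> complex) set" where
  "test_funs P = {F. smooth F \<and>
     (\<exists>S. compact S \<and> S \<subseteq> {(t, x). rp P < norm x} \<and> (\<forall>z. z \<notin> S \<longrightarrow> F z = 0))}"

definition ft :: "(real \<times> (real ^ 3) \<Rightarrow> complex) \<Rightarrow> fld" where
  "ft F \<omega> m r \<theta> = of_real (1 / (2 * pi)) *
     (LINT t|lborel. set_lebesgue_integral lborel {0..2 * pi}
        (\<lambda>\<phi>. exp (\<i> * of_real (\<omega> * t - of_int m * \<phi>)) * F (t, r *\<^sub>R sph \<theta> \<phi>)))"

section \<open>Norms and spaces\<close>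

definition ennsqrt :: "ennreal \<Rightarrow> ennreal" where
  "ennsqrt x = (if x = \<infinity> then \<infinity> else ennreal (sqrt (enn2real x)))"

definition l1L1 :: "(real \<Rightarrow> int \<Rightarrow> complex) \<Rightarrow> ennreal" where
  "l1L1 f = (\<integral>\<^sup>+m. \<integral>\<^sup>+\<omega>. ennreal (norm (f \<omega> m)) \<partial>lborel \<partial>count_space UNIV)"

definition l2L2 :: "(real \<Rightarrow> int \<Rightarrow> complex) \<Rightarrow> ennreal" where
  "l2L2 f = ennsqrt (\<integral>\<^sup>+m. \<integral>\<^sup>+\<omega>. ennreal ((norm (f \<omega> m))\<^sup>2) \<partial>lborel \<partial>count_space UNIV)"

text \<open>
  At fixed \<open>(r, \<theta>)\<close> both norms see a function only through its value and its image under
  \<open>W0_op\<close>, which involves a derivative in \<open>r\<close>.  Since limits of test functions in these norms need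
  not be differentiable, an element of the closures is a pair \<open>(f, f0)\<close>, where \<open>f0\<close> plays the
  role of \<open>W0_op P f\<close>; for a test function \<open>F\<close> the pair is \<open>(ft F, W0_op P (ft F))\<close>.
\<close>

definition H_norm :: "kerr_data \<Rightarrow> real \<Rightarrow> fld \<times> fld \<Rightarrow> real \<times> real \<Rightarrow> ennreal" where
  "H_norm P q u = (\<lambda>(r, \<theta>).
     l2L2 (\<lambda>\<omega> m. of_real (vel P r powr q) * fst u \<omega> m r \<theta>)
     + l2L2 (\<lambda>\<omega> m. of_real (sqrt (chi_hi P r)) * (snd u \<omega> m r \<theta> /
         of_real (max (max \<bar>of_int m\<bar> \<bar>\<omega>\<bar>) 1))))"

definition W_norm :: "kerr_data \<Rightarrow> real \<Rightarrow> fld \<times> fld \<Rightarrow> real \<times> real \<Rightarrow> ennreal" where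
  "W_norm P q w = (\<lambda>(r, \<theta>).
     l1L1 (\<lambda>\<omega> m. of_real \<omega> * fst w \<omega> m r \<theta>)
     + l1L1 (\<lambda>\<omega> m. of_int m * fst w \<omega> m r \<theta>)
     + l1L1 (\<lambda>\<omega> m. of_real (vel P r powr (- q)) * snd w \<omega> m r \<theta>))"

definition pair_diff :: "kerr_data \<Rightarrow> fld \<times> fld \<Rightarrow> (real \<times> (real ^ 3) \<Rightarrow> complex) \<Rightarrow> fld \<times> fld" where
  "pair_diff P u F =
     ((\<lambda>\<omega> m r \<theta>. fst u \<omega> m r \<theta> - ft F \<omega> m r \<theta>),
      (\<lambda>\<omega> m r \<theta>. snd u \<omega> m r \<theta> - W0_op P (ft F) \<omega> m r \<theta>))"

definition dom_rt :: "kerr_data \<Rightarrow> (real \<times> real) set" where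
  "dom_rt P = {rp P<..} \<times> {0<..<pi}"

definition meas_fld :: "kerr_data \<Rightarrow> fld \<Rightarrow> bool" where
  "meas_fld P f \<longleftrightarrow> (\<lambda>(\<omega>, m, r, \<theta>). f \<omega> m r \<theta>) \<in> borel_measurable
     (lborel \<Otimes>\<^sub>M (count_space UNIV \<Otimes>\<^sub>M restrict_space lborel (dom_rt P)))"

text \<open>
  The spaces are formed at each \<open>(r, \<theta>)\<close>: the slice of the pair at \<open>(r, \<theta>)\<close> is a limit, in the
  norm at \<open>(r, \<theta>)\<close>, of slices of test functions.
\<close>

definition H_space :: "kerr_data \<Rightarrow> real \<Rightarrow> (fld \<times> fld) set" where
  "H_space P q = {u. meas_fld P (fst u) \<and> meas_fld P (snd u) \<and>
     (\<forall>z\<in>dom_rt P. \<exists>F. range F \<subseteq> test_funs P \<and>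
        (\<lambda>n::nat. H_norm P q (pair_diff P u (F n)) z) \<longlonglongrightarrow> 0)}"

definition W_space :: "kerr_data \<Rightarrow> real \<Rightarrow> (fld \<times> fld) set" where
  "W_space P q = {w. meas_fld P (fst w) \<and> meas_fld P (snd w) \<and>
     (\<forall>z\<in>dom_rt P. \<exists>F. range F \<subseteq> test_funs P \<and>
        (\<lambda>n::nat. W_norm P q (pair_diff P w (F n)) z) \<longlonglongrightarrow> 0)}"

text \<open>
  For elements of the closures the convolution and its \<open>r\<close>-derivative need not exist (the norm of
  \<open>w\<close> does not control \<open>w\<close> itself near \<open>\<omega> = m = 0\<close>, that of \<open>u\<close> contains no \<open>r\<close>-derivative for
  large \<open>r\<close>), so there the commutator is the continuous extension of \<open>commutator\<close> from test
  functions.  \<open>is_commutator P q w u K\<close> says that \<open>K\<close> represents its value at \<open>(w, u)\<close>: whenever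
  test functions converge to \<open>w\<close> and \<open>u\<close> at \<open>(r, \<theta>)\<close>, their commutators converge to \<open>K\<close> in
  \<open>l2L2\<close> at \<open>(r, \<theta>)\<close>.  Constant sequences show that for test functions \<open>K\<close> is
  \<open>commutator\<close> itself, up to null sets of frequencies.
\<close>

definition is_commutator ::
    "kerr_data \<Rightarrow> real \<Rightarrow> fld \<times> fld \<Rightarrow> fld \<times> fld \<Rightarrow> fld \<Rightarrow> bool" where
  "is_commutator P q w u K \<longleftrightarrow> meas_fld P K \<and>
     (\<forall>(r, \<theta>)\<in>dom_rt P. \<forall>E F.
        range E \<subseteq> test_funs P \<and> range F \<subseteq> test_funs P \<and>
        (\<lambda>n::nat. W_norm P q (pair_diff P w (E n)) (r, \<theta>)) \<longlonglongrightarrow> 0 \<and>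
        (\<lambda>n::nat. H_norm P q (pair_diff P u (F n)) (r, \<theta>)) \<longlonglongrightarrow> 0 \<longrightarrow>
        (\<lambda>n::nat. l2L2 (\<lambda>\<omega> m. commutator P (ft (E n)) (ft (F n)) \<omega> m r \<theta> - K \<omega> m r \<theta>)) \<longlonglongrightarrow> 0)"

end

theory Submission
  imports Defs
begin

text \<open>
  Write \<open>\<xi> = (\<omega>, m)\<close>. One has \<open>W = A W\<^sub>0 - \<i> D\<close> with real multipliers \<open>A\<close>, \<open>D\<close> depending on \<open>\<xi>\<close> and
  \<open>r\<close>, and \<open>W\<^sub>0\<close> acts on convolutions as a derivation because \<open>\<omega> - \<omega>\<^sub>r\<close> is linear in \<open>\<xi>\<close>. So the
  commutator is the integral over \<open>\<xi>'\<close> of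
  \<open>A(\<xi>) W\<^sub>0w(\<xi>') u(\<xi>-\<xi>') + (A(\<xi>) - A(\<xi>-\<xi>')) w(\<xi>') W\<^sub>0u(\<xi>-\<xi>') - \<i> (D(\<xi>) - D(\<xi>-\<xi>')) w(\<xi>') u(\<xi>-\<xi>')\<close>.
  Here \<open>A\<close> is homogeneous of degree \<open>0\<close> and Lipschitz in the angle, and equals \<open>1\<close> where the cut-off in \<open>r\<close>
  is not \<open>1\<close>, while \<open>D\<close> is homogeneous of degree \<open>1\<close> with Lipschitz constant \<open>O(v)\<close>. The kernel is thus
  dominated by the product of the densities of the two norms, and Young's inequality concludes.

  The bound on \<open>D\<close> is explicit. For \<open>x = m/\<omega>\<close> the critical point \<open>p\<close> of \<open>(\<omega> - \<omega>\<^sub>r)\<^sup>2/v\<^sup>2\<close> is a double root of a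
  quartic polynomial in \<open>r\<close>, so \<open>f\<close>-natural is \<open>(r - p) (Q/\<Delta>)\<^sup>1\<^sup>/\<^sup>2\<close> with a positive quadratic \<open>Q\<close>; multiplying by
  conjugates shows how it cancels against \<open>h\<^sub>0\<close> at the horizon and at infinity.
\<close>

section \<open>Uniformly bounded and uniformly Lipschitz families\<close>

text \<open>The difficulty is uniformity: each bound needs one constant for all radii, although
  \<open>(T r)^2 / Delta P r\<close> is unbounded both at the horizon and at infinity. In
  \<open>ubl\<close> the index is therefore the radius and the variable is the angle of the
  frequency: \<open>x = m/\<omega>\<close> on the support of \<open>tchi1\<close> (which includes
  \<open>m = 0\<close>), and \<open>y = \<omega>/m\<close> on that of \<open>1 - tchi1\<close>
  (which includes \<open>\<omega> = 0\<close>). A square root is Lipschitz only away from the zeros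
  of its radicand. Pulling out \<open>r - p\<close> leaves a radicand bounded below; for
  \<open>h\<close>-sharp the cut-offs force \<open>r\<close> to exceed \<open>p\<close> by a fixed
  amount. Degree 0 makes differences of \<open>A\<close> of size
  \<open>|\<xi>'| / |\<xi> - \<xi>'|\<close>: the denominator is the weight on
  \<open>W\<^sub>0 u\<close>, the numerator the weights on \<open>w\<close>. The \<open>1\<close> in
  the maximum is paid for by the integrality of \<open>m\<close>. On the closures the integral of
  the kernel makes sense for almost every frequency. It is continuous in both norms, hence
  represents the commutator, and every other representative agrees with it.\<close>

definition ubl :: "'i set \<Rightarrow> ('i \<Rightarrow> real set) \<Rightarrow> ('i \<Rightarrow> real \<Rightarrow> real) \<Rightarrow> bool" where
  "ubl I S f \<longleftrightarrow> (\<exists>K\<ge>0. \<forall>i\<in>I. \<forall>x\<in>S i. \<bar>f i x\<bar> \<le> K \<and> (\<forall>y\<in>S i. \<bar>f i x - f i y\<bar> \<le> K * \<bar>x - y\<bar>))"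

lemma ublI:
  assumes "\<And>i x. i \<in> I \<Longrightarrow> x \<in> S i \<Longrightarrow> \<bar>f i x\<bar> \<le> B"
    and "\<And>i x y. i \<in> I \<Longrightarrow> x \<in> S i \<Longrightarrow> y \<in> S i \<Longrightarrow> \<bar>f i x - f i y\<bar> \<le> L * \<bar>x - y\<bar>"
  shows "ubl I S f"
proof -
  define K where "K = max 0 (max B L)"
  have "L * \<bar>x - y\<bar> \<le> K * \<bar>x - y\<bar>" for x y
    by (rule mult_right_mono) (auto simp: K_def)
  note L = order_trans[OF assms(2) this]
  have "B \<le> K" "0 \<le> K" by (auto simp: K_def)
  note B = order_trans[OF assms(1) this(1)]
  show ?thesis
    unfolding ubl_def by (intro exI[of _ K] conjI ballI \<open>0 \<le> K\<close> L B)
qed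

lemma ublE:
  assumes "ubl I S f"
  obtains K where "K \<ge> 0" "\<And>i x. i \<in> I \<Longrightarrow> x \<in> S i \<Longrightarrow> \<bar>f i x\<bar> \<le> K"
    "\<And>i x y. i \<in> I \<Longrightarrow> x \<in> S i \<Longrightarrow> y \<in> S i \<Longrightarrow> \<bar>f i x - f i y\<bar> \<le> K * \<bar>x - y\<bar>"
  using assms unfolding ubl_def by blast

lemma ubl_cong:
  assumes "ubl I S f" "\<And>i x. i \<in> I \<Longrightarrow> x \<in> S i \<Longrightarrow> f i x = g i x"
  shows "ubl I S g"
  using assms(1) by (rule ublE, intro ublI) (auto simp flip: assms(2))

lemma ubl_subset:
  assumes "ubl I S f" "I' \<subseteq> I" "\<And>i. i \<in> I' \<Longrightarrow> S' i \<subseteq> S i"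
  shows "ubl I' S' f"
  using assms(1) by (rule ublE, intro ublI) (use assms(2,3) in blast)+

text \<open>Only index sets are joined, never domains of the variable, so no Lipschitz bound has to
  cross a boundary. This glues ranges of the radius that are treated by different arguments.\<close>

lemma ubl_Un:
  assumes "ubl I S f" "ubl I' S f"
  shows "ubl (I \<union> I') S f"
proof -
  obtain K where K: "K \<ge> 0" "\<And>i x. i \<in> I \<Longrightarrow> x \<in> S i \<Longrightarrow> \<bar>f i x\<bar> \<le> K"
    "\<And>i x y. i \<in> I \<Longrightarrow> x \<in> S i \<Longrightarrow> y \<in> S i \<Longrightarrow> \<bar>f i x - f i y\<bar> \<le> K * \<bar>x - y\<bar>"
    using assms(1) by (rule ublE) blast
  obtain L where L: "L \<ge> 0" "\<And>i x. i \<in> I' \<Longrightarrow> x \<in> S i \<Longrightarrow> \<bar>f i x\<bar> \<le> L"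
    "\<And>i x y. i \<in> I' \<Longrightarrow> x \<in> S i \<Longrightarrow> y \<in> S i \<Longrightarrow> \<bar>f i x - f i y\<bar> \<le> L * \<bar>x - y\<bar>"
    using assms(2) by (rule ublE) blast
  have *: "K * \<bar>x - y\<bar> \<le> (K + L) * \<bar>x - y\<bar>" "L * \<bar>x - y\<bar> \<le> (K + L) * \<bar>x - y\<bar>" for x y
    using K(1) L(1) by (auto intro!: mult_right_mono)
  show ?thesis
  proof (rule ublI[where B = "K + L" and L = "K + L"])
    fix i x assume "i \<in> I \<union> I'" "x \<in> S i"
    then show "\<bar>f i x\<bar> \<le> K + L" using K(1,2) L(1,2) by fastforce
  next
    fix i x y assume "i \<in> I \<union> I'" "x \<in> S i" "y \<in> S i"
    then show "\<bar>f i x - f i y\<bar> \<le> (K + L) * \<bar>x - y\<bar>"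
      using order_trans[OF K(3) *(1), of i x y] order_trans[OF L(3) *(2), of i x y] by auto
  qed
qed

lemma ubl_const:
  assumes "\<And>i. i \<in> I \<Longrightarrow> \<bar>c i\<bar> \<le> B"
  shows "ubl I S (\<lambda>i x. c i)"
  by (rule ublI[where B = B and L = 0]) (use assms in auto)

lemma ubl_ident:
  assumes "\<And>i x. i \<in> I \<Longrightarrow> x \<in> S i \<Longrightarrow> \<bar>x\<bar> \<le> B"
  shows "ubl I S (\<lambda>i x. x)"
  by (rule ublI[where B = B and L = 1]) (use assms in auto)

lemma ubl_add:
  assumes "ubl I S f" "ubl I S g"
  shows "ubl I S (\<lambda>i x. f i x + g i x)"
proof -
  obtain K where K: "K \<ge> 0" "\<And>i x. i \<in> I \<Longrightarrow> x \<in> S i \<Longrightarrow> \<bar>f i x\<bar> \<le> K"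
    "\<And>i x y. i \<in> I \<Longrightarrow> x \<in> S i \<Longrightarrow> y \<in> S i \<Longrightarrow> \<bar>f i x - f i y\<bar> \<le> K * \<bar>x - y\<bar>"
    using assms(1) by (rule ublE) blast
  obtain L where L: "L \<ge> 0" "\<And>i x. i \<in> I \<Longrightarrow> x \<in> S i \<Longrightarrow> \<bar>g i x\<bar> \<le> L"
    "\<And>i x y. i \<in> I \<Longrightarrow> x \<in> S i \<Longrightarrow> y \<in> S i \<Longrightarrow> \<bar>g i x - g i y\<bar> \<le> L * \<bar>x - y\<bar>"
    using assms(2) by (rule ublE) blast
  show ?thesis
  proof (rule ublI[where B = "K + L" and L = "K + L"])
    fix i x assume "i \<in> I" "x \<in> S i"
    then show "\<bar>f i x + g i x\<bar> \<le> K + L"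
      using K(2)[of i x] L(2)[of i x] by linarith
  next
    fix i x y assume "i \<in> I" "x \<in> S i" "y \<in> S i"
    then show "\<bar>(f i x + g i x) - (f i y + g i y)\<bar> \<le> (K + L) * \<bar>x - y\<bar>"
      unfolding distrib_right using K(3)[of i x y] L(3)[of i x y] by linarith
  qed
qed

lemma ubl_minus: "ubl I S f \<Longrightarrow> ubl I S (\<lambda>i x. - f i x)"
  unfolding ubl_def by (simp add: abs_minus_commute)

lemma ubl_diff:
  assumes "ubl I S f" "ubl I S g"
  shows "ubl I S (\<lambda>i x. f i x - g i x)"
  by (rule ubl_cong[OF ubl_add[OF assms(1) ubl_minus[OF assms(2)]]]) simp

text \<open>Only the values of \<open>g\<close> where the cut-off \<open>f\<close> does not vanish matter: if \<open>f i y = 0\<close>,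
  then \<open>f i x * g i x = (f i x - f i y) * g i x\<close>.\<close>

lemma ubl_cutoff:
  assumes "ubl I S f" "ubl I (\<lambda>i. {x \<in> S i. f i x \<noteq> 0}) g"
  shows "ubl I S (\<lambda>i x. f i x * g i x)"
proof -
  obtain K where K: "K \<ge> 0" "\<And>i x. i \<in> I \<Longrightarrow> x \<in> S i \<Longrightarrow> \<bar>f i x\<bar> \<le> K"
    "\<And>i x y. i \<in> I \<Longrightarrow> x \<in> S i \<Longrightarrow> y \<in> S i \<Longrightarrow> \<bar>f i x - f i y\<bar> \<le> K * \<bar>x - y\<bar>"
    using assms(1) by (rule ublE) blast
  obtain L where L: "L \<ge> 0" "\<And>i x. i \<in> I \<Longrightarrow> x \<in> S i \<Longrightarrow> f i x \<noteq> 0 \<Longrightarrow> \<bar>g i x\<bar> \<le> L"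
    "\<And>i x y. i \<in> I \<Longrightarrow> x \<in> S i \<Longrightarrow> y \<in> S i \<Longrightarrow> f i x \<noteq> 0 \<Longrightarrow> f i y \<noteq> 0 \<Longrightarrow> \<bar>g i x - g i y\<bar> \<le> L * \<bar>x - y\<bar>"
    using assms(2) by (rule ublE) auto
  have half: "\<bar>f i x * g i x - f i y * g i y\<bar> \<le> (2 * K * L) * \<bar>x - y\<bar>"
    if "i \<in> I" "x \<in> S i" "y \<in> S i" "f i x \<noteq> 0" for i x y
  proof -
    have 1: "\<bar>f i x - f i y\<bar> * \<bar>g i x\<bar> \<le> (K * \<bar>x - y\<bar>) * L"
      using that K L by (intro mult_mono) auto
    have 2: "\<bar>f i y\<bar> * \<bar>g i x - g i y\<bar> \<le> K * (L * \<bar>x - y\<bar>)"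
    proof (cases "f i y = 0")
      case False
      then show ?thesis using that K L by (intro mult_mono) auto
    qed (use K(1) L(1) in auto)
    have "\<bar>f i x * g i x - f i y * g i y\<bar> = \<bar>(f i x - f i y) * g i x + f i y * (g i x - g i y)\<bar>"
      by (simp add: algebra_simps)
    also have "\<dots> \<le> \<bar>f i x - f i y\<bar> * \<bar>g i x\<bar> + \<bar>f i y\<bar> * \<bar>g i x - g i y\<bar>"
      by (metis abs_mult abs_triangle_ineq)
    also have "\<dots> \<le> (2 * K * L) * \<bar>x - y\<bar>"
      using 1 2 by (simp add: algebra_simps)
    finally show ?thesis .
  qed
  show ?thesis
  proof (rule ublI[where B = "K * L" and L = "2 * K * L"])
    fix i x assume *: "i \<in> I" "x \<in> S i"
    show "\<bar>f i x * g i x\<bar> \<le> K * L"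
    proof (cases "f i x = 0")
      case False
      then show ?thesis using * K L unfolding abs_mult by (intro mult_mono) auto
    qed (use K(1) L(1) in auto)
  next
    fix i x y assume *: "i \<in> I" "x \<in> S i" "y \<in> S i"
    show "\<bar>f i x * g i x - f i y * g i y\<bar> \<le> (2 * K * L) * \<bar>x - y\<bar>"
    proof (cases "f i x = 0")
      case True
      then show ?thesis
        using half[of i y x] * K(1) L(1) by (cases "f i y = 0") (auto simp: abs_minus_commute)
    qed (use half * in auto)
  qed
qed

lemma ubl_mult:
  assumes "ubl I S f" "ubl I S g"
  shows "ubl I S (\<lambda>i x. f i x * g i x)"
  by (rule ubl_cutoff[OF assms(1)], rule ubl_subset[OF assms(2)]) auto

lemma ubl_power: "ubl I S f \<Longrightarrow> ubl I S (\<lambda>i x. f i x ^ n)"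
proof (induction n)
  case 0
  then show ?case using ubl_const[of I "\<lambda>_. 1" 1 S] by simp
qed (simp add: ubl_mult)

text \<open>The outer function is the same for every index; a single function is written as a family
  over the one-point type \<open>unit\<close>.\<close>

lemma ubl_compose:
  assumes g: "ubl (UNIV :: unit set) (\<lambda>_. T) (\<lambda>_. g)" and f: "ubl I S f"
    and "\<And>i x. i \<in> I \<Longrightarrow> x \<in> S i \<Longrightarrow> f i x \<in> T"
  shows "ubl I S (\<lambda>i x. g (f i x))"
proof -
  obtain K where K: "K \<ge> 0" "\<And>i x. i \<in> I \<Longrightarrow> x \<in> S i \<Longrightarrow> \<bar>f i x\<bar> \<le> K"
    "\<And>i x y. i \<in> I \<Longrightarrow> x \<in> S i \<Longrightarrow> y \<in> S i \<Longrightarrow> \<bar>f i x - f i y\<bar> \<le> K * \<bar>x - y\<bar>"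
    using f by (rule ublE) blast
  obtain L where L: "L \<ge> 0" "\<And>x. x \<in> T \<Longrightarrow> \<bar>g x\<bar> \<le> L"
    "\<And>x y. x \<in> T \<Longrightarrow> y \<in> T \<Longrightarrow> \<bar>g x - g y\<bar> \<le> L * \<bar>x - y\<bar>"
    using g by (rule ublE) blast
  show ?thesis
  proof (rule ublI[where B = L and L = "L * K"])
    fix i x y assume *: "i \<in> I" "x \<in> S i" "y \<in> S i"
    have "\<bar>g (f i x) - g (f i y)\<bar> \<le> L * \<bar>f i x - f i y\<bar>"
      using * assms(3) by (intro L(3)) auto
    also have "\<dots> \<le> L * (K * \<bar>x - y\<bar>)"
      using * L K by (intro mult_left_mono) auto
    finally show "\<bar>g (f i x) - g (f i y)\<bar> \<le> L * K * \<bar>x - y\<bar>" by (simp add: mult.assoc)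
  qed (use L assms(3) in auto)
qed

lemma ubl_inverse:
  assumes f: "ubl I S f" and c: "0 < c" "\<And>i x. i \<in> I \<Longrightarrow> x \<in> S i \<Longrightarrow> c \<le> \<bar>f i x\<bar>"
  shows "ubl I S (\<lambda>i x. inverse (f i x))"
proof (rule ubl_compose[OF _ f, where T = "{z. c \<le> \<bar>z\<bar>}"])
  show "ubl (UNIV :: unit set) (\<lambda>_. {z. c \<le> \<bar>z\<bar>}) (\<lambda>_. inverse)"
  proof (rule ublI[where B = "inverse c" and L = "inverse c * inverse c"])
    fix x y :: real assume "x \<in> {z. c \<le> \<bar>z\<bar>}" "y \<in> {z. c \<le> \<bar>z\<bar>}"
    then have *: "c \<le> \<bar>x\<bar>" "c \<le> \<bar>y\<bar>" by auto
    then have "inverse x - inverse y = - (inverse x * (x - y) * inverse y)"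
      using c(1) by (intro inverse_diff_inverse) auto
    then have "\<bar>inverse x - inverse y\<bar> = inverse \<bar>x\<bar> * inverse \<bar>y\<bar> * \<bar>x - y\<bar>"
      by (simp add: abs_mult)
    also have "\<dots> \<le> inverse c * inverse c * \<bar>x - y\<bar>"
      using * c(1) by (intro mult_right_mono mult_mono le_imp_inverse_le) auto
    finally show "\<bar>inverse x - inverse y\<bar> \<le> inverse c * inverse c * \<bar>x - y\<bar>" .
  qed (use c(1) in \<open>auto intro!: le_imp_inverse_le\<close>)
qed (use c in auto)

lemma ubl_divide:
  assumes "ubl I S f" "ubl I S g" and "0 < c" "\<And>i x. i \<in> I \<Longrightarrow> x \<in> S i \<Longrightarrow> c \<le> \<bar>g i x\<bar>"
  shows "ubl I S (\<lambda>i x. f i x / g i x)"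
  unfolding divide_inverse using assms by (intro ubl_mult ubl_inverse)

text \<open>Follows from \<open>(sqrt x - sqrt y) * (sqrt x + sqrt y) = x - y\<close>, with
  Lipschitz constant \<open>1 / sqrt c\<close>. Supplying \<open>c\<close> is the purpose of
  \<open>QQ_scaled_ge\<close> and \<open>hsharp_lower_bound\<close>.\<close>

lemma ubl_sqrt:
  assumes f: "ubl I S f" and c: "0 < c" "\<And>i x. i \<in> I \<Longrightarrow> x \<in> S i \<Longrightarrow> c \<le> f i x"
  shows "ubl I S (\<lambda>i x. sqrt (f i x))"
proof -
  obtain K where K: "K \<ge> 0" "\<And>i x. i \<in> I \<Longrightarrow> x \<in> S i \<Longrightarrow> \<bar>f i x\<bar> \<le> K"
    using f by (rule ublE) blast
  show ?thesis
  proof (rule ubl_compose[OF _ f, where T = "{c..K}"])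
    show "ubl (UNIV :: unit set) (\<lambda>_. {c..K}) (\<lambda>_. sqrt)"
    proof (rule ublI[where B = "sqrt K" and L = "inverse (sqrt c)"])
      fix x y assume "x \<in> {c..K}" "y \<in> {c..K}"
      then have *: "c \<le> x" "c \<le> y" by auto
      then have "(sqrt x - sqrt y) * (sqrt x + sqrt y) = x - y"
        using c(1) by (simp add: algebra_simps)
      then have "\<bar>sqrt x - sqrt y\<bar> * (sqrt x + sqrt y) = \<bar>x - y\<bar>"
        using * c(1) by (metis abs_mult abs_of_nonneg add_nonneg_nonneg less_le_trans less_imp_le real_sqrt_ge_zero)
      moreover have "\<bar>sqrt x - sqrt y\<bar> * sqrt c \<le> \<bar>sqrt x - sqrt y\<bar> * (sqrt x + sqrt y)"
        using * c(1) by (intro mult_left_mono) (auto intro: add_increasing2)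
      ultimately show "\<bar>sqrt x - sqrt y\<bar> \<le> inverse (sqrt c) * \<bar>x - y\<bar>"
        using c(1) by (simp add: field_simps)
    qed (use c(1) in auto)
  qed (use c K in auto, use K in fastforce)
qed

lemma ubl_unitI:
  assumes "\<And>x. x \<in> T \<Longrightarrow> \<bar>g x\<bar> \<le> B" "\<And>x y. x \<in> T \<Longrightarrow> y \<in> T \<Longrightarrow> \<bar>g x - g y\<bar> \<le> L * \<bar>x - y\<bar>"
  shows "ubl I (\<lambda>_. T) (\<lambda>_. g)"
  by (rule ublI) (use assms in auto)

section \<open>Smooth functions of one variable, and homogeneous functions of two variables\<close>

lemma smooth_has_derivative_real:
  fixes f :: "real \<Rightarrow> real"
  assumes "smooth f"
  obtains f' where "\<And>x. (f has_real_derivative f' x) (at x)" "continuous_on UNIV f'"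
proof -
  have "Ck (Suc 0) f" using assms unfolding smooth_def by blast
  then have d: "f differentiable (at x)" and c: "continuous_on UNIV (\<lambda>x. frechet_derivative f (at x) 1)" for x
    by auto
  have der: "(f has_real_derivative frechet_derivative f (at x) 1) (at x)" for x
  proof -
    have "(f has_derivative frechet_derivative f (at x)) (at x)"
      using d frechet_derivative_works by blast
    moreover have "frechet_derivative f (at x) = (\<lambda>h. frechet_derivative f (at x) 1 * h)"
    proof
      fix h
      show "frechet_derivative f (at x) h = frechet_derivative f (at x) 1 * h"
        using linear_scale[OF linear_frechet_derivative[OF d], of x h 1]
        by simp
    qed
    ultimately show ?thesis unfolding has_field_derivative_def by metis
  qed
  from der c show ?thesis by (rule that)
qed

lemma smooth_imp_continuous: "smooth f \<Longrightarrow> continuous_on A f"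
  unfolding smooth_def using Ck.simps(1) continuous_on_subset by blast

lemma smooth_imp_ubl:
  fixes f :: "real \<Rightarrow> real"
  assumes "smooth f"
  shows "ubl I (\<lambda>_. {\<alpha>..\<beta>}) (\<lambda>_. f)"
proof -
  obtain f' where f': "\<And>x. (f has_real_derivative f' x) (at x)" "continuous_on UNIV f'"
    using smooth_has_derivative_real[OF assms] by blast
  have "bounded (f' ` {\<alpha>..\<beta>})" "bounded (f ` {\<alpha>..\<beta>})"
    using f'(2) smooth_imp_continuous[OF assms]
    by (auto intro!: compact_imp_bounded compact_continuous_image intro: continuous_on_subset)
  then obtain L B where LB: "\<And>x. x \<in> {\<alpha>..\<beta>} \<Longrightarrow> \<bar>f' x\<bar> \<le> L" "\<And>x. x \<in> {\<alpha>..\<beta>} \<Longrightarrow> \<bar>f x\<bar> \<le> B"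
    by (metis (no_types, opaque_lifting) bounded_iff image_eqI real_norm_def)
  show ?thesis
  proof (rule ubl_unitI[where B = B and L = L])
    fix x y assume "x \<in> {\<alpha>..\<beta>}" "y \<in> {\<alpha>..\<beta>}"
    then show "\<bar>f x - f y\<bar> \<le> L * \<bar>x - y\<bar>"
      using field_differentiable_bound[of "{\<alpha>..\<beta>}" f f' L x y] f'(1) LB(1)
      by (auto intro: has_field_derivative_at_within)
  qed (use LB in auto)
qed

text \<open>A function constant to the left of \<open>\<alpha>\<close> and to the right of \<open>\<beta>\<close> factors through the
  retraction onto \<open>{\<alpha>..\<beta>}\<close>.\<close>

lemma smooth_imp_ubl_UNIV:
  fixes f :: "real \<Rightarrow> real"
  assumes "smooth f" "\<alpha> \<le> \<beta>" "\<And>x. x \<le> \<alpha> \<Longrightarrow> f x = f \<alpha>" "\<And>x. x \<ge> \<beta> \<Longrightarrow> f x = f \<beta>"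
  shows "ubl I (\<lambda>_. UNIV) (\<lambda>_. f)"
proof -
  obtain K where K: "K \<ge> 0" "\<And>x. x \<in> {\<alpha>..\<beta>} \<Longrightarrow> \<bar>f x\<bar> \<le> K"
    "\<And>x y. x \<in> {\<alpha>..\<beta>} \<Longrightarrow> y \<in> {\<alpha>..\<beta>} \<Longrightarrow> \<bar>f x - f y\<bar> \<le> K * \<bar>x - y\<bar>"
    using smooth_imp_ubl[OF assms(1), of "UNIV :: unit set"] by (rule ublE) blast
  define c where "c x = max \<alpha> (min \<beta> x)" for x
  have c: "c x \<in> {\<alpha>..\<beta>}" "\<bar>c x - c y\<bar> \<le> \<bar>x - y\<bar>" "f (c x) = f x" for x y
    using assms(2) assms(3,4)[of x] by (auto simp: c_def min_def max_def)
  show ?thesis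
  proof (rule ubl_unitI[where B = K and L = K])
    fix x y :: real
    have "\<bar>f x - f y\<bar> \<le> K * \<bar>c x - c y\<bar>" using K(3)[of "c x" "c y"] c(1,3) by simp
    also have "\<dots> \<le> K * \<bar>x - y\<bar>" using K(1) c(2) by (intro mult_left_mono) auto
    finally show "\<bar>f x - f y\<bar> \<le> K * \<bar>x - y\<bar>" .
    show "\<bar>f x\<bar> \<le> K" using K(2)[of "c x"] c by simp
  qed
qed

text \<open>The function \<open>q * d (p / q)\<close> is homogeneous of degree 1 with profile
  \<open>d\<close>. A bound \<open>B\<close> on one of the two quotients suffices, by the identity
  for \<open>q' * (x - x')\<close> below. The default \<open>p / 0 = 0\<close> is harmless because
  it is multiplied by \<open>q = 0\<close>.\<close>

lemma hom1_lipschitz_aux: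
  fixes d :: "real \<Rightarrow> real"
  assumes K: "0 \<le> K" "q \<noteq> 0 \<Longrightarrow> \<bar>d (p / q)\<bar> \<le> K" "q' \<noteq> 0 \<Longrightarrow> \<bar>d (p' / q')\<bar> \<le> K"
    and L: "q \<noteq> 0 \<Longrightarrow> q' \<noteq> 0 \<Longrightarrow> \<bar>d (p / q) - d (p' / q')\<bar> \<le> K * \<bar>p / q - p' / q'\<bar>"
    and B: "0 \<le> B" "q \<noteq> 0 \<Longrightarrow> q' \<noteq> 0 \<Longrightarrow> \<bar>p / q\<bar> \<le> B"
  shows "\<bar>q * d (p / q) - q' * d (p' / q')\<bar> \<le> K * (1 + B) * (\<bar>p - p'\<bar> + \<bar>q - q'\<bar>)"
proof -
  have *: "K * t \<le> K * (1 + B) * (s + t)" if "0 \<le> s" "0 \<le> t" for s t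
  proof -
    have "K * (1 + B) * (s + t) = K * t + K * (s + B * s + B * t)" by (simp add: algebra_simps)
    moreover have "0 \<le> K * (s + B * s + B * t)" using K(1) B(1) that by auto
    ultimately show ?thesis by linarith
  qed
  consider "q = 0" "q' = 0" | "q = 0" "q' \<noteq> 0" | "q \<noteq> 0" "q' = 0" | "q \<noteq> 0" "q' \<noteq> 0" by blast
  then show ?thesis
  proof cases
    case 1 then show ?thesis using K(1) B(1) by simp
  next
    case 2
    then have "\<bar>q * d (p / q) - q' * d (p' / q')\<bar> \<le> K * \<bar>q - q'\<bar>"
      using K(3) by (simp add: abs_mult mult.commute[of K] mult_left_mono)
    also note *[of "\<bar>p - p'\<bar>"] finally show ?thesis by simp
  next
    case 3
    then have "\<bar>q * d (p / q) - q' * d (p' / q')\<bar> \<le> K * \<bar>q - q'\<bar>"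
      using K(2) by (simp add: abs_mult mult.commute[of K] mult_left_mono)
    also note *[of "\<bar>p - p'\<bar>"] finally show ?thesis by simp
  next
    case 4
    define x x' where "x = p / q" and "x' = p' / q'"
    have px: "p = q * x" "p' = q' * x'" using 4 by (auto simp: x_def x'_def)
    \<comment> \<open>Multiplication by \<open>q'\<close> turns the difference of quotients into
      differences of numerators and denominators; the only quotient left as a coefficient is the
      bounded one.\<close>
    have "q' * (x - x') = (p - p') - x * (q - q')" by (simp add: px algebra_simps)
    then have "\<bar>q'\<bar> * \<bar>x - x'\<bar> \<le> \<bar>p - p'\<bar> + \<bar>x\<bar> * \<bar>q - q'\<bar>"
      by (metis abs_mult abs_triangle_ineq4)
    also have "\<dots> \<le> \<bar>p - p'\<bar> + B * \<bar>q - q'\<bar>"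
      using B(2) 4 by (intro add_left_mono mult_right_mono) (auto simp: x_def)
    finally have 1: "\<bar>q'\<bar> * \<bar>x - x'\<bar> \<le> \<bar>p - p'\<bar> + B * \<bar>q - q'\<bar>" .
    have "q * d x - q' * d x' = (q - q') * d x + q' * (d x - d x')" by (simp add: algebra_simps)
    then have "\<bar>q * d x - q' * d x'\<bar> \<le> \<bar>q - q'\<bar> * \<bar>d x\<bar> + \<bar>q'\<bar> * \<bar>d x - d x'\<bar>"
      by (metis abs_mult abs_triangle_ineq)
    also have "\<dots> \<le> \<bar>q - q'\<bar> * K + \<bar>q'\<bar> * (K * \<bar>x - x'\<bar>)"
      using K L 4 unfolding x_def x'_def by (intro add_mono mult_left_mono) auto
    also have "\<dots> = K * (\<bar>q - q'\<bar> + \<bar>q'\<bar> * \<bar>x - x'\<bar>)" by (simp add: algebra_simps)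
    also have "\<dots> \<le> K * (\<bar>q - q'\<bar> + (\<bar>p - p'\<bar> + B * \<bar>q - q'\<bar>))"
      using 1 K(1) by (intro mult_left_mono add_left_mono) auto
    also have "\<dots> \<le> K * ((1 + B) * (\<bar>p - p'\<bar> + \<bar>q - q'\<bar>))"
      using K(1) B(1) by (intro mult_left_mono) (auto simp: algebra_simps)
    finally show ?thesis by (simp add: x_def x'_def mult.assoc)
  qed
qed

lemma hom1_lipschitz_on:
  fixes d :: "real \<Rightarrow> real"
  assumes "0 \<le> K" "\<And>y. y \<in> S \<Longrightarrow> \<bar>d y\<bar> \<le> K" "\<And>y z. y \<in> S \<Longrightarrow> z \<in> S \<Longrightarrow> \<bar>d y - d z\<bar> \<le> K * \<bar>y - z\<bar>"
    and "0 \<le> B" "\<And>y. y \<in> S \<Longrightarrow> \<bar>y\<bar> \<le> B"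
    and "q \<noteq> 0 \<Longrightarrow> p / q \<in> S" "q' \<noteq> 0 \<Longrightarrow> p' / q' \<in> S"
  shows "\<bar>q * d (p / q) - q' * d (p' / q')\<bar> \<le> K * (1 + B) * (\<bar>p - p'\<bar> + \<bar>q - q'\<bar>)"
  using assms by (intro hom1_lipschitz_aux) (auto simp del: abs_divide)

text \<open>If both quotients exceed \<open>Y\<close>, both terms vanish. Otherwise one quotient is
  bounded by \<open>Y\<close>, and the estimate is symmetric in the two points.\<close>

lemma hom1_lipschitz:
  fixes d :: "real \<Rightarrow> real"
  assumes K: "0 \<le> K" "\<And>y. \<bar>d y\<bar> \<le> K" "\<And>y z. \<bar>d y - d z\<bar> \<le> K * \<bar>y - z\<bar>"
    and Y: "0 \<le> Y" "\<And>y. Y < \<bar>y\<bar> \<Longrightarrow> d y = 0"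
  shows "\<bar>q * d (p / q) - q' * d (p' / q')\<bar> \<le> K * (1 + Y) * (\<bar>p - p'\<bar> + \<bar>q - q'\<bar>)"
proof -
  consider "\<bar>p / q\<bar> \<le> Y" | "\<bar>p' / q'\<bar> \<le> Y" | "Y < \<bar>p / q\<bar>" "Y < \<bar>p' / q'\<bar>" by linarith
  then show ?thesis
  proof cases
    case 1 then show ?thesis using K Y(1) by (intro hom1_lipschitz_aux)
  next
    case 2
    then have "\<bar>q' * d (p' / q') - q * d (p / q)\<bar> \<le> K * (1 + Y) * (\<bar>p' - p\<bar> + \<bar>q' - q\<bar>)"
      using K Y(1) by (intro hom1_lipschitz_aux)
    then show ?thesis by (simp only: abs_minus_commute)
  next
    case 3 then show ?thesis using Y K(1) by simp
  qed
qed

lemma ubl_const0: "ubl I S (\<lambda>i x. c)"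
  by (rule ubl_const[OF order_refl])

lemmas ubl_intros = ubl_const0 ubl_add ubl_diff ubl_mult ubl_power

section \<open>The potential and its critical point\<close>

locale kerr =
  fixes P :: kerr_data
  assumes admissible: "kerr_setup P"
begin

abbreviation M where "M \<equiv> Mass P"
abbreviation a where "a \<equiv> Spin P"
abbreviation T where "T r \<equiv> r\<^sup>2 + a\<^sup>2"
text \<open>The value of \<open>om_plus P m\<close> per unit of \<open>m\<close>, the threshold for
  \<open>\<omega>/m\<close>.\<close>

abbreviation Op where "Op \<equiv> a / ((rp P)\<^sup>2 + a\<^sup>2)"

lemma a_pos: "0 < a" and a_less_M: "a < M" and xi_l_pos: "0 < xi_l P" and xi_r_pos: "0 < xi_r P"
  and del_pos: "0 < del P" and rp_less_r_lo: "rp P < r_lo P" and r_lo_less_r_hi: "r_lo P < r_hi P"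
  and mono_h0: "mono_on {rp P<..} (h0 P)"
  and h0_sq: "r > rp P \<Longrightarrow> (h0 P r)\<^sup>2 = 1 - (vel P r)\<^sup>2 / (vel0 P)\<^sup>2"
  using admissible unfolding kerr_setup_def by auto

lemma a_nz [simp]: "a \<noteq> 0" using a_pos by simp

lemma M_pos: "0 < M" using a_pos a_less_M by simp

lemma disc_pos: "0 < M\<^sup>2 - a\<^sup>2"
  using a_pos a_less_M by (simp add: power_strict_mono)

lemma M_less_rp: "M < rp P"
  using disc_pos by (simp add: rp_def)

lemma rp_minus_M_sq: "(rp P - M)\<^sup>2 = M\<^sup>2 - a\<^sup>2"
  using disc_pos by (simp add: rp_def)

lemma rp_pos: "0 < rp P" using M_pos M_less_rp by simp

lemma rp_sq: "(rp P)\<^sup>2 = 2 * M * rp P - a\<^sup>2"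
  using rp_minus_M_sq by (simp add: power2_eq_square algebra_simps)

lemma T_pos: "0 < T r" using a_pos by (simp add: sum_power2_gt_zero_iff)

lemma Op_pos: "0 < Op" using T_pos a_pos by simp

lemma Delta_eq: "Delta P r = (r - M)\<^sup>2 - (M\<^sup>2 - a\<^sup>2)"
  by (simp add: Delta_def power2_eq_square algebra_simps)

lemma Delta_mono: "rp P \<le> s \<Longrightarrow> s \<le> r \<Longrightarrow> Delta P s \<le> Delta P r"
  unfolding Delta_eq using M_less_rp by (simp add: power_mono)

lemma Delta_pos: "rp P < r \<Longrightarrow> 0 < Delta P r"
  unfolding Delta_eq rp_minus_M_sq[symmetric] using M_less_rp
  by (simp add: power_strict_mono)

lemma Delta_le: "Delta P r \<le> (r - M)\<^sup>2"
  unfolding Delta_eq using disc_pos by simp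

text \<open>This is \<open>2 * r * Delta P r / (r - M) - T r\<close>. By
  \<open>Phi_has_derivative\<close> the derivative of the potential is a positive multiple of
  \<open>NN x r * (kappa r + a * x)\<close>; dividing by \<open>r - M\<close> is what makes
  \<open>x\<close> enter as an additive constant only.\<close>

definition kappa :: "real \<Rightarrow> real" where
  "kappa r = (r - M)\<^sup>2 - (3 * M\<^sup>2 - a\<^sup>2) - 2 * M * (M\<^sup>2 - a\<^sup>2) / (r - M)"

text \<open>The square contributes slope at least \<open>2 * (rp P - M)\<close>, and the subtracted
  fraction decreases. The slope is positive since \<open>a < M\<close>; it makes the critical radius
  a Lipschitz function of \<open>x\<close>.\<close>

lemma kappa_diff:
  assumes "rp P \<le> s" "s \<le> r"
  shows "2 * (rp P - M) * (r - s) \<le> kappa r - kappa s"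
proof -
  have "2 * M * (M\<^sup>2 - a\<^sup>2) / (r - M) \<le> 2 * M * (M\<^sup>2 - a\<^sup>2) / (s - M)"
    using assms M_less_rp M_pos disc_pos by (intro divide_left_mono mult_pos_pos) auto
  moreover have "(r - M)\<^sup>2 - (s - M)\<^sup>2 = (r + s - 2 * M) * (r - s)"
    by (simp add: power2_eq_square algebra_simps)
  moreover have "2 * (rp P - M) * (r - s) \<le> (r + s - 2 * M) * (r - s)"
    using assms by (intro mult_right_mono) auto
  ultimately show ?thesis unfolding kappa_def by linarith
qed

lemma kappa_strict_mono: "rp P \<le> s \<Longrightarrow> s < r \<Longrightarrow> kappa s < kappa r"
  using kappa_diff[of s r] M_less_rp
  by (smt (verit, best) mult_pos_pos)

lemma kappa_rp: "kappa (rp P) = - (T (rp P))"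
proof -
  have "kappa (rp P) = (rp P - M)\<^sup>2 - (3 * M\<^sup>2 - a\<^sup>2) - 2 * M * ((rp P - M)\<^sup>2) / (rp P - M)"
    by (simp add: kappa_def rp_minus_M_sq)
  also have "\<dots> = (M\<^sup>2 - a\<^sup>2) - (3 * M\<^sup>2 - a\<^sup>2) - 2 * M * (rp P - M)"
  proof -
    have "2 * M * ((rp P - M)\<^sup>2) / (rp P - M) = 2 * M * (rp P - M)"
      using M_less_rp by (simp add: power2_eq_square)
    then show ?thesis by (simp only: rp_minus_M_sq)
  qed
  also have "\<dots> = - (T (rp P))" unfolding rp_sq by (simp add: power2_eq_square algebra_simps)
  finally show ?thesis .
qed

text \<open>By \<open>kappa_rp\<close> the hypothesis says \<open>kappa (rp P) < - a * x\<close>, so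
  the intermediate value theorem gives a root and strict monotonicity its uniqueness.\<close>

lemma kappa_root_ex1:
  assumes "a * x < T (rp P)"
  shows "\<exists>!r. rp P < r \<and> kappa r = - a * x"
proof -
  \<comment> \<open>\<open>M \<le> s\<close> bounds the fraction in \<open>kappa (M + s)\<close> by
    \<open>2 * (M^2 - a^2)\<close>, \<open>1 \<le> s\<close> gives \<open>s \<le> s^2\<close>, and
    the other summands absorb the constants. \<open>M + s\<close> may lie to the left of the
    horizon, hence the maximum in \<open>R\<close>.\<close>
  define s where "s = M + 1 + 3 * M\<^sup>2 + 2 * (M\<^sup>2 - a\<^sup>2) + \<bar>a * x\<bar>"
  define R where "R = max (rp P) (M + s)"
  have "0 \<le> 3 * M\<^sup>2 + 2 * (M\<^sup>2 - a\<^sup>2) + \<bar>a * x\<bar>"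
    using disc_pos by (intro add_nonneg_nonneg) auto
  then have s: "M \<le> s" "1 \<le> s" using M_pos unfolding s_def by auto
  have "kappa R \<ge> - a * x"
  proof -
    have "2 * M * (M\<^sup>2 - a\<^sup>2) / (M + s - M) \<le> 2 * (M\<^sup>2 - a\<^sup>2)"
      using mult_right_mono[OF s(1), of "2 * (M\<^sup>2 - a\<^sup>2)"] s disc_pos by (simp add: field_simps)
    moreover have "(M + s - M)\<^sup>2 \<ge> s" using s by (simp add: power2_eq_square)
    ultimately have *: "kappa (M + s) \<ge> - a * x"
      using M_pos a_pos unfolding kappa_def s_def by (smt (verit) zero_le_power2 mult_minus_left)
    show ?thesis
    proof (cases "rp P \<le> M + s")
      case True then show ?thesis using * by (simp add: R_def max_def)
    next
      case False
      have "kappa (M + s) \<le> kappa (rp P)"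
      proof -
        have "0 < s" using s by simp
        then have "2 * M * (M\<^sup>2 - a\<^sup>2) / (rp P - M) \<le> 2 * M * (M\<^sup>2 - a\<^sup>2) / (M + s - M)"
          using False M_less_rp M_pos disc_pos by (intro divide_left_mono mult_pos_pos) auto
        moreover have "(M + s - M)\<^sup>2 \<le> (rp P - M)\<^sup>2"
          using False s by (intro power_mono) auto
        ultimately show ?thesis unfolding kappa_def by linarith
      qed
      then show ?thesis using * False by (simp add: R_def max_def)
    qed
  qed
  moreover have "kappa (rp P) < - a * x" using assms kappa_rp by simp
  moreover have "continuous_on {rp P..R} kappa"
    unfolding kappa_def using M_less_rp by (intro continuous_intros) auto
  ultimately obtain r where r: "rp P \<le> r" "r \<le> R" "kappa r = - a * x"
    using IVT'[of kappa "rp P" "- a * x" R] by (force simp: R_def)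
  moreover have "r \<noteq> rp P" using r \<open>kappa (rp P) < - a * x\<close> by auto
  ultimately show ?thesis
    using kappa_strict_mono by (intro ex1I[of _ r]) (auto, metis linorder_neqE_linordered_idom less_imp_le less_irrefl)
qed

definition rho :: "real \<Rightarrow> real" where
  "rho x = (THE r. rp P < r \<and> kappa r = - a * x)"

lemma rho: "a * x < T (rp P) \<Longrightarrow> rp P < rho x \<and> kappa (rho x) = - a * x"
  unfolding rho_def by (rule theI'[OF kappa_root_ex1])

text \<open>The reciprocals of the end points of the interval of \<open>y = \<omega>/m\<close> on
  which \<open>chi2\<close> is prescribed to vanish. Outside that interval \<open>m/\<omega>\<close>
  lies between \<open>xlo\<close> and \<open>xhi\<close>, and so does the value 0 belonging to
  \<open>m = 0\<close>.\<close>

definition xlo where "xlo = - 2 / xi_l P"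
definition xhi where "xhi = 1 / (Op + xi_r P / 2)"

lemma xlo_neg: "xlo < 0" and xhi_pos: "0 < xhi"
  using xi_l_pos xi_r_pos Op_pos by (auto simp: xlo_def xhi_def add_pos_pos)

lemma xhi_less: "a * xhi < T (rp P)"
proof -
  have "Op / (Op + xi_r P / 2) < 1"
    using xi_r_pos Op_pos by (subst divide_less_eq_1_pos) auto
  then have "Op * xhi < 1" by (simp add: xhi_def del: times_divide_eq_left)
  then show ?thesis using T_pos[of "rp P"] by (simp add: field_simps)
qed

lemma X_less: "x \<le> xhi \<Longrightarrow> a * x < T (rp P)"
  using xhi_less mult_left_mono[of x xhi a] a_pos by linarith

text \<open>Clamping \<open>x = m/\<omega>\<close> to the range that occurs makes \<open>rhoc\<close> continuous on all of \<open>\<real>\<close>, so that the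
  multipliers below are Borel functions.\<close>

definition clampX where "clampX x = max xlo (min xhi x)"
definition rhoc where "rhoc x = rho (clampX x)"

lemma clampX: "clampX x \<in> {xlo..xhi}" "\<bar>clampX x - clampX y\<bar> \<le> \<bar>x - y\<bar>" "x \<in> {xlo..xhi} \<Longrightarrow> clampX x = x"
  using xlo_neg xhi_pos by (auto simp: clampX_def min_def max_def)

lemma rhoc: "rp P < rhoc x" "kappa (rhoc x) = - a * clampX x"
  using rho[OF X_less, of "clampX x"] clampX(1)[of x] by (auto simp: rhoc_def)

lemma rhoc_in: "x \<in> {xlo..xhi} \<Longrightarrow> kappa (rhoc x) = - a * x"
  by (simp add: rhoc clampX(3))

lemma rhoc_eq_rho: "x \<in> {xlo..xhi} \<Longrightarrow> rhoc x = rho x"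
  by (simp add: rhoc_def clampX(3))

lemma rhoc_lipschitz: "\<bar>rhoc x - rhoc y\<bar> \<le> a / (2 * (rp P - M)) * \<bar>x - y\<bar>"
proof -
  have *: "2 * (rp P - M) * \<bar>rhoc x - rhoc y\<bar> \<le> \<bar>kappa (rhoc x) - kappa (rhoc y)\<bar>"
    using kappa_diff[of "rhoc x" "rhoc y"] kappa_diff[of "rhoc y" "rhoc x"] rhoc(1)[of x] rhoc(1)[of y]
    by (cases "rhoc x \<le> rhoc y") auto
  also have "\<dots> = a * \<bar>clampX x - clampX y\<bar>"
    using a_pos by (simp add: rhoc(2) abs_mult flip: right_diff_distrib)
  also have "\<dots> \<le> a * \<bar>x - y\<bar>" using clampX(2) a_pos by (intro mult_left_mono) auto
  finally show ?thesis using M_less_rp by (simp add: field_simps)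
qed

text \<open>All critical radii that occur lie between \<open>rmin\<close> and \<open>rmax\<close>,
  hence at a fixed distance from the horizon and from infinity, the two places where
  \<open>(T r)^2 / Delta P r\<close> is unbounded.\<close>

definition rmin where "rmin = rhoc xhi"
definition rmax where "rmax = rhoc xlo"

lemma rhoc_antimono: "x \<le> y \<Longrightarrow> rhoc y \<le> rhoc x"
proof (rule ccontr)
  assume "x \<le> y" "\<not> rhoc y \<le> rhoc x"
  then have "kappa (rhoc x) < kappa (rhoc y)" using rhoc(1)[of x] by (intro kappa_strict_mono) auto
  then have "a * clampX y < a * clampX x" by (simp add: rhoc)
  moreover have "clampX x \<le> clampX y" using \<open>x \<le> y\<close> by (auto simp: clampX_def)
  ultimately show False using a_pos by simp
qed

lemma rhoc_bounds: "rmin \<le> rhoc x" "rhoc x \<le> rmax"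
  unfolding rmin_def rmax_def
  using rhoc_antimono[of xlo x] rhoc_antimono[of x xhi] xlo_neg xhi_pos
  by (cases "x < xlo"; cases "xhi < x"; force simp: rhoc_def clampX_def)+

lemma rmin_gt: "rp P < rmin" by (simp add: rmin_def rhoc)

lemma rmin_le_rmax: "rmin \<le> rmax" using rhoc_bounds[of 0] by simp

text \<open>At a critical point \<open>p\<close> one has
  \<open>NN x p = 2 * p * Delta P p / (p - M)\<close>; inserting this into
  \<open>NN^2 / Delta\<close> eliminates \<open>x\<close> and leaves this expression.\<close>

definition JJ where "JJ p = 4 * p\<^sup>2 * Delta P p / (p - M)\<^sup>2"
definition QQ where "QQ p r = (r + p)\<^sup>2 - 4 * M * p * Delta P p / (p - M)\<^sup>2"
text \<open>The square root of \<open>NN^2 - JJ * Delta\<close> taken with the sign of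
  \<open>r - p\<close>. The change of sign prescribed for \<open>f\<close>-natural turns
  \<open>\<bar>r - p\<bar>\<close> into \<open>r - p\<close>, so that the only root left is that of
  \<open>QQ\<close>, which stays away from 0.\<close>

definition AA where "AA p r = (r - p) * sqrt (QQ p r)"
definition NN where "NN x r = T r - a * x"

text \<open>With \<open>x = m/\<omega>\<close> one has \<open>(\<omega> - \<omega>\<^sub>r)\<^sup>2/v\<^sup>2 = \<omega>\<^sup>2 NN\<^sup>2/\<Delta>\<close>. Its critical point \<open>p\<close> solves
  \<open>kappa p = - a x\<close> and its critical value is \<open>\<omega>\<^sup>2 JJ p\<close>, so \<open>p\<close> is a double root of \<open>NN\<^sup>2 - JJ p \<Delta>\<close>.\<close>

lemma NN_sq:
  assumes "M < p" "kappa p = - a * x"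
  shows "(NN x r)\<^sup>2 - JJ p * Delta P r = (r - p)\<^sup>2 * QQ p r"
proof -
  \<comment> \<open>With \<open>i\<close> as a separate variable subject to \<open>s * i = 1\<close>
    the claim becomes a polynomial identity.\<close>
  define s i where "s = p - M" and "i = 1 / s"
  have si: "s * i = 1" "p = M + s" using assms(1) by (auto simp: s_def i_def)
  have x: "a * x = - (s\<^sup>2 - (3 * M\<^sup>2 - a\<^sup>2) - 2 * M * (M\<^sup>2 - a\<^sup>2) * i)"
    using assms(2) by (simp add: kappa_def s_def i_def)
  have J: "JJ p = 4 * p\<^sup>2 * (s\<^sup>2 - (M\<^sup>2 - a\<^sup>2)) * i\<^sup>2"
    and Q: "QQ p r = (r + p)\<^sup>2 - 4 * M * p * (s\<^sup>2 - (M\<^sup>2 - a\<^sup>2)) * i\<^sup>2"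
    by (simp_all add: JJ_def QQ_def Delta_eq s_def i_def power_divide)
  have D: "Delta P r = (r - M)\<^sup>2 - (M\<^sup>2 - a\<^sup>2)" by (rule Delta_eq)
  show ?thesis
    unfolding NN_def J Q x D unfolding si(2) using si(1) by algebra
qed

definition cq where "cq = 1 - M / rp P"

lemma cq_pos: "0 < cq" using M_less_rp rp_pos by (simp add: cq_def)

text \<open>\<open>Delta P p\<close> is at most \<open>(p - M)^2\<close>, then
  \<open>M * p \<le> (M / rp P) * (r * p)\<close> because \<open>r\<close> is at least
  \<open>rp P\<close>, and \<open>4 * r * p \<le> (r + p)^2\<close>. What remains of the square is
  the fraction \<open>cq\<close>.\<close>

lemma QQ_ge:
  assumes "rp P \<le> r" "rp P \<le> p"
  shows "cq * (r + p)\<^sup>2 \<le> QQ p r"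
proof -
  have p: "0 < p - M" "0 < p" "0 < r" using assms M_less_rp rp_pos by auto
  have "Delta P p / (p - M)\<^sup>2 \<le> 1" using Delta_le p by (simp add: divide_le_eq_1)
  then have "4 * M * p * (Delta P p / (p - M)\<^sup>2) \<le> 4 * M * p * 1"
    using M_pos p by (intro mult_left_mono) auto
  then have 1: "(r + p)\<^sup>2 - 4 * M * p \<le> QQ p r" by (simp add: QQ_def)
  have "M * p \<le> (M / rp P) * (r * p)"
    using assms M_pos rp_pos p by (simp add: field_simps)
  then have "4 * M * p \<le> (M / rp P) * (4 * (r * p))" by (simp only: mult.left_commute[of _ 4] mult.assoc mult_le_cancel_left_pos zero_less_numeral)
  moreover have "4 * (r * p) \<le> (r + p)\<^sup>2"
    using zero_le_power2[of "r - p"] by (simp add: power2_eq_square algebra_simps)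
  then have "(M / rp P) * (4 * (r * p)) \<le> (M / rp P) * (r + p)\<^sup>2"
    using M_pos rp_pos by (intro mult_left_mono) auto
  ultimately have "4 * M * p \<le> (M / rp P) * (r + p)\<^sup>2" by (rule order_trans)
  then show ?thesis using 1 unfolding cq_def left_diff_distrib by linarith
qed

lemma QQ_pos: "rp P \<le> r \<Longrightarrow> rp P \<le> p \<Longrightarrow> 0 < QQ p r"
  using QQ_ge[of r p] cq_pos rp_pos by (smt (verit) mult_pos_pos zero_less_power)

lemma AA_sq:
  assumes "rp P \<le> r" "rp P < p" "kappa p = - a * x"
  shows "(AA p r)\<^sup>2 = (NN x r)\<^sup>2 - JJ p * Delta P r"
  using NN_sq[of p x r] QQ_pos[of r p] assms M_less_rp by (simp add: AA_def power_mult_distrib)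

lemma NN_pos:
  assumes "rp P \<le> r" "a * x < T (rp P)"
  shows "0 < NN x r"
  using assms power_mono[of "rp P" r 2] rp_pos unfolding NN_def by linarith

section \<open>Bounds uniform in the radius, up to the horizon and to infinity\<close>

lemma ubl_rhoc: "ubl I S (\<lambda>_ x. rhoc x)"
proof (rule ublI[where B = rmax and L = "a / (2 * (rp P - M))"])
  fix x show "\<bar>rhoc x\<bar> \<le> rmax" using rhoc(1)[of x] rhoc_bounds(2)[of x] rp_pos by simp
qed (use rhoc_lipschitz in auto)

lemma ubl_Delta_rhoc: "ubl I S (\<lambda>_ x. Delta P (rhoc x) / (rhoc x - M)\<^sup>2)"
proof (rule ubl_divide[where c = "(rp P - M)\<^sup>2"])
  show "ubl I S (\<lambda>_ x. Delta P (rhoc x))"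
    unfolding Delta_def by (intro ubl_intros ubl_rhoc)
  show "ubl I S (\<lambda>_ x. (rhoc x - M)\<^sup>2)"
    by (intro ubl_intros ubl_rhoc)
  show "(rp P - M)\<^sup>2 \<le> \<bar>(rhoc x - M)\<^sup>2\<bar>" for x
    using rhoc(1)[of x] M_less_rp by (simp add: power_mono)
qed (use M_less_rp in auto)

lemma ubl_JJ: "ubl I S (\<lambda>_ x. JJ (rhoc x))"
proof (rule ubl_cong)
  show "ubl I S (\<lambda>_ x. 4 * (rhoc x)\<^sup>2 * (Delta P (rhoc x) / (rhoc x - M)\<^sup>2))"
    by (intro ubl_intros ubl_rhoc ubl_Delta_rhoc)
qed (simp add: JJ_def)

lemma inverse_r_le: "rp P < r \<Longrightarrow> \<bar>1 / r\<bar> \<le> 1 / rp P"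
  using rp_pos by (simp add: field_simps)

lemma r_sq_T: "\<bar>r\<^sup>2 / T r\<bar> \<le> 1" and a_T: "\<bar>a / T r\<bar> \<le> 1 / a"
proof -
  have "a * a \<le> T r" by (simp add: power2_eq_square)
  then show "\<bar>a / T r\<bar> \<le> 1 / a" using T_pos[of r] a_pos by (simp add: divide_simps)
  show "\<bar>r\<^sup>2 / T r\<bar> \<le> 1" using T_pos[of r] by simp
qed

lemma r_sq_T_ge: "rp P < r \<Longrightarrow> 1 / 2 \<le> r\<^sup>2 / T r"
  using T_pos[of r] power_strict_mono[of a r 2] a_pos a_less_M M_less_rp by (simp add: field_simps)

text \<open>\<open>QQ\<close> grows like \<open>r^2\<close>. Uniformity up to infinity comes from
  the second factor, which is polynomial in the bounded quantity \<open>1 / r\<close>.\<close>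

lemma QQ_scaled: "rp P < r \<Longrightarrow> QQ p r = r\<^sup>2 * ((1 + p * (1 / r))\<^sup>2 - 4 * M * p * (Delta P p / (p - M)\<^sup>2) * (1 / r)\<^sup>2)"
proof -
  assume "rp P < r"
  then have *: "r * (1 / r) = 1" using rp_pos by simp
  have "r\<^sup>2 * ((1 + p * (1 / r))\<^sup>2 - c * (1 / r)\<^sup>2) = (r + p * (r * (1 / r)))\<^sup>2 - c * (r * (1 / r))\<^sup>2" for c
    by algebra
  from this[of "4 * M * p * (Delta P p / (p - M)\<^sup>2)"] show ?thesis
    unfolding * QQ_def by (simp only: mult_1_right power_one times_divide_eq_right)
qed

lemma QQ_scaled_ge:
  assumes "rp P < r" "rp P \<le> p"
  shows "cq \<le> (1 + p * (1 / r))\<^sup>2 - 4 * M * p * (Delta P p / (p - M)\<^sup>2) * (1 / r)\<^sup>2"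
proof -
  have r: "0 < r" "0 < p" using assms rp_pos by auto
  have "r\<^sup>2 \<le> (r + p)\<^sup>2" using r by (intro power_mono) auto
  then have "cq * r\<^sup>2 \<le> QQ p r"
    using QQ_ge[of r p] assms cq_pos by (smt (verit, best) mult_left_mono)
  then show ?thesis unfolding QQ_scaled[OF assms(1)] using r
    by (simp only: mult.commute[of cq] mult_le_cancel_left_pos zero_less_power)
qed

lemma AA_scaled:
  assumes "rp P < r"
  shows "AA p r / T r = (1 - p * (1 / r)) *
    sqrt ((1 + p * (1 / r))\<^sup>2 - 4 * M * p * (Delta P p / (p - M)\<^sup>2) * (1 / r)\<^sup>2) * (r\<^sup>2 / T r)"
proof -
  have r: "0 < r" using assms rp_pos by auto
  then have "AA p r = (1 - p * (1 / r)) * r * (r *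
    sqrt ((1 + p * (1 / r))\<^sup>2 - 4 * M * p * (Delta P p / (p - M)\<^sup>2) * (1 / r)\<^sup>2))"
    unfolding AA_def QQ_scaled[OF assms] real_sqrt_mult by (simp add: field_simps)
  then show ?thesis by (simp add: power2_eq_square mult.assoc mult.left_commute)
qed

lemma ubl_AA: "ubl {rp P<..} S (\<lambda>r x. AA (rhoc x) r / T r)"
proof (rule ubl_cong)
  have r: "ubl {rp P<..} S (\<lambda>r x. 1 / r)" "ubl {rp P<..} S (\<lambda>r x. r\<^sup>2 / T r)"
    by (rule ubl_const[where B = "1 / rp P"], use inverse_r_le in simp,
        rule ubl_const[where B = 1], use r_sq_T in simp)
  show "ubl {rp P<..} S (\<lambda>r x. (1 - rhoc x * (1 / r)) *
    sqrt ((1 + rhoc x * (1 / r))\<^sup>2 - 4 * M * rhoc x * (Delta P (rhoc x) / (rhoc x - M)\<^sup>2) * (1 / r)\<^sup>2) * (r\<^sup>2 / T r))"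
    using QQ_scaled_ge rhoc(1) cq_pos
    by (intro ubl_intros ubl_rhoc ubl_Delta_rhoc r ubl_sqrt[where c = cq]) (auto simp: less_imp_le)
qed (simp add: AA_scaled)

lemma AA_zero_ubl: "ubl {rp P<..} S (\<lambda>r x. AA (rhoc 0) r / T r)"
proof -
  obtain K where "\<And>r x. r \<in> {rp P<..} \<Longrightarrow> x \<in> UNIV \<Longrightarrow> \<bar>AA (rhoc x) r / T r\<bar> \<le> K"
    using ubl_AA[of "\<lambda>_. UNIV"] by (rule ublE) blast
  then show ?thesis by (intro ubl_const[where B = K]) blast
qed

text \<open>\<open>AA / T\<close> vanishes only at the critical radius, and to first order; the
  factor \<open>1 / 2\<close> is the lower bound of \<open>r^2 / T r\<close>. This feeds the
  denominators of \<open>E_nat\<close> and the radicand of \<open>hsharp\<close>.\<close>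

lemma AA_ge:
  assumes "rp P < r"
  shows "\<bar>1 - rhoc x * (1 / r)\<bar> * (sqrt cq / 2) \<le> \<bar>AA (rhoc x) r / T r\<bar>"
proof -
  have "sqrt cq * (1 / 2) \<le> sqrt ((1 + rhoc x * (1 / r))\<^sup>2 - 4 * M * rhoc x * (Delta P (rhoc x) / (rhoc x - M)\<^sup>2) * (1 / r)\<^sup>2) * (r\<^sup>2 / T r)"
    using QQ_scaled_ge[OF assms, of "rhoc x"] rhoc(1)[of x] cq_pos r_sq_T_ge[OF assms]
    by (intro mult_mono real_sqrt_le_mono) auto
  then have "\<bar>1 - rhoc x * (1 / r)\<bar> * (sqrt cq / 2) \<le> \<bar>1 - rhoc x * (1 / r)\<bar> *
     (sqrt ((1 + rhoc x * (1 / r))\<^sup>2 - 4 * M * rhoc x * (Delta P (rhoc x) / (rhoc x - M)\<^sup>2) * (1 / r)\<^sup>2) * (r\<^sup>2 / T r))"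
    by (intro mult_left_mono) auto
  also have "\<dots> = \<bar>AA (rhoc x) r / T r\<bar>"
    unfolding AA_scaled[OF assms] using QQ_scaled_ge[OF assms, of "rhoc x"] rhoc(1)[of x] cq_pos r_sq_T_ge[OF assms]
    by (simp add: abs_mult mult.assoc)
  finally show ?thesis .
qed

lemma AA_sgn: "rp P < r \<Longrightarrow> rp P < p \<Longrightarrow> (0 \<le> AA p r \<longleftrightarrow> p \<le> r) \<and> (AA p r \<le> 0 \<longleftrightarrow> r \<le> p)"
  using QQ_pos[of r p] by (simp add: AA_def zero_le_mult_iff mult_le_0_iff)

lemma NN_T: "NN x r / T r = 1 - a / T r * x"
  using T_pos[of r] by (simp add: NN_def field_simps)

lemma ubl_NN:
  assumes "\<And>r x. r \<in> I \<Longrightarrow> x \<in> S r \<Longrightarrow> \<bar>x\<bar> \<le> B"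
  shows "ubl I S (\<lambda>r x. NN x r / T r)"
  unfolding NN_T
  by (intro ubl_intros ubl_const[where B = "1 / a"] ubl_ident[where B = B]) (use a_T assms in auto)

text \<open>A lower bound for \<open>NN x r / T r\<close>, since \<open>a / T r\<close> is largest
  at the horizon. It is positive thanks to the margin \<open>xi_r P / 2\<close> in
  \<open>xhi\<close>.\<close>

definition cN where "cN = 1 - Op * xhi"

lemma cN_pos: "0 < cN"
  using xhi_less T_pos[of "rp P"] by (simp add: cN_def field_simps)

lemma NN_T_ge:
  assumes "rp P < r" "x \<le> xhi"
  shows "cN \<le> NN x r / T r"
proof -
  have "T (rp P) \<le> T r" using assms rp_pos by (simp add: power_mono)
  then have "a / T r \<le> Op"
    using a_pos T_pos by (intro divide_left_mono mult_pos_pos) auto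
  then have "a / T r * x \<le> Op * xhi"
    using assms xhi_pos a_pos T_pos[of r] Op_pos
    by (smt (verit) divide_pos_pos mult_left_mono mult_right_mono)
  then show ?thesis unfolding NN_T cN_def by simp
qed

text \<open>\<open>v \<omega> E_nat\<close> is \<open>\<omega> f - h\<^sub>0 (\<omega> - \<omega>\<^sub>r)/v\<close> for \<open>f\<close> the \<open>f\<close>-natural of the frequency, with \<open>x = m/\<omega>\<close>.\<close>

definition E_nat where
  "E_nat r x = (AA (rhoc x) r / T r - NN x r / T r * (AA (rhoc 0) r / T r)) * ((T r)\<^sup>2 / Delta P r)"

lemma zero_in_X: "0 \<in> {xlo..xhi}" using xlo_neg xhi_pos by simp

lemma AA_scaled_sq:
  assumes "rp P < r" "x \<in> {xlo..xhi}"
  shows "(AA (rhoc x) r / T r)\<^sup>2 = (NN x r / T r)\<^sup>2 - JJ (rhoc x) * (Delta P r / (T r)\<^sup>2)"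
  using AA_sq[of r "rhoc x" x] assms rhoc(1)[of x] rhoc_in[of x]
  by (simp add: power_divide diff_divide_distrib)

text \<open>For \<open>x = 0\<close> the function \<open>NN\<close> is \<open>T\<close>. This is the
  equation defining \<open>h\<^sub>0\<^sup>2\<close>, and \<open>AA (rhoc 0) r / T r\<close> turns
  out to be \<open>h\<^sub>0\<close> itself in \<open>h0_eq\<close>.\<close>

lemma AA_zero_sq: "rp P < r \<Longrightarrow> (AA (rhoc 0) r / T r)\<^sup>2 = 1 - JJ (rhoc 0) * (Delta P r / (T r)\<^sup>2)"
  using AA_scaled_sq[OF _ zero_in_X] T_pos[of r] by (simp add: NN_def)

text \<open>Multiplication by the conjugate. The squares of both terms of the difference equal
  \<open>(NN x r / T r)^2\<close> up to multiples of \<open>Delta P r / (T r)^2\<close>, so their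
  difference carries the factor that cancels the singular weight.\<close>

lemma E_nat_outer:
  assumes r: "rp P < r" and x: "x \<in> {xlo..xhi}"
    and nz: "AA (rhoc x) r / T r + NN x r / T r * (AA (rhoc 0) r / T r) \<noteq> 0"
  shows "E_nat r x = ((NN x r / T r)\<^sup>2 * JJ (rhoc 0) - JJ (rhoc x)) /
     (AA (rhoc x) r / T r + NN x r / T r * (AA (rhoc 0) r / T r))"
proof -
  define u n v d where "u = AA (rhoc x) r / T r" and "n = NN x r / T r" and "v = AA (rhoc 0) r / T r"
    and "d = Delta P r / (T r)\<^sup>2"
  have d: "d \<noteq> 0" "(T r)\<^sup>2 / Delta P r = 1 / d"
    using Delta_pos[OF r] T_pos[of r] by (auto simp: d_def)
  have "u\<^sup>2 = n\<^sup>2 - JJ (rhoc x) * d" "v\<^sup>2 = 1 - JJ (rhoc 0) * d"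
    using AA_scaled_sq[OF r x] AA_zero_sq[OF r] by (auto simp: u_def v_def n_def d_def)
  then have "(u - n * v) * (u + n * v) = d * (n\<^sup>2 * JJ (rhoc 0) - JJ (rhoc x))"
    by algebra
  moreover have "u + n * v \<noteq> 0" using nz unfolding u_def n_def v_def .
  ultimately have "(u - n * v) * (1 / d) = (n\<^sup>2 * JJ (rhoc 0) - JJ (rhoc x)) / (u + n * v)"
    using d(1) by (simp add: frac_eq_eq mult.commute)
  then show ?thesis unfolding E_nat_def d(2) u_def n_def v_def .
qed

lemma X_bounded: "x \<in> {xlo..xhi} \<Longrightarrow> \<bar>x\<bar> \<le> max (- xlo) xhi"
  by auto

lemma T_sq_Delta_bounded:
  assumes "rp P < s" "s \<le> r" "r \<le> R"
  shows "\<bar>(T r)\<^sup>2 / Delta P r\<bar> \<le> (T R)\<^sup>2 / Delta P s"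
proof -
  have "T r \<le> T R" using assms rp_pos by (simp add: power_mono)
  then have "(T r)\<^sup>2 \<le> (T R)\<^sup>2" using T_pos[of r] by (intro power_mono) auto
  moreover have "Delta P s \<le> Delta P r" "0 < Delta P s" "0 < Delta P r"
    using assms Delta_mono[of s r] Delta_pos[of s] by auto
  ultimately show ?thesis by (auto intro!: frac_le)
qed

text \<open>Away from the roots of \<open>AA\<close> the formula of \<open>E_nat_outer\<close> exhibits the cancellation at the
  horizon and at infinity; in between \<open>T\<^sup>2/\<Delta>\<close> is bounded.\<close>

lemma ubl_E_nat: "ubl {rp P<..} (\<lambda>_. {xlo..xhi}) E_nat"
proof -
  \<comment> \<open>A radius strictly between the horizon and all critical radii; to its left the
    ratio of critical radius to \<open>r\<close> is at least \<open>rmin / r1 > 1\<close>.\<close>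
  define r1 where "r1 = (rp P + rmin) / 2"
  have r1: "rp P < r1" "r1 < rmin" using rmin_gt by (auto simp: r1_def)
  \<comment> \<open>The entries of the minimum bound \<open>\<bar>1 - p / r\<bar>\<close> from
    below: the second for \<open>r < r1\<close>, the first for \<open>r > 2 * rmax\<close>, where
    \<open>p / r \<le> 1 / 2\<close>.\<close>
  define c where "c = min (1 / 2) (rmin / r1 - 1) * (sqrt cq / 2)"
  have c: "0 < c" using r1 cq_pos rp_pos by (simp add: c_def)
  let ?J = "{rp P<..<r1} \<union> {2 * rmax<..}"
  have den: "c \<le> \<bar>AA (rhoc x) r / T r + NN x r / T r * (AA (rhoc 0) r / T r)\<bar>"
    if r: "r \<in> ?J" and x: "x \<in> {xlo..xhi}" for r x
  proof -
    have rr: "rp P < r" using that rmin_le_rmax rmin_gt rp_pos by auto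
    have n: "0 \<le> NN x r / T r" using NN_T_ge[OF rr, of x] cN_pos x by auto
    have "min (1 / 2) (rmin / r1 - 1) \<le> \<bar>1 - rhoc x * (1 / r)\<bar>"
    proof (cases "r < r1")
      case True
      have "rmin / r1 \<le> rhoc x / r"
        using True rr rp_pos rhoc_bounds(1)[of x] rmin_gt by (intro frac_le) auto
      then show ?thesis by auto
    next
      case False
      then have "rhoc x / r \<le> 1 / 2" using r rr rp_pos rhoc_bounds(2)[of x] by (simp add: field_simps)
      then show ?thesis by (simp only: mult_1_right times_divide_eq_right)
    qed
    then have "c \<le> \<bar>1 - rhoc x * (1 / r)\<bar> * (sqrt cq / 2)"
      unfolding c_def using cq_pos by (intro mult_right_mono) auto
    also have "\<dots> \<le> \<bar>AA (rhoc x) r / T r\<bar>" by (rule AA_ge[OF rr])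
    \<comment> \<open>Both summands are nonpositive to the left of all critical radii and
      nonnegative to the right of them, so the sum cannot cancel.\<close>
    also have "\<dots> \<le> \<bar>AA (rhoc x) r / T r + NN x r / T r * (AA (rhoc 0) r / T r)\<bar>"
    proof (cases "r < r1")
      case True
      then have "r \<le> rhoc x" "r \<le> rhoc 0" using rhoc_bounds(1) r1 by (meson less_le_trans less_trans less_imp_le)+
      then have "AA (rhoc x) r / T r \<le> 0" "AA (rhoc 0) r / T r \<le> 0"
        using AA_sgn[OF rr rhoc(1)] T_pos[of r] by (auto intro: divide_nonpos_pos)
      then show ?thesis using mult_nonneg_nonpos[OF n, of "AA (rhoc 0) r / T r"] by linarith
    next
      case False
      then have "rhoc x \<le> r" "rhoc 0 \<le> r"
        using r rhoc_bounds(2)[of x] rhoc_bounds(2)[of 0] rhoc(1)[of x] rp_pos by auto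
      then have "0 \<le> AA (rhoc x) r / T r" "0 \<le> AA (rhoc 0) r / T r"
        using AA_sgn[OF rr rhoc(1)] T_pos[of r] by (auto intro: divide_nonneg_pos)
      then show ?thesis using mult_nonneg_nonneg[OF n, of "AA (rhoc 0) r / T r"] by linarith
    qed
    finally show ?thesis .
  qed
  have J: "?J \<subseteq> {rp P<..}" using rmin_le_rmax rmin_gt rp_pos by auto
  have n: "ubl I (\<lambda>_. {xlo..xhi}) (\<lambda>r x. NN x r / T r)" for I
    by (rule ubl_NN[where B = "max (- xlo) xhi"]) (use X_bounded in auto)
  have AA: "ubl I (\<lambda>_. {xlo..xhi}) (\<lambda>r x. AA (rhoc x) r / T r)"
    "ubl I (\<lambda>_. {xlo..xhi}) (\<lambda>r x. AA (rhoc 0) r / T r)" if "I \<subseteq> {rp P<..}" for I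
    using that by (auto intro: ubl_subset[OF ubl_AA] ubl_subset[OF AA_zero_ubl])
  have "ubl ?J (\<lambda>_. {xlo..xhi}) E_nat"
  proof (rule ubl_cong)
    show "ubl ?J (\<lambda>_. {xlo..xhi}) (\<lambda>r x. ((NN x r / T r)\<^sup>2 * JJ (rhoc 0) - JJ (rhoc x)) /
     (AA (rhoc x) r / T r + NN x r / T r * (AA (rhoc 0) r / T r)))"
      using c den by (intro ubl_divide[where c = c] ubl_intros ubl_JJ n AA[OF J])
  next
    fix r x assume *: "r \<in> ?J" "x \<in> {xlo..xhi}"
    have "AA (rhoc x) r / T r + NN x r / T r * (AA (rhoc 0) r / T r) \<noteq> 0"
      using den[OF *] c by linarith
    with * J show "((NN x r / T r)\<^sup>2 * JJ (rhoc 0) - JJ (rhoc x)) /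
     (AA (rhoc x) r / T r + NN x r / T r * (AA (rhoc 0) r / T r)) = E_nat r x"
      by (intro E_nat_outer[symmetric]) auto
  qed
  moreover have "ubl {r1..2 * rmax} (\<lambda>_. {xlo..xhi}) E_nat"
  proof -
    have I: "{r1..2 * rmax} \<subseteq> {rp P<..}" using r1 by auto
    have "ubl {r1..2 * rmax} (\<lambda>_. {xlo..xhi}) (\<lambda>r x. (T r)\<^sup>2 / Delta P r)"
      using T_sq_Delta_bounded[OF r1(1)] by (intro ubl_const) auto
    then show ?thesis unfolding E_nat_def[abs_def] by (intro ubl_intros n AA[OF I])
  qed
  ultimately have "ubl (?J \<union> {r1..2 * rmax}) (\<lambda>_. {xlo..xhi}) E_nat" by (rule ubl_Un)
  then show ?thesis by (rule ubl_subset) auto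
qed

section \<open>Closed forms of \<open>r_nat\<close>, \<open>f_nat\<close>, \<open>vel0\<close> and
  \<open>h0\<close>\<close>

lemma vel_pos: "rp P < r \<Longrightarrow> 0 < vel P r"
  using Delta_pos T_pos by (simp add: vel_def)

lemma vel_sq: "rp P < r \<Longrightarrow> (vel P r)\<^sup>2 = Delta P r / (T r)\<^sup>2"
  using Delta_pos[of r] by (simp add: vel_def power_divide)

lemma om_diff: "\<omega> \<noteq> 0 \<Longrightarrow> \<omega> - om_r P m r = \<omega> * (NN (of_int m / \<omega>) r / T r)"
  unfolding NN_T om_r_def by (simp add: right_diff_distrib)

lemma Phi_eq:
  assumes "\<omega> \<noteq> 0" "rp P < r"
  shows "(\<omega> - om_r P m r)\<^sup>2 / (vel P r)\<^sup>2 = \<omega>\<^sup>2 * ((NN (of_int m / \<omega>) r)\<^sup>2 / Delta P r)"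
  using T_pos[of r] Delta_pos[of r] assms
  by (simp add: om_diff vel_sq power_mult_distrib power_divide)

lemma Phi_has_derivative:
  assumes r: "rp P < r"
  shows "((\<lambda>s. (NN x s)\<^sup>2 / Delta P s) has_real_derivative
     2 * NN x r * (r - M) * (kappa r + a * x) / (Delta P r)\<^sup>2) (at r)"
proof -
  have D: "Delta P r \<noteq> 0" "r - M \<noteq> 0" using Delta_pos[OF r] M_less_rp r by auto
  have "((\<lambda>s. (NN x s)\<^sup>2 / Delta P s) has_real_derivative
     (2 * NN x r * (2 * r) * Delta P r - (NN x r)\<^sup>2 * (2 * r - 2 * M)) / (Delta P r * Delta P r)) (at r)"
    unfolding NN_def Delta_def
    by (rule derivative_eq_intros refl | use D in \<open>simp add: Delta_def; fail\<close>)+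
  moreover have "2 * NN x r * (2 * r) * Delta P r - (NN x r)\<^sup>2 * (2 * r - 2 * M) =
     2 * NN x r * (r - M) * (kappa r + a * x)"
  proof -
    have "(r - M) * (2 * M * (M\<^sup>2 - a\<^sup>2) / (r - M)) = 2 * M * (M\<^sup>2 - a\<^sup>2)" using D by simp
    then have "(r - M) * (kappa r + a * x) = (r - M) * ((r - M)\<^sup>2 - (3 * M\<^sup>2 - a\<^sup>2) + a * x) - 2 * M * (M\<^sup>2 - a\<^sup>2)"
      unfolding kappa_def by (simp add: algebra_simps)
    also have "\<dots> = 2 * r * Delta P r - NN x r * (r - M)"
      by (simp add: NN_def Delta_def power2_eq_square algebra_simps)
    finally have "2 * NN x r * ((r - M) * (kappa r + a * x)) = 2 * NN x r * (2 * r * Delta P r - NN x r * (r - M))"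
      by simp
    then show ?thesis by (simp add: power2_eq_square algebra_simps)
  qed
  ultimately show ?thesis by (simp add: power2_eq_square)
qed

lemma Rstar_Phi:
  assumes w: "\<omega> \<noteq> 0" and r: "rp P < r" and x: "x = of_int m / \<omega>"
  shows "Rstar P (\<lambda>s. (\<omega> - om_r P m s)\<^sup>2 / (vel P s)\<^sup>2) r =
     Delta P r / T r * (\<omega>\<^sup>2 * (2 * NN x r * (r - M) * (kappa r + a * x) / (Delta P r)\<^sup>2))"
proof -
  have "((\<lambda>s. \<omega>\<^sup>2 * ((NN x s)\<^sup>2 / Delta P s)) has_real_derivative
     \<omega>\<^sup>2 * (2 * NN x r * (r - M) * (kappa r + a * x) / (Delta P r)\<^sup>2)) (at r)"
    by (rule DERIV_cmult[OF Phi_has_derivative[OF r]])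
  then have "((\<lambda>s. (\<omega> - om_r P m s)\<^sup>2 / (vel P s)\<^sup>2) has_real_derivative
     \<omega>\<^sup>2 * (2 * NN x r * (r - M) * (kappa r + a * x) / (Delta P r)\<^sup>2)) (at r)"
    by (rule has_field_derivative_transform_within_open[where S = "{rp P<..}"])
      (use w r x Phi_eq in auto)
  then show ?thesis
    unfolding Rstar_def by (simp add: has_real_derivative_iff_has_vector_derivative vector_derivative_at)
qed

text \<open>The bound on \<open>a * x\<close> makes \<open>NN\<close> positive outside the horizon,
  so the derivative of the potential vanishes through the factor \<open>kappa r + a * x\<close>
  only.\<close>

lemma r_nat_eq:
  assumes w: "\<omega> \<noteq> 0" and x: "x = of_int m / \<omega>" "a * x < T (rp P)"
  shows "r_nat P \<omega> m = rho x"
proof -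
  have "Rstar P (\<lambda>s. (\<omega> - om_r P m s)\<^sup>2 / (vel P s)\<^sup>2) r = 0 \<longleftrightarrow> kappa r = - a * x" if "rp P < r" for r
    using Rstar_Phi[OF w that x(1)] NN_pos[of r x] x(2) that w Delta_pos[OF that] T_pos[of r] M_less_rp
    by auto
  then show ?thesis unfolding r_nat_def rho_def by (intro arg_cong[where f = The]) auto
qed

text \<open>\<open>NN^2 - JJ * Delta\<close> is the square of \<open>AA\<close>. This gives the
  minimum of the potential without any discussion of monotonicity: \<open>JJ\<close> is a lower
  bound, attained where \<open>AA\<close> vanishes.\<close>

lemma Phi_ge:
  assumes r: "rp P < r" and x: "x \<in> {xlo..xhi}"
  shows "JJ (rhoc x) \<le> (NN x r)\<^sup>2 / Delta P r"
proof -
  have "JJ (rhoc x) * Delta P r \<le> (NN x r)\<^sup>2"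
    using AA_sq[of r "rhoc x" x] r rhoc(1)[of x] rhoc_in[OF x] zero_le_power2[of "AA (rhoc x) r"]
    by simp
  then show ?thesis using Delta_pos[OF r] by (simp add: pos_le_divide_eq)
qed

lemma Phi_rhoc: "x \<in> {xlo..xhi} \<Longrightarrow> (NN x (rhoc x))\<^sup>2 / Delta P (rhoc x) = JJ (rhoc x)"
  using AA_sq[of "rhoc x" "rhoc x" x] rhoc(1)[of x] rhoc_in[of x] Delta_pos[of "rhoc x"]
  by (simp add: field_simps AA_def)

lemma INF_Phi:
  assumes "\<omega> \<noteq> 0" "of_int m / \<omega> \<in> {xlo..xhi}"
  shows "(INF s\<in>{rp P<..}. (\<omega> - om_r P m s)\<^sup>2 / (vel P s)\<^sup>2) = \<omega>\<^sup>2 * JJ (rhoc (of_int m / \<omega>))"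
proof (rule cInf_eq_minimum)
  show "\<omega>\<^sup>2 * JJ (rhoc (of_int m / \<omega>)) \<in> (\<lambda>s. (\<omega> - om_r P m s)\<^sup>2 / (vel P s)\<^sup>2) ` {rp P<..}"
    using rhoc(1) unfolding Phi_rhoc[OF assms(2), symmetric]
    by (intro image_eqI[of _ _ "rhoc (of_int m / \<omega>)"] Phi_eq[OF assms(1), symmetric]) auto
  show "\<omega>\<^sup>2 * JJ (rhoc (of_int m / \<omega>)) \<le> y"
    if y: "y \<in> (\<lambda>s. (\<omega> - om_r P m s)\<^sup>2 / (vel P s)\<^sup>2) ` {rp P<..}" for y
  proof -
    obtain s where s: "rp P < s" "y = (\<omega> - om_r P m s)\<^sup>2 / (vel P s)\<^sup>2"
      using y by (elim imageE) auto
    show ?thesis unfolding s(2) Phi_eq[OF assms(1) s(1)]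
      using Phi_ge[OF s(1) assms(2)] by (rule mult_left_mono) simp
  qed
qed

text \<open>The factor -1 or 1 in \<open>f_nat\<close> is the sign of \<open>AA\<close> and cancels
  the absolute value that the root of a square produces.\<close>

lemma f_nat_eq:
  assumes w: "\<omega> \<noteq> 0" and x: "of_int m / \<omega> \<in> {xlo..xhi}" and r: "rp P < r"
  shows "f_nat P \<omega> m r = AA (rhoc (of_int m / \<omega>)) r / sqrt (Delta P r)"
proof -
  let ?x = "of_int m / \<omega>"
  have eq: "(\<omega> - om_r P m s)\<^sup>2 / (\<omega>\<^sup>2 * (vel P s)\<^sup>2) = (NN ?x s)\<^sup>2 / Delta P s" if "rp P < s" for s
  proof -
    have "(\<omega> - om_r P m s)\<^sup>2 / (\<omega>\<^sup>2 * (vel P s)\<^sup>2) = ((\<omega> - om_r P m s)\<^sup>2 / (vel P s)\<^sup>2) / \<omega>\<^sup>2"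
      by simp
    then show ?thesis unfolding Phi_eq[OF w that, of m] using w by simp
  qed
  have "(INF s\<in>{rp P<..}. (\<omega> - om_r P m s)\<^sup>2 / (\<omega>\<^sup>2 * (vel P s)\<^sup>2)) = JJ (rhoc ?x)"
  proof (rule cInf_eq_minimum)
    show "JJ (rhoc ?x) \<in> (\<lambda>s. (\<omega> - om_r P m s)\<^sup>2 / (\<omega>\<^sup>2 * (vel P s)\<^sup>2)) ` {rp P<..}"
      using rhoc(1) eq[OF rhoc(1)] Phi_rhoc[OF x] by (intro image_eqI[of _ _ "rhoc ?x"]) auto
  qed (use eq Phi_ge[OF _ x] in auto)
  moreover have "r_nat P \<omega> m = rhoc ?x"
    using r_nat_eq[OF w refl] rhoc_eq_rho[OF x] X_less[of ?x] x by auto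
  moreover have "(NN ?x r)\<^sup>2 / Delta P r - JJ (rhoc ?x) = (AA (rhoc ?x) r)\<^sup>2 / Delta P r"
    using AA_sq[of r "rhoc ?x" ?x] r rhoc(1)[of ?x] rhoc_in[OF x] Delta_pos[OF r]
    by (simp add: field_simps)
  ultimately have "f_nat P \<omega> m r = (if r < rhoc ?x then - 1 else 1) * sqrt ((AA (rhoc ?x) r)\<^sup>2 / Delta P r)"
    unfolding f_nat_def eq[OF r] by simp
  also have "\<dots> = (if r < rhoc ?x then - 1 else 1) * (\<bar>AA (rhoc ?x) r\<bar> / sqrt (Delta P r))"
    by (simp add: real_sqrt_divide)
  also have "\<dots> = AA (rhoc ?x) r / sqrt (Delta P r)"
    using AA_sgn[OF r rhoc(1), of ?x] by auto
  finally show ?thesis .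
qed

lemma JJ_pos: "0 < JJ (rhoc x)"
  using rhoc(1)[of x] Delta_pos M_less_rp rp_pos unfolding JJ_def
  by (intro divide_pos_pos mult_pos_pos) auto

text \<open>For \<open>x = 0\<close> the potential is \<open>1 / v\<^sup>2\<close>, so its minimum
  \<open>JJ (rhoc 0)\<close> gives the maximum of \<open>v\<close>, attained at
  \<open>rhoc 0\<close>.\<close>

lemma vel_le: "rp P < r \<Longrightarrow> vel P r \<le> 1 / sqrt (JJ (rhoc 0))"
proof -
  assume r: "rp P < r"
  have "JJ (rhoc 0) \<le> (T r)\<^sup>2 / Delta P r" using Phi_ge[OF r zero_in_X] by (simp add: NN_def)
  then have "(vel P r)\<^sup>2 \<le> 1 / JJ (rhoc 0)"
  proof -
    have "1 / ((T r)\<^sup>2 / Delta P r) \<le> 1 / JJ (rhoc 0)"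
      using \<open>JJ (rhoc 0) \<le> _\<close> JJ_pos[of 0] by (intro divide_left_mono mult_pos_pos) auto
    then show ?thesis using vel_sq[OF r] by simp
  qed
  then have "sqrt ((vel P r)\<^sup>2) \<le> sqrt (1 / JJ (rhoc 0))" by (rule real_sqrt_le_mono)
  then show ?thesis using vel_pos[OF r] by (simp add: real_sqrt_divide)
qed

lemma vel0_sq: "(vel0 P)\<^sup>2 = 1 / JJ (rhoc 0)"
proof -
  have "vel0 P = 1 / sqrt (JJ (rhoc 0))"
    unfolding vel0_def
  proof (rule cSup_eq_maximum)
    have "(vel P (rhoc 0))\<^sup>2 = 1 / JJ (rhoc 0)"
      using Phi_rhoc[OF zero_in_X] vel_sq[OF rhoc(1), of 0] T_pos[of "rhoc 0"] Delta_pos[OF rhoc(1), of 0] JJ_pos[of 0]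
      by (simp add: NN_def field_simps)
    then have "vel P (rhoc 0) = 1 / sqrt (JJ (rhoc 0))"
      using vel_pos[OF rhoc(1), of 0] by (metis real_sqrt_abs abs_of_pos real_sqrt_divide real_sqrt_one)
    then show "1 / sqrt (JJ (rhoc 0)) \<in> vel P ` {rp P<..}" using rhoc(1) by (metis greaterThan_iff imageI)
  qed (use vel_le in auto)
  then show ?thesis using JJ_pos[of 0] by (simp add: power_divide)
qed

text \<open>The setup gives only the square of \<open>h0\<close> and its monotonicity. The square
  vanishes at \<open>rhoc 0\<close>, so monotonicity fixes the sign on either side, and it is the
  sign of \<open>AA (rhoc 0)\<close>.\<close>

lemma h0_eq:
  assumes r: "rp P < r"
  shows "h0 P r = AA (rhoc 0) r / T r"
proof -
  have sq: "(h0 P s)\<^sup>2 = (AA (rhoc 0) s / T s)\<^sup>2" if "rp P < s" for s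
    using h0_sq[OF that] AA_zero_sq[OF that] vel_sq[OF that] vel0_sq JJ_pos[of 0] by simp
  have "h0 P (rhoc 0) = 0" using sq[OF rhoc(1), of 0] by (simp add: AA_def)
  then have "rhoc 0 \<le> r \<Longrightarrow> 0 \<le> h0 P r" "r \<le> rhoc 0 \<Longrightarrow> h0 P r \<le> 0"
    using mono_onD[OF mono_h0, of "rhoc 0" r] mono_onD[OF mono_h0, of r "rhoc 0"] r rhoc(1)[of 0] by auto
  moreover have "rhoc 0 \<le> r \<Longrightarrow> 0 \<le> AA (rhoc 0) r / T r" "r \<le> rhoc 0 \<Longrightarrow> AA (rhoc 0) r / T r \<le> 0"
    using AA_sgn[OF r rhoc(1), of 0] T_pos[of r] by (auto intro: divide_nonneg_pos divide_nonpos_pos)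
  ultimately show ?thesis using sq[OF r] power2_eq_iff[of "h0 P r"]
    by (cases "rhoc 0 \<le> r") (smt (verit))+
qed

end

section \<open>The multipliers of the commutator\<close>

text \<open>With \<open>\<alpha>\<close> the function of degree 0 with profile \<open>d\<close>,
  both \<open>q * \<alpha>\<close> and \<open>p * \<alpha>\<close> are of degree 1 with compactly
  supported profiles \<open>d y\<close> and \<open>d y * y\<close>, hence Lipschitz; dividing out
  \<open>q\<close> or \<open>p\<close> costs the factor
  \<open>max \<bar>p'\<bar> \<bar>q'\<bar>\<close>. The value 0 at \<open>q = 0\<close> fits because
  \<open>d\<close> vanishes for large \<open>y\<close>.\<close>

lemma hom0_lipschitz:
  fixes d :: "'i \<Rightarrow> real \<Rightarrow> real"
  assumes d: "ubl I (\<lambda>_. UNIV) d" and Y: "\<And>i y. i \<in> I \<Longrightarrow> Y < \<bar>y\<bar> \<Longrightarrow> d i y = 0"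
  shows "\<exists>C\<ge>0. \<forall>i\<in>I. \<forall>p q p' q'.
    max \<bar>p'\<bar> \<bar>q'\<bar> * \<bar>(if q = 0 then 0 else d i (p / q)) - (if q' = 0 then 0 else d i (p' / q'))\<bar>
      \<le> C * (\<bar>p - p'\<bar> + \<bar>q - q'\<bar>)"
proof -
  define Y' where "Y' = max 0 Y"
  have Y': "0 \<le> Y'" "\<And>i y. i \<in> I \<Longrightarrow> Y' < \<bar>y\<bar> \<Longrightarrow> d i y = 0" using Y by (auto simp: Y'_def)
  have "ubl I (\<lambda>_. UNIV) (\<lambda>i y. d i y * y)"
  proof (rule ubl_cutoff[OF d], rule ubl_ident)
    fix i x assume "i \<in> I" "x \<in> {x \<in> UNIV. d i x \<noteq> 0}"
    then show "\<bar>x\<bar> \<le> Y'" using Y'(2)[of i x] by force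
  qed
  then obtain L where L: "0 \<le> L" "\<And>i y. i \<in> I \<Longrightarrow> \<bar>d i y * y\<bar> \<le> L"
    "\<And>i x y. i \<in> I \<Longrightarrow> \<bar>d i x * x - d i y * y\<bar> \<le> L * \<bar>x - y\<bar>"
    by (rule ublE) auto
  obtain K where K: "0 \<le> K" "\<And>i y. i \<in> I \<Longrightarrow> \<bar>d i y\<bar> \<le> K"
    "\<And>i x y. i \<in> I \<Longrightarrow> \<bar>d i x - d i y\<bar> \<le> K * \<bar>x - y\<bar>"
    using d by (rule ublE) auto
  define C where "C = (K + L) * (1 + Y') + K"
  have "0 \<le> C" using K(1) L(1) Y'(1) by (simp add: C_def)
  moreover have "max \<bar>p'\<bar> \<bar>q'\<bar> * \<bar>(if q = 0 then 0 else d i (p / q)) - (if q' = 0 then 0 else d i (p' / q'))\<bar>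
      \<le> C * (\<bar>p - p'\<bar> + \<bar>q - q'\<bar>)" if i: "i \<in> I" for i p q p' q'
  proof -
    define \<alpha> \<alpha>' where "\<alpha> = (if q = 0 then 0 else d i (p / q))" and "\<alpha>' = (if q' = 0 then 0 else d i (p' / q'))"
    define s where "s = \<bar>p - p'\<bar> + \<bar>q - q'\<bar>"
    have \<alpha>K: "\<bar>\<alpha>\<bar> \<le> K" using K(1,2) i by (auto simp: \<alpha>_def)
    have "\<bar>q * d i (p / q) - q' * d i (p' / q')\<bar> \<le> K * (1 + Y') * s"
      unfolding s_def by (rule hom1_lipschitz) (use K Y' i in auto)
    then have 1: "\<bar>q * \<alpha> - q' * \<alpha>'\<bar> \<le> K * (1 + Y') * s"
      by (auto simp: \<alpha>_def \<alpha>'_def)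
    have "\<bar>q * (d i (p / q) * (p / q)) - q' * (d i (p' / q') * (p' / q'))\<bar> \<le> L * (1 + Y') * s"
      unfolding s_def by (rule hom1_lipschitz[where d = "\<lambda>y. d i y * y"]) (use L Y' i in auto)
    moreover have "q * (d i (p / q) * (p / q)) = p * \<alpha>" "q' * (d i (p' / q') * (p' / q')) = p' * \<alpha>'"
      by (auto simp: \<alpha>_def \<alpha>'_def)
    ultimately have 2: "\<bar>p * \<alpha> - p' * \<alpha>'\<bar> \<le> L * (1 + Y') * s" by simp
    have *: "\<bar>z'\<bar> * \<bar>\<alpha> - \<alpha>'\<bar> \<le> C * s"
      if z: "\<bar>z * \<alpha> - z' * \<alpha>'\<bar> \<le> B * (1 + Y') * s" "\<bar>z - z'\<bar> \<le> s" "B \<le> K + L" for z z' B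
    proof -
      \<comment> \<open>Used with \<open>z = p\<close> and with \<open>z = q\<close>: it recovers
        the increment of \<open>\<alpha>\<close> from that of \<open>z * \<alpha>\<close>.\<close>
      have "z' * (\<alpha> - \<alpha>') = (z * \<alpha> - z' * \<alpha>') - (z - z') * \<alpha>" by (simp add: algebra_simps)
      then have "\<bar>z'\<bar> * \<bar>\<alpha> - \<alpha>'\<bar> \<le> \<bar>z * \<alpha> - z' * \<alpha>'\<bar> + \<bar>z - z'\<bar> * \<bar>\<alpha>\<bar>"
        by (metis abs_mult abs_triangle_ineq4)
      also have "\<dots> \<le> B * (1 + Y') * s + s * K"
        using z \<alpha>K K(1) by (intro add_mono mult_mono) (auto simp: s_def)
      also have "\<dots> \<le> (K + L) * (1 + Y') * s + s * K"
        using z Y'(1) by (intro add_right_mono mult_right_mono) (auto simp: s_def)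
      also have "\<dots> = C * s" by (simp add: C_def algebra_simps)
      finally show ?thesis .
    qed
    have "\<bar>p'\<bar> * \<bar>\<alpha> - \<alpha>'\<bar> \<le> C * s" by (rule *[OF 2]) (use K(1) in \<open>auto simp: s_def\<close>)
    moreover have "\<bar>q'\<bar> * \<bar>\<alpha> - \<alpha>'\<bar> \<le> C * s" by (rule *[OF 1]) (use L(1) in \<open>auto simp: s_def\<close>)
    ultimately show ?thesis unfolding \<alpha>_def[symmetric] \<alpha>'_def[symmetric] s_def[symmetric]
      by (simp add: max_def)
  qed
  ultimately show ?thesis by blast
qed

context kerr
begin

section \<open>Cut-offs and critical radii in terms of \<open>y = \<omega>/m\<close>\<close>

lemma smooth_data: "smooth (Rss P)" "smooth (chi1 P)" "smooth (chi2 P)" "smooth (psi P)" "smooth (chi_hi P)"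
  using admissible unfolding kerr_setup_def by blast+

lemma cutoff_bounds: "0 \<le> chi1 P y" "chi1 P y \<le> 1" "0 \<le> chi2 P y" "chi2 P y \<le> 1"
    "0 \<le> psi P y" "psi P y \<le> 1" "0 \<le> chi_hi P y"
  using admissible unfolding kerr_setup_def by blast+

lemma chi1_eq_1: "y \<le> - xi_l P \<or> Op + xi_r P \<le> y \<Longrightarrow> chi1 P y = 1"
  and chi1_eq_0: "- (3/4) * xi_l P \<le> y \<Longrightarrow> y \<le> Op + (3/4) * xi_r P \<Longrightarrow> chi1 P y = 0"
  and chi2_eq_1: "y \<le> - (3/4) * xi_l P \<or> Op + (3/4) * xi_r P \<le> y \<Longrightarrow> chi2 P y = 1"
  and chi2_eq_0: "- (1/2) * xi_l P \<le> y \<Longrightarrow> y \<le> Op + (1/2) * xi_r P \<Longrightarrow> chi2 P y = 0"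
  and psi_eq_0: "y \<le> del P / 4 \<Longrightarrow> psi P y = 0"
  and psi_eq_1: "del P / 2 \<le> y \<Longrightarrow> psi P y = 1"
  and chi_hi_eq_1: "y < r_hi P + (7/8) * del P \<Longrightarrow> chi_hi P y = 1"
  using admissible unfolding kerr_setup_def by blast+

lemma Rss_bounds: "(\<omega>, m) \<in> G_set P \<Longrightarrow>
    R_sharp P \<omega> m \<le> Rss P (\<omega> / of_int m) \<and> Rss P (\<omega> / of_int m) < R_sharp P \<omega> m + del P / 4"
  using admissible unfolding kerr_setup_def by blast

lemma r_nat_less_r_lo: "of_int m * om_plus P m < of_int m * \<omega> \<Longrightarrow>
    of_int m * \<omega> < of_int m * om_plus P m + xi_r P * (of_int m)\<^sup>2 \<Longrightarrow> r_nat P \<omega> m < r_lo P"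
  and r_nat_less_r_hi: "- xi_l P * (of_int m)\<^sup>2 < of_int m * \<omega> \<Longrightarrow>
    of_int m * \<omega> \<le> - (1/2) * xi_l P * (of_int m)\<^sup>2 \<Longrightarrow> r_nat P \<omega> m < r_hi P"
  using admissible unfolding kerr_setup_def by blast+

text \<open>By homogeneity a frequency with \<open>m \<noteq> 0\<close> is represented by the pair
  \<open>(y, 1)\<close>. Between the two thresholds the solution of \<open>y = a / T r\<close> is
  monotone in \<open>y\<close>, so it stays between the two radii.\<close>

lemma R_sharp_bounds: "r_lo P \<le> R_sharp P y 1" "R_sharp P y 1 \<le> r_hi P"
proof -
  have lo: "0 < r_lo P" "0 < r_hi P" using rp_pos rp_less_r_lo r_lo_less_r_hi by auto
  have "r_lo P \<le> R_sharp P y 1 \<and> R_sharp P y 1 \<le> r_hi P"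
  proof (cases "y \<le> a / T (r_hi P) \<or> a / T (r_lo P) \<le> y")
    case True
    then show ?thesis using r_lo_less_r_hi by (auto simp: R_sharp_def)
  next
    case False
    then have y: "a / T (r_hi P) < y" "y < a / T (r_lo P)" by auto
    have y0: "0 < y" using y(1) a_pos T_pos[of "r_hi P"] by (smt (verit) divide_pos_pos)
    \<comment> \<open>The square of the radius at which \<open>y = a / T r\<close>.\<close>
    define z where "z = a / y - a\<^sup>2"
    have z: "(r_lo P)\<^sup>2 \<le> z" "z \<le> (r_hi P)\<^sup>2"
      using y y0 T_pos[of "r_hi P"] T_pos[of "r_lo P"] by (auto simp: z_def field_simps)
    have z0: "0 < z" using z(1) lo by (smt (verit) zero_less_power)
    have s: "r_lo P \<le> sqrt z" "sqrt z \<le> r_hi P"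
      using z lo by (auto intro: real_le_rsqrt real_le_lsqrt)
    have "(THE r. rp P < r \<and> y - om_r P 1 r = 0) = sqrt z"
    proof (rule the_equality)
      show "rp P < sqrt z \<and> y - om_r P 1 (sqrt z) = 0"
        using s rp_less_r_lo z0 y0 a_pos by (auto simp: om_r_def z_def)
    next
      fix r assume r: "rp P < r \<and> y - om_r P 1 r = 0"
      then have "y * T r = a" using T_pos[of r] by (simp add: om_r_def)
      then have "r\<^sup>2 = z" using y0 by (simp add: z_def field_simps)
      then show "r = sqrt z" using r rp_pos by auto
    qed
    moreover have "R_sharp P y 1 = (THE r. rp P < r \<and> y - om_r P 1 r = 0)"
      unfolding R_sharp_def using y by (auto simp: not_le)
    ultimately show ?thesis using s by simp
  qed
  then show "r_lo P \<le> R_sharp P y 1" "R_sharp P y 1 \<le> r_hi P" by auto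
qed

lemma chi1_ne_1: "chi1 P y \<noteq> 1 \<Longrightarrow> - xi_l P < y \<and> y < Op + xi_r P"
  using chi1_eq_1[of y] by force

lemma om_plus_1: "om_plus P 1 = Op" by (simp add: om_plus_def)

lemma Rss_on_support:
  assumes "chi1 P y \<noteq> 1"
  shows "R_sharp P y 1 \<le> Rss P y" "Rss P y < R_sharp P y 1 + del P / 4"
proof -
  have "(y, 1) \<in> G_set P" using chi1_ne_1[OF assms] by (simp add: G_set_def om_plus_1)
  from Rss_bounds[OF this] show "R_sharp P y 1 \<le> Rss P y" "Rss P y < R_sharp P y 1 + del P / 4" by auto
qed

text \<open>The cut-off in front of \<open>W_sharp\<close>, as a function of radius and angle for
  \<open>m \<noteq> 0\<close>; for \<open>m = 0\<close> that cut-off is 0.\<close>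

definition tsharp where "tsharp r y = (1 - chi1 P y) * psi P (r - Rss P y)"

lemma tsharp_support:
  assumes "tsharp r y \<noteq> 0"
  shows "- xi_l P < y" "y < Op + xi_r P" "R_sharp P y 1 + del P / 4 < r" "r_lo P < r"
proof -
  have 1: "chi1 P y \<noteq> 1" and "\<not> r - Rss P y \<le> del P / 4"
    using assms psi_eq_0 by (auto simp: tsharp_def)
  then show "R_sharp P y 1 + del P / 4 < r" using Rss_on_support[OF 1] by simp
  then show "r_lo P < r" using R_sharp_bounds(1)[of y] del_pos by simp
qed (use chi1_ne_1[of y] assms in \<open>auto simp: tsharp_def\<close>)

lemma inverse_in_X:
  assumes "y < - (1/2) * xi_l P \<or> Op + (1/2) * xi_r P < y"
  shows "y \<noteq> 0" "1 / y \<in> {xlo..xhi}"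
proof -
  show "y \<noteq> 0" using assms xi_l_pos xi_r_pos Op_pos by auto
  show "1 / y \<in> {xlo..xhi}"
  proof (cases "y < 0")
    case True
    then have "y < - (1/2) * xi_l P" using assms xi_r_pos Op_pos by auto
    then have "xlo \<le> 1 / y" using True xi_l_pos by (simp add: xlo_def field_simps)
    moreover have "1 / y \<le> xhi" using True xhi_pos by (smt (verit) divide_pos_neg zero_less_one)
    ultimately show ?thesis by simp
  next
    case False
    then have y: "Op + (1/2) * xi_r P < y" using assms xi_l_pos by auto
    moreover have "0 < Op + (1/2) * xi_r P" using Op_pos xi_r_pos by auto
    ultimately have "1 / y \<le> 1 / (Op + (1/2) * xi_r P)" "0 \<le> 1 / y"
      using False by (auto intro!: divide_left_mono mult_pos_pos)
    moreover have "xhi = 1 / (Op + (1/2) * xi_r P)" by (simp add: xhi_def)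
    ultimately show ?thesis using xlo_neg unfolding atLeastAtMost_iff by linarith
  qed
qed

lemma chi2_support: "chi2 P y \<noteq> 0 \<Longrightarrow> y < - (1/2) * xi_l P \<or> Op + (1/2) * xi_r P < y"
  using chi2_eq_0[of y] by force

lemma chi1_support: "chi1 P y \<noteq> 0 \<Longrightarrow> y < - (1/2) * xi_l P \<or> Op + (1/2) * xi_r P < y"
  using chi1_eq_0[of y] xi_l_pos xi_r_pos by force

text \<open>The point of the choice of the two sharp radii. For negative \<open>y\<close> the
  critical radius is below \<open>r_hi P\<close>, which is then \<open>R_sharp\<close>; for positive
  \<open>y\<close> it is below \<open>r_lo P\<close>, which never exceeds \<open>R_sharp\<close>;
  and \<open>tsharp\<close> lives beyond \<open>R_sharp\<close> by at least
  \<open>del P / 4\<close>.\<close>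

lemma rhoc_less_on_support:
  assumes t: "tsharp r y \<noteq> 0" and c: "chi2 P y \<noteq> 0"
  shows "rhoc (1 / y) + del P / 4 < r"
proof -
  note y = chi2_support[OF c]
  have X: "y \<noteq> 0" "1 / y \<in> {xlo..xhi}" using inverse_in_X[OF y] by auto
  have rn: "r_nat P y 1 = rhoc (1 / y)"
    using r_nat_eq[of y "1 / y" 1] X_less[of "1 / y"] rhoc_eq_rho[OF X(2)] X by simp
  show ?thesis
  proof (cases "y < - (1/2) * xi_l P")
    case True
    then have "r_nat P y 1 < r_hi P" using r_nat_less_r_hi[of 1 y] tsharp_support(1)[OF t] by simp
    moreover have "y \<le> a / T (r_hi P)"
      using True xi_l_pos a_pos T_pos[of "r_hi P"] by (smt (verit) divide_pos_pos mult_minus_left mult_pos_pos)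
    then have "R_sharp P y 1 = r_hi P" by (simp add: R_sharp_def)
    ultimately show ?thesis using tsharp_support(3)[OF t] rn by simp
  next
    case False
    then have "r_nat P y 1 < r_lo P" using y r_nat_less_r_lo[of 1 y] tsharp_support(2)[OF t] xi_r_pos om_plus_1 by simp
    then show ?thesis using tsharp_support(3)[OF t] rn R_sharp_bounds(1)[of y] by simp
  qed
qed

text \<open>The minimum of the potential divided by its value at \<open>r\<close>. Thus
  \<open>hsharp\<close> interpolates between 1, where \<open>chi2\<close> vanishes, and
  \<open>\<bar>AA\<bar> / NN\<close>, where \<open>chi2\<close> is 1.\<close>

definition beta where
  "beta r y = JJ (rhoc (1 / y)) * (Delta P r / (T r)\<^sup>2) / (NN (1 / y) r / T r)\<^sup>2"
definition hsharp where "hsharp r y = sqrt (1 - chi2 P y * beta r y)"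
text \<open>\<open>v m E_sharp\<close> is \<open>(\<omega> - \<omega>\<^sub>r) (h - h\<^sub>0)/v\<close> for \<open>h\<close> the \<open>h\<close>-sharp of the frequency, with \<open>y = \<omega>/m\<close>.\<close>

definition E_sharp where
  "E_sharp r y = (y - a / T r) * ((hsharp r y - AA (rhoc 0) r / T r) * ((T r)\<^sup>2 / Delta P r))"

lemma one_minus_beta:
  assumes r: "rp P < r" and c: "chi2 P y \<noteq> 0"
  shows "1 - beta r y = ((AA (rhoc (1 / y)) r / T r) / (NN (1 / y) r / T r))\<^sup>2"
proof -
  have X: "1 / y \<in> {xlo..xhi}" by (rule inverse_in_X[OF chi2_support[OF c]])
  have "NN (1 / y) r / T r \<noteq> 0" using NN_T_ge[OF r, of "1 / y"] X cN_pos by (smt (verit) atLeastAtMost_iff)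
  then show ?thesis
    unfolding power_divide[of "AA (rhoc (1 / y)) r / T r"] AA_scaled_sq[OF r X] beta_def diff_divide_distrib
    by simp
qed

lemma beta_nonneg: "rp P < r \<Longrightarrow> 0 \<le> beta r y"
  using JJ_pos[of "1 / y"] Delta_pos[of r] unfolding beta_def by (intro divide_nonneg_nonneg mult_nonneg_nonneg) auto

text \<open>Where \<open>chi2\<close> vanishes the radicand is 1. Elsewhere it is at least
  \<open>1 - beta\<close>, the square of \<open>AA / NN\<close>, and \<open>AA\<close> is bounded
  below because \<open>r\<close> exceeds the critical radius by \<open>del P / 4\<close>.\<close>

lemma hsharp_lower_bound:
  "\<exists>c>0. \<forall>r y. rp P < r \<longrightarrow> tsharp r y \<noteq> 0 \<longrightarrow> c \<le> 1 - chi2 P y * beta r y"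
proof -
  define B where "B = 1 + 1 / a * max (- xlo) xhi"
  \<comment> \<open>If \<open>r > p + del P / 4\<close> and \<open>p \<le> rmax\<close>, then
    \<open>1 - p / r\<close> is at least \<open>e\<close>.\<close>
  define e where "e = del P / 4 / (rmax + del P / 4)"
  define c where "c = (e * (sqrt cq / 2) / B)\<^sup>2"
  have B: "0 < B" using a_pos xhi_pos by (simp add: B_def add_pos_nonneg)
  have rmax: "0 < rmax" using rmin_le_rmax rmin_gt rp_pos by simp
  have e: "0 < e" using del_pos rmax by (simp add: e_def)
  have "min 1 c \<le> 1 - chi2 P y * beta r y" if r: "rp P < r" and t: "tsharp r y \<noteq> 0" for r y
  proof (cases "chi2 P y = 0")
    case False
    have X: "1 / y \<in> {xlo..xhi}" by (rule inverse_in_X[OF chi2_support[OF False]])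
    have "e \<le> \<bar>1 - rhoc (1 / y) * (1 / r)\<bar>"
    proof -
      have r': "rhoc (1 / y) + del P / 4 < r" by (rule rhoc_less_on_support[OF t False])
      have "rhoc (1 / y) / r \<le> rhoc (1 / y) / (rhoc (1 / y) + del P / 4)"
        using r' r rp_pos rhoc(1)[of "1 / y"] del_pos by (intro divide_left_mono mult_pos_pos) auto
      also have "\<dots> = 1 - del P / 4 / (rhoc (1 / y) + del P / 4)"
        using rhoc(1)[of "1 / y"] rp_pos del_pos by (simp add: field_simps)
      finally have 1: "rhoc (1 / y) / r \<le> 1 - del P / 4 / (rhoc (1 / y) + del P / 4)" .
      have "e \<le> del P / 4 / (rhoc (1 / y) + del P / 4)"
        unfolding e_def using rhoc(1)[of "1 / y"] rhoc_bounds(2)[of "1 / y"] rp_pos del_pos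
        by (intro divide_left_mono mult_pos_pos) auto
      with 1 show ?thesis by (simp only: mult_1_right times_divide_eq_right)
    qed
    then have "e * (sqrt cq / 2) \<le> \<bar>1 - rhoc (1 / y) * (1 / r)\<bar> * (sqrt cq / 2)"
      using cq_pos by (intro mult_right_mono) auto
    also have "\<dots> \<le> \<bar>AA (rhoc (1 / y)) r / T r\<bar>" by (rule AA_ge[OF r])
    finally have u: "e * (sqrt cq / 2) \<le> \<bar>AA (rhoc (1 / y)) r / T r\<bar>" .
    have n: "0 < NN (1 / y) r / T r" using NN_T_ge[OF r, of "1 / y"] X cN_pos by (smt (verit) atLeastAtMost_iff)
    have "\<bar>a / T r * (1 / y)\<bar> \<le> 1 / a * max (- xlo) xhi"
      unfolding abs_mult using a_T[of r] X_bounded[OF X] a_pos by (intro mult_mono) auto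
    then have nB: "\<bar>NN (1 / y) r / T r\<bar> \<le> B" unfolding NN_T B_def by linarith
    have "e * (sqrt cq / 2) / B \<le> \<bar>AA (rhoc (1 / y)) r / T r\<bar> / \<bar>NN (1 / y) r / T r\<bar>"
      using n by (intro frac_le u nB abs_ge_zero) linarith
    then have "c \<le> (\<bar>AA (rhoc (1 / y)) r / T r\<bar> / \<bar>NN (1 / y) r / T r\<bar>)\<^sup>2"
      unfolding c_def using e cq_pos B by (intro power_mono) auto
    also have "\<dots> = 1 - beta r y" unfolding one_minus_beta[OF r False]
      by (simp only: power_divide power2_abs)
    also have "\<dots> \<le> 1 - chi2 P y * beta r y"
      using mult_right_mono[OF cutoff_bounds(4) beta_nonneg[OF r, of y], of y] by simp
    finally show ?thesis by simp
  qed simp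
  moreover have "0 < min 1 c" using e cq_pos B by (simp add: c_def)
  ultimately show ?thesis by blast
qed

lemma ubl_psi: "ubl I S (\<lambda>_. psi P)" and ubl_chi1: "ubl I S (\<lambda>_. chi1 P)" and ubl_chi2: "ubl I S (\<lambda>_. chi2 P)"
proof -
  have "ubl I (\<lambda>_. UNIV) (\<lambda>_. psi P)"
    by (rule smooth_imp_ubl_UNIV[where \<alpha> = 0 and \<beta> = "del P"]) (use smooth_data del_pos psi_eq_0 psi_eq_1 in auto)
  then show "ubl I S (\<lambda>_. psi P)" by (rule ubl_subset) auto
  have *: "- xi_l P \<le> Op + xi_r P" using xi_l_pos xi_r_pos Op_pos by simp
  have "ubl I (\<lambda>_. UNIV) (\<lambda>_. chi1 P)"
    by (rule smooth_imp_ubl_UNIV[OF _ *]) (use smooth_data chi1_eq_1 in auto)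
  then show "ubl I S (\<lambda>_. chi1 P)" by (rule ubl_subset) auto
  have "ubl I (\<lambda>_. UNIV) (\<lambda>_. chi2 P)"
  proof (rule smooth_imp_ubl_UNIV[OF _ *])
    show "chi2 P x = chi2 P (- xi_l P)" if "x \<le> - xi_l P" for x
      using chi2_eq_1[of x] chi2_eq_1[of "- xi_l P"] that xi_l_pos by auto
    show "chi2 P x = chi2 P (Op + xi_r P)" if "Op + xi_r P \<le> x" for x
      using chi2_eq_1[of x] chi2_eq_1[of "Op + xi_r P"] that xi_r_pos by auto
  qed (use smooth_data in auto)
  then show "ubl I S (\<lambda>_. chi2 P)" by (rule ubl_subset) auto
qed

text \<open>\<open>Rss\<close> is Lipschitz on bounded intervals only, so the factor
  \<open>1 - chi1\<close> is used to confine \<open>y\<close>. The constant is uniform in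
  \<open>r\<close> because \<open>psi\<close> is globally Lipschitz and \<open>r\<close> drops out
  of the difference of its arguments.\<close>

lemma ubl_tsharp: "ubl I S tsharp"
proof -
  have "ubl I (\<lambda>_. UNIV) (\<lambda>r y. (1 - chi1 P y) * psi P (r - Rss P y))"
  proof (rule ubl_cutoff)
    show "ubl I (\<lambda>_. UNIV) (\<lambda>r y. 1 - chi1 P y)" by (intro ubl_intros ubl_chi1)
    obtain K where K: "0 \<le> K" "\<And>x y. \<bar>psi P x - psi P y\<bar> \<le> K * \<bar>x - y\<bar>"
      using ubl_psi[of "UNIV :: unit set" "\<lambda>_. UNIV"] by (rule ublE) auto
    obtain L where L: "\<And>x y. x \<in> {- xi_l P..Op + xi_r P} \<Longrightarrow> y \<in> {- xi_l P..Op + xi_r P} \<Longrightarrow> \<bar>Rss P x - Rss P y\<bar> \<le> L * \<bar>x - y\<bar>"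
      using smooth_imp_ubl[OF smooth_data(1), of "UNIV :: unit set" "- xi_l P" "Op + xi_r P"] by (rule ublE) auto
    show "ubl I (\<lambda>i. {y \<in> UNIV. 1 - chi1 P y \<noteq> 0}) (\<lambda>r y. psi P (r - Rss P y))"
    proof (rule ublI[where B = 1 and L = "K * L"])
      fix r x y assume "x \<in> {y \<in> UNIV. 1 - chi1 P y \<noteq> 0}" "y \<in> {y \<in> UNIV. 1 - chi1 P y \<noteq> 0}"
      then have "\<bar>Rss P y - Rss P x\<bar> \<le> L * \<bar>y - x\<bar>"
        using chi1_ne_1[of x] chi1_ne_1[of y] by (intro L) auto
      then have "K * \<bar>(r - Rss P x) - (r - Rss P y)\<bar> \<le> K * (L * \<bar>x - y\<bar>)"
        using K(1) by (intro mult_left_mono) (auto simp: abs_minus_commute)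
      then show "\<bar>psi P (r - Rss P x) - psi P (r - Rss P y)\<bar> \<le> K * L * \<bar>x - y\<bar>"
        using K(2)[of "r - Rss P x" "r - Rss P y"] by (simp add: mult.assoc)
    qed (use cutoff_bounds in auto)
  qed
  then have "ubl I (\<lambda>_. UNIV) tsharp" unfolding tsharp_def[abs_def] .
  then show ?thesis by (rule ubl_subset) auto
qed

lemma inverse_bounded: "chi2 P y \<noteq> 0 \<Longrightarrow> min ((1/2) * xi_l P) (Op + (1/2) * xi_r P) \<le> \<bar>y\<bar>"
proof -
  assume "chi2 P y \<noteq> 0"
  then have "(1/2) * xi_l P \<le> \<bar>y\<bar> \<or> Op + (1/2) * xi_r P \<le> \<bar>y\<bar>"
    using chi2_support[of y] by linarith
  then show ?thesis unfolding min_le_iff_disj .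
qed

lemma y_bounded: "tsharp r y \<noteq> 0 \<Longrightarrow> \<bar>y\<bar> \<le> max (xi_l P) (Op + xi_r P)"
  using tsharp_support(1,2)[of r y] by auto

text \<open>The nested set is the form that \<open>ubl_cutoff\<close> requires for the cut-off
  \<open>chi2\<close>; on it \<open>y\<close> is bounded away from 0.\<close>

lemma ubl_inverse_y:
  "ubl {rp P<..} (\<lambda>r. {y \<in> {y. tsharp r y \<noteq> 0}. chi2 P y \<noteq> 0}) (\<lambda>r y. 1 / y)"
proof (rule ubl_divide[where c = "min ((1/2) * xi_l P) (Op + (1/2) * xi_r P)"])
  show "0 < min ((1/2) * xi_l P) (Op + (1/2) * xi_r P)" using xi_l_pos xi_r_pos Op_pos by auto
  show "min ((1/2) * xi_l P) (Op + (1/2) * xi_r P) \<le> \<bar>y\<bar>"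
    if "y \<in> {y \<in> {y. tsharp r y \<noteq> 0}. chi2 P y \<noteq> 0}" for r y
    using that by (intro inverse_bounded) auto
qed (auto intro!: ubl_const0 ubl_ident y_bounded)

lemma ubl_JJ_NN:
  "ubl {rp P<..} (\<lambda>r. {y \<in> {y. tsharp r y \<noteq> 0}. chi2 P y \<noteq> 0}) (\<lambda>r y. JJ (rhoc (1 / y)) / (NN (1 / y) r / T r)\<^sup>2)"
proof (rule ubl_divide[where c = "cN\<^sup>2"])
  show "ubl {rp P<..} (\<lambda>r. {y \<in> {y. tsharp r y \<noteq> 0}. chi2 P y \<noteq> 0}) (\<lambda>r y. JJ (rhoc (1 / y)))"
    by (rule ubl_compose[OF ubl_JJ ubl_inverse_y, where T = UNIV]) auto
  show "ubl {rp P<..} (\<lambda>r. {y \<in> {y. tsharp r y \<noteq> 0}. chi2 P y \<noteq> 0}) (\<lambda>r y. (NN (1 / y) r / T r)\<^sup>2)"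
    unfolding NN_T by (intro ubl_intros ubl_inverse_y ubl_const[where B = "1 / a"]) (use a_T in auto)
  show "cN\<^sup>2 \<le> \<bar>(NN (1 / y) r / T r)\<^sup>2\<bar>"
    if "r \<in> {rp P<..}" "y \<in> {y \<in> {y. tsharp r y \<noteq> 0}. chi2 P y \<noteq> 0}" for r y
  proof -
    have "1 / y \<le> xhi" using inverse_in_X(2)[OF chi2_support[of y]] that by auto
    then have "cN \<le> NN (1 / y) r / T r" using that by (intro NN_T_ge) auto
    then show ?thesis using cN_pos by (simp only: abs_power2 power_mono less_imp_le)
  qed
qed (use cN_pos in auto)

lemma ubl_hsharp: "ubl {rp P<..} (\<lambda>r. {y. tsharp r y \<noteq> 0}) hsharp"
proof -
  obtain c where c: "0 < c" "\<And>r y. rp P < r \<Longrightarrow> tsharp r y \<noteq> 0 \<Longrightarrow> c \<le> 1 - chi2 P y * beta r y"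
    using hsharp_lower_bound by blast
  have "ubl {rp P<..} (\<lambda>r. {y \<in> {y. tsharp r y \<noteq> 0}. chi2 P y \<noteq> 0}) beta"
  proof (rule ubl_cong)
    have "\<bar>Delta P r / (T r)\<^sup>2\<bar> \<le> 1 / JJ (rhoc 0)" if "rp P < r" for r
    proof -
      have "(vel P r)\<^sup>2 \<le> (1 / sqrt (JJ (rhoc 0)))\<^sup>2"
        using vel_le[OF that] vel_pos[OF that] by (intro power_mono) auto
      then show ?thesis using vel_sq[OF that] JJ_pos[of 0] Delta_pos[OF that] by (simp add: power_divide)
    qed
    then show "ubl {rp P<..} (\<lambda>r. {y \<in> {y. tsharp r y \<noteq> 0}. chi2 P y \<noteq> 0})
      (\<lambda>r y. JJ (rhoc (1 / y)) / (NN (1 / y) r / T r)\<^sup>2 * (Delta P r / (T r)\<^sup>2))"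
      by (intro ubl_intros ubl_JJ_NN ubl_const[where B = "1 / JJ (rhoc 0)"]) auto
  qed (simp add: beta_def)
  then have "ubl {rp P<..} (\<lambda>r. {y. tsharp r y \<noteq> 0}) (\<lambda>r y. chi2 P y * beta r y)"
    by (intro ubl_cutoff ubl_chi2)
  then show ?thesis unfolding hsharp_def[abs_def]
    using c by (intro ubl_sqrt[where c = c] ubl_diff ubl_const0) auto
qed

lemma hsharp_nonneg: "rp P < r \<Longrightarrow> tsharp r y \<noteq> 0 \<Longrightarrow> 0 \<le> hsharp r y"
  using hsharp_lower_bound unfolding hsharp_def by (metis less_imp_le order_trans real_sqrt_ge_zero)

text \<open>Conjugates again: the squares of \<open>hsharp\<close> and of
  \<open>AA (rhoc 0) / T\<close> are both 1 up to multiples of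
  \<open>Delta P r / (T r)^2\<close>.\<close>

lemma E_sharp_outer:
  assumes r: "rp P < r" and t: "tsharp r y \<noteq> 0" and nz: "hsharp r y + AA (rhoc 0) r / T r \<noteq> 0"
  shows "E_sharp r y = (y - a / T r) * ((JJ (rhoc 0) - chi2 P y * (JJ (rhoc (1 / y)) / (NN (1 / y) r / T r)\<^sup>2)) /
     (hsharp r y + AA (rhoc 0) r / T r))"
proof -
  define h v d g where "h = hsharp r y" and "v = AA (rhoc 0) r / T r" and "d = Delta P r / (T r)\<^sup>2"
    and "g = chi2 P y * (JJ (rhoc (1 / y)) / (NN (1 / y) r / T r)\<^sup>2)"
  have d: "d \<noteq> 0" "(T r)\<^sup>2 / Delta P r = 1 / d" using Delta_pos[OF r] T_pos[of r] by (auto simp: d_def)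
  have "0 \<le> 1 - chi2 P y * beta r y" using hsharp_lower_bound r t by (meson less_imp_le order_trans)
  then have "h\<^sup>2 = 1 - chi2 P y * beta r y" unfolding h_def hsharp_def by simp
  moreover have "chi2 P y * beta r y = g * d"
    unfolding g_def d_def beta_def divide_inverse by (simp only: mult_ac)
  ultimately have "h\<^sup>2 = 1 - g * d" by simp
  moreover have "v\<^sup>2 = 1 - JJ (rhoc 0) * d" unfolding v_def d_def by (rule AA_zero_sq[OF r])
  ultimately have "(h - v) * (h + v) = d * (JJ (rhoc 0) - g)" by algebra
  moreover have "h + v \<noteq> 0" using nz unfolding h_def v_def .
  ultimately have "(h - v) * (1 / d) = (JJ (rhoc 0) - g) / (h + v)"
    using d(1) by (simp add: frac_eq_eq mult.commute)
  then show ?thesis unfolding E_sharp_def d(2) h_def v_def g_def by simp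
qed

text \<open>Below \<open>r_lo P\<close> the domain is empty, so the horizon is never reached. Up to
  \<open>2 * rmax\<close> the weight \<open>(T r)^2 / Delta P r\<close> is bounded, and beyond that
  radius \<open>E_sharp_outer\<close> shows the cancellation at infinity.\<close>

lemma ubl_E_sharp: "ubl {rp P<..} (\<lambda>r. {y. tsharp r y \<noteq> 0}) E_sharp"
proof -
  let ?S = "\<lambda>r. {y. tsharp r y \<noteq> 0}"
  have pre: "ubl {rp P<..} ?S (\<lambda>r y. y - a / T r)"
    by (intro ubl_intros ubl_ident[OF y_bounded] ubl_const[where B = "1 / a"]) (use a_T in auto)
  have "ubl {rp P<..<r_lo P} ?S E_sharp"
    by (rule ublI[where B = 0 and L = 0]) (use tsharp_support(4) in force)+
  moreover have "ubl {r_lo P..2 * rmax} ?S E_sharp"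
  proof -
    have I: "{r_lo P..2 * rmax} \<subseteq> {rp P<..}" using rp_less_r_lo by auto
    have "ubl {r_lo P..2 * rmax} ?S (\<lambda>r x. (T r)\<^sup>2 / Delta P r)"
      using T_sq_Delta_bounded[OF rp_less_r_lo] by (intro ubl_const) auto
    then show ?thesis unfolding E_sharp_def[abs_def]
      using I by (intro ubl_mult ubl_diff ubl_subset[OF pre] ubl_subset[OF ubl_hsharp] ubl_subset[OF AA_zero_ubl]) auto
  qed
  moreover have "ubl {2 * rmax<..} ?S E_sharp"
  proof -
    have I: "{2 * rmax<..} \<subseteq> {rp P<..}" using rmin_le_rmax rmin_gt rp_pos by auto
    \<comment> \<open>Both summands are nonnegative beyond \<open>rhoc 0\<close>, and the second is
      bounded below by \<open>AA_ge\<close>.\<close>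
    have den: "sqrt cq / 4 \<le> hsharp r y + AA (rhoc 0) r / T r" if r: "r \<in> {2 * rmax<..}" and t: "tsharp r y \<noteq> 0" for r y
    proof -
      have rr: "rp P < r" using r I by auto
      have "rhoc 0 / r \<le> 1 / 2" using r rr rp_pos rhoc_bounds(2)[of 0] by (simp add: field_simps)
      then have "1 / 2 \<le> \<bar>1 - rhoc 0 * (1 / r)\<bar>" by (simp only: mult_1_right times_divide_eq_right)
      then have "1 / 2 * (sqrt cq / 2) \<le> \<bar>1 - rhoc 0 * (1 / r)\<bar> * (sqrt cq / 2)"
        using cq_pos by (intro mult_right_mono) auto
      also have "\<dots> \<le> \<bar>AA (rhoc 0) r / T r\<bar>" by (rule AA_ge[OF rr])
      also have "\<dots> = AA (rhoc 0) r / T r"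
      proof (rule abs_of_nonneg)
        have "rhoc 0 \<le> r" using r rhoc_bounds(2)[of 0] rhoc(1)[of 0] rp_pos by auto
        then show "0 \<le> AA (rhoc 0) r / T r"
          using AA_sgn[OF rr rhoc(1), of 0] T_pos[of r] by (intro divide_nonneg_pos) auto
      qed
      also have "\<dots> \<le> hsharp r y + AA (rhoc 0) r / T r" using hsharp_nonneg[OF rr t] by simp
      finally show ?thesis by simp
    qed
    show ?thesis
    proof (rule ubl_cong)
      show "ubl {2 * rmax<..} ?S (\<lambda>r y. (y - a / T r) * ((JJ (rhoc 0) - chi2 P y * (JJ (rhoc (1 / y)) / (NN (1 / y) r / T r)\<^sup>2)) /
         (hsharp r y + AA (rhoc 0) r / T r)))"
      proof -
        have c: "ubl {2 * rmax<..} ?S (\<lambda>r y. chi2 P y * (JJ (rhoc (1 / y)) / (NN (1 / y) r / T r)\<^sup>2))"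
          by (rule ubl_cutoff[OF ubl_chi2 ubl_subset[OF ubl_JJ_NN I]]) auto
        have h: "ubl {2 * rmax<..} ?S hsharp" by (rule ubl_subset[OF ubl_hsharp I]) auto
        have v: "ubl {2 * rmax<..} ?S (\<lambda>r y. AA (rhoc 0) r / T r)" by (rule ubl_subset[OF AA_zero_ubl I]) auto
        have p: "ubl {2 * rmax<..} ?S (\<lambda>r y. y - a / T r)" by (rule ubl_subset[OF pre I]) auto
        show ?thesis
        proof (rule ubl_mult[OF p ubl_divide[OF ubl_diff[OF ubl_const0 c] ubl_add[OF h v], where c = "sqrt cq / 4"]])
          show "sqrt cq / 4 \<le> \<bar>hsharp r y + AA (rhoc 0) r / T r\<bar>"
            if "r \<in> {2 * rmax<..}" "y \<in> {y. tsharp r y \<noteq> 0}" for r y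
            by (rule order_trans[OF den abs_ge_self]) (use that in auto)
        qed (use cq_pos in auto)
      qed
    next
      fix r y assume *: "r \<in> {2 * rmax<..}" "y \<in> ?S r"
      have "hsharp r y + AA (rhoc 0) r / T r \<noteq> 0" using den[OF *(1), of y] * cq_pos by (smt (verit) mem_Collect_eq real_sqrt_gt_0_iff divide_pos_pos)
      with * I show "(y - a / T r) * ((JJ (rhoc 0) - chi2 P y * (JJ (rhoc (1 / y)) / (NN (1 / y) r / T r)\<^sup>2)) /
         (hsharp r y + AA (rhoc 0) r / T r)) = E_sharp r y"
        by (intro E_sharp_outer[symmetric]) auto
    qed
  qed
  ultimately have "ubl (({rp P<..<r_lo P} \<union> {r_lo P..2 * rmax}) \<union> {2 * rmax<..}) ?S E_sharp" by (intro ubl_Un)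
  then show ?thesis by (rule ubl_subset) auto
qed

section \<open>The multipliers \<open>A\<close> and \<open>D\<close> and their differences\<close>

definition Aop :: "real \<Rightarrow> int \<Rightarrow> real \<Rightarrow> real" where
  "Aop \<omega> m r = tchi1 P \<omega> m + (1 - tchi1 P \<omega> m) * chi_sharp P \<omega> m r"

text \<open>The first summand is expressed through \<open>m/\<omega>\<close>, the second through
  \<open>\<omega>/m\<close>; where one of the quotients is a division by 0, its factor
  \<open>\<omega>\<close> or \<open>m\<close> is 0 as well.\<close>

definition Dop :: "real \<Rightarrow> int \<Rightarrow> real \<Rightarrow> real" where
  "Dop \<omega> m r = vel P r * (tchi1 P \<omega> m * (\<omega> * E_nat r (of_int m / \<omega>))
     + of_int m * (tsharp r (\<omega> / of_int m) * E_sharp r (\<omega> / of_int m)))"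

lemma tchi1_bounds: "0 \<le> tchi1 P \<omega> m" "tchi1 P \<omega> m \<le> 1"
  using cutoff_bounds by (auto simp: tchi1_def)

lemma Aop_bounds: "\<bar>Aop \<omega> m r\<bar> \<le> 1"
proof -
  let ?t = "tchi1 P \<omega> m" and ?s = "chi_sharp P \<omega> m r"
  have s: "0 \<le> ?s" "?s \<le> 1" using cutoff_bounds by (auto simp: chi_sharp_def)
  have "0 \<le> Aop \<omega> m r" unfolding Aop_def using tchi1_bounds[of \<omega> m] s by simp
  moreover have "(1 - ?t) * ?s \<le> 1 - ?t" using tchi1_bounds[of \<omega> m] s by (intro mult_left_le) auto
  ultimately show ?thesis by (simp add: Aop_def)
qed

text \<open>The profile of \<open>1 - Aop\<close>. Unlike that of \<open>Aop\<close> it has compact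
  support in \<open>y\<close>, as \<open>hom0_lipschitz\<close> demands, and \<open>Aop = 1\<close>
  at \<open>m = 0\<close> matches the value 0 prescribed there.\<close>

definition asharp where "asharp r y = (1 - chi1 P y) - tsharp r y"

lemma Aop_eq: "Aop \<omega> m r = 1 - (if real_of_int m = 0 then 0 else asharp r (\<omega> / of_int m))"
  by (simp add: Aop_def asharp_def tchi1_def tsharp_def chi_sharp_def algebra_simps)

lemma asharp_support: "asharp r y \<noteq> 0 \<Longrightarrow> chi1 P y \<noteq> 1"
  by (auto simp: asharp_def tsharp_def)

text \<open>Beyond this radius \<open>r - Rss P y\<close> exceeds \<open>del P / 2\<close> on the
  support of \<open>1 - chi1\<close>, so \<open>chi_sharp\<close> is 1 there. This happens before
  \<open>chi_hi\<close> starts to drop, at \<open>7/8\<close> of \<open>del P\<close>.\<close>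

lemma asharp_far: "r_hi P + (3/4) * del P \<le> r \<Longrightarrow> asharp r y = 0"
proof (rule ccontr)
  assume r: "r_hi P + (3/4) * del P \<le> r" and "asharp r y \<noteq> 0"
  then have "Rss P y < r_hi P + del P / 4"
    using Rss_on_support[OF asharp_support] R_sharp_bounds(2)[of y] by fastforce
  then have "psi P (r - Rss P y) = 1" using r by (intro psi_eq_1) auto
  then show False using \<open>asharp r y \<noteq> 0\<close> by (simp add: asharp_def tsharp_def)
qed

lemma chi1_support_bounded: "chi1 P y \<noteq> 1 \<Longrightarrow> \<bar>y\<bar> \<le> max (xi_l P) (Op + xi_r P)"
  using chi1_ne_1[of y] by auto

text \<open>The left factor and \<open>chi_hi\<close> are those of the second term of
  \<open>H_norm\<close>: this difference multiplies \<open>W\<^sub>0 u\<close>, of which that norm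
  controls only the weighted and cut-off version.\<close>

lemma Aop_diff:
  "\<exists>C\<ge>0. \<forall>r>rp P. \<forall>\<omega> m \<omega>' m'. \<bar>Aop \<omega> m r - Aop \<omega>' m' r\<bar> * max (max \<bar>of_int m'\<bar> \<bar>\<omega>'\<bar>) 1
     \<le> C * (\<bar>\<omega> - \<omega>'\<bar> + \<bar>of_int m - of_int m'\<bar>) * sqrt (chi_hi P r)"
proof -
  have "ubl UNIV (\<lambda>_. UNIV) asharp" unfolding asharp_def[abs_def] by (intro ubl_intros ubl_chi1 ubl_tsharp)
  moreover have "asharp r y = 0" if "max (xi_l P) (Op + xi_r P) < \<bar>y\<bar>" for r y
    using that chi1_support_bounded[OF asharp_support[of r y]] by linarith
  ultimately obtain C where C: "0 \<le> C" "\<And>r p q p' q'.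
    max \<bar>p'\<bar> \<bar>q'\<bar> * \<bar>(if q = 0 then 0 else asharp r (p / q)) - (if q' = 0 then 0 else asharp r (p' / q'))\<bar>
      \<le> C * (\<bar>p - p'\<bar> + \<bar>q - q'\<bar>)"
    using hom0_lipschitz[of UNIV asharp "max (xi_l P) (Op + xi_r P)"] by auto
  \<comment> \<open>Beyond \<open>r_hi P + (3/4) * del P\<close> both multipliers are 1; below that
    radius \<open>chi_hi\<close> is 1.\<close>
  have "\<bar>Aop \<omega> m r - Aop \<omega>' m' r\<bar> * max (max \<bar>of_int m'\<bar> \<bar>\<omega>'\<bar>) 1
     \<le> (C + 2) * (\<bar>\<omega> - \<omega>'\<bar> + \<bar>of_int m - of_int m'\<bar>) * sqrt (chi_hi P r)" for r \<omega> \<omega>' m m'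
  proof (cases "r_hi P + (3/4) * del P \<le> r")
    case True
    then have "Aop \<omega> m r = 1" "Aop \<omega>' m' r = 1" by (auto simp: Aop_eq asharp_far)
    then show ?thesis using C(1) cutoff_bounds by simp
  next
    case False
    define s where "s = \<bar>\<omega> - \<omega>'\<bar> + \<bar>real_of_int m - of_int m'\<bar>"
    have chi: "chi_hi P r = 1" using False del_pos by (intro chi_hi_eq_1) auto
    have 1: "max \<bar>\<omega>'\<bar> \<bar>of_int m'\<bar> * \<bar>Aop \<omega> m r - Aop \<omega>' m' r\<bar> \<le> C * s"
    proof -
      have "\<bar>Aop \<omega> m r - Aop \<omega>' m' r\<bar> = \<bar>(if real_of_int m = 0 then 0 else asharp r (\<omega> / of_int m)) -
          (if real_of_int m' = 0 then 0 else asharp r (\<omega>' / of_int m'))\<bar>"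
        unfolding Aop_eq by linarith
      then show ?thesis using C(2) unfolding s_def by (simp only:)
    qed
    have "\<bar>Aop \<omega> m r - Aop \<omega>' m' r\<bar> \<le> (C + 2) * s"
    proof -
      have "0 \<le> s" by (simp add: s_def)
      \<comment> \<open>The entry 1 of the maximum. If both integers vanish, so does the difference;
        if \<open>m'\<close> is not 0, the homogeneous weight is already at least 1; otherwise the
        frequencies differ by at least 1 and the trivial bound 2 suffices.\<close>
      consider "m = 0" "m' = 0" | "m' \<noteq> 0" | "m \<noteq> 0" "m' = 0" by blast
      then show ?thesis
      proof cases
        case 1 then show ?thesis using \<open>0 \<le> s\<close> C(1) by (simp add: Aop_eq)
      next
        case 2
        then have "1 \<le> \<bar>real_of_int m'\<bar>" by linarith
        then have "1 * \<bar>Aop \<omega> m r - Aop \<omega>' m' r\<bar> \<le> max \<bar>\<omega>'\<bar> \<bar>of_int m'\<bar> * \<bar>Aop \<omega> m r - Aop \<omega>' m' r\<bar>"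
          by (intro mult_right_mono) auto
        also note 1
        also have "C * s \<le> (C + 2) * s" using \<open>0 \<le> s\<close> by (simp add: mult_right_mono)
        finally show ?thesis by simp
      next
        case 3
        then have "1 \<le> s" by (simp add: s_def)
        have "\<bar>Aop \<omega> m r - Aop \<omega>' m' r\<bar> \<le> 2"
          using Aop_bounds[of \<omega> m r] Aop_bounds[of \<omega>' m' r] by linarith
        also have "2 \<le> (C + 2) * s"
          using mult_mono[of 2 "C + 2" 1 s] \<open>1 \<le> s\<close> C(1) by simp
        finally show ?thesis .
      qed
    qed
    moreover have "C * s \<le> (C + 2) * s" by (intro mult_right_mono) (auto simp: s_def)
    with 1 have "max \<bar>\<omega>'\<bar> \<bar>of_int m'\<bar> * \<bar>Aop \<omega> m r - Aop \<omega>' m' r\<bar> \<le> (C + 2) * s" by linarith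
    moreover have "max (max \<bar>of_int m'\<bar> \<bar>\<omega>'\<bar>) 1 = max \<bar>\<omega>'\<bar> \<bar>real_of_int m'\<bar> \<or> max (max \<bar>of_int m'\<bar> \<bar>\<omega>'\<bar>) 1 = (1 :: real)"
      by (simp add: max.commute max_def)
    ultimately show ?thesis
      unfolding chi s_def[symmetric] by (elim disjE) (simp_all only: mult.commute[of _ "max _ _"] mult_1_right real_sqrt_one)
  qed
  then show ?thesis using C(1) by (intro exI[of _ "C + 2"]) auto
qed

lemma tchi1_cone: "tchi1 P \<omega> m \<noteq> 0 \<Longrightarrow> \<omega> \<noteq> 0 \<Longrightarrow> of_int m / \<omega> \<in> {xlo..xhi}"
proof (cases "m = 0")
  case False
  assume "tchi1 P \<omega> m \<noteq> 0" "\<omega> \<noteq> 0"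
  then show ?thesis using False inverse_in_X(2)[OF chi1_support[of "\<omega> / of_int m"]] by (simp add: tchi1_def)
qed (use zero_in_X in auto)

lemma tchi1_zero_freq: "tchi1 P 0 m \<noteq> 0 \<Longrightarrow> m = 0"
  using chi1_support[of 0] xi_l_pos xi_r_pos Op_pos by (auto simp: tchi1_def split: if_splits)

lemma tchi1_diff:
  "\<exists>C\<ge>0. \<forall>\<omega> m \<omega>' m'. \<bar>\<omega>'\<bar> * \<bar>tchi1 P \<omega> m - tchi1 P \<omega>' m'\<bar> \<le> C * (\<bar>\<omega> - \<omega>'\<bar> + \<bar>of_int m - of_int m'\<bar>)"
proof -
  have "ubl (UNIV :: unit set) (\<lambda>_. UNIV) (\<lambda>_ y. 1 - chi1 P y)" by (intro ubl_intros ubl_chi1)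
  moreover have "1 - chi1 P y = 0" if "max (xi_l P) (Op + xi_r P) < \<bar>y\<bar>" for y
    using that chi1_support_bounded[of y] by linarith
  ultimately obtain C where C: "0 \<le> C" "\<And>p q p' q'.
    max \<bar>p'\<bar> \<bar>q'\<bar> * \<bar>(if q = 0 then 0 else 1 - chi1 P (p / q)) - (if q' = 0 then 0 else 1 - chi1 P (p' / q'))\<bar>
      \<le> C * (\<bar>p - p'\<bar> + \<bar>q - q'\<bar>)"
    using hom0_lipschitz[of "UNIV :: unit set" "\<lambda>_ y. 1 - chi1 P y" "max (xi_l P) (Op + xi_r P)"] by auto
  have "\<bar>\<omega>'\<bar> * \<bar>tchi1 P \<omega> m - tchi1 P \<omega>' m'\<bar> \<le> C * (\<bar>\<omega> - \<omega>'\<bar> + \<bar>of_int m - of_int m'\<bar>)" for \<omega> \<omega>' m m'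
  proof -
    have eq: "tchi1 P \<omega> m = 1 - (if real_of_int m = 0 then 0 else 1 - chi1 P (\<omega> / of_int m))" for \<omega> m
      by (simp add: tchi1_def)
    have "\<bar>\<omega>'\<bar> * \<bar>tchi1 P \<omega> m - tchi1 P \<omega>' m'\<bar> \<le> max \<bar>\<omega>'\<bar> \<bar>of_int m'\<bar> * \<bar>tchi1 P \<omega> m - tchi1 P \<omega>' m'\<bar>"
      by (intro mult_right_mono) auto
    also have "\<dots> = max \<bar>\<omega>'\<bar> \<bar>of_int m'\<bar> * \<bar>(if real_of_int m = 0 then 0 else 1 - chi1 P (\<omega> / of_int m)) -
        (if real_of_int m' = 0 then 0 else 1 - chi1 P (\<omega>' / of_int m'))\<bar>"
      unfolding eq by (intro arg_cong2[where f = "(*)"] refl) linarith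
    also note C(2)
    finally show ?thesis .
  qed
  then show ?thesis using C(1) by blast
qed

lemma ubl_tsharp_E_sharp: "ubl {rp P<..} (\<lambda>_. UNIV) (\<lambda>r y. tsharp r y * E_sharp r y)"
  using ubl_E_sharp by (intro ubl_cutoff ubl_tsharp) simp

text \<open>The second summand of \<open>Dop\<close> is of degree 1 with a compactly supported
  profile. In the first, \<open>E_nat\<close> is controlled only for \<open>m/\<omega>\<close> in
  the cone, so the product rule separates the increment of \<open>tchi1\<close>, of degree 0, from
  that of \<open>\<omega> * E_nat\<close> inside the cone.\<close>

lemma Dop_diff:
  "\<exists>C\<ge>0. \<forall>r>rp P. \<forall>\<omega> m \<omega>' m'. \<bar>Dop \<omega> m r - Dop \<omega>' m' r\<bar>
     \<le> C * (\<bar>\<omega> - \<omega>'\<bar> + \<bar>of_int m - of_int m'\<bar>) * vel P r"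
proof -
  obtain K where K: "0 \<le> K" "\<And>r y. rp P < r \<Longrightarrow> \<bar>tsharp r y * E_sharp r y\<bar> \<le> K"
    "\<And>r x y. rp P < r \<Longrightarrow> \<bar>tsharp r x * E_sharp r x - tsharp r y * E_sharp r y\<bar> \<le> K * \<bar>x - y\<bar>"
    using ubl_tsharp_E_sharp by (rule ublE) auto
  obtain L where L: "0 \<le> L" "\<And>r x. rp P < r \<Longrightarrow> x \<in> {xlo..xhi} \<Longrightarrow> \<bar>E_nat r x\<bar> \<le> L"
    "\<And>r x y. rp P < r \<Longrightarrow> x \<in> {xlo..xhi} \<Longrightarrow> y \<in> {xlo..xhi} \<Longrightarrow> \<bar>E_nat r x - E_nat r y\<bar> \<le> L * \<bar>x - y\<bar>"
    using ubl_E_nat by (rule ublE) auto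
  obtain N where N: "0 \<le> N" "\<And>\<omega> m \<omega>' m'. \<bar>\<omega>'\<bar> * \<bar>tchi1 P \<omega> m - tchi1 P \<omega>' m'\<bar> \<le> N * (\<bar>\<omega> - \<omega>'\<bar> + \<bar>of_int m - of_int m'\<bar>)"
    using tchi1_diff by blast
  define Y where "Y = max (xi_l P) (Op + xi_r P)"
  define B where "B = max (- xlo) xhi"
  have YB: "0 \<le> Y" "0 \<le> B" using xi_l_pos xhi_pos by (auto simp: Y_def B_def)
  define C where "C = K * (1 + Y) + (N * L + L * (1 + B))"
  have second: "\<bar>q * (tsharp r (p / q) * E_sharp r (p / q)) - q' * (tsharp r (p' / q') * E_sharp r (p' / q'))\<bar>
      \<le> K * (1 + Y) * (\<bar>p - p'\<bar> + \<bar>q - q'\<bar>)" if r: "rp P < r" for r p q p' q'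
  proof (rule hom1_lipschitz[where d = "\<lambda>y. tsharp r y * E_sharp r y"])
    show "tsharp r y * E_sharp r y = 0" if "Y < \<bar>y\<bar>" for y
      using that y_bounded[of r y] by (force simp: Y_def)
  qed (use K r YB in auto)
  have E_nat: "\<bar>\<omega> * E_nat r (of_int m / \<omega>)\<bar> \<le> L * \<bar>\<omega>\<bar>" if "rp P < r" "tchi1 P \<omega> m \<noteq> 0" for r \<omega> m
  proof (cases "\<omega> = 0")
    case False
    then have "\<bar>E_nat r (of_int m / \<omega>)\<bar> \<le> L" using tchi1_cone[OF that(2)] that(1) by (intro L(2)) auto
    then show ?thesis by (simp add: abs_mult mult.commute[of L] mult_left_mono)
  qed simp
  \<comment> \<open>The term multiplied by the increment of \<open>tchi1\<close> sits at the second
    frequency, which therefore has to lie in the cone. Exchanging the two frequencies removes this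
    condition in \<open>first'\<close>.\<close>
  have first: "\<bar>tchi1 P \<omega> m * (\<omega> * E_nat r (of_int m / \<omega>)) - tchi1 P \<omega>' m' * (\<omega>' * E_nat r (of_int m' / \<omega>'))\<bar>
      \<le> (N * L + L * (1 + B)) * (\<bar>\<omega> - \<omega>'\<bar> + \<bar>of_int m - of_int m'\<bar>)"
    if r: "rp P < r" and t: "tchi1 P \<omega>' m' \<noteq> 0" for r \<omega> \<omega>' m m'
  proof -
    let ?F = "\<omega> * E_nat r (of_int m / \<omega>)" and ?F' = "\<omega>' * E_nat r (of_int m' / \<omega>')"
    let ?t = "tchi1 P \<omega> m" and ?t' = "tchi1 P \<omega>' m'"
    let ?s = "\<bar>\<omega> - \<omega>'\<bar> + \<bar>real_of_int m - of_int m'\<bar>"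
    have 1: "\<bar>?t - ?t'\<bar> * \<bar>?F'\<bar> \<le> N * L * ?s"
    proof -
      have "\<bar>?t - ?t'\<bar> * \<bar>?F'\<bar> \<le> \<bar>?t - ?t'\<bar> * (L * \<bar>\<omega>'\<bar>)"
        by (intro mult_left_mono E_nat[OF r t]) auto
      also have "\<dots> = L * (\<bar>\<omega>'\<bar> * \<bar>?t - ?t'\<bar>)" by simp
      also have "\<dots> \<le> L * (N * ?s)" by (intro mult_left_mono N(2) L(1))
      finally show ?thesis by (simp add: mult_ac)
    qed
    have 2: "\<bar>?t\<bar> * \<bar>?F - ?F'\<bar> \<le> L * (1 + B) * ?s"
    proof (cases "?t = 0")
      case False
      have "\<bar>?t\<bar> * \<bar>?F - ?F'\<bar> \<le> 1 * \<bar>?F - ?F'\<bar>"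
        using tchi1_bounds[of \<omega> m] by (intro mult_right_mono) auto
      also have "1 * \<bar>?F - ?F'\<bar> \<le> L * (1 + B) * (\<bar>of_int m - of_int m'\<bar> + \<bar>\<omega> - \<omega>'\<bar>)"
        unfolding mult_1_left
        by (rule hom1_lipschitz_on[where S = "{xlo..xhi}"])
          (use L r YB X_bounded tchi1_cone[OF False] tchi1_cone[OF t] in \<open>auto simp: B_def\<close>)
      finally show ?thesis by (simp add: add.commute)
    qed (use L(1) YB in auto)
    have "?t * ?F - ?t' * ?F' = (?t - ?t') * ?F' + ?t * (?F - ?F')" by (simp add: algebra_simps)
    then have "\<bar>?t * ?F - ?t' * ?F'\<bar> \<le> \<bar>?t - ?t'\<bar> * \<bar>?F'\<bar> + \<bar>?t\<bar> * \<bar>?F - ?F'\<bar>"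
      by (metis abs_mult abs_triangle_ineq)
    also have "\<dots> \<le> (N * L + L * (1 + B)) * ?s" using 1 2 unfolding distrib_right by linarith
    finally show ?thesis .
  qed
  have first': "\<bar>tchi1 P \<omega> m * (\<omega> * E_nat r (of_int m / \<omega>)) - tchi1 P \<omega>' m' * (\<omega>' * E_nat r (of_int m' / \<omega>'))\<bar>
      \<le> (N * L + L * (1 + B)) * (\<bar>\<omega> - \<omega>'\<bar> + \<bar>of_int m - of_int m'\<bar>)" if r: "rp P < r" for r \<omega> \<omega>' m m'
  proof (cases "tchi1 P \<omega>' m' = 0")
    case True
    show ?thesis
    proof (cases "tchi1 P \<omega> m = 0")
      case False
      show ?thesis using first[OF r False, of \<omega>' m'] by (simp only: abs_minus_commute)
    qed (use True N(1) L(1) YB in simp)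
  qed (use first[OF r] in simp)
  have "0 \<le> C" using K(1) L(1) N(1) YB by (simp add: C_def)
  moreover have "\<bar>Dop \<omega> m r - Dop \<omega>' m' r\<bar> \<le> C * (\<bar>\<omega> - \<omega>'\<bar> + \<bar>of_int m - of_int m'\<bar>) * vel P r"
    if r: "rp P < r" for r \<omega> \<omega>' m m'
  proof -
    let ?s = "\<bar>\<omega> - \<omega>'\<bar> + \<bar>real_of_int m - of_int m'\<bar>"
    let ?a = "tchi1 P \<omega> m * (\<omega> * E_nat r (of_int m / \<omega>))" and ?a' = "tchi1 P \<omega>' m' * (\<omega>' * E_nat r (of_int m' / \<omega>'))"
    let ?b = "of_int m * (tsharp r (\<omega> / of_int m) * E_sharp r (\<omega> / of_int m))"
      and ?b' = "of_int m' * (tsharp r (\<omega>' / of_int m') * E_sharp r (\<omega>' / of_int m'))"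
    have "Dop \<omega> m r - Dop \<omega>' m' r = vel P r * ((?a - ?a') + (?b - ?b'))"
      unfolding Dop_def by (simp only: algebra_simps)
    then have "\<bar>Dop \<omega> m r - Dop \<omega>' m' r\<bar> = vel P r * \<bar>(?a - ?a') + (?b - ?b')\<bar>"
      using vel_pos[OF r] by (simp only: abs_mult abs_of_pos)
    also have "\<dots> \<le> vel P r * ((N * L + L * (1 + B)) * ?s + K * (1 + Y) * ?s)"
      using vel_pos[OF r] first'[OF r, of \<omega> m \<omega>' m'] second[OF r, of "of_int m" \<omega> "of_int m'" \<omega>']
      by (intro mult_left_mono) linarith+
    also have "\<dots> = C * ?s * vel P r" by (simp add: C_def algebra_simps)
    finally show ?thesis .
  qed
  ultimately show ?thesis by blast
qed

section \<open>Identification of \<open>W\<close> with its multipliers\<close>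

lemma chi_sharp_tsharp: "m \<noteq> 0 \<Longrightarrow> (1 - tchi1 P \<omega> m) * chi_sharp P \<omega> m r = tsharp r (\<omega> / of_int m)"
  by (simp add: tchi1_def chi_sharp_def tsharp_def)

lemma G'_set_iff:
  assumes "m \<noteq> 0"
  shows "(\<omega>, m) \<notin> G'_set P \<longleftrightarrow> - (1/2) * xi_l P < \<omega> / of_int m \<and> \<omega> / of_int m < Op + (1/2) * xi_r P"
proof -
  define y where "y = \<omega> / of_int m"
  have m2: "0 < (real_of_int m)\<^sup>2" using assms by simp
  have "of_int m * \<omega> = y * (of_int m)\<^sup>2" using assms by (simp add: y_def power2_eq_square)
  moreover have "of_int m * om_plus P m + (1/2) * xi_r P * (of_int m)\<^sup>2 = (Op + (1/2) * xi_r P) * (of_int m)\<^sup>2"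
    by (simp add: om_plus_def power2_eq_square algebra_simps)
  ultimately show ?thesis
    unfolding G'_set_def y_def[symmetric] using m2 by (simp only: mem_Collect_eq case_prod_conv not_not mult_less_cancel_right_pos)
qed

text \<open>Outside \<open>G'_set\<close> the cut-off \<open>chi2\<close> vanishes, so that
  \<open>hsharp\<close> is 1 too. Where \<open>chi2 = 1\<close>, the radius lies beyond the critical
  one, hence \<open>h_nat = AA / NN\<close> is nonnegative and equals the root of its
  square.\<close>

lemma h_sharp_eq:
  assumes m: "m \<noteq> 0" and r: "rp P < r" and y: "y = \<omega> / of_int m" and t: "tsharp r y \<noteq> 0"
  shows "h_sharp P \<omega> m r = hsharp r y"
proof -
  have tchi2: "tchi2 P \<omega> m = chi2 P y" using m by (simp add: tchi2_def y)
  show ?thesis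
  proof (cases "chi2 P y = 0")
    case True
    then show ?thesis by (simp add: h_sharp_def tchi2 hsharp_def)
  next
    case False
    note ys = chi2_support[OF False]
    have X: "y \<noteq> 0" "1 / y \<in> {xlo..xhi}" using inverse_in_X[OF ys] by auto
    have w: "\<omega> \<noteq> 0" and x: "of_int m / \<omega> = 1 / y" using X(1) m by (auto simp: y)
    have G: "(\<omega>, m) \<in> G'_set P" using G'_set_iff[OF m, of \<omega>] ys unfolding y by auto
    have n: "0 < NN (1 / y) r / T r" using NN_T_ge[OF r, of "1 / y"] X(2) cN_pos by (smt (verit) atLeastAtMost_iff)
    show ?thesis
    proof (cases "chi2 P y < 1")
      case True
      have eq: "(vel P r)\<^sup>2 / (\<omega> - om_r P m r)\<^sup>2 * (INF s\<in>{rp P<..}. (\<omega> - om_r P m s)\<^sup>2 / (vel P s)\<^sup>2) = beta r y"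
        unfolding INF_Phi[OF w X(2)[folded x]] unfolding om_diff[OF w] x vel_sq[OF r] beta_def
        using w by (simp only: power_mult_distrib) (simp add: mult.commute)
      show ?thesis unfolding h_sharp_def tchi2 hsharp_def mult.assoc eq using G True by simp
    next
      case False
      then have c: "chi2 P y = 1" using cutoff_bounds(4)[of y] by simp
      have "rhoc (1 / y) \<le> r" using rhoc_less_on_support[OF t \<open>chi2 P y \<noteq> 0\<close>] del_pos by simp
      then have u: "0 \<le> AA (rhoc (1 / y)) r / T r"
        using AA_sgn[OF r rhoc(1), of "1 / y"] T_pos[of r] by (intro divide_nonneg_pos) auto
      have "h_sharp P \<omega> m r = h_nat P \<omega> m r" using G False by (simp add: h_sharp_def tchi2)
      also have "\<dots> = \<omega> * (sqrt (Delta P r) / T r) * (AA (rhoc (1 / y)) r / sqrt (Delta P r)) / (\<omega> * (NN (1 / y) r / T r))"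
        unfolding h_nat_def f_nat_eq[OF w X(2)[folded x] r] om_diff[OF w] x vel_def ..
      also have "\<dots> = (AA (rhoc (1 / y)) r / T r) / (NN (1 / y) r / T r)"
        using w Delta_pos[OF r] T_pos[of r] by simp
      also have "\<dots> = hsharp r y"
        unfolding hsharp_def c mult_1_left one_minus_beta[OF r \<open>chi2 P y \<noteq> 0\<close>] real_sqrt_abs
        by (rule abs_of_nonneg[symmetric, OF divide_nonneg_pos[OF u n]])
      finally show ?thesis .
    qed
  qed
qed

text \<open>Splits off the part of \<open>f_nat\<close> that \<open>W0_op\<close> accounts for. At
  \<open>\<omega> = 0\<close> a nonzero \<open>tchi1\<close> forces \<open>m = 0\<close>, and then
  both sides vanish whatever value \<open>f_nat\<close> takes.\<close>

lemma W_op_first: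
  assumes r: "rp P < r"
  shows "tchi1 P \<omega> m * (\<omega> * f_nat P \<omega> m r) =
    tchi1 P \<omega> m * (h0 P r * (\<omega> - om_r P m r) / vel P r) + vel P r * (tchi1 P \<omega> m * (\<omega> * E_nat r (of_int m / \<omega>)))"
proof (cases "tchi1 P \<omega> m = 0")
  case False
  show ?thesis
  proof (cases "\<omega> = 0")
    case True
    then have "m = 0" using tchi1_zero_freq False by simp
    then show ?thesis using True by (simp add: om_r_def)
  next
    case w: False
    let ?x = "of_int m / \<omega>"
    define D t u n v where "D = sqrt (Delta P r)" and "t = T r" and "u = AA (rhoc ?x) r"
      and "n = NN ?x r" and "v = AA (rhoc 0) r"
    have D: "D \<noteq> 0" "Delta P r = D\<^sup>2" "t \<noteq> 0" using Delta_pos[OF r] T_pos[of r] by (auto simp: D_def t_def)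
    have "f_nat P \<omega> m r = v / t * (n / t) / (D / t) + D / t * ((u / t - n / t * (v / t)) * (t\<^sup>2 / D\<^sup>2))"
      unfolding f_nat_eq[OF w tchi1_cone[OF False w] r] u_def[symmetric] D_def[symmetric]
    proof -
      have "D / t * (t\<^sup>2 / D\<^sup>2) = t / D" using D by (simp add: power2_eq_square)
      then have "D / t * ((u / t - n / t * (v / t)) * (t\<^sup>2 / D\<^sup>2)) = t / D * (u / t - n / t * (v / t))"
        by (metis mult.commute mult.left_commute)
      also have "\<dots> = u / D - n * v / (t * D)" using D by (simp add: right_diff_distrib)
      finally have 1: "D / t * ((u / t - n / t * (v / t)) * (t\<^sup>2 / D\<^sup>2)) = u / D - n * v / (t * D)" .
      have "v / t * (n / t) / (D / t) = n * v / (t * D)" using D by simp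
      with 1 show "u / D = v / t * (n / t) / (D / t) + D / t * ((u / t - n / t * (v / t)) * (t\<^sup>2 / D\<^sup>2))" by linarith
    qed
    moreover have "\<tau> * (w * (p * k / d + d * e)) = \<tau> * (p * (w * k) / d) + d * (\<tau> * (w * e))" for \<tau> w p k d e :: real
      by (simp add: algebra_simps)
    ultimately show ?thesis
      unfolding h0_eq[OF r] om_diff[OF w] vel_def unfolding D_def[symmetric] unfolding E_nat_def D(2) t_def[symmetric]
        u_def[symmetric] n_def[symmetric] v_def[symmetric] by (simp only:)
  qed
qed simp

lemma W_op_second:
  assumes r: "rp P < r"
  shows "(1 - tchi1 P \<omega> m) * chi_sharp P \<omega> m r * ((\<omega> - om_r P m r) * h_sharp P \<omega> m r / vel P r) =
    (1 - tchi1 P \<omega> m) * chi_sharp P \<omega> m r * (h0 P r * (\<omega> - om_r P m r) / vel P r)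
      + vel P r * (of_int m * (tsharp r (\<omega> / of_int m) * E_sharp r (\<omega> / of_int m)))"
proof (cases "m = 0")
  case m: False
  define y where "y = \<omega> / of_int m"
  show ?thesis
  proof (cases "tsharp r y = 0")
    case False
    have L: "\<omega> - om_r P m r = of_int m * (y - a / T r)"
      using m by (simp add: y_def om_r_def algebra_simps)
    have v: "1 / vel P r = vel P r * ((T r)\<^sup>2 / Delta P r)"
    proof -
      have "(T r)\<^sup>2 / Delta P r = 1 / (vel P r)\<^sup>2" unfolding vel_sq[OF r] by simp
      then show ?thesis using vel_pos[OF r] by (simp add: power2_eq_square)
    qed
    have "(\<omega> - om_r P m r) * h_sharp P \<omega> m r * (1 / vel P r) =
      h0 P r * (\<omega> - om_r P m r) * (1 / vel P r) + vel P r * (of_int m * E_sharp r y)"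
      unfolding h_sharp_eq[OF m r y_def False] E_sharp_def h0_eq[OF r, symmetric] L v
    proof -
      show "k * X * g * (v * c) = h * (k * X) * (v * c) + v * (k * (X * ((g - h) * c)))" for k X g v c h :: real
        by (simp add: algebra_simps)
    qed
    then have "(\<omega> - om_r P m r) * h_sharp P \<omega> m r / vel P r =
      h0 P r * (\<omega> - om_r P m r) / vel P r + vel P r * (of_int m * E_sharp r y)" by simp
    then show ?thesis unfolding chi_sharp_tsharp[OF m] y_def[symmetric] by (simp add: algebra_simps)
  qed (simp add: chi_sharp_tsharp[OF m] y_def)
qed (simp add: tchi1_def)

text \<open>The radial derivative enters \<open>W_nat\<close>, \<open>W_sharp\<close> and
  \<open>W0_op\<close> through one and the same term, so this is pointwise algebra and applies
  equally to convolutions.\<close>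

lemma W_op_eq:
  assumes r: "rp P < r"
  shows "W_op P f \<omega> m r \<theta> = of_real (Aop \<omega> m r) * W0_op P f \<omega> m r \<theta> - \<i> * of_real (Dop \<omega> m r) * f \<omega> m r \<theta>"
proof -
  define t s v L where "t = tchi1 P \<omega> m" and "s = (1 - tchi1 P \<omega> m) * chi_sharp P \<omega> m r"
    and "v = vel P r" and "L = \<omega> - om_r P m r"
  define R F where "R = Rstar P (\<lambda>s. f \<omega> m s \<theta>) r" and "F = f \<omega> m r \<theta>"
  have "Dop \<omega> m r = t * (\<omega> * f_nat P \<omega> m r) + s * (L * h_sharp P \<omega> m r / v) - (t + s) * (h0 P r * L / v)"
    using W_op_first[OF r, of \<omega> m] W_op_second[OF r, of \<omega> m]
    unfolding Dop_def t_def s_def v_def L_def distrib_left[of "vel P r"] distrib_right by linarith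
  then have D: "complex_of_real (Dop \<omega> m r) = of_real t * of_real (\<omega> * f_nat P \<omega> m r)
      + of_real s * (of_real (1 / v) * of_real (L * h_sharp P \<omega> m r)) - (of_real t + of_real s) * (of_real (1 / v) * of_real (h0 P r * L))"
    by (simp only: of_real_add of_real_diff of_real_mult of_real_divide of_real_1) simp
  have A: "complex_of_real (Aop \<omega> m r) = of_real t + of_real s"
    by (simp add: Aop_def t_def s_def)
  show ?thesis
    unfolding W_op_def W_nat_def W_sharp_def W0_op_def A D
    unfolding R_def[symmetric] F_def[symmetric] L_def[symmetric] v_def[symmetric]
    unfolding s_def[symmetric] unfolding t_def[symmetric]
  proof -
    show "T * (k * R - I * w * F) + S * (k * (R - I * H * F)) =
        (T + S) * (k * (R - I * h * F)) - I * (T * w + S * (k * H) - (T + S) * (k * h)) * F"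
      for T S k R I w F H h :: complex
      by (simp add: algebra_simps)
  qed
qed

text \<open>Write \<open>v\<close> as \<open>v powr (1 - q) * v powr q\<close>. The first factor is
  bounded because \<open>v\<close> is and because \<open>1 - q\<close> lies between 0 and 1.\<close>

lemma vel_le_powr:
  assumes r: "rp P < r" and q: "q \<in> {0..1}"
  shows "vel P r \<le> max 1 (1 / sqrt (JJ (rhoc 0))) * vel P r powr q"
proof -
  let ?B = "max 1 (1 / sqrt (JJ (rhoc 0)))"
  have v: "0 < vel P r" "vel P r \<le> ?B" using vel_pos[OF r] vel_le[OF r] by auto
  have "vel P r powr (1 - q) \<le> ?B powr (1 - q)" using v q by (intro powr_mono2) auto
  also have "\<dots> \<le> ?B powr 1" using q by (intro powr_mono) auto
  finally have "vel P r powr (1 - q) * vel P r powr q \<le> ?B * vel P r powr q"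
    by (intro mult_right_mono) auto
  then show ?thesis using v by (simp flip: powr_add)
qed

section \<open>Borel measurability of the multipliers\<close>

lemma continuous_on_rhoc: "continuous_on S rhoc"
proof (rule continuous_on_subset[where s = UNIV])
  have "(a / (2 * (rp P - M)))-lipschitz_on UNIV rhoc"
    using rhoc_lipschitz a_pos M_less_rp by (intro lipschitz_onI) (auto simp: dist_real_def)
  then show "continuous_on UNIV rhoc" by (rule lipschitz_on_continuous_on)
qed simp

lemma borel_measurable_data [measurable]:
  "rhoc \<in> borel_measurable borel" "chi1 P \<in> borel_measurable borel" "chi2 P \<in> borel_measurable borel"
  "psi P \<in> borel_measurable borel" "Rss P \<in> borel_measurable borel" "chi_hi P \<in> borel_measurable borel"
  by (auto intro!: borel_measurable_continuous_onI continuous_on_rhoc smooth_imp_continuous smooth_data)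

lemma borel_measurable_vel [measurable]: "vel P \<in> borel_measurable borel"
  unfolding vel_def Delta_def by measurable

lemma measurable_Aop:
  assumes [measurable]: "f \<in> borel_measurable N" "g \<in> measurable N (count_space UNIV)" "h \<in> borel_measurable N"
  shows "(\<lambda>x. Aop (f x) (g x) (h x)) \<in> borel_measurable N"
  unfolding Aop_def tchi1_def chi_sharp_def by measurable

text \<open>The definite description and the infima behind \<open>f_nat\<close> and
  \<open>h_sharp\<close> have been replaced by expressions in the continuous function
  \<open>rhoc\<close>, so everything in \<open>Dop\<close> is visibly Borel.\<close>

lemma measurable_Dop:
  assumes [measurable]: "f \<in> borel_measurable N" "g \<in> measurable N (count_space UNIV)" "h \<in> borel_measurable N"
  shows "(\<lambda>x. Dop (f x) (g x) (h x)) \<in> borel_measurable N"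
  unfolding Dop_def tchi1_def tsharp_def E_sharp_def E_nat_def hsharp_def beta_def AA_def QQ_def JJ_def NN_def Delta_def
  by measurable

end

section \<open>Convolution operators on \<open>\<int> \<times> \<real>\<close>\<close>

text \<open>Points are pairs \<open>(m, \<omega>)\<close>, in the opposite order to the arguments of
  \<open>fld\<close>.\<close>

abbreviation ZR :: "(int \<times> real) measure" where
  "ZR \<equiv> count_space UNIV \<Otimes>\<^sub>M lborel"

interpretation ZR: pair_sigma_finite "count_space (UNIV :: int set)" "lborel :: real measure"
  by (intro pair_sigma_finite.intro sigma_finite_measure_count_space sigma_finite_lborel)

lemma sigma_finite_ZR: "sigma_finite_measure ZR"
  by (rule ZR.P.sigma_finite_measure_axioms)

lemma in_space_ZR [simp, measurable]: "x \<in> space ZR"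
  by (cases x) (simp add: space_pair_measure)

interpretation ZR2: pair_sigma_finite ZR ZR
  by (intro pair_sigma_finite.intro sigma_finite_ZR)

lemma measurable_diff_count_space [measurable (raw)]:
  fixes f g :: "'a \<Rightarrow> int"
  assumes f: "f \<in> measurable N (count_space UNIV)" and g: "g \<in> measurable N (count_space UNIV)"
  shows "(\<lambda>x. f x - g x) \<in> measurable N (count_space UNIV)"
proof (rule measurable_compose_countable[OF _ g, where f = "\<lambda>i x. f x - i"])
  show "(\<lambda>x. f x - i) \<in> measurable N (count_space UNIV)" for i
    using measurable_compose[OF f, of "\<lambda>j. j - i" "count_space UNIV"] by simp
qed

lemma measurable_diff_ZR [measurable (raw)]:
  assumes "f \<in> measurable N ZR" "g \<in> measurable N ZR"
  shows "(\<lambda>x. f x - g x) \<in> measurable N ZR"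
proof -
  have [measurable]: "(\<lambda>x. fst (f x)) \<in> measurable N (count_space UNIV)" "(\<lambda>x. snd (f x)) \<in> borel_measurable N"
    "(\<lambda>x. fst (g x)) \<in> measurable N (count_space UNIV)" "(\<lambda>x. snd (g x)) \<in> borel_measurable N"
    using measurable_compose[OF assms(1) measurable_fst] measurable_compose[OF assms(1) measurable_snd]
      measurable_compose[OF assms(2) measurable_fst] measurable_compose[OF assms(2) measurable_snd] by simp_all
  have "(\<lambda>x. (fst (f x) - fst (g x), snd (f x) - snd (g x))) \<in> measurable N ZR" by measurable
  then show ?thesis by (simp add: minus_prod_def)
qed

lemma nn_integral_ZR:
  "f \<in> borel_measurable ZR \<Longrightarrow> (\<integral>\<^sup>+m. \<integral>\<^sup>+\<omega>. f (m, \<omega>) \<partial>lborel \<partial>count_space UNIV) = integral\<^sup>N ZR f"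
  by (rule lborel.nn_integral_fst)

lemma nn_integral_ZR_translate:
  assumes [measurable]: "f \<in> borel_measurable ZR"
  shows "(\<integral>\<^sup>+x. f (x - c) \<partial>ZR) = integral\<^sup>N ZR f"
proof -
  have "(\<integral>\<^sup>+x. f (x - c) \<partial>ZR) = (\<integral>\<^sup>+m. \<integral>\<^sup>+\<omega>. f (m - fst c, \<omega> - snd c) \<partial>lborel \<partial>count_space UNIV)"
    by (subst nn_integral_ZR[symmetric]) (simp_all add: minus_prod_def)
  also have "\<dots> = (\<integral>\<^sup>+m. \<integral>\<^sup>+\<omega>. f (m - fst c, \<omega>) \<partial>lborel \<partial>count_space UNIV)"
    by (subst (2) nn_integral_real_affine[where c = 1 and t = "- snd c"]) simp_all
  also have "\<dots> = (\<integral>\<^sup>+m. \<integral>\<^sup>+\<omega>. f (m, \<omega>) \<partial>lborel \<partial>count_space UNIV)"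
    by (rule nn_integral_bij_count_space[where g = "\<lambda>m. m - fst c"])
      (auto intro!: bij_betwI[where g = "\<lambda>m. m + fst c"])
  also have "\<dots> = integral\<^sup>N ZR f" by (rule nn_integral_ZR) fact
  finally show ?thesis .
qed

text \<open>Cauchy-Schwarz with the integrand split as \<open>sqrt p * (sqrt p * u)\<close>, then
  Fubini and translation invariance. In \<open>ennreal\<close> no finiteness is at stake.\<close>

lemma young_ZR:
  fixes p u :: "int \<times> real \<Rightarrow> real"
  assumes [measurable]: "p \<in> borel_measurable ZR" "u \<in> borel_measurable ZR"
    and p: "\<And>x. 0 \<le> p x" and u: "\<And>x. 0 \<le> u x"
  shows "(\<integral>\<^sup>+x. (\<integral>\<^sup>+y. ennreal (p y * u (x - y)) \<partial>ZR)\<^sup>2 \<partial>ZR) \<le> (\<integral>\<^sup>+x. ennreal (p x) \<partial>ZR)\<^sup>2 * (\<integral>\<^sup>+x. ennreal ((u x)\<^sup>2) \<partial>ZR)"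
proof -
  let ?p = "\<integral>\<^sup>+x. ennreal (p x) \<partial>ZR" and ?u = "\<integral>\<^sup>+x. ennreal ((u x)\<^sup>2) \<partial>ZR"
  have CS: "(\<integral>\<^sup>+y. ennreal (p y * u (x - y)) \<partial>ZR)\<^sup>2 \<le> ?p * (\<integral>\<^sup>+y. ennreal (p y * (u (x - y))\<^sup>2) \<partial>ZR)" for x
  proof -
    have "(\<integral>\<^sup>+y. ennreal (p y * u (x - y)) \<partial>ZR) = (\<integral>\<^sup>+y. ennreal (sqrt (p y)) * ennreal (sqrt (p y) * u (x - y)) \<partial>ZR)"
      using p u by (intro nn_integral_cong) (simp add: ennreal_mult[symmetric] mult.assoc[symmetric])
    also have "(\<dots>)\<^sup>2 \<le> (\<integral>\<^sup>+y. (ennreal (sqrt (p y)))\<^sup>2 \<partial>ZR) * (\<integral>\<^sup>+y. (ennreal (sqrt (p y) * u (x - y)))\<^sup>2 \<partial>ZR)"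
      by (rule Cauchy_Schwarz_nn_integral) measurable
    also have "\<dots> = ?p * (\<integral>\<^sup>+y. ennreal (p y * (u (x - y))\<^sup>2) \<partial>ZR)"
      using p u by (simp add: ennreal_power power_mult_distrib)
    finally show ?thesis .
  qed
  have "(\<integral>\<^sup>+x. (\<integral>\<^sup>+y. ennreal (p y * u (x - y)) \<partial>ZR)\<^sup>2 \<partial>ZR) \<le>
      (\<integral>\<^sup>+x. ?p * (\<integral>\<^sup>+y. ennreal (p y * (u (x - y))\<^sup>2) \<partial>ZR) \<partial>ZR)"
    by (intro nn_integral_mono CS)
  also have "\<dots> = ?p * (\<integral>\<^sup>+x. \<integral>\<^sup>+y. ennreal (p y * (u (x - y))\<^sup>2) \<partial>ZR \<partial>ZR)"
    by (rule nn_integral_cmult) measurable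
  also have "(\<integral>\<^sup>+x. \<integral>\<^sup>+y. ennreal (p y * (u (x - y))\<^sup>2) \<partial>ZR \<partial>ZR) = (\<integral>\<^sup>+y. \<integral>\<^sup>+x. ennreal (p y * (u (x - y))\<^sup>2) \<partial>ZR \<partial>ZR)"
    by (rule ZR2.Fubini') measurable
  also have "\<dots> = (\<integral>\<^sup>+y. ennreal (p y) * ?u \<partial>ZR)"
  proof (intro nn_integral_cong)
    fix y
    have "(\<integral>\<^sup>+x. ennreal (p y * (u (x - y))\<^sup>2) \<partial>ZR) = ennreal (p y) * (\<integral>\<^sup>+x. ennreal ((u (x - y))\<^sup>2) \<partial>ZR)"
      using p by (subst nn_integral_cmult[symmetric]) (auto simp: ennreal_mult)
    then show "(\<integral>\<^sup>+x. ennreal (p y * (u (x - y))\<^sup>2) \<partial>ZR) = ennreal (p y) * ?u"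
      by (subst (asm) nn_integral_ZR_translate[where f = "\<lambda>x. ennreal ((u x)\<^sup>2)"]) measurable
  qed
  also have "\<dots> = ?p * ?u" by (rule nn_integral_multc) measurable
  finally show ?thesis by (simp add: power2_eq_square mult.assoc)
qed

lemma kernel_bound_ZR:
  fixes k :: "int \<times> real \<Rightarrow> int \<times> real \<Rightarrow> complex"
  assumes [measurable]: "p \<in> borel_measurable ZR" "u \<in> borel_measurable ZR"
    and p: "\<And>x. 0 \<le> p x" and u: "\<And>x. 0 \<le> u x"
    and k: "\<And>x y. norm (k x y) \<le> C * (p y * u (x - y))" and C: "0 \<le> C"
  shows "(\<integral>\<^sup>+x. (\<integral>\<^sup>+y. ennreal (norm (k x y)) \<partial>ZR)\<^sup>2 \<partial>ZR)
    \<le> ennreal (C\<^sup>2) * ((\<integral>\<^sup>+x. ennreal (p x) \<partial>ZR)\<^sup>2 * (\<integral>\<^sup>+x. ennreal ((u x)\<^sup>2) \<partial>ZR))"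
proof -
  have "(\<integral>\<^sup>+y. ennreal (norm (k x y)) \<partial>ZR)\<^sup>2 \<le> ennreal (C\<^sup>2) * (\<integral>\<^sup>+y. ennreal (p y * u (x - y)) \<partial>ZR)\<^sup>2" for x
  proof -
    have "(\<integral>\<^sup>+y. ennreal (norm (k x y)) \<partial>ZR) \<le> (\<integral>\<^sup>+y. ennreal C * ennreal (p y * u (x - y)) \<partial>ZR)"
      using k C p u by (intro nn_integral_mono) (simp add: ennreal_mult[symmetric] ennreal_leI)
    also have "\<dots> = ennreal C * (\<integral>\<^sup>+y. ennreal (p y * u (x - y)) \<partial>ZR)"
      by (rule nn_integral_cmult) measurable
    finally have "(\<integral>\<^sup>+y. ennreal (norm (k x y)) \<partial>ZR)\<^sup>2 \<le> (ennreal C * (\<integral>\<^sup>+y. ennreal (p y * u (x - y)) \<partial>ZR))\<^sup>2"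
      by (rule power_mono) simp
    then show ?thesis using C by (simp add: power_mult_distrib ennreal_power)
  qed
  then have "(\<integral>\<^sup>+x. (\<integral>\<^sup>+y. ennreal (norm (k x y)) \<partial>ZR)\<^sup>2 \<partial>ZR) \<le>
      (\<integral>\<^sup>+x. ennreal (C\<^sup>2) * (\<integral>\<^sup>+y. ennreal (p y * u (x - y)) \<partial>ZR)\<^sup>2 \<partial>ZR)"
    by (intro nn_integral_mono)
  also have "\<dots> = ennreal (C\<^sup>2) * (\<integral>\<^sup>+x. (\<integral>\<^sup>+y. ennreal (p y * u (x - y)) \<partial>ZR)\<^sup>2 \<partial>ZR)"
    by (rule nn_integral_cmult) measurable
  also have "\<dots> \<le> ennreal (C\<^sup>2) * ((\<integral>\<^sup>+x. ennreal (p x) \<partial>ZR)\<^sup>2 * (\<integral>\<^sup>+x. ennreal ((u x)\<^sup>2) \<partial>ZR))"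
    by (intro mult_left_mono young_ZR p u) auto
  finally show ?thesis .
qed

lemma kernel_integrable_ZR:
  fixes k :: "int \<times> real \<Rightarrow> int \<times> real \<Rightarrow> complex"
  assumes km [measurable]: "case_prod k \<in> borel_measurable (ZR \<Otimes>\<^sub>M ZR)"
    and fin: "(\<integral>\<^sup>+x. (\<integral>\<^sup>+y. ennreal (norm (k x y)) \<partial>ZR)\<^sup>2 \<partial>ZR) < \<infinity>"
  shows "AE x in ZR. integrable ZR (k x)"
proof -
  have "AE x in ZR. (\<integral>\<^sup>+y. ennreal (norm (k x y)) \<partial>ZR)\<^sup>2 \<noteq> \<infinity>"
    using fin by (intro nn_integral_PInf_AE) auto
  moreover have "k x \<in> borel_measurable ZR" for x
    using measurable_compose[OF measurable_Pair1' km, of x] by (simp add: space_pair_measure)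
  ultimately show ?thesis
    by (auto simp: integrable_iff_bounded power_less_top_ennreal less_top[symmetric] elim!: eventually_mono)
qed

lemma ennreal_sum_square_le: "(x + y)\<^sup>2 \<le> 2 * x\<^sup>2 + 2 * (y :: ennreal)\<^sup>2"
proof (cases x; cases y)
  fix s t :: real assume st: "0 \<le> s" "0 \<le> t" "x = ennreal s" "y = ennreal t"
  have "(s + t)\<^sup>2 \<le> 2 * s\<^sup>2 + 2 * t\<^sup>2" using zero_le_power2[of "s - t"] by (simp add: power2_eq_square algebra_simps)
  then have "ennreal ((s + t)\<^sup>2) \<le> ennreal (2 * s\<^sup>2 + 2 * t\<^sup>2)" by (rule ennreal_leI)
  also have "\<dots> = 2 * ennreal (s\<^sup>2) + 2 * ennreal (t\<^sup>2)"
    by (simp add: ennreal_plus ennreal_mult)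
  finally show ?thesis using st by (simp add: ennreal_power flip: ennreal_plus)
qed (auto simp: ennreal_mult_top power2_eq_square)

text \<open>Where one of the integrals does not exist, Isabelle's integral is \<open>0\<close>; this happens only on a null set.\<close>

lemma kernel_diff_ZR:
  fixes k k' :: "int \<times> real \<Rightarrow> int \<times> real \<Rightarrow> complex"
  assumes [measurable]: "case_prod k1 \<in> borel_measurable (ZR \<Otimes>\<^sub>M ZR)" "case_prod k2 \<in> borel_measurable (ZR \<Otimes>\<^sub>M ZR)"
    and int: "AE x in ZR. integrable ZR (k x)" "AE x in ZR. integrable ZR (k' x)"
    and split: "\<And>x y. k x y - k' x y = k1 x y + k2 x y"
  shows "(\<integral>\<^sup>+x. ennreal ((norm (integral\<^sup>L ZR (k x) - integral\<^sup>L ZR (k' x)))\<^sup>2) \<partial>ZR)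
    \<le> 2 * (\<integral>\<^sup>+x. (\<integral>\<^sup>+y. ennreal (norm (k1 x y)) \<partial>ZR)\<^sup>2 \<partial>ZR) + 2 * (\<integral>\<^sup>+x. (\<integral>\<^sup>+y. ennreal (norm (k2 x y)) \<partial>ZR)\<^sup>2 \<partial>ZR)"
proof -
  have [measurable]: "k1 x \<in> borel_measurable ZR" "k2 x \<in> borel_measurable ZR" for x
    using measurable_compose[OF measurable_Pair1' assms(1), of x] measurable_compose[OF measurable_Pair1' assms(2), of x]
    by simp_all
  have "(\<integral>\<^sup>+x. ennreal ((norm (integral\<^sup>L ZR (k x) - integral\<^sup>L ZR (k' x)))\<^sup>2) \<partial>ZR)
    \<le> (\<integral>\<^sup>+x. 2 * (\<integral>\<^sup>+y. ennreal (norm (k1 x y)) \<partial>ZR)\<^sup>2 + 2 * (\<integral>\<^sup>+y. ennreal (norm (k2 x y)) \<partial>ZR)\<^sup>2 \<partial>ZR)"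
  proof (rule nn_integral_mono_AE)
    show "AE x in ZR. ennreal ((norm (integral\<^sup>L ZR (k x) - integral\<^sup>L ZR (k' x)))\<^sup>2) \<le>
      2 * (\<integral>\<^sup>+y. ennreal (norm (k1 x y)) \<partial>ZR)\<^sup>2 + 2 * (\<integral>\<^sup>+y. ennreal (norm (k2 x y)) \<partial>ZR)\<^sup>2"
      using int
    proof eventually_elim
      fix x assume i: "integrable ZR (k x)" "integrable ZR (k' x)"
      have "ennreal (norm (integral\<^sup>L ZR (k x) - integral\<^sup>L ZR (k' x))) = ennreal (norm (\<integral>y. k1 x y + k2 x y \<partial>ZR))"
        using i by (simp add: split flip: Bochner_Integration.integral_diff)
      also have "\<dots> \<le> (\<integral>\<^sup>+y. ennreal (norm (k1 x y + k2 x y)) \<partial>ZR)"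
      proof (rule integral_norm_bound_ennreal)
        show "integrable ZR (\<lambda>y. k1 x y + k2 x y)"
          using Bochner_Integration.integrable_diff[OF i] by (simp add: split)
      qed
      also have "\<dots> \<le> (\<integral>\<^sup>+y. ennreal (norm (k1 x y)) + ennreal (norm (k2 x y)) \<partial>ZR)"
        by (intro nn_integral_mono) (simp add: norm_triangle_ineq flip: ennreal_plus)
      also have "\<dots> = (\<integral>\<^sup>+y. ennreal (norm (k1 x y)) \<partial>ZR) + (\<integral>\<^sup>+y. ennreal (norm (k2 x y)) \<partial>ZR)"
        by (rule nn_integral_add) measurable
      finally have "(ennreal (norm (integral\<^sup>L ZR (k x) - integral\<^sup>L ZR (k' x))))\<^sup>2 \<le>
          ((\<integral>\<^sup>+y. ennreal (norm (k1 x y)) \<partial>ZR) + (\<integral>\<^sup>+y. ennreal (norm (k2 x y)) \<partial>ZR))\<^sup>2"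
        by (rule power_mono) simp
      also note ennreal_sum_square_le
      finally show "ennreal ((norm (integral\<^sup>L ZR (k x) - integral\<^sup>L ZR (k' x)))\<^sup>2) \<le>
          2 * (\<integral>\<^sup>+y. ennreal (norm (k1 x y)) \<partial>ZR)\<^sup>2 + 2 * (\<integral>\<^sup>+y. ennreal (norm (k2 x y)) \<partial>ZR)\<^sup>2"
        by (simp add: ennreal_power)
    qed
  qed
  also have "\<dots> = 2 * (\<integral>\<^sup>+x. (\<integral>\<^sup>+y. ennreal (norm (k1 x y)) \<partial>ZR)\<^sup>2 \<partial>ZR) + 2 * (\<integral>\<^sup>+x. (\<integral>\<^sup>+y. ennreal (norm (k2 x y)) \<partial>ZR)\<^sup>2 \<partial>ZR)"
    by (simp add: nn_integral_add nn_integral_cmult)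
  finally show ?thesis .
qed

lemma ennsqrt_sq: "(ennsqrt x)\<^sup>2 = x"
  by (cases x) (auto simp: ennsqrt_def power2_eq_square ennreal_mult_top simp flip: ennreal_mult)

lemma ennsqrt_tendsto_0:
  fixes f :: "nat \<Rightarrow> ennreal"
  shows "(\<lambda>n. ennsqrt (f n)) \<longlonglongrightarrow> 0 \<longleftrightarrow> f \<longlonglongrightarrow> 0"
proof
  assume "(\<lambda>n. ennsqrt (f n)) \<longlonglongrightarrow> 0"
  then have "(\<lambda>n. ennsqrt (f n) * ennsqrt (f n)) \<longlonglongrightarrow> 0 * 0"
    by (intro tendsto_mult_ennreal) auto
  then show "f \<longlonglongrightarrow> 0" by (simp flip: power2_eq_square add: ennsqrt_sq)
next
  assume f: "f \<longlonglongrightarrow> 0"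
  show "(\<lambda>n. ennsqrt (f n)) \<longlonglongrightarrow> 0"
  proof (rule order_tendstoI)
    fix e :: ennreal assume "0 < e"
    then have "0 < e\<^sup>2" by (simp add: power2_eq_square ennreal_zero_less_mult_iff)
    then have "\<forall>\<^sub>F n in sequentially. f n < e\<^sup>2" using order_tendstoD(2)[OF f] by blast
    then show "\<forall>\<^sub>F n in sequentially. ennsqrt (f n) < e"
    proof eventually_elim
      case (elim n)
      then show ?case using power_mono[of e "ennsqrt (f n)" 2] by (metis ennsqrt_sq not_le zero_le)
    qed
  qed simp
qed

section \<open>An integrable majorant on the frequency space\<close>

lemma integrable_Cauchy_density: "integrable lborel (\<lambda>x::real. 1 / (1 + x\<^sup>2))"
proof -
  have half: "(\<integral>\<^sup>+x. ennreal (1 / (1 + x\<^sup>2)) * indicator {0..} x \<partial>lborel) = ennreal (pi / 2 - arctan 0)"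
  proof (rule nn_integral_FTC_atLeast)
    show "(arctan has_real_derivative 1 / (1 + x\<^sup>2)) (at x)" for x
      using DERIV_arctan[of x] by (simp add: inverse_eq_divide)
  qed (auto intro: tendsto_arctan_at_top)
  have "(\<integral>\<^sup>+x. ennreal (1 / (1 + x\<^sup>2)) \<partial>lborel) \<le>
      (\<integral>\<^sup>+x. ennreal (1 / (1 + x\<^sup>2)) * indicator {0..} x + ennreal (1 / (1 + (- x)\<^sup>2)) * indicator {0..} (- x) \<partial>lborel)"
    by (intro nn_integral_mono) (auto simp: indicator_def)
  also have "\<dots> = (\<integral>\<^sup>+x. ennreal (1 / (1 + x\<^sup>2)) * indicator {0..} x \<partial>lborel) +
      (\<integral>\<^sup>+x. ennreal (1 / (1 + (- x)\<^sup>2)) * indicator {0..} (- x) \<partial>lborel)"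
    by (rule nn_integral_add) measurable
  also have "(\<integral>\<^sup>+x. ennreal (1 / (1 + (- x)\<^sup>2)) * indicator {0..} (- x) \<partial>lborel) =
      (\<integral>\<^sup>+x. ennreal (1 / (1 + x\<^sup>2)) * indicator {0..} x \<partial>lborel)"
    by (subst (2) nn_integral_real_affine[where c = "- 1" and t = 0]) auto
  finally have "(\<integral>\<^sup>+x. ennreal (1 / (1 + x\<^sup>2)) \<partial>lborel) \<le> ennreal (pi / 2) + ennreal (pi / 2)"
    unfolding half by simp
  also have "\<dots> < \<infinity>" by (simp add: ennreal_add_eq_top less_top)
  finally show ?thesis by (intro integrableI_bounded) auto
qed

lemma nn_integral_int_inverse_square:
  "(\<integral>\<^sup>+m. ennreal (1 / (1 + (real_of_int m)\<^sup>2)) \<partial>count_space UNIV) < \<infinity>"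
proof -
  let ?f = "\<lambda>m::int. ennreal (1 / (1 + (real_of_int m)\<^sup>2))"
  have summ: "summable (\<lambda>n::nat. 1 / (1 + (real n)\<^sup>2))"
  proof (rule summable_comparison_test')
    show "summable (\<lambda>n::nat. inverse ((real n)\<^sup>2))" by (rule inverse_power_summable) simp
    show "norm (1 / (1 + (real n)\<^sup>2)) \<le> inverse ((real n)\<^sup>2)" if "1 \<le> n" for n
      using that by (simp add: field_simps add_pos_nonneg)
  qed
  have half: "(\<integral>\<^sup>+m. ?f m * indicator {0..} m \<partial>count_space UNIV) < \<infinity>"
  proof -
    have "(\<integral>\<^sup>+m. ?f m * indicator {0..} m \<partial>count_space UNIV) = (\<integral>\<^sup>+m. ?f m \<partial>count_space {0..})"
      by (rule nn_integral_count_space_indicator[symmetric]) simp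
    also have "\<dots> = (\<integral>\<^sup>+n. ?f (int n) \<partial>count_space UNIV)"
      by (rule nn_integral_bij_count_space[symmetric]) (auto simp: bij_betw_def inj_on_def image_iff dest: zero_le_imp_eq_int)
    also have "\<dots> = (\<Sum>n. ?f (int n))" by (rule nn_integral_count_space_nat)
    also have "\<dots> = ennreal (\<Sum>n. 1 / (1 + (real n)\<^sup>2))"
      using summ by (simp add: suminf_ennreal_eq sums_iff)
    finally show ?thesis by simp
  qed
  have "(\<integral>\<^sup>+m. ?f m \<partial>count_space UNIV) \<le> (\<integral>\<^sup>+m. ?f m * indicator {0..} m + ?f (- m) * indicator {0..} (- m) \<partial>count_space UNIV)"
    by (intro nn_integral_mono) (auto simp: indicator_def)
  also have "\<dots> = (\<integral>\<^sup>+m. ?f m * indicator {0..} m \<partial>count_space UNIV) + (\<integral>\<^sup>+m. ?f (- m) * indicator {0..} (- m) \<partial>count_space UNIV)"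
    by (rule nn_integral_add) auto
  also have "(\<integral>\<^sup>+m. ?f (- m) * indicator {0..} (- m) \<partial>count_space UNIV) = (\<integral>\<^sup>+m. ?f m * indicator {0..} m \<partial>count_space UNIV)"
    by (rule nn_integral_bij_count_space) (auto intro!: bij_betwI[where g = uminus])
  finally show ?thesis using half by (auto intro: le_less_trans)
qed

text \<open>The decay obtained from two integrations by parts in each of \<open>t\<close> and
  \<open>\<phi>\<close>; it is integrable, and square integrable because it is at most 1.\<close>

definition decay :: "int \<times> real \<Rightarrow> real" where
  "decay x = 1 / (1 + (real_of_int (fst x))\<^sup>2) * (1 / (1 + (snd x)\<^sup>2))"

lemma decay_measurable [measurable]: "decay \<in> borel_measurable ZR"
  unfolding decay_def by measurable

lemma decay_bounds: "0 < decay x" "decay x \<le> 1"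
  by (auto simp: decay_def field_simps add_pos_nonneg mult_nonneg_nonneg)

lemma decay_fin: "(\<integral>\<^sup>+x. ennreal (decay x) \<partial>ZR) < \<infinity>"
proof -
  have "(\<integral>\<^sup>+x. ennreal (decay x) \<partial>ZR) = (\<integral>\<^sup>+m. \<integral>\<^sup>+\<omega>. ennreal (1 / (1 + (real_of_int m)\<^sup>2)) * ennreal (1 / (1 + \<omega>\<^sup>2)) \<partial>lborel \<partial>count_space UNIV)"
    by (subst nn_integral_ZR[symmetric]) (auto simp: decay_def ennreal_mult[symmetric])
  also have "\<dots> = (\<integral>\<^sup>+m. ennreal (1 / (1 + (real_of_int m)\<^sup>2)) * (\<integral>\<^sup>+\<omega>. ennreal (1 / (1 + \<omega>\<^sup>2)) \<partial>lborel) \<partial>count_space UNIV)"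
    by (subst nn_integral_cmult) auto
  also have "\<dots> = (\<integral>\<^sup>+m. ennreal (1 / (1 + (real_of_int m)\<^sup>2)) \<partial>count_space UNIV) * (\<integral>\<^sup>+\<omega>. ennreal (1 / (1 + \<omega>\<^sup>2)) \<partial>lborel)"
    by (rule nn_integral_multc) auto
  also have "\<dots> < \<infinity>"
    using nn_integral_int_inverse_square integrable_Cauchy_density
    by (auto simp: integrable_iff_bounded ennreal_mult_less_top)
  finally show ?thesis .
qed

lemma integrable_decay: "integrable ZR decay"
  using decay_fin decay_bounds(1) by (intro integrableI_bounded) (auto simp: less_imp_le)

lemma decay_bound_fin:
  assumes "\<And>x. norm (f x :: complex) \<le> C * decay x"
  shows "(\<integral>\<^sup>+x. ennreal (norm (f x)) \<partial>ZR) < \<infinity>" "(\<integral>\<^sup>+x. ennreal ((norm (f x))\<^sup>2) \<partial>ZR) < \<infinity>"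
proof -
  have C: "0 \<le> C" using order_trans[OF norm_ge_zero assms, of undefined] decay_bounds(1)[of undefined]
    by (simp add: zero_le_mult_iff)
  have "(\<integral>\<^sup>+x. ennreal (norm (f x)) \<partial>ZR) \<le> (\<integral>\<^sup>+x. ennreal C * ennreal (decay x) \<partial>ZR)"
    using assms C decay_bounds(1) by (intro nn_integral_mono) (auto simp: ennreal_leI less_imp_le simp flip: ennreal_mult)
  also have "\<dots> < \<infinity>" using decay_fin by (subst nn_integral_cmult) (auto simp: ennreal_mult_less_top)
  finally show "(\<integral>\<^sup>+x. ennreal (norm (f x)) \<partial>ZR) < \<infinity>" .
  have "(norm (f x))\<^sup>2 \<le> C\<^sup>2 * decay x" for x
  proof -
    have "(norm (f x))\<^sup>2 \<le> (C * decay x)\<^sup>2" using assms by (intro power_mono) auto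
    also have "\<dots> = C\<^sup>2 * (decay x * decay x)" by (simp add: power2_eq_square)
    also have "\<dots> \<le> C\<^sup>2 * (decay x * 1)" using decay_bounds[of x] by (intro mult_left_mono) auto
    finally show ?thesis by simp
  qed
  then have "(\<integral>\<^sup>+x. ennreal ((norm (f x))\<^sup>2) \<partial>ZR) \<le> (\<integral>\<^sup>+x. ennreal (C\<^sup>2) * ennreal (decay x) \<partial>ZR)"
    using decay_bounds(1) by (intro nn_integral_mono) (auto simp: ennreal_leI less_imp_le simp flip: ennreal_mult)
  also have "\<dots> < \<infinity>" using decay_fin by (subst nn_integral_cmult) (auto simp: ennreal_mult_less_top)
  finally show "(\<integral>\<^sup>+x. ennreal ((norm (f x))\<^sup>2) \<partial>ZR) < \<infinity>" .
qed

section \<open>Test functions and their Fourier transforms\<close>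

text \<open>Dominated convergence for the difference quotients: the mean value inequality bounds the
  remainder quotient by \<open>2 * w\<close>.\<close>

lemma has_vector_derivative_integral:
  fixes f f' :: "real \<Rightarrow> 'a \<Rightarrow> complex"
  assumes e: "0 < e"
    and int: "\<And>s. s \<in> ball r e \<Longrightarrow> integrable M (f s)"
    and der: "\<And>s x. s \<in> ball r e \<Longrightarrow> ((\<lambda>s. f s x) has_vector_derivative f' s x) (at s)"
    and meas [measurable]: "f' r \<in> borel_measurable M"
    and w: "integrable M w" "\<And>s x. s \<in> ball r e \<Longrightarrow> norm (f' s x) \<le> w x"
  shows "((\<lambda>s. \<integral>x. f s x \<partial>M) has_vector_derivative (\<integral>x. f' r x \<partial>M)) (at r)"
proof -
  have r: "r \<in> ball r e" using e by simp
  have i': "integrable M (f' r)"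
    by (rule Bochner_Integration.integrable_bound[OF w(1)]) (use w(2)[OF r] in \<open>auto intro: order_trans[OF _ abs_ge_self]\<close>)
  have mvt: "norm (f y x - f r x) \<le> w x * \<bar>y - r\<bar>" if y: "y \<in> ball r e" for y x
  proof -
    have "norm (f y x - f r x) \<le> w x * norm (y - r)"
    proof (rule differentiable_bound[where S = "ball r e" and f' = "\<lambda>s h. h *\<^sub>R f' s x"])
      show "((\<lambda>s. f s x) has_derivative (\<lambda>h. h *\<^sub>R f' s x)) (at s within ball r e)" if "s \<in> ball r e" for s
        using der[OF that, of x] unfolding has_vector_derivative_def by (rule has_derivative_at_withinI)
      show "onorm (\<lambda>h. h *\<^sub>R f' s x) \<le> w x" if "s \<in> ball r e" for s
        by (rule onorm_le) (use w(2)[OF that, of x] in \<open>auto simp: mult.commute[of _ "\<bar>_\<bar>"] intro!: mult_left_mono\<close>)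
    qed (use y r in auto)
    then show ?thesis by simp
  qed
  show ?thesis
    unfolding has_vector_derivative_def has_derivative_within
  proof
    show "bounded_linear (\<lambda>h. h *\<^sub>R (\<integral>x. f' r x \<partial>M))" by (rule bounded_linear_scaleR_left)
    show "((\<lambda>y. (1 / norm (y - r)) *\<^sub>R ((\<integral>x. f y x \<partial>M) - ((\<integral>x. f r x \<partial>M) + (y - r) *\<^sub>R (\<integral>x. f' r x \<partial>M)))) \<longlongrightarrow> 0) (at r)"
      unfolding tendsto_at_iff_sequentially
    proof (intro allI impI)
      fix X :: "nat \<Rightarrow> real" assume X: "\<forall>i. X i \<in> UNIV - {r}" "X \<longlonglongrightarrow> r"
      \<comment> \<open>The bounds hold only inside the ball, so the sequence is shifted until it
        stays there.\<close>
      obtain N where N: "\<And>n. N \<le> n \<Longrightarrow> X n \<in> ball r e"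
        using X(2) e unfolding lim_sequentially by (auto simp: dist_commute)
      define q where "q y x = (1 / norm (y - r)) *\<^sub>R (f y x - (f r x + (y - r) *\<^sub>R f' r x))" for y x
      have qi: "(1 / norm (y - r)) *\<^sub>R ((\<integral>x. f y x \<partial>M) - ((\<integral>x. f r x \<partial>M) + (y - r) *\<^sub>R (\<integral>x. f' r x \<partial>M))) = (\<integral>x. q y x \<partial>M)"
        if "y \<in> ball r e" for y
        unfolding q_def using int[OF that] int[OF r] i' by simp
      have "(\<lambda>n. \<integral>x. q (X (n + N)) x \<partial>M) \<longlonglongrightarrow> (\<integral>x. 0 \<partial>M)"
      proof (rule integral_dominated_convergence[where w = "\<lambda>x. 2 * w x"])
        show "AE x in M. (\<lambda>n. q (X (n + N)) x) \<longlonglongrightarrow> 0"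
        proof (rule AE_I2)
          fix x
          have "((\<lambda>y. q y x) \<longlongrightarrow> 0) (at r)"
            using der[OF r, of x] unfolding has_vector_derivative_def has_derivative_within q_def by simp
          then have "(\<lambda>n. q (X n) x) \<longlonglongrightarrow> 0"
            using X unfolding tendsto_at_iff_sequentially by (auto simp: o_def)
          then show "(\<lambda>n. q (X (n + N)) x) \<longlonglongrightarrow> 0" by (rule LIMSEQ_ignore_initial_segment)
        qed
        show "AE x in M. norm (q (X (n + N)) x) \<le> 2 * w x" for n
        proof (rule AE_I2)
          fix x
          let ?y = "X (n + N)"
          have y: "?y \<in> ball r e" "?y \<noteq> r" using N X(1) by auto
          have "norm (f ?y x - (f r x + (?y - r) *\<^sub>R f' r x)) \<le> norm (f ?y x - f r x) + norm ((?y - r) *\<^sub>R f' r x)"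
            by (metis diff_diff_eq norm_triangle_ineq4)
          also have "\<dots> \<le> w x * \<bar>?y - r\<bar> + \<bar>?y - r\<bar> * w x"
            using mvt[OF y(1), of x] w(2)[OF r, of x] by (intro add_mono) (auto intro!: mult_left_mono)
          finally show "norm (q ?y x) \<le> 2 * w x"
            using y(2) by (simp add: q_def divide_simps mult.commute)
        qed
        show "(\<lambda>x. q (X (n + N)) x) \<in> borel_measurable M" for n
          using borel_measurable_integrable[OF int[OF N[of "n + N"]]] borel_measurable_integrable[OF int[OF r]]
          unfolding q_def by measurable
      qed (use w in auto)
      then have "(\<lambda>n. \<integral>x. q (X (n + N)) x \<partial>M) \<longlonglongrightarrow> 0" by simp
      then have "((\<lambda>y. (1 / norm (y - r)) *\<^sub>R ((\<integral>x. f y x \<partial>M) - ((\<integral>x. f r x \<partial>M) + (y - r) *\<^sub>R (\<integral>x. f' r x \<partial>M)))) \<circ> (\<lambda>n. X (n + N))) \<longlonglongrightarrow> 0"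
        using qi[OF N] by (simp add: o_def)
      then show "((\<lambda>y. (1 / norm (y - r)) *\<^sub>R ((\<integral>x. f y x \<partial>M) - ((\<integral>x. f r x \<partial>M) + (y - r) *\<^sub>R (\<integral>x. f' r x \<partial>M)))) \<circ> X) \<longlonglongrightarrow> 0"
        unfolding o_def by (rule LIMSEQ_offset)
    qed
  qed
qed

section \<open>Stability of test functions under the vector fields in use\<close>

lemma frechet_derivative_eqI: "(f has_derivative f') (at x) \<Longrightarrow> frechet_derivative f (at x) = f'"
  by (rule frechet_derivative_at[symmetric])

lemma Ck_Suc_imp_Ck: "Ck (Suc k) f \<Longrightarrow> Ck k f"
proof (induction k arbitrary: f)
  case 0
  then have "f differentiable (at x)" for x by simp
  then show ?case
    by (auto intro!: differentiable_imp_continuous_within continuous_at_imp_continuous_on)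
next
  case (Suc k)
  have f: "\<forall>x. f differentiable (at x)" "Ck (Suc k) (\<lambda>x. frechet_derivative f (at x) e)" for e
    using Suc.prems unfolding Ck.simps(2)[of "Suc k"] by blast+
  have "Ck k (\<lambda>x. frechet_derivative f (at x) e)" for e
    by (rule Suc.IH[OF f(2)])
  with f(1) show ?case unfolding Ck.simps(2)[of k] by blast
qed

lemma Ck_SucI:
  assumes "\<And>x. (f has_derivative f' x) (at x)" "\<And>e. Ck k (\<lambda>x. f' x e)"
  shows "Ck (Suc k) f"
proof -
  have eq: "frechet_derivative f (at x) = f' x" for x by (rule frechet_derivative_eqI[OF assms(1)])
  have "\<forall>x. f differentiable (at x)" using assms(1) unfolding differentiable_def by blast
  then show ?thesis unfolding Ck.simps(2) eq using assms(2) by blast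
qed

lemma Ck_SucD:
  assumes "Ck (Suc k) f"
  shows "(f has_derivative frechet_derivative f (at x)) (at x)" "Ck k (\<lambda>x. frechet_derivative f (at x) e)"
proof -
  have "f differentiable (at x)" using assms unfolding Ck.simps(2) by blast
  then show "(f has_derivative frechet_derivative f (at x)) (at x)" by (simp only: frechet_derivative_works)
  show "Ck k (\<lambda>x. frechet_derivative f (at x) e)" using assms unfolding Ck.simps(2) by blast
qed

lemma Ck_scaleR_const: "Ck k f \<Longrightarrow> Ck k (\<lambda>x. c *\<^sub>R f x)"
proof (induction k arbitrary: f)
  case (Suc k)
  show ?case
    by (rule Ck_SucI[OF has_derivative_scaleR_right[OF Ck_SucD(1)[OF Suc.prems]]]) (rule Suc.IH[OF Ck_SucD(2)[OF Suc.prems]])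
qed (auto intro: continuous_intros)

lemma Ck_add: "Ck k f \<Longrightarrow> Ck k g \<Longrightarrow> Ck k (\<lambda>x. f x + g x)"
proof (induction k arbitrary: f g)
  case (Suc k)
  show ?case
    by (rule Ck_SucI[OF has_derivative_add[OF Ck_SucD(1)[OF Suc.prems(1)] Ck_SucD(1)[OF Suc.prems(2)]]])
      (rule Suc.IH[OF Ck_SucD(2)[OF Suc.prems(1)] Ck_SucD(2)[OF Suc.prems(2)]])
qed (auto intro: continuous_intros)

text \<open>The rotation and scaling fields have linear coefficients. The derivative of a linear
  factor is constant, so the induction meets only a constant multiple of \<open>f\<close> besides
  the derivative of \<open>f\<close>.\<close>

lemma Ck_scaleR_linear:
  assumes l: "bounded_linear (l :: _ \<Rightarrow> real)"
  shows "Ck k f \<Longrightarrow> Ck k (\<lambda>x. l x *\<^sub>R f x)"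
proof (induction k arbitrary: f)
  case 0
  then show ?case using bounded_linear.continuous_on[OF l continuous_on_id] by (auto intro: continuous_intros)
next
  case (Suc k)
  show ?case
  proof (rule Ck_SucI)
    show "((\<lambda>x. l x *\<^sub>R f x) has_derivative (\<lambda>e. l x *\<^sub>R frechet_derivative f (at x) e + l e *\<^sub>R f x)) (at x)" for x
      by (intro has_derivative_scaleR bounded_linear_imp_has_derivative[OF l] Ck_SucD(1)[OF Suc.prems])
    show "Ck k (\<lambda>x. l x *\<^sub>R frechet_derivative f (at x) e + l e *\<^sub>R f x)" for e
      by (rule Ck_add[OF Suc.IH[OF Ck_SucD(2)[OF Suc.prems]] Ck_scaleR_const[OF Ck_Suc_imp_Ck[OF Suc.prems]]])
  qed
qed

lemma test_funs_zero_outside: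
  assumes S: "compact S" "\<And>z. z \<notin> S \<Longrightarrow> F z = 0" and z: "z \<notin> S"
  shows "frechet_derivative F (at z) e = 0"
proof -
  have "open (- S)" using S(1) compact_imp_closed by auto
  have "((\<lambda>_. 0) has_derivative (\<lambda>_. 0)) (at z)" by simp
  then have "(F has_derivative (\<lambda>_. 0)) (at z)"
    by (rule has_derivative_transform_within_open[OF _ \<open>open (- S)\<close>]) (use S z in auto)
  then show ?thesis by (simp add: frechet_derivative_eqI)
qed

lemma test_funs_frechet_derivative:
  assumes "F \<in> test_funs P"
  shows "(\<lambda>z. frechet_derivative F (at z) e) \<in> test_funs P"
proof -
  obtain S where S: "compact S" "S \<subseteq> {(t, x). rp P < norm x}" "\<And>z. z \<notin> S \<Longrightarrow> F z = 0" and "smooth F"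
    using assms unfolding test_funs_def by auto
  have "Ck k (\<lambda>z. frechet_derivative F (at z) e)" for k
  proof -
    have "Ck (Suc k) F" using \<open>smooth F\<close> unfolding smooth_def ..
    then show ?thesis unfolding Ck.simps(2) by blast
  qed
  then show ?thesis
    unfolding test_funs_def smooth_def mem_Collect_eq
    using S test_funs_zero_outside[OF S(1,3)] by (intro conjI exI[of _ S]) auto
qed

lemma test_funs_scaleR_linear:
  assumes "F \<in> test_funs P" "bounded_linear (l :: _ \<Rightarrow> real)"
  shows "(\<lambda>z. l z *\<^sub>R F z) \<in> test_funs P"
proof -
  obtain S where S: "compact S" "S \<subseteq> {(t, x). rp P < norm x}" "\<And>z. z \<notin> S \<Longrightarrow> F z = 0" and F: "smooth F"
    using assms(1) unfolding test_funs_def by auto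
  have "smooth (\<lambda>z. l z *\<^sub>R F z)" using F Ck_scaleR_linear[OF assms(2)] unfolding smooth_def by blast
  moreover have "\<forall>z. z \<notin> S \<longrightarrow> l z *\<^sub>R F z = 0" using S(3) by simp
  ultimately show ?thesis unfolding test_funs_def using S(1,2) by blast
qed

lemma test_funs_add:
  assumes "F \<in> test_funs P" "G \<in> test_funs P"
  shows "(\<lambda>z. F z + G z) \<in> test_funs P"
proof -
  obtain S where S: "compact S" "S \<subseteq> {(t, x). rp P < norm x}" "\<And>z. z \<notin> S \<Longrightarrow> F z = 0" and F: "smooth F"
    using assms(1) unfolding test_funs_def by auto
  obtain S' where S': "compact S'" "S' \<subseteq> {(t, x). rp P < norm x}" "\<And>z. z \<notin> S' \<Longrightarrow> G z = 0" and G: "smooth G"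
    using assms(2) unfolding test_funs_def by auto
  have "smooth (\<lambda>z. F z + G z)" using F G Ck_add unfolding smooth_def by blast
  moreover have "compact (S \<union> S')" "S \<union> S' \<subseteq> {(t, x). rp P < norm x}" "\<forall>z. z \<notin> S \<union> S' \<longrightarrow> F z + G z = 0"
    using S S' by auto
  ultimately show ?thesis unfolding test_funs_def by blast
qed

lemma test_funs_has_derivative:
  assumes "F \<in> test_funs P"
  shows "(F has_derivative frechet_derivative F (at z)) (at z)"
proof -
  have "Ck (Suc 0) F" using assms unfolding test_funs_def smooth_def by blast
  then show ?thesis by (rule Ck_SucD)
qed

lemma test_funs_continuous: "F \<in> test_funs P \<Longrightarrow> continuous_on A F"
  unfolding test_funs_def by (auto intro: smooth_imp_continuous)

definition d_t where "d_t F = (\<lambda>z. frechet_derivative F (at z) (1, 0))" for F :: "real \<times> (real ^ 3) \<Rightarrow> complex"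

text \<open>\<open>d_phi\<close> differentiates along the rotations about the axis, \<open>d_r\<close> is \<open>r \<partial>\<^sub>r\<close>.\<close>

definition d_phi where "d_phi F = (\<lambda>z. frechet_derivative F (at z) (0, vector [- (snd z $ 2), snd z $ 1, 0]))"
  for F :: "real \<times> (real ^ 3) \<Rightarrow> complex"
definition d_r where "d_r F = (\<lambda>z. frechet_derivative F (at z) (0, snd z))" for F :: "real \<times> (real ^ 3) \<Rightarrow> complex"

lemma bounded_linear_coordinate: "bounded_linear (\<lambda>z :: real \<times> (real ^ 3). snd z $ i)"
  by (rule bounded_linear_compose[OF bounded_linear_vec_nth bounded_linear_snd])

lemma d_t_test_funs: "F \<in> test_funs P \<Longrightarrow> d_t F \<in> test_funs P"
  unfolding d_t_def by (rule test_funs_frechet_derivative)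

lemma test_funs_linear:
  assumes "F \<in> test_funs P"
  shows "linear (frechet_derivative F (at z))"
  using has_derivative_bounded_linear[OF test_funs_has_derivative[OF assms]] by (rule bounded_linear.linear)

text \<open>By linearity in the direction, the derivative along the field is a combination of
  Cartesian derivatives with coordinates as coefficients, which is globally smooth; the axis needs
  no separate treatment.\<close>

lemma d_phi_test_funs:
  assumes F: "F \<in> test_funs P"
  shows "d_phi F \<in> test_funs P"
proof -
  have "(\<lambda>z. (- (snd z $ 2)) *\<^sub>R frechet_derivative F (at z) (0, axis 1 1) +
     (snd z $ 1) *\<^sub>R frechet_derivative F (at z) (0, axis 2 1)) \<in> test_funs P"
    by (intro test_funs_add test_funs_scaleR_linear test_funs_frechet_derivative F bounded_linear_coordinate
        bounded_linear_minus)
  also have "(\<lambda>z. (- (snd z $ 2)) *\<^sub>R frechet_derivative F (at z) (0, axis 1 1) +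
     (snd z $ 1) *\<^sub>R frechet_derivative F (at z) (0, axis 2 1)) = d_phi F"
  proof
    fix z :: "real \<times> (real ^ 3)"
    have "(0 :: real, vector [- (snd z $ 2), snd z $ 1, 0] :: real ^ 3) = (- (snd z $ 2)) *\<^sub>R (0, axis 1 1) + (snd z $ 1) *\<^sub>R (0, axis 2 1)"
      by (simp add: vec_eq_iff forall_3 axis_def)
    then show "(- (snd z $ 2)) *\<^sub>R frechet_derivative F (at z) (0, axis 1 1) +
     (snd z $ 1) *\<^sub>R frechet_derivative F (at z) (0, axis 2 1) = d_phi F z"
      unfolding d_phi_def by (simp only: linear_add[OF test_funs_linear[OF F]] linear_scale[OF test_funs_linear[OF F]])
  qed
  finally show ?thesis .
qed

lemma d_r_test_funs:
  assumes F: "F \<in> test_funs P"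
  shows "d_r F \<in> test_funs P"
proof -
  let ?G = "\<lambda>z. (snd z $ 1) *\<^sub>R frechet_derivative F (at z) (0, axis 1 1) +
     ((snd z $ 2) *\<^sub>R frechet_derivative F (at z) (0, axis 2 1) + (snd z $ 3) *\<^sub>R frechet_derivative F (at z) (0, axis 3 1))"
  have "?G \<in> test_funs P"
    by (intro test_funs_add test_funs_scaleR_linear test_funs_frechet_derivative F bounded_linear_coordinate)
  also have "?G = d_r F"
  proof
    fix z :: "real \<times> (real ^ 3)"
    have "(0 :: real, snd z) = (snd z $ 1) *\<^sub>R (0, axis 1 1) + ((snd z $ 2) *\<^sub>R (0, axis 2 1) + (snd z $ 3) *\<^sub>R (0, axis 3 1))"
      by (simp add: vec_eq_iff forall_3 axis_def)
    then show "?G z = d_r F z"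
      unfolding d_r_def by (simp only: linear_add[OF test_funs_linear[OF F]] linear_scale[OF test_funs_linear[OF F]])
  qed
  finally show ?thesis .
qed

lemma test_funs_bounds:
  assumes "F \<in> test_funs P"
  obtains B K where "0 < K" "0 \<le> B" "\<And>z. norm (F z) \<le> B" "\<And>t x. K < \<bar>t\<bar> \<Longrightarrow> F (t, x) = 0"
proof -
  obtain S where S: "compact S" "\<And>z. z \<notin> S \<Longrightarrow> F z = 0"
    using assms unfolding test_funs_def by auto
  obtain B where B: "\<And>z. z \<in> S \<Longrightarrow> norm (F z) \<le> B"
    using compact_imp_bounded[OF compact_continuous_image[OF test_funs_continuous[OF assms] S(1)]]
    unfolding bounded_iff by auto
  obtain K where K: "\<And>z. z \<in> S \<Longrightarrow> norm z \<le> K"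
    using compact_imp_bounded[OF S(1)] unfolding bounded_iff by auto
  show ?thesis
  proof (rule that[of "max K 1" "max B 0"])
    show "norm (F z) \<le> max B 0" for z using B[of z] S(2)[of z] by (cases "z \<in> S") auto
    show "F (t, x) = 0" if "max K 1 < \<bar>t\<bar>" for t x
    proof (rule S(2))
      have "\<bar>t\<bar> \<le> norm (t, x)" by (simp add: norm_Pair)
      then show "(t, x) \<notin> S" using K[of "(t, x)"] that by auto
    qed
  qed auto
qed

section \<open>Fourier transforms of test functions: derivatives and decay\<close>

lemma sph_eq: "sph \<theta> \<phi> = (sin \<theta> * cos \<phi>) *\<^sub>R axis 1 1 + ((sin \<theta> * sin \<phi>) *\<^sub>R axis 2 1 + cos \<theta> *\<^sub>R axis 3 1)"
  by (simp add: sph_def vec_eq_iff forall_3 axis_def)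

lemma continuous_on_sph [continuous_intros]:
  fixes f :: "'a::t2_space \<Rightarrow> real"
  shows "continuous_on A f \<Longrightarrow> continuous_on A (\<lambda>x. sph \<theta> (f x))"
  unfolding sph_eq
  by (intro continuous_intros)

lemma sph_periodic: "sph \<theta> (2 * pi) = sph \<theta> 0"
  by (simp add: sph_def)

lemma sph_has_vector_derivative:
  "((\<lambda>\<phi>. sph \<theta> \<phi>) has_vector_derivative vector [- (sph \<theta> \<phi> $ 2), sph \<theta> \<phi> $ 1, 0]) (at \<phi>)"
proof -
  have eq: "vector [- (sph \<theta> \<phi> $ 2), sph \<theta> \<phi> $ 1, 0] =
      (sin \<theta> * - sin \<phi>) *\<^sub>R axis 1 1 + ((sin \<theta> * cos \<phi>) *\<^sub>R axis 2 1 + (0 :: real) *\<^sub>R axis 3 (1 :: real) :: real ^ 3)"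
    by (simp add: sph_def vec_eq_iff forall_3 axis_def)
  show ?thesis unfolding eq unfolding sph_eq
    by (intro has_vector_derivative_add has_vector_derivative_scaleR[THEN has_vector_derivative_eq_rhs])
      (auto intro!: derivative_eq_intros)
qed

text \<open>The integrand of \<open>ft\<close> on the plane, with the range of \<open>\<phi>\<close>
  as an indicator: the iterated integral becomes a single one, to which Fubini and differentiation
  under the integral apply.\<close>

definition ftk :: "(real \<times> (real ^ 3) \<Rightarrow> complex) \<Rightarrow> real \<Rightarrow> int \<Rightarrow> real \<Rightarrow> real \<Rightarrow> real \<times> real \<Rightarrow> complex" where
  "ftk F \<omega> m r \<theta> p = indicator {0..2 * pi} (snd p) *\<^sub>R
     (exp (\<i> * of_real (\<omega> * fst p - of_int m * snd p)) * F (fst p, r *\<^sub>R sph \<theta> (snd p)))"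

lemma test_funs_measurable:
  assumes "F \<in> test_funs P"
  shows "(\<lambda>p. F (fst p, r *\<^sub>R sph \<theta> (snd p))) \<in> borel_measurable (lborel \<Otimes>\<^sub>M lborel)"
proof -
  have "continuous_on UNIV (\<lambda>p::real \<times> real. F (fst p, r *\<^sub>R sph \<theta> (snd p)))"
    by (intro continuous_on_compose2[OF test_funs_continuous[OF assms, of UNIV]] continuous_intros) auto
  then show ?thesis unfolding lborel_prod by (simp add: borel_measurable_continuous_onI)
qed

lemma ftk_measurable:
  assumes "F \<in> test_funs P"
  shows "ftk F \<omega> m r \<theta> \<in> borel_measurable (lborel \<Otimes>\<^sub>M lborel)"
proof -
  note [measurable] = test_funs_measurable[OF assms]
  show ?thesis unfolding ftk_def[abs_def] by measurable
qed

lemma norm_ftk_le: "(\<And>z. norm (F z) \<le> B) \<Longrightarrow> (\<And>t x. K < \<bar>t\<bar> \<Longrightarrow> F (t, x) = 0) \<Longrightarrow>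
    norm (ftk F \<omega> m r \<theta> p) \<le> B * indicator ({- K..K} \<times> {0..2 * pi}) p"
  by (cases p) (auto simp: ftk_def norm_mult indicator_def)

lemma integrable_box:
  fixes B K :: real
  shows "integrable (lborel \<Otimes>\<^sub>M lborel) (\<lambda>p. B * indicator ({- K..K} \<times> {0..2 * pi}) p)"
proof (intro integrable_mult_right integrable_real_indicator)
  show "{- K..K} \<times> {0..2 * pi} \<in> sets (lborel \<Otimes>\<^sub>M lborel)" by (intro pair_measureI) auto
  have "emeasure (lborel \<Otimes>\<^sub>M lborel) ({- K..K} \<times> {0..2 * pi}) = emeasure lborel {- K..K} * emeasure lborel {0..2 * pi}"
    by (rule lborel.emeasure_pair_measure_Times) auto
  also have "\<dots> < \<infinity>" by (simp add: ennreal_mult_less_top emeasure_lborel_Icc_eq)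
  finally show "emeasure (lborel \<Otimes>\<^sub>M lborel) ({- K..K} \<times> {0..2 * pi}) < \<infinity>" .
qed

lemma ftk_integrable:
  assumes F: "F \<in> test_funs P"
  shows "integrable (lborel \<Otimes>\<^sub>M lborel) (ftk F \<omega> m r \<theta>)"
proof -
  obtain K B where BK: "0 < K" "0 \<le> B" "\<And>z. norm (F z) \<le> B" "\<And>t x. K < \<bar>t\<bar> \<Longrightarrow> F (t, x) = 0"
    by (rule test_funs_bounds[OF F]) blast
  have "norm (ftk F \<omega> m r \<theta> p) \<le> norm (B * indicator ({- K..K} \<times> {0..2 * pi}) p)" for p
    unfolding real_norm_def by (rule order_trans[OF norm_ftk_le[of F B K, OF BK(3,4)] abs_ge_self])
  then show ?thesis
    by (intro Bochner_Integration.integrable_bound[OF integrable_box ftk_measurable[OF F]] AE_I2)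
qed

lemma ft_eq:
  assumes F: "F \<in> test_funs P"
  shows "ft F \<omega> m r \<theta> = of_real (1 / (2 * pi)) * (\<integral>p. ftk F \<omega> m r \<theta> p \<partial>(lborel \<Otimes>\<^sub>M lborel))"
  unfolding lborel_pair.integral_fst'[OF ftk_integrable[OF F], symmetric]
  by (simp add: ft_def ftk_def set_lebesgue_integral_def)

lemma ft_bounded:
  assumes F: "F \<in> test_funs P"
  obtains C where "\<And>\<omega> m r \<theta>. norm (ft F \<omega> m r \<theta>) \<le> C"
proof -
  obtain K B where BK: "0 < K" "0 \<le> B" "\<And>z. norm (F z) \<le> B" "\<And>t x. K < \<bar>t\<bar> \<Longrightarrow> F (t, x) = 0"
    by (rule test_funs_bounds[OF F]) blast
  define I where "I = (\<integral>p. B * indicator ({- K..K} \<times> {0..2 * pi}) p \<partial>(lborel \<Otimes>\<^sub>M lborel))"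
  have "norm (ft F \<omega> m r \<theta>) \<le> 1 / (2 * pi) * I" for \<omega> m r \<theta>
  proof -
    have "norm (\<integral>p. ftk F \<omega> m r \<theta> p \<partial>(lborel \<Otimes>\<^sub>M lborel)) \<le> (\<integral>p. norm (ftk F \<omega> m r \<theta> p) \<partial>(lborel \<Otimes>\<^sub>M lborel))"
      by (rule integral_norm_bound)
    also have "\<dots> \<le> I" unfolding I_def
      using norm_ftk_le[of F B K, OF BK(3,4)] by (intro integral_mono integrable_norm ftk_integrable[OF F] integrable_box)
    finally show ?thesis unfolding ft_eq[OF F] norm_mult
      by (intro mult_mono) (auto simp: norm_divide norm_mult)
  qed
  then show ?thesis by (rule that)
qed

lemma exp_has_vector_derivative:
  "((\<lambda>t. exp (\<i> * of_real (c * t + d))) has_vector_derivative \<i> * of_real c * exp (\<i> * of_real (c * t + d))) (at t)"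
proof -
  have "((\<lambda>z. exp (\<i> * (of_real c * z + of_real d))) has_field_derivative \<i> * of_real c * exp (\<i> * of_real (c * t + d))) (at (of_real t))"
    by (auto intro!: derivative_eq_intros)
  from has_vector_derivative_real_field[OF this] show ?thesis by simp
qed

text \<open>Integration by parts: for fixed \<open>\<phi>\<close> the function \<open>g\<close> is
  the \<open>t\<close>-derivative of exponential times \<open>F\<close>, and compact support removes
  the boundary terms.\<close>

lemma ft_d_t:
  assumes F: "F \<in> test_funs P"
  shows "ft (d_t F) \<omega> m r \<theta> = - \<i> * of_real \<omega> * ft F \<omega> m r \<theta>"
proof -
  obtain K where K: "0 < K" "\<And>t x. K < \<bar>t\<bar> \<Longrightarrow> F (t, x) = 0"
    by (rule test_funs_bounds[OF F]) blast
  obtain L where L: "0 < L" "\<And>t x. L < \<bar>t\<bar> \<Longrightarrow> d_t F (t, x) = 0"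
    by (rule test_funs_bounds[OF d_t_test_funs[OF F]]) blast
  \<comment> \<open>Larger than both support bounds, so that \<open>F\<close> vanishes at the ends
    of the window and \<open>E'\<close> outside it.\<close>
  define N where "N = K + L"
  define g where "g p = ftk (d_t F) \<omega> m r \<theta> p + \<i> * of_real \<omega> * ftk F \<omega> m r \<theta> p" for p
  have gi: "integrable (lborel \<Otimes>\<^sub>M lborel) g"
    unfolding g_def by (intro Bochner_Integration.integrable_add integrable_mult_right ftk_integrable[OF F]
        ftk_integrable[OF d_t_test_funs[OF F]])
  have "(\<integral>t. g (t, \<phi>) \<partial>lborel) = 0" for \<phi>
  proof -
    define x where "x = r *\<^sub>R sph \<theta> \<phi>"
    define e where "e t = exp (\<i> * of_real (\<omega> * t + - (of_int m * \<phi>)))" for t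
    define E' where "E' t = e t * d_t F (t, x) + \<i> * of_real \<omega> * e t * F (t, x)" for t
    have der: "((\<lambda>t. e t * F (t, x)) has_vector_derivative E' t) (at t)" for t
    proof -
      have "((\<lambda>t. F (t, x)) has_derivative (\<lambda>h. frechet_derivative F (at (t, x)) (h, 0))) (at t)"
        by (rule has_derivative_compose[OF _ test_funs_has_derivative[OF F], where f = "\<lambda>t. (t, x)"])
          (auto intro!: derivative_eq_intros)
      moreover have "frechet_derivative F (at (t, x)) (h, 0) = h *\<^sub>R d_t F (t, x)" for h
        unfolding d_t_def using linear_scale[OF test_funs_linear[OF F], of "(t, x)" h "(1, 0)"] by simp
      ultimately have "((\<lambda>t. F (t, x)) has_vector_derivative d_t F (t, x)) (at t)"
        unfolding has_vector_derivative_def by simp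
      from has_vector_derivative_mult[OF exp_has_vector_derivative[of \<omega> "- (of_int m * \<phi>)" t] this]
      show ?thesis unfolding E'_def e_def by (simp add: add.commute)
    qed
    have cont: "continuous_on A (\<lambda>t. F (t, x))" "continuous_on A (\<lambda>t. d_t F (t, x))" for A
      by (intro continuous_on_compose2[OF test_funs_continuous[OF F, of UNIV]]
          continuous_on_compose2[OF test_funs_continuous[OF d_t_test_funs[OF F], of UNIV]] continuous_intros; simp)+
    have "(\<integral>t. indicator {- (N + 1)..N + 1} t *\<^sub>R E' t \<partial>lborel) = e (N + 1) * F (N + 1, x) - e (- (N + 1)) * F (- (N + 1), x)"
    proof (rule integral_FTC_Icc)
      show "- (N + 1) \<le> N + 1" using K L by (simp add: N_def)
      show "continuous_on {- (N + 1)..N + 1} E'" unfolding E'_def e_def by (intro continuous_intros cont)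
    qed (use der in \<open>auto intro: has_vector_derivative_at_within\<close>)
    also have "\<dots> = 0" using K L by (simp add: N_def)
    also have "(\<lambda>t. indicator {- (N + 1)..N + 1} t *\<^sub>R E' t) = E'"
      using K L by (auto simp: fun_eq_iff indicator_def E'_def N_def)
    finally have "(\<integral>t. E' t \<partial>lborel) = 0" .
    moreover have "g (t, \<phi>) = indicator {0..2 * pi} \<phi> *\<^sub>R E' t" for t
      by (simp add: g_def ftk_def E'_def e_def x_def algebra_simps)
    ultimately show ?thesis by simp
  qed
  then have "(\<integral>p. g p \<partial>(lborel \<Otimes>\<^sub>M lborel)) = 0"
    using lborel_pair.integral_snd[of "\<lambda>t \<phi>. g (t, \<phi>)"] gi by simp
  then have "(\<integral>p. ftk (d_t F) \<omega> m r \<theta> p \<partial>(lborel \<Otimes>\<^sub>M lborel)) + \<i> * of_real \<omega> * (\<integral>p. ftk F \<omega> m r \<theta> p \<partial>(lborel \<Otimes>\<^sub>M lborel)) = 0"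
    unfolding g_def using ftk_integrable[OF F] ftk_integrable[OF d_t_test_funs[OF F]] by simp
  then have "(\<integral>p. ftk (d_t F) \<omega> m r \<theta> p \<partial>(lborel \<Otimes>\<^sub>M lborel)) = - \<i> * of_real \<omega> * (\<integral>p. ftk F \<omega> m r \<theta> p \<partial>(lborel \<Otimes>\<^sub>M lborel))"
    by (simp add: add_eq_0_iff)
  then show ?thesis unfolding ft_eq[OF F] ft_eq[OF d_t_test_funs[OF F]] by simp
qed

text \<open>Integration by parts over one period. The boundary terms cancel because \<open>m\<close>
  is an integer and \<open>sph\<close> is periodic in \<open>\<phi>\<close>.\<close>

lemma ft_d_phi:
  assumes F: "F \<in> test_funs P"
  shows "ft (d_phi F) \<omega> m r \<theta> = \<i> * of_int m * ft F \<omega> m r \<theta>"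
proof -
  define g where "g p = ftk (d_phi F) \<omega> m r \<theta> p - \<i> * of_int m * ftk F \<omega> m r \<theta> p" for p
  have gi: "integrable (lborel \<Otimes>\<^sub>M lborel) g"
    unfolding g_def by (intro Bochner_Integration.integrable_diff integrable_mult_right ftk_integrable[OF F]
        ftk_integrable[OF d_phi_test_funs[OF F]])
  have "(\<integral>\<phi>. g (t, \<phi>) \<partial>lborel) = 0" for t
  proof -
    define x where "x \<phi> = r *\<^sub>R sph \<theta> \<phi>" for \<phi>
    define e where "e \<phi> = exp (\<i> * of_real (- of_int m * \<phi> + \<omega> * t))" for \<phi>
    define E' where "E' \<phi> = e \<phi> * d_phi F (t, x \<phi>) + \<i> * of_real (- of_int m) * e \<phi> * F (t, x \<phi>)" for \<phi>
    have der: "((\<lambda>\<phi>. e \<phi> * F (t, x \<phi>)) has_vector_derivative E' \<phi>) (at \<phi>)" for \<phi>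
    proof -
      let ?J = "vector [- (x \<phi> $ 2), x \<phi> $ 1, 0] :: real ^ 3"
      have "(x has_vector_derivative r *\<^sub>R vector [- (sph \<theta> \<phi> $ 2), sph \<theta> \<phi> $ 1, 0]) (at \<phi>)"
        unfolding x_def using has_vector_derivative_scaleR[OF DERIV_const sph_has_vector_derivative, of r] by simp
      moreover have "r *\<^sub>R vector [- (sph \<theta> \<phi> $ 2), sph \<theta> \<phi> $ 1, 0] = ?J"
        by (simp add: x_def vec_eq_iff forall_3)
      ultimately have "(x has_derivative (\<lambda>h. h *\<^sub>R ?J)) (at \<phi>)"
        unfolding has_vector_derivative_def by simp
      then have "((\<lambda>\<phi>. (t, x \<phi>)) has_derivative (\<lambda>h. (0, h *\<^sub>R ?J))) (at \<phi>)"
        by (intro has_derivative_Pair has_derivative_const)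
      then have "((\<lambda>\<phi>. F (t, x \<phi>)) has_derivative (\<lambda>h. frechet_derivative F (at (t, x \<phi>)) (0, h *\<^sub>R ?J))) (at \<phi>)"
        by (rule has_derivative_compose[OF _ test_funs_has_derivative[OF F]])
      moreover have "frechet_derivative F (at (t, x \<phi>)) (0, h *\<^sub>R ?J) = h *\<^sub>R d_phi F (t, x \<phi>)" for h
        unfolding d_phi_def using linear_scale[OF test_funs_linear[OF F], of "(t, x \<phi>)" h "(0, ?J)"] by simp
      ultimately have "((\<lambda>\<phi>. F (t, x \<phi>)) has_vector_derivative d_phi F (t, x \<phi>)) (at \<phi>)"
        unfolding has_vector_derivative_def by simp
      from has_vector_derivative_mult[OF exp_has_vector_derivative[of "- of_int m" "\<omega> * t" \<phi>] this]
      show ?thesis unfolding E'_def e_def by (simp add: add.commute)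
    qed
    have cont: "continuous_on A (\<lambda>\<phi>. F (t, x \<phi>))" "continuous_on A (\<lambda>\<phi>. d_phi F (t, x \<phi>))" for A
      unfolding x_def
      by (intro continuous_on_compose2[OF test_funs_continuous[OF F, of UNIV]]
          continuous_on_compose2[OF test_funs_continuous[OF d_phi_test_funs[OF F], of UNIV]] continuous_intros; simp)+
    have "(\<integral>\<phi>. indicator {0..2 * pi} \<phi> *\<^sub>R E' \<phi> \<partial>lborel) = e (2 * pi) * F (t, x (2 * pi)) - e 0 * F (t, x 0)"
    proof (rule integral_FTC_Icc)
      show "continuous_on {0..2 * pi} E'" unfolding E'_def e_def by (intro continuous_intros cont)
    qed (use der in \<open>auto intro: has_vector_derivative_at_within\<close>)
    also have "e (2 * pi) = e 0"
      unfolding e_def exp_eq by (intro exI[of _ "- m"]) (simp add: algebra_simps)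
    also have "x (2 * pi) = x 0" by (simp add: x_def sph_periodic)
    finally have "(\<integral>\<phi>. indicator {0..2 * pi} \<phi> *\<^sub>R E' \<phi> \<partial>lborel) = 0" by simp
    moreover have "g (t, \<phi>) = indicator {0..2 * pi} \<phi> *\<^sub>R E' \<phi>" for \<phi>
      by (simp add: g_def ftk_def E'_def e_def x_def algebra_simps)
    ultimately show ?thesis by simp
  qed
  then have "(\<integral>p. g p \<partial>(lborel \<Otimes>\<^sub>M lborel)) = 0"
    using lborel_pair.integral_fst'[OF gi] by simp
  then have "(\<integral>p. ftk (d_phi F) \<omega> m r \<theta> p \<partial>(lborel \<Otimes>\<^sub>M lborel)) = \<i> * of_int m * (\<integral>p. ftk F \<omega> m r \<theta> p \<partial>(lborel \<Otimes>\<^sub>M lborel))"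
    unfolding g_def using ftk_integrable[OF F] ftk_integrable[OF d_phi_test_funs[OF F]] by simp
  then show ?thesis unfolding ft_eq[OF F] ft_eq[OF d_phi_test_funs[OF F]] by simp
qed

text \<open>The radial derivative of the integrand is \<open>1 / s\<close> times that for
  \<open>d_r F\<close>; on a ball of radius \<open>r / 2\<close> around \<open>r\<close> this factor
  is at most \<open>2 / r\<close>, which gives the majorant.\<close>

lemma ft_has_vector_derivative:
  assumes F: "F \<in> test_funs P" and r: "0 < r"
  shows "((\<lambda>s. ft F \<omega> m s \<theta>) has_vector_derivative (1 / r) *\<^sub>R ft (d_r F) \<omega> m r \<theta>) (at r)"
proof -
  obtain K B where BK: "0 < K" "0 \<le> B" "\<And>z. norm (d_r F z) \<le> B" "\<And>t x. K < \<bar>t\<bar> \<Longrightarrow> d_r F (t, x) = 0"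
    by (rule test_funs_bounds[OF d_r_test_funs[OF F]]) blast
  have s: "0 < s" "1 / s \<le> 2 / r" if "s \<in> ball r (r / 2)" for s
  proof -
    have "r / 2 < s" using that by (auto simp: dist_real_def abs_if split: if_splits)
    then show "0 < s" "1 / s \<le> 2 / r" using r by (auto simp: field_simps)
  qed
  have "((\<lambda>s. \<integral>p. ftk F \<omega> m s \<theta> p \<partial>(lborel \<Otimes>\<^sub>M lborel)) has_vector_derivative
      (\<integral>p. (1 / r) *\<^sub>R ftk (d_r F) \<omega> m r \<theta> p \<partial>(lborel \<Otimes>\<^sub>M lborel))) (at r)"
  proof (rule has_vector_derivative_integral[where e = "r / 2" and f' = "\<lambda>s p. (1 / s) *\<^sub>R ftk (d_r F) \<omega> m s \<theta> p"])
    show "((\<lambda>s. ftk F \<omega> m s \<theta> p) has_vector_derivative (1 / s) *\<^sub>R ftk (d_r F) \<omega> m s \<theta> p) (at s)"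
      if "s \<in> ball r (r / 2)" for s p
    proof -
      define v where "v = sph \<theta> (snd p)"
      define e where "e = exp (\<i> * of_real (\<omega> * fst p - of_int m * snd p))"
      have "((\<lambda>s. (fst p, s *\<^sub>R v)) has_derivative (\<lambda>h. (0, h *\<^sub>R v))) (at s)"
        by (auto intro!: derivative_eq_intros)
      then have "((\<lambda>s. F (fst p, s *\<^sub>R v)) has_derivative (\<lambda>h. frechet_derivative F (at (fst p, s *\<^sub>R v)) (0, h *\<^sub>R v))) (at s)"
        by (rule has_derivative_compose[OF _ test_funs_has_derivative[OF F]])
      moreover have "frechet_derivative F (at (fst p, s *\<^sub>R v)) (0, h *\<^sub>R v) = h *\<^sub>R ((1 / s) *\<^sub>R d_r F (fst p, s *\<^sub>R v))" for h
        unfolding d_r_def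
        using linear_scale[OF test_funs_linear[OF F], of "(fst p, s *\<^sub>R v)" "h * (1 / s)" "(0, s *\<^sub>R v)"] s(1)[OF that]
        by simp
      ultimately have "((\<lambda>s. F (fst p, s *\<^sub>R v)) has_vector_derivative (1 / s) *\<^sub>R d_r F (fst p, s *\<^sub>R v)) (at s)"
        unfolding has_vector_derivative_def by simp
      then have "((\<lambda>s. indicator {0..2 * pi} (snd p) *\<^sub>R (e * F (fst p, s *\<^sub>R v))) has_vector_derivative
          indicator {0..2 * pi} (snd p) *\<^sub>R (e * ((1 / s) *\<^sub>R d_r F (fst p, s *\<^sub>R v)))) (at s)"
        by (intro bounded_linear.has_vector_derivative[OF bounded_linear_scaleR_right]
            bounded_linear.has_vector_derivative[OF bounded_linear_mult_right])
      then show ?thesis unfolding ftk_def e_def v_def by (simp add: scaleR_left_commute)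
    qed
    show "norm ((1 / s) *\<^sub>R ftk (d_r F) \<omega> m s \<theta> p) \<le> 2 / r * (B * indicator ({- K..K} \<times> {0..2 * pi}) p)"
      if "s \<in> ball r (r / 2)" for s p
      unfolding norm_scaleR using s[OF that] norm_ftk_le[of "d_r F" B K, OF BK(3,4)] using r by (intro mult_mono) auto
  qed (use r F d_r_test_funs[OF F] in \<open>auto intro!: ftk_integrable ftk_measurable integrable_box borel_measurable_scaleR integrable_mult_right\<close>)
  then have "((\<lambda>s. of_real (1 / (2 * pi)) * (\<integral>p. ftk F \<omega> m s \<theta> p \<partial>(lborel \<Otimes>\<^sub>M lborel))) has_vector_derivative
      of_real (1 / (2 * pi)) * (\<integral>p. (1 / r) *\<^sub>R ftk (d_r F) \<omega> m r \<theta> p \<partial>(lborel \<Otimes>\<^sub>M lborel))) (at r)"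
    by (rule bounded_linear.has_vector_derivative[OF bounded_linear_mult_right])
  then show ?thesis
    unfolding ft_eq[OF F] ft_eq[OF d_r_test_funs[OF F]] by simp
qed

text \<open>The transforms of \<open>F\<close>, of its second \<open>t\<close>- and
  \<open>\<phi>\<close>-derivatives and of the mixed fourth one are bounded; adding the four bounds
  gives \<open>(1 + m^2) * (1 + \<omega>^2)\<close> times the transform. The constant is uniform in
  \<open>r\<close> and \<open>\<theta>\<close>.\<close>

lemma ft_decay:
  assumes F: "F \<in> test_funs P"
  obtains C where "0 \<le> C" "\<And>\<omega> m r \<theta>. norm (ft F \<omega> m r \<theta>) \<le> C * decay (m, \<omega>)"
proof -
  let ?t = "d_t (d_t F)" and ?p = "d_phi (d_phi F)" and ?q = "d_phi (d_phi (d_t (d_t F)))"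
  note ft_pair = d_t_test_funs d_phi_test_funs F
  obtain C0 where C0: "\<And>\<omega> m r \<theta>. norm (ft F \<omega> m r \<theta>) \<le> C0" by (rule ft_bounded[OF F]) blast
  have tpq: "?t \<in> test_funs P" "?p \<in> test_funs P" "?q \<in> test_funs P" by (intro ft_pair)+
  obtain C1 where C1: "\<And>\<omega> m r \<theta>. norm (ft ?t \<omega> m r \<theta>) \<le> C1" by (rule ft_bounded[OF tpq(1)]) blast
  obtain C2 where C2: "\<And>\<omega> m r \<theta>. norm (ft ?p \<omega> m r \<theta>) \<le> C2" by (rule ft_bounded[OF tpq(2)]) blast
  obtain C3 where C3: "\<And>\<omega> m r \<theta>. norm (ft ?q \<omega> m r \<theta>) \<le> C3" by (rule ft_bounded[OF tpq(3)]) blast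
  note C = C1 C2 C3
  have t: "ft ?t \<omega> m r \<theta> = - of_real (\<omega>\<^sup>2) * ft F \<omega> m r \<theta>" for \<omega> m r \<theta>
    by (simp add: ft_d_t[OF d_t_test_funs[OF F]] ft_d_t[OF F] power2_eq_square algebra_simps)
  have p: "ft (d_phi (d_phi G)) \<omega> m r \<theta> = - of_real ((of_int m)\<^sup>2) * ft G \<omega> m r \<theta>" if "G \<in> test_funs P" for G \<omega> m r \<theta>
    by (simp add: ft_d_phi[OF d_phi_test_funs[OF that]] ft_d_phi[OF that] power2_eq_square algebra_simps)
  have "norm (ft F \<omega> m r \<theta>) \<le> (C0 + C1 + C2 + C3) * decay (m, \<omega>)" for \<omega> m r \<theta>
  proof -
    let ?n = "norm (ft F \<omega> m r \<theta>)"
    have 1: "\<omega>\<^sup>2 * ?n \<le> C1" using C(1)[of \<omega> m r \<theta>] unfolding t by (simp add: norm_mult norm_power)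
    have 2: "(of_int m)\<^sup>2 * ?n \<le> C2" using C(2)[of \<omega> m r \<theta>] unfolding p[OF F] by (simp add: norm_mult norm_power)
    have 3: "(of_int m)\<^sup>2 * (\<omega>\<^sup>2 * ?n) \<le> C3"
      using C(3)[of \<omega> m r \<theta>] unfolding p[OF d_t_test_funs[OF d_t_test_funs[OF F]]] t by (simp add: norm_mult norm_power)
    have "((1 + (of_int m)\<^sup>2) * (1 + \<omega>\<^sup>2)) * ?n \<le> C0 + C1 + C2 + C3"
      using C0[of \<omega> m r \<theta>] 1 2 3 by (simp add: algebra_simps)
    moreover have "0 < (1 + (real_of_int m)\<^sup>2) * (1 + \<omega>\<^sup>2)" by (simp add: add_pos_nonneg)
    ultimately show ?thesis unfolding decay_def by (simp add: pos_le_divide_eq mult.commute)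
  qed
  moreover have "0 \<le> C0 + C1 + C2 + C3"
    using order_trans[OF norm_ge_zero C0] order_trans[OF norm_ge_zero C(1)] order_trans[OF norm_ge_zero C(2)]
      order_trans[OF norm_ge_zero C(3)] by simp
  ultimately show ?thesis using that by blast
qed

lemma ft_measurable:
  assumes F: "F \<in> test_funs P"
  shows "(\<lambda>x. ft F (snd x) (fst x) r \<theta>) \<in> borel_measurable ZR"
proof -
  note [measurable] = test_funs_measurable[OF F, of r \<theta>]
  have [measurable]: "(\<lambda>(x, p). ftk F (snd x) (fst x) r \<theta> p) \<in> borel_measurable (ZR \<Otimes>\<^sub>M (lborel \<Otimes>\<^sub>M lborel))"
    unfolding ftk_def by measurable
  show ?thesis unfolding ft_eq[OF F]
    by (intro borel_measurable_times borel_measurable_const lborel_pair.P.borel_measurable_lebesgue_integral) measurable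
qed

section \<open>The kernel of the commutator\<close>

definition slice :: "fld \<Rightarrow> real \<Rightarrow> real \<Rightarrow> int \<times> real \<Rightarrow> complex" where
  "slice f r \<theta> x = f (snd x) (fst x) r \<theta>"

definition sq_int :: "(int \<times> real \<Rightarrow> complex) \<Rightarrow> ennreal" where
  "sq_int g = (\<integral>\<^sup>+x. ennreal ((norm (g x))\<^sup>2) \<partial>ZR)"

definition pair_minus :: "fld \<times> fld \<Rightarrow> fld \<times> fld \<Rightarrow> fld \<times> fld" where
  "pair_minus w e = ((\<lambda>\<omega> m r \<theta>. fst w \<omega> m r \<theta> - fst e \<omega> m r \<theta>), (\<lambda>\<omega> m r \<theta>. snd w \<omega> m r \<theta> - snd e \<omega> m r \<theta>))"

definition slice_meas :: "fld \<times> fld \<Rightarrow> real \<Rightarrow> real \<Rightarrow> bool" where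
  "slice_meas w r \<theta> \<longleftrightarrow> slice (fst w) r \<theta> \<in> borel_measurable ZR \<and> slice (snd w) r \<theta> \<in> borel_measurable ZR"

lemma slice_meas_pair_minus: "slice_meas w r \<theta> \<Longrightarrow> slice_meas e r \<theta> \<Longrightarrow> slice_meas (pair_minus w e) r \<theta>"
  unfolding slice_meas_def pair_minus_def slice_def by auto

lemma sq_int_add_le:
  assumes [measurable]: "f \<in> borel_measurable ZR" "g \<in> borel_measurable ZR"
    and h: "\<And>x. norm (h x) \<le> norm (f x) + norm (g x)"
  shows "sq_int h \<le> 2 * sq_int f + 2 * sq_int g"
proof -
  have "sq_int h \<le> (\<integral>\<^sup>+x. 2 * ennreal ((norm (f x))\<^sup>2) + 2 * ennreal ((norm (g x))\<^sup>2) \<partial>ZR)"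
    unfolding sq_int_def
  proof (rule nn_integral_mono)
    fix x
    have "(norm (h x))\<^sup>2 \<le> (norm (f x) + norm (g x))\<^sup>2" using h by (intro power_mono) auto
    then have "ennreal ((norm (h x))\<^sup>2) \<le> (ennreal (norm (f x)) + ennreal (norm (g x)))\<^sup>2"
      by (simp add: ennreal_leI ennreal_power flip: ennreal_plus)
    also note ennreal_sum_square_le
    finally show "ennreal ((norm (h x))\<^sup>2) \<le> 2 * ennreal ((norm (f x))\<^sup>2) + 2 * ennreal ((norm (g x))\<^sup>2)"
      by (simp add: ennreal_power)
  qed
  also have "\<dots> = 2 * sq_int f + 2 * sq_int g"
    unfolding sq_int_def by (simp add: nn_integral_add nn_integral_cmult)
  finally show ?thesis .
qed

lemma l1L1_eq:
  assumes [measurable]: "(\<lambda>x. f (snd x) (fst x)) \<in> borel_measurable ZR"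
  shows "l1L1 f = (\<integral>\<^sup>+x. ennreal (norm (f (snd x) (fst x))) \<partial>ZR)"
  unfolding l1L1_def by (subst nn_integral_ZR[symmetric]) auto

lemma l2L2_eq:
  assumes [measurable]: "(\<lambda>x. f (snd x) (fst x)) \<in> borel_measurable ZR"
  shows "l2L2 f = ennsqrt (sq_int (\<lambda>x. f (snd x) (fst x)))"
  unfolding l2L2_def sq_int_def by (subst nn_integral_ZR[symmetric]) auto

context kerr
begin

text \<open>The second components stand for the images under \<open>W0_op\<close> as independent
  data, so no derivative is taken and the kernel is defined for all pairs in the closures.\<close>

definition kern :: "fld \<times> fld \<Rightarrow> fld \<times> fld \<Rightarrow> real \<Rightarrow> real \<Rightarrow> int \<times> real \<Rightarrow> int \<times> real \<Rightarrow> complex" where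
  "kern w u r \<theta> x y =
     of_real (Aop (snd x) (fst x) r) * (slice (snd w) r \<theta> y * slice (fst u) r \<theta> (x - y))
     + of_real (Aop (snd x) (fst x) r - Aop (snd (x - y)) (fst (x - y)) r) * (slice (fst w) r \<theta> y * slice (snd u) r \<theta> (x - y))
     - \<i> * of_real (Dop (snd x) (fst x) r - Dop (snd (x - y)) (fst (x - y)) r) * (slice (fst w) r \<theta> y * slice (fst u) r \<theta> (x - y))"

definition K0 :: "fld \<times> fld \<Rightarrow> fld \<times> fld \<Rightarrow> fld" where
  "K0 w u \<omega> m r \<theta> = (\<integral>y. kern w u r \<theta> (m, \<omega>) y \<partial>ZR)"

definition wdens :: "real \<Rightarrow> fld \<times> fld \<Rightarrow> real \<Rightarrow> real \<Rightarrow> int \<times> real \<Rightarrow> real" where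
  "wdens q w r \<theta> y = norm (of_real (snd y) * slice (fst w) r \<theta> y) + norm (of_int (fst y) * slice (fst w) r \<theta> y)
     + norm (of_real (vel P r powr (- q)) * slice (snd w) r \<theta> y)"

definition udens :: "real \<Rightarrow> fld \<times> fld \<Rightarrow> real \<Rightarrow> real \<Rightarrow> int \<times> real \<Rightarrow> real" where
  "udens q u r \<theta> y = norm (of_real (vel P r powr q) * slice (fst u) r \<theta> y)
     + norm (of_real (sqrt (chi_hi P r)) * (slice (snd u) r \<theta> y / of_real (max (max \<bar>of_int (fst y)\<bar> \<bar>snd y\<bar>) 1)))"

text \<open>Adding the densities before squaring suits Young's inequality, whereas
  \<open>H_norm\<close> adds the two norms after integration; \<open>H_norm_ge\<close> compares the
  two.\<close>

definition usq where "usq q u r \<theta> = (\<integral>\<^sup>+x. ennreal ((udens q u r \<theta> x)\<^sup>2) \<partial>ZR)"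

lemma wdens_nonneg: "0 \<le> wdens q w r \<theta> y" and udens_nonneg: "0 \<le> udens q u r \<theta> y"
  by (auto simp: wdens_def udens_def)

text \<open>Each of the three terms is matched with one product of a term of \<open>wdens\<close>
  and a term of \<open>udens\<close>. The fourth product, of the two \<open>W\<^sub>0\<close> terms,
  is nonnegative and simply added.\<close>

lemma kern_bound:
  "\<exists>C\<ge>0. \<forall>q\<in>{0..1}. \<forall>r>rp P. \<forall>w u \<theta> x y. norm (kern w u r \<theta> x y) \<le> C * (wdens q w r \<theta> y * udens q u r \<theta> (x - y))"
proof -
  obtain C1 where C1: "0 \<le> C1" "\<And>r \<omega> m \<omega>' m'. rp P < r \<Longrightarrow> \<bar>Aop \<omega> m r - Aop \<omega>' m' r\<bar> * max (max \<bar>of_int m'\<bar> \<bar>\<omega>'\<bar>) 1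
     \<le> C1 * (\<bar>\<omega> - \<omega>'\<bar> + \<bar>of_int m - of_int m'\<bar>) * sqrt (chi_hi P r)"
    using Aop_diff by auto
  obtain C2 where C2: "0 \<le> C2" "\<And>r \<omega> m \<omega>' m'. rp P < r \<Longrightarrow> \<bar>Dop \<omega> m r - Dop \<omega>' m' r\<bar>
     \<le> C2 * (\<bar>\<omega> - \<omega>'\<bar> + \<bar>of_int m - of_int m'\<bar>) * vel P r"
    using Dop_diff by auto
  define B where "B = max 1 (1 / sqrt (JJ (rhoc 0)))"
  have B: "0 \<le> B" by (simp add: B_def)
  define C where "C = 1 + C1 + C2 * B"
  have "norm (kern w u r \<theta> x y) \<le> C * (wdens q w r \<theta> y * udens q u r \<theta> (x - y))"
    if q: "q \<in> {0..1}" and r: "rp P < r" for q w u r \<theta> x y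
  proof -
    define w1 w2 u1 u2 where "w1 = norm (slice (fst w) r \<theta> y)" and "w2 = norm (slice (snd w) r \<theta> y)"
      and "u1 = norm (slice (fst u) r \<theta> (x - y))" and "u2 = norm (slice (snd u) r \<theta> (x - y))"
    define L where "L = \<bar>snd y\<bar> + \<bar>real_of_int (fst y)\<bar>"
    define N where "N = max (max \<bar>real_of_int (fst (x - y))\<bar> \<bar>snd (x - y)\<bar>) 1"
    define c where "c = sqrt (chi_hi P r)"
    define v where "v = vel P r"
    have nn: "0 \<le> w1" "0 \<le> w2" "0 \<le> u1" "0 \<le> u2" "0 \<le> L" "1 \<le> N" "0 \<le> c" "0 < v"
      using cutoff_bounds vel_pos[OF r] by (auto simp: w1_def w2_def u1_def u2_def L_def N_def c_def v_def)
    have Ldiff: "L = \<bar>snd x - snd (x - y)\<bar> + \<bar>real_of_int (fst x) - of_int (fst (x - y))\<bar>"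
      by (simp add: L_def)
    have wdens: "wdens q w r \<theta> y = L * w1 + v powr (- q) * w2"
      unfolding wdens_def L_def w1_def w2_def v_def by (simp add: norm_mult algebra_simps)
    have udens: "udens q u r \<theta> (x - y) = v powr q * u1 + c * u2 / N"
      unfolding udens_def u1_def u2_def v_def c_def N_def using cutoff_bounds by (simp add: norm_mult norm_divide)
    \<comment> \<open>The opposite powers of \<open>v\<close> in the two norms balance in the
      product of \<open>W\<^sub>0 w\<close> and \<open>u\<close>.\<close>
    have vq: "v powr (- q) * v powr q = 1" using nn by (simp add: powr_minus field_simps)
    have pU: "wdens q w r \<theta> y * udens q u r \<theta> (x - y) =
        w2 * u1 + (L * w1) * (c * u2 / N) + (L * w1) * (v powr q * u1) + v powr (- q) * w2 * (c * u2 / N)"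
      unfolding wdens udens using vq by algebra
    let ?X = "L * w1 * (c * u2 / N)" and ?Y = "L * w1 * (v powr q * u1)"
    have XY: "0 \<le> ?X" "0 \<le> ?Y" "0 \<le> w2 * u1" "0 \<le> v powr (- q) * w2 * (c * u2 / N)"
      using nn by (auto intro!: mult_nonneg_nonneg divide_nonneg_nonneg)
    have t1: "\<bar>Aop (snd x) (fst x) r\<bar> * (w2 * u1) \<le> w2 * u1"
      using Aop_bounds nn by (intro mult_left_le_one_le) auto
    have t2: "\<bar>Aop (snd x) (fst x) r - Aop (snd (x - y)) (fst (x - y)) r\<bar> * (w1 * u2) \<le> C1 * ?X"
    proof -
      have "\<bar>Aop (snd x) (fst x) r - Aop (snd (x - y)) (fst (x - y)) r\<bar> * N \<le> C1 * L * c"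
        unfolding N_def Ldiff c_def by (rule C1(2)[OF r])
      then have "\<bar>Aop (snd x) (fst x) r - Aop (snd (x - y)) (fst (x - y)) r\<bar> \<le> C1 * L * c / N"
        using nn by (simp add: pos_le_divide_eq)
      then have "\<bar>Aop (snd x) (fst x) r - Aop (snd (x - y)) (fst (x - y)) r\<bar> * (w1 * u2) \<le> C1 * L * c / N * (w1 * u2)"
        using nn by (intro mult_right_mono) auto
      then show ?thesis by (simp add: mult_ac)
    qed
    have t3: "\<bar>Dop (snd x) (fst x) r - Dop (snd (x - y)) (fst (x - y)) r\<bar> * (w1 * u1) \<le> C2 * B * ?Y"
    proof -
      have "\<bar>Dop (snd x) (fst x) r - Dop (snd (x - y)) (fst (x - y)) r\<bar> \<le> C2 * L * v"
        unfolding Ldiff v_def by (rule C2(2)[OF r])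
      also have "\<dots> \<le> C2 * L * (B * v powr q)"
        unfolding v_def B_def using C2(1) nn by (intro mult_left_mono vel_le_powr[OF r q]) auto
      finally have "\<bar>Dop (snd x) (fst x) r - Dop (snd (x - y)) (fst (x - y)) r\<bar> * (w1 * u1) \<le> C2 * L * (B * v powr q) * (w1 * u1)"
        using nn by (intro mult_right_mono) auto
      then show ?thesis by (simp add: mult_ac)
    qed
    have "norm (kern w u r \<theta> x y) \<le> \<bar>Aop (snd x) (fst x) r\<bar> * (w2 * u1)
        + \<bar>Aop (snd x) (fst x) r - Aop (snd (x - y)) (fst (x - y)) r\<bar> * (w1 * u2)
        + \<bar>Dop (snd x) (fst x) r - Dop (snd (x - y)) (fst (x - y)) r\<bar> * (w1 * u1)"
      unfolding kern_def w1_def w2_def u1_def u2_def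
      by (rule order_trans[OF norm_triangle_ineq4], rule add_mono, rule order_trans[OF norm_triangle_ineq], rule add_mono)
        (simp_all only: norm_mult norm_of_real norm_ii mult_1_left order_refl)
    also have "\<dots> \<le> w2 * u1 + C1 * ?X + C2 * B * ?Y" using t1 t2 t3 by linarith
    also have "\<dots> \<le> C * (w2 * u1 + ?X + ?Y + v powr (- q) * w2 * (c * u2 / N))"
    proof -
      have "1 \<le> C" "C1 \<le> C" "C2 * B \<le> C" "0 \<le> C" using C1(1) C2(1) B by (auto simp: C_def)
      note this(1-3)[THEN mult_right_mono] mult_nonneg_nonneg[OF this(4) XY(4)]
      from this(1)[OF XY(3)] this(2)[OF XY(1)] this(3)[OF XY(2)] this(4) show ?thesis unfolding distrib_left by linarith
    qed
    finally show ?thesis unfolding pU .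
  qed
  moreover have "0 \<le> C" using C1(1) C2(1) B by (simp add: C_def)
  ultimately show ?thesis by blast
qed

lemma wdens_measurable: "slice_meas w r \<theta> \<Longrightarrow> wdens q w r \<theta> \<in> borel_measurable ZR"
  and udens_measurable: "slice_meas u r \<theta> \<Longrightarrow> udens q u r \<theta> \<in> borel_measurable ZR"
proof -
  show "wdens q w r \<theta> \<in> borel_measurable ZR" if "slice_meas w r \<theta>"
  proof -
    have [measurable]: "slice (fst w) r \<theta> \<in> borel_measurable ZR" "slice (snd w) r \<theta> \<in> borel_measurable ZR"
      using that by (auto simp: slice_meas_def)
    show ?thesis unfolding wdens_def[abs_def] by measurable
  qed
  show "udens q u r \<theta> \<in> borel_measurable ZR" if "slice_meas u r \<theta>"
  proof -
    have [measurable]: "slice (fst u) r \<theta> \<in> borel_measurable ZR" "slice (snd u) r \<theta> \<in> borel_measurable ZR"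
      using that by (auto simp: slice_meas_def)
    show ?thesis unfolding udens_def[abs_def] by measurable
  qed
qed

lemma W_norm_eq:
  assumes "slice_meas w r \<theta>"
  shows "W_norm P q w (r, \<theta>) = (\<integral>\<^sup>+x. ennreal (wdens q w r \<theta> x) \<partial>ZR)"
proof -
  have m [measurable]: "slice (fst w) r \<theta> \<in> borel_measurable ZR" "slice (snd w) r \<theta> \<in> borel_measurable ZR"
    using assms by (auto simp: slice_meas_def)
  have m' [measurable]: "(\<lambda>x. fst w (snd x) (fst x) r \<theta>) \<in> borel_measurable ZR" "(\<lambda>x. snd w (snd x) (fst x) r \<theta>) \<in> borel_measurable ZR"
    using m by (simp_all add: slice_def[abs_def])
  have "W_norm P q w (r, \<theta>) = (\<integral>\<^sup>+x. ennreal (norm (of_real (snd x) * slice (fst w) r \<theta> x)) \<partial>ZR)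
     + (\<integral>\<^sup>+x. ennreal (norm (of_int (fst x) * slice (fst w) r \<theta> x)) \<partial>ZR)
     + (\<integral>\<^sup>+x. ennreal (norm (of_real (vel P r powr (- q)) * slice (snd w) r \<theta> x)) \<partial>ZR)"
  proof -
    have "l1L1 (\<lambda>\<omega> m. of_real \<omega> * fst w \<omega> m r \<theta>) = (\<integral>\<^sup>+x. ennreal (norm (of_real (snd x) * slice (fst w) r \<theta> x)) \<partial>ZR)"
      unfolding slice_def by (rule l1L1_eq) measurable
    moreover have "l1L1 (\<lambda>\<omega> m. of_int m * fst w \<omega> m r \<theta>) = (\<integral>\<^sup>+x. ennreal (norm (of_int (fst x) * slice (fst w) r \<theta> x)) \<partial>ZR)"
      unfolding slice_def by (rule l1L1_eq) measurable
    moreover have "l1L1 (\<lambda>\<omega> m. of_real (vel P r powr (- q)) * snd w \<omega> m r \<theta>) =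
        (\<integral>\<^sup>+x. ennreal (norm (of_real (vel P r powr (- q)) * slice (snd w) r \<theta> x)) \<partial>ZR)"
      unfolding slice_def by (rule l1L1_eq) measurable
    ultimately show ?thesis unfolding W_norm_def case_prod_conv by (simp only:)
  qed
  also have "\<dots> = (\<integral>\<^sup>+x. ennreal (norm (of_real (snd x) * slice (fst w) r \<theta> x)) + ennreal (norm (of_int (fst x) * slice (fst w) r \<theta> x)) \<partial>ZR)
     + (\<integral>\<^sup>+x. ennreal (norm (of_real (vel P r powr (- q)) * slice (snd w) r \<theta> x)) \<partial>ZR)"
    by (rule arg_cong[where f = "\<lambda>z. z + _"], rule nn_integral_add[symmetric]) measurable
  also have "\<dots> = (\<integral>\<^sup>+x. (ennreal (norm (of_real (snd x) * slice (fst w) r \<theta> x)) + ennreal (norm (of_int (fst x) * slice (fst w) r \<theta> x)))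
     + ennreal (norm (of_real (vel P r powr (- q)) * slice (snd w) r \<theta> x)) \<partial>ZR)"
    by (rule nn_integral_add[symmetric]) measurable
  also have "\<dots> = (\<integral>\<^sup>+x. ennreal (wdens q w r \<theta> x) \<partial>ZR)"
    unfolding wdens_def by (simp only: ennreal_plus norm_ge_zero add_nonneg_nonneg)
  finally show ?thesis .
qed

text \<open>The factor 2 is that of \<open>(x + y)^2 \<le> 2 * x^2 + 2 * y^2\<close> under the
  integral; outside it \<open>x^2 + y^2 \<le> (x + y)^2\<close>.\<close>

lemma H_norm_ge:
  assumes "slice_meas u r \<theta>"
  shows "usq q u r \<theta> \<le> 2 * (H_norm P q u (r, \<theta>))\<^sup>2"
proof -
  have m [measurable]: "slice (fst u) r \<theta> \<in> borel_measurable ZR" "slice (snd u) r \<theta> \<in> borel_measurable ZR"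
    using assms by (auto simp: slice_meas_def)
  have m' [measurable]: "(\<lambda>x. fst u (snd x) (fst x) r \<theta>) \<in> borel_measurable ZR" "(\<lambda>x. snd u (snd x) (fst x) r \<theta>) \<in> borel_measurable ZR"
    using m by (simp_all add: slice_def[abs_def])
  define f where "f x = of_real (vel P r powr q) * slice (fst u) r \<theta> x" for x
  define g where "g x = of_real (sqrt (chi_hi P r)) * (slice (snd u) r \<theta> x / of_real (max (max \<bar>of_int (fst x)\<bar> \<bar>snd x\<bar>) 1))" for x
  have fg [measurable]: "f \<in> borel_measurable ZR" "g \<in> borel_measurable ZR"
    unfolding f_def g_def by measurable
  have H: "H_norm P q u (r, \<theta>) = ennsqrt (sq_int f) + ennsqrt (sq_int g)"
  proof -
    have "l2L2 (\<lambda>\<omega> m. of_real (vel P r powr q) * fst u \<omega> m r \<theta>) = ennsqrt (sq_int f)"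
      unfolding f_def slice_def by (rule l2L2_eq) measurable
    moreover have "l2L2 (\<lambda>\<omega> m. of_real (sqrt (chi_hi P r)) * (snd u \<omega> m r \<theta> / of_real (max (max \<bar>of_int m\<bar> \<bar>\<omega>\<bar>) 1))) = ennsqrt (sq_int g)"
      unfolding g_def slice_def by (rule l2L2_eq) measurable
    ultimately show ?thesis unfolding H_norm_def case_prod_conv by (simp only:)
  qed
  have "usq q u r \<theta> = sq_int (\<lambda>x. of_real (udens q u r \<theta> x))"
    unfolding usq_def sq_int_def by simp
  also have "\<dots> \<le> 2 * sq_int f + 2 * sq_int g"
  proof (rule sq_int_add_le[OF fg])
    fix x
    have "udens q u r \<theta> x = norm (f x) + norm (g x)" unfolding udens_def f_def g_def ..
    then show "norm (complex_of_real (udens q u r \<theta> x)) \<le> norm (f x) + norm (g x)"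
      unfolding norm_of_real abs_of_nonneg[OF udens_nonneg] by (rule eq_refl)
  qed
  also have "\<dots> = 2 * ((ennsqrt (sq_int f))\<^sup>2 + (ennsqrt (sq_int g))\<^sup>2)"
    by (simp add: ennsqrt_sq distrib_left)
  also have "\<dots> \<le> 2 * (ennsqrt (sq_int f) + ennsqrt (sq_int g))\<^sup>2"
  proof (rule mult_left_mono)
    show "x\<^sup>2 + y\<^sup>2 \<le> (x + y)\<^sup>2" for x y :: ennreal
    proof -
      have "(x + y)\<^sup>2 = x\<^sup>2 + y\<^sup>2 + (x * y + y * x)" by (simp add: power2_eq_square distrib_left distrib_right ac_simps)
      then show ?thesis using add_increasing2[OF zero_le[of "x * y + y * x"] order_refl[of "x\<^sup>2 + y\<^sup>2"]] by simp
    qed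
  qed simp
  finally show ?thesis unfolding H .
qed

lemma kern_measurable:
  assumes "slice_meas w r \<theta>" "slice_meas u r \<theta>"
  shows "case_prod (kern w u r \<theta>) \<in> borel_measurable (ZR \<Otimes>\<^sub>M ZR)"
proof -
  have [measurable]: "slice (fst w) r \<theta> \<in> borel_measurable ZR" "slice (snd w) r \<theta> \<in> borel_measurable ZR"
    "slice (fst u) r \<theta> \<in> borel_measurable ZR" "slice (snd u) r \<theta> \<in> borel_measurable ZR"
    using assms by (auto simp: slice_meas_def)
  have A [measurable]: "(\<lambda>x. Aop (snd x) (fst x) r) \<in> borel_measurable ZR" "(\<lambda>x. Dop (snd x) (fst x) r) \<in> borel_measurable ZR"
    by (intro measurable_Aop measurable_Dop; measurable)+
  have d: "(\<lambda>p. fst p - snd p) \<in> measurable (ZR \<Otimes>\<^sub>M ZR) ZR" by measurable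
  have [measurable]: "(\<lambda>p. Aop (snd (fst p - snd p)) (fst (fst p - snd p)) r) \<in> borel_measurable (ZR \<Otimes>\<^sub>M ZR)"
     "(\<lambda>p. Dop (snd (fst p - snd p)) (fst (fst p - snd p)) r) \<in> borel_measurable (ZR \<Otimes>\<^sub>M ZR)"
    using measurable_compose[OF d A(1)] measurable_compose[OF d A(2)] by simp_all
  show ?thesis unfolding kern_def split_beta' by measurable
qed

lemma kern_estimate:
  "\<exists>C>0. \<forall>q\<in>{0..1}. \<forall>r>rp P. \<forall>w u \<theta>. slice_meas w r \<theta> \<longrightarrow> slice_meas u r \<theta> \<longrightarrow>
    (\<integral>\<^sup>+x. (\<integral>\<^sup>+y. ennreal (norm (kern w u r \<theta> x y)) \<partial>ZR)\<^sup>2 \<partial>ZR) \<le> ennreal C * ((W_norm P q w (r, \<theta>))\<^sup>2 * usq q u r \<theta>)"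
proof -
  obtain C where C: "0 \<le> C" "\<And>q r w u \<theta> x y. q \<in> {0..1} \<Longrightarrow> rp P < r \<Longrightarrow>
      norm (kern w u r \<theta> x y) \<le> C * (wdens q w r \<theta> y * udens q u r \<theta> (x - y))"
    using kern_bound by auto
  \<comment> \<open>The summand 1 only makes the constant positive.\<close>
  have "(\<integral>\<^sup>+x. (\<integral>\<^sup>+y. ennreal (norm (kern w u r \<theta> x y)) \<partial>ZR)\<^sup>2 \<partial>ZR) \<le> ennreal (C\<^sup>2 + 1) * ((W_norm P q w (r, \<theta>))\<^sup>2 * usq q u r \<theta>)"
    if q: "q \<in> {0..1}" and r: "rp P < r" and w: "slice_meas w r \<theta>" and u: "slice_meas u r \<theta>" for q r w u \<theta>
  proof -
    have "(\<integral>\<^sup>+x. (\<integral>\<^sup>+y. ennreal (norm (kern w u r \<theta> x y)) \<partial>ZR)\<^sup>2 \<partial>ZR) \<le> ennreal (C\<^sup>2) * ((W_norm P q w (r, \<theta>))\<^sup>2 * usq q u r \<theta>)"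
      unfolding W_norm_eq[OF w] usq_def
      by (rule kernel_bound_ZR[OF wdens_measurable[OF w] udens_measurable[OF u] wdens_nonneg udens_nonneg C(2)[OF q r] C(1)])
    also have "\<dots> \<le> ennreal (C\<^sup>2 + 1) * ((W_norm P q w (r, \<theta>))\<^sup>2 * usq q u r \<theta>)"
      by (intro mult_right_mono ennreal_leI) auto
    finally show ?thesis .
  qed
  moreover have "0 < C\<^sup>2 + 1" by (simp add: add_nonneg_pos)
  ultimately show ?thesis by blast
qed

text \<open>The kernel is bilinear; the difference is telescoped through the mixed pair
  \<open>(w, f)\<close>.\<close>

lemma kern_split: "kern w u r \<theta> x y - kern e f r \<theta> x y = kern (pair_minus w e) f r \<theta> x y + kern w (pair_minus u f) r \<theta> x y"
  unfolding kern_def pair_minus_def slice_def fst_conv snd_conv by (simp only: algebra_simps)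

lemma kern_AE_integrable:
  assumes q: "q \<in> {0..1}" and r: "rp P < r" and w: "slice_meas w r \<theta>" and u: "slice_meas u r \<theta>"
    and fin: "W_norm P q w (r, \<theta>) < \<infinity>" "usq q u r \<theta> < \<infinity>"
  shows "AE x in ZR. integrable ZR (kern w u r \<theta> x)"
proof (rule kernel_integrable_ZR[OF kern_measurable[OF w u]])
  obtain C where "(\<integral>\<^sup>+x. (\<integral>\<^sup>+y. ennreal (norm (kern w u r \<theta> x y)) \<partial>ZR)\<^sup>2 \<partial>ZR) \<le> ennreal C * ((W_norm P q w (r, \<theta>))\<^sup>2 * usq q u r \<theta>)"
    using kern_estimate q r w u by blast
  also have "\<dots> < \<infinity>" using fin by (simp add: power2_eq_square ennreal_mult_less_top)
  finally show "(\<integral>\<^sup>+x. (\<integral>\<^sup>+y. ennreal (norm (kern w u r \<theta> x y)) \<partial>ZR)\<^sup>2 \<partial>ZR) < \<infinity>" .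
qed

lemma slice_K0: "slice (K0 w u) r \<theta> = (\<lambda>x. integral\<^sup>L ZR (kern w u r \<theta> x))"
  by (simp add: slice_def K0_def fun_eq_iff)

lemma slice_K0_measurable:
  assumes "slice_meas w r \<theta>" "slice_meas u r \<theta>"
  shows "slice (K0 w u) r \<theta> \<in> borel_measurable ZR"
  unfolding slice_K0 by (rule ZR.P.borel_measurable_lebesgue_integral[OF kern_measurable[OF assms]])

lemma K0_bound:
  "\<exists>C>0. \<forall>q\<in>{0..1}. \<forall>r>rp P. \<forall>w u \<theta>. slice_meas w r \<theta> \<longrightarrow> slice_meas u r \<theta> \<longrightarrow>
    sq_int (slice (K0 w u) r \<theta>) \<le> ennreal C * ((W_norm P q w (r, \<theta>))\<^sup>2 * usq q u r \<theta>)"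
proof -
  obtain C where C: "0 < C" "\<And>q r w u \<theta>. q \<in> {0..1} \<Longrightarrow> rp P < r \<Longrightarrow> slice_meas w r \<theta> \<Longrightarrow> slice_meas u r \<theta> \<Longrightarrow>
    (\<integral>\<^sup>+x. (\<integral>\<^sup>+y. ennreal (norm (kern w u r \<theta> x y)) \<partial>ZR)\<^sup>2 \<partial>ZR) \<le> ennreal C * ((W_norm P q w (r, \<theta>))\<^sup>2 * usq q u r \<theta>)"
    using kern_estimate by auto
  have "sq_int (slice (K0 w u) r \<theta>) \<le> (\<integral>\<^sup>+x. (\<integral>\<^sup>+y. ennreal (norm (kern w u r \<theta> x y)) \<partial>ZR)\<^sup>2 \<partial>ZR)" for w u r \<theta>
    unfolding sq_int_def slice_K0
  proof (rule nn_integral_mono)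
    fix x
    have "ennreal (norm (integral\<^sup>L ZR (kern w u r \<theta> x))) \<le> (\<integral>\<^sup>+y. ennreal (norm (kern w u r \<theta> x y)) \<partial>ZR)"
      by (cases "integrable ZR (kern w u r \<theta> x)") (auto intro: integral_norm_bound_ennreal simp: not_integrable_integral_eq)
    from power_mono[OF this, of 2] show "ennreal ((norm (integral\<^sup>L ZR (kern w u r \<theta> x)))\<^sup>2) \<le> (\<integral>\<^sup>+y. ennreal (norm (kern w u r \<theta> x y)) \<partial>ZR)\<^sup>2"
      by (simp add: ennreal_power)
  qed
  then have "sq_int (slice (K0 w u) r \<theta>) \<le> ennreal C * ((W_norm P q w (r, \<theta>))\<^sup>2 * usq q u r \<theta>)"
    if "q \<in> {0..1}" "rp P < r" "slice_meas w r \<theta>" "slice_meas u r \<theta>" for q w u r \<theta>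
    using C(2)[OF that] order_trans by blast
  then show ?thesis using C(1) by blast
qed

text \<open>Joint continuity of \<open>K0\<close>. The finiteness conditions make both kernels
  integrable for almost every frequency, which is what allows the integrals to be
  subtracted.\<close>

lemma K0_diff_bound:
  "\<exists>C>0. \<forall>q\<in>{0..1}. \<forall>r>rp P. \<forall>w u e f \<theta>. slice_meas w r \<theta> \<longrightarrow> slice_meas u r \<theta> \<longrightarrow> slice_meas e r \<theta> \<longrightarrow> slice_meas f r \<theta> \<longrightarrow>
    W_norm P q w (r, \<theta>) < \<infinity> \<longrightarrow> usq q u r \<theta> < \<infinity> \<longrightarrow> W_norm P q e (r, \<theta>) < \<infinity> \<longrightarrow> usq q f r \<theta> < \<infinity> \<longrightarrow>
    sq_int (\<lambda>x. slice (K0 w u) r \<theta> x - slice (K0 e f) r \<theta> x)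
      \<le> ennreal C * ((W_norm P q (pair_minus w e) (r, \<theta>))\<^sup>2 * usq q f r \<theta> + (W_norm P q w (r, \<theta>))\<^sup>2 * usq q (pair_minus u f) r \<theta>)"
proof -
  obtain C where C: "0 < C" "\<And>q r w u \<theta>. q \<in> {0..1} \<Longrightarrow> rp P < r \<Longrightarrow> slice_meas w r \<theta> \<Longrightarrow> slice_meas u r \<theta> \<Longrightarrow>
    (\<integral>\<^sup>+x. (\<integral>\<^sup>+y. ennreal (norm (kern w u r \<theta> x y)) \<partial>ZR)\<^sup>2 \<partial>ZR) \<le> ennreal C * ((W_norm P q w (r, \<theta>))\<^sup>2 * usq q u r \<theta>)"
    using kern_estimate by auto
  have "sq_int (\<lambda>x. slice (K0 w u) r \<theta> x - slice (K0 e f) r \<theta> x)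
      \<le> ennreal (2 * C) * ((W_norm P q (pair_minus w e) (r, \<theta>))\<^sup>2 * usq q f r \<theta> + (W_norm P q w (r, \<theta>))\<^sup>2 * usq q (pair_minus u f) r \<theta>)"
    if q: "q \<in> {0..1}" and r: "rp P < r" and w: "slice_meas w r \<theta>" and u: "slice_meas u r \<theta>"
      and e: "slice_meas e r \<theta>" and f: "slice_meas f r \<theta>"
      and fin: "W_norm P q w (r, \<theta>) < \<infinity>" "usq q u r \<theta> < \<infinity>" "W_norm P q e (r, \<theta>) < \<infinity>" "usq q f r \<theta> < \<infinity>"
    for q r w u e f \<theta>
  proof -
    note we = slice_meas_pair_minus[OF w e] and uf = slice_meas_pair_minus[OF u f]
    have "sq_int (\<lambda>x. slice (K0 w u) r \<theta> x - slice (K0 e f) r \<theta> x)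
      \<le> 2 * (\<integral>\<^sup>+x. (\<integral>\<^sup>+y. ennreal (norm (kern (pair_minus w e) f r \<theta> x y)) \<partial>ZR)\<^sup>2 \<partial>ZR)
       + 2 * (\<integral>\<^sup>+x. (\<integral>\<^sup>+y. ennreal (norm (kern w (pair_minus u f) r \<theta> x y)) \<partial>ZR)\<^sup>2 \<partial>ZR)"
      unfolding sq_int_def slice_K0
      by (rule kernel_diff_ZR[OF kern_measurable[OF we f] kern_measurable[OF w uf]
            kern_AE_integrable[OF q r w u fin(1,2)] kern_AE_integrable[OF q r e f fin(3,4)] kern_split])
    also have "\<dots> \<le> 2 * (ennreal C * ((W_norm P q (pair_minus w e) (r, \<theta>))\<^sup>2 * usq q f r \<theta>))
       + 2 * (ennreal C * ((W_norm P q w (r, \<theta>))\<^sup>2 * usq q (pair_minus u f) r \<theta>))"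
      by (intro add_mono mult_left_mono C(2)[OF q r we f] C(2)[OF q r w uf]) auto
    also have "\<dots> = ennreal (2 * C) * ((W_norm P q (pair_minus w e) (r, \<theta>))\<^sup>2 * usq q f r \<theta> + (W_norm P q w (r, \<theta>))\<^sup>2 * usq q (pair_minus u f) r \<theta>)"
      using C(1) by (simp add: ennreal_mult distrib_left mult.assoc)
    finally show ?thesis .
  qed
  moreover have "0 < 2 * C" using C(1) by simp
  ultimately show ?thesis by blast
qed

lemma wdens_triangle: "wdens q w r \<theta> y \<le> wdens q (pair_minus w e) r \<theta> y + wdens q e r \<theta> y"
proof -
  have *: "norm (c * x) \<le> norm (c * (x - z)) + norm (c * z)" for c x z :: complex
    using norm_triangle_ineq[of "c * (x - z)" "c * z"] by (simp add: algebra_simps)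
  have "slice (fst (pair_minus w e)) r \<theta> y = slice (fst w) r \<theta> y - slice (fst e) r \<theta> y"
    "slice (snd (pair_minus w e)) r \<theta> y = slice (snd w) r \<theta> y - slice (snd e) r \<theta> y"
    by (auto simp: slice_def pair_minus_def)
  then show ?thesis
    unfolding wdens_def
    using *[of "of_real (snd y)" "slice (fst w) r \<theta> y" "slice (fst e) r \<theta> y"]
      *[of "of_int (fst y)" "slice (fst w) r \<theta> y" "slice (fst e) r \<theta> y"]
      *[of "of_real (vel P r powr (- q))" "slice (snd w) r \<theta> y" "slice (snd e) r \<theta> y"] by simp
qed

lemma udens_triangle: "udens q w r \<theta> y \<le> udens q (pair_minus w e) r \<theta> y + udens q e r \<theta> y"
  and udens_triangle': "udens q e r \<theta> y \<le> udens q (pair_minus w e) r \<theta> y + udens q w r \<theta> y"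
proof -
  have *: "norm (c * x) \<le> norm (c * (x - z)) + norm (c * z)" "norm (c * z) \<le> norm (c * (x - z)) + norm (c * x)" for c x z :: complex
    using norm_triangle_ineq[of "c * (x - z)" "c * z"] norm_triangle_ineq4[of "c * x" "c * (x - z)"] by (simp_all add: algebra_simps)
  define c1 c2 where "c1 = complex_of_real (vel P r powr q)"
    and "c2 = complex_of_real (sqrt (chi_hi P r)) / of_real (max (max \<bar>of_int (fst y)\<bar> \<bar>snd y\<bar>) 1)"
  have u: "udens q w r \<theta> y = norm (c1 * slice (fst w) r \<theta> y) + norm (c2 * slice (snd w) r \<theta> y)" for w
    by (simp add: udens_def c1_def c2_def)
  have s: "slice (fst (pair_minus w e)) r \<theta> y = slice (fst w) r \<theta> y - slice (fst e) r \<theta> y"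
    "slice (snd (pair_minus w e)) r \<theta> y = slice (snd w) r \<theta> y - slice (snd e) r \<theta> y"
    by (auto simp: slice_def pair_minus_def)
  show "udens q w r \<theta> y \<le> udens q (pair_minus w e) r \<theta> y + udens q e r \<theta> y" unfolding u s
    using *(1)[of c1 "slice (fst w) r \<theta> y" "slice (fst e) r \<theta> y"] *(1)[of c2 "slice (snd w) r \<theta> y" "slice (snd e) r \<theta> y"] by linarith
  show "udens q e r \<theta> y \<le> udens q (pair_minus w e) r \<theta> y + udens q w r \<theta> y" unfolding u s
    using *(2)[of c1 "slice (fst e) r \<theta> y" "slice (fst w) r \<theta> y"] *(2)[of c2 "slice (snd e) r \<theta> y" "slice (snd w) r \<theta> y"] by linarith
qed

lemma W_norm_triangle:
  assumes w: "slice_meas w r \<theta>" and e: "slice_meas e r \<theta>"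
  shows "W_norm P q w (r, \<theta>) \<le> W_norm P q (pair_minus w e) (r, \<theta>) + W_norm P q e (r, \<theta>)"
proof -
  note m [measurable] = wdens_measurable[OF e, of q] wdens_measurable[OF slice_meas_pair_minus[OF w e], of q]
  have "(\<integral>\<^sup>+x. ennreal (wdens q w r \<theta> x) \<partial>ZR) \<le> (\<integral>\<^sup>+x. ennreal (wdens q (pair_minus w e) r \<theta> x) + ennreal (wdens q e r \<theta> x) \<partial>ZR)"
    by (intro nn_integral_mono) (simp add: wdens_triangle ennreal_leI wdens_nonneg flip: ennreal_plus)
  also have "\<dots> = (\<integral>\<^sup>+x. ennreal (wdens q (pair_minus w e) r \<theta> x) \<partial>ZR) + (\<integral>\<^sup>+x. ennreal (wdens q e r \<theta> x) \<partial>ZR)"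
    by (rule nn_integral_add) measurable
  finally show ?thesis unfolding W_norm_eq[OF w] W_norm_eq[OF e] W_norm_eq[OF slice_meas_pair_minus[OF w e]] .
qed

lemma usq_triangle:
  assumes u: "slice_meas u r \<theta>" and f: "slice_meas f r \<theta>"
  shows "usq q u r \<theta> \<le> 2 * usq q (pair_minus u f) r \<theta> + 2 * usq q f r \<theta>"
    and "usq q f r \<theta> \<le> 2 * usq q (pair_minus u f) r \<theta> + 2 * usq q u r \<theta>"
proof -
  note m [measurable] = udens_measurable[OF u, of q] udens_measurable[OF f, of q] udens_measurable[OF slice_meas_pair_minus[OF u f], of q]
  have U: "usq q u r \<theta> = sq_int (\<lambda>x. of_real (udens q u r \<theta> x))" for u
    unfolding usq_def sq_int_def by simp
  have n: "norm (complex_of_real (udens q u r \<theta> x)) = udens q u r \<theta> x" for u x by (simp add: udens_nonneg)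
  show "usq q u r \<theta> \<le> 2 * usq q (pair_minus u f) r \<theta> + 2 * usq q f r \<theta>"
    unfolding U by (rule sq_int_add_le; (unfold n, rule udens_triangle)?; measurable)
  show "usq q f r \<theta> \<le> 2 * usq q (pair_minus u f) r \<theta> + 2 * usq q u r \<theta>"
    unfolding U by (rule sq_int_add_le; (unfold n, rule udens_triangle')?; measurable)
qed

section \<open>Norms, kernel and commutator of test functions\<close>

definition ft_pair :: "(real \<times> (real ^ 3) \<Rightarrow> complex) \<Rightarrow> fld \<times> fld" where
  "ft_pair F = (ft F, W0_op P (ft F))"

lemma pair_diff_eq: "pair_diff P u F = pair_minus u (ft_pair F)"
  by (simp add: pair_diff_def pair_minus_def ft_pair_def)

text \<open>Multiplication by \<open>\<omega>\<close> and \<open>m\<close> is traded for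
  \<open>d_t\<close> and \<open>d_phi\<close>. The coefficients left depend on \<open>r\<close>
  alone, so decay and measurability carry over from transforms of test functions.\<close>

lemma W0_op_ft:
  assumes F: "F \<in> test_funs P" and r: "rp P < r"
  shows "W0_op P (ft F) \<omega> m r \<theta> = of_real (1 / vel P r * (Delta P r / T r * (1 / r))) * ft (d_r F) \<omega> m r \<theta>
    + of_real (h0 P r / vel P r) * ft (d_t F) \<omega> m r \<theta> + of_real (h0 P r / vel P r * (a / T r)) * ft (d_phi F) \<omega> m r \<theta>"
proof -
  have r0: "0 < r" using r rp_pos by simp
  have vd: "vector_derivative (\<lambda>s. ft F \<omega> m s \<theta>) (at r) = (1 / r) *\<^sub>R ft (d_r F) \<omega> m r \<theta>"
    by (rule vector_derivative_at[OF ft_has_vector_derivative[OF F r0]])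
  define D where "D = Delta P r / T r"
  define V where "V = vel P r"
  define B where "B = a / T r"
  have om: "om_r P m r = B * of_int m" by (simp add: om_r_def B_def)
  show ?thesis
    unfolding W0_op_def Rstar_def vd ft_d_t[OF F] ft_d_phi[OF F] om
    unfolding D_def[symmetric] V_def[symmetric] B_def[symmetric]
    by (simp add: scaleR_conv_of_real algebra_simps diff_divide_distrib add_divide_distrib)
qed

lemma ft_pair_decay:
  assumes F: "F \<in> test_funs P" and r: "rp P < r"
  obtains C where "0 \<le> C" "\<And>x \<theta>. norm (slice (fst (ft_pair F)) r \<theta> x) \<le> C * decay x"
    "\<And>x \<theta>. norm (of_real (snd x) * slice (fst (ft_pair F)) r \<theta> x) \<le> C * decay x"
    "\<And>x \<theta>. norm (of_int (fst x) * slice (fst (ft_pair F)) r \<theta> x) \<le> C * decay x"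
    "\<And>x \<theta>. norm (slice (snd (ft_pair F)) r \<theta> x) \<le> C * decay x"
proof -
  obtain C0 where C0: "0 \<le> C0" "\<And>\<omega> m r \<theta>. norm (ft F \<omega> m r \<theta>) \<le> C0 * decay (m, \<omega>)" by (rule ft_decay[OF F]) blast
  obtain C1 where C1: "0 \<le> C1" "\<And>\<omega> m r \<theta>. norm (ft (d_t F) \<omega> m r \<theta>) \<le> C1 * decay (m, \<omega>)" by (rule ft_decay[OF d_t_test_funs[OF F]]) blast
  obtain C2 where C2: "0 \<le> C2" "\<And>\<omega> m r \<theta>. norm (ft (d_phi F) \<omega> m r \<theta>) \<le> C2 * decay (m, \<omega>)" by (rule ft_decay[OF d_phi_test_funs[OF F]]) blast
  obtain C3 where C3: "0 \<le> C3" "\<And>\<omega> m r \<theta>. norm (ft (d_r F) \<omega> m r \<theta>) \<le> C3 * decay (m, \<omega>)" by (rule ft_decay[OF d_r_test_funs[OF F]]) blast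
  define b1 b2 b3 where "b1 = 1 / vel P r * (Delta P r / T r * (1 / r))" and "b2 = h0 P r / vel P r" and "b3 = h0 P r / vel P r * (a / T r)"
  define C where "C = C0 + C1 + C2 + (\<bar>b1\<bar> * C3 + \<bar>b2\<bar> * C1 + \<bar>b3\<bar> * C2)"
  have nn: "0 \<le> \<bar>b1\<bar> * C3" "0 \<le> \<bar>b2\<bar> * C1" "0 \<le> \<bar>b3\<bar> * C2" using C1 C2 C3 by auto
  have le: "B * decay x \<le> C * decay x" if "B \<le> C" for B x
    using that decay_bounds(1)[of x] by (intro mult_right_mono) auto
  show ?thesis
  proof (rule that[of C])
    show "0 \<le> C" using nn C0(1) C1(1) C2(1) by (simp add: C_def)
    fix x \<theta>
    show "norm (slice (fst (ft_pair F)) r \<theta> x) \<le> C * decay x"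
      using C0(2)[of "snd x" "fst x" r \<theta>] le[of C0 x] nn C0(1) C1(1) C2(1) by (simp add: slice_def ft_pair_def C_def)
    have "norm (of_real (snd x) * slice (fst (ft_pair F)) r \<theta> x) = norm (ft (d_t F) (snd x) (fst x) r \<theta>)"
      unfolding ft_d_t[OF F] by (simp add: slice_def ft_pair_def norm_mult)
    then show "norm (of_real (snd x) * slice (fst (ft_pair F)) r \<theta> x) \<le> C * decay x"
      using C1(2)[of "snd x" "fst x" r \<theta>] le[of C1 x] nn C0(1) C1(1) C2(1) by (simp add: C_def)
    have "norm (of_int (fst x) * slice (fst (ft_pair F)) r \<theta> x) = norm (ft (d_phi F) (snd x) (fst x) r \<theta>)"
      unfolding ft_d_phi[OF F] by (simp add: slice_def ft_pair_def norm_mult)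
    then show "norm (of_int (fst x) * slice (fst (ft_pair F)) r \<theta> x) \<le> C * decay x"
      using C2(2)[of "snd x" "fst x" r \<theta>] le[of C2 x] nn C0(1) C1(1) C2(1) by (simp add: C_def)
    have "norm (slice (snd (ft_pair F)) r \<theta> x) \<le> \<bar>b1\<bar> * norm (ft (d_r F) (snd x) (fst x) r \<theta>)
        + \<bar>b2\<bar> * norm (ft (d_t F) (snd x) (fst x) r \<theta>) + \<bar>b3\<bar> * norm (ft (d_phi F) (snd x) (fst x) r \<theta>)"
      unfolding slice_def ft_pair_def snd_conv W0_op_ft[OF F r] b1_def b2_def b3_def
      by (rule order_trans[OF norm_triangle_ineq], rule add_mono, rule order_trans[OF norm_triangle_ineq], rule add_mono)
        (simp_all only: norm_mult norm_of_real order_refl)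
    also have "\<dots> \<le> \<bar>b1\<bar> * (C3 * decay x) + \<bar>b2\<bar> * (C1 * decay x) + \<bar>b3\<bar> * (C2 * decay x)"
      using C1(2)[of "snd x" "fst x" r \<theta>] C2(2)[of "snd x" "fst x" r \<theta>] C3(2)[of "snd x" "fst x" r \<theta>]
      by (intro add_mono mult_left_mono) auto
    also have "\<dots> = (\<bar>b1\<bar> * C3 + \<bar>b2\<bar> * C1 + \<bar>b3\<bar> * C2) * decay x" by (simp add: algebra_simps)
    also have "\<dots> \<le> C * decay x" using C0(1) C1(1) C2(1) by (intro le) (simp add: C_def)
    finally show "norm (slice (snd (ft_pair F)) r \<theta> x) \<le> C * decay x" .
  qed
qed

lemma ft_pair_slice_meas:
  assumes F: "F \<in> test_funs P" and r: "rp P < r"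
  shows "slice_meas (ft_pair F) r \<theta>"
proof -
  have [measurable]: "(\<lambda>x. ft G (snd x) (fst x) r \<theta>) \<in> borel_measurable ZR" if "G \<in> test_funs P" for G
    by (rule ft_measurable[OF that])
  note [measurable] = F d_t_test_funs[OF F] d_phi_test_funs[OF F] d_r_test_funs[OF F]
  show ?thesis
    unfolding slice_meas_def slice_def[abs_def] ft_pair_def fst_conv snd_conv W0_op_ft[OF F r]
    using ft_measurable[OF F] ft_measurable[OF d_t_test_funs[OF F]] ft_measurable[OF d_phi_test_funs[OF F]]
      ft_measurable[OF d_r_test_funs[OF F]]
    by (intro conjI borel_measurable_add borel_measurable_times borel_measurable_const)
qed

lemma wdens_udens_ft_pair_decay:
  assumes F: "F \<in> test_funs P" and r: "rp P < r"
  obtains C where "0 \<le> C" "\<And>x \<theta>. wdens q (ft_pair F) r \<theta> x \<le> C * decay x" "\<And>x \<theta>. udens q (ft_pair F) r \<theta> x \<le> C * decay x"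
proof -
  obtain C where C: "0 \<le> C" "\<And>x \<theta>. norm (slice (fst (ft_pair F)) r \<theta> x) \<le> C * decay x"
    "\<And>x \<theta>. norm (of_real (snd x) * slice (fst (ft_pair F)) r \<theta> x) \<le> C * decay x"
    "\<And>x \<theta>. norm (of_int (fst x) * slice (fst (ft_pair F)) r \<theta> x) \<le> C * decay x"
    "\<And>x \<theta>. norm (slice (snd (ft_pair F)) r \<theta> x) \<le> C * decay x"
    by (rule ft_pair_decay[OF F r]) blast
  define A1 A2 A3 where "A1 = vel P r powr (- q)" and "A2 = vel P r powr q" and "A3 = sqrt (chi_hi P r)"
  have A: "0 \<le> A1" "0 \<le> A2" "0 \<le> A3" using cutoff_bounds by (auto simp: A1_def A2_def A3_def)
  define B where "B = 2 * C + A1 * C + A2 * C + A3 * C"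
  have d: "0 < decay x" for x by (rule decay_bounds)
  have nn: "0 \<le> A1 * C" "0 \<le> A2 * C" "0 \<le> A3 * C" using A C(1) by auto
  show ?thesis
  proof (rule that[of B])
    show "0 \<le> B" using nn C(1) by (simp add: B_def)
    fix x \<theta>
    have Bx: "B * decay x = 2 * (C * decay x) + A1 * (C * decay x) + A2 * (C * decay x) + A3 * (C * decay x)"
      by (simp add: B_def algebra_simps)
    have nnx: "0 \<le> C * decay x" "0 \<le> A1 * (C * decay x)" "0 \<le> A2 * (C * decay x)" "0 \<le> A3 * (C * decay x)"
      using A C(1) d[of x] by auto
    have 1: "norm (of_real A1 * slice (snd (ft_pair F)) r \<theta> x) \<le> A1 * (C * decay x)"
      using A(1) C(5)[where x = x and \<theta> = \<theta>] by (simp add: norm_mult mult_left_mono)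
    have 2: "norm (of_real A2 * slice (fst (ft_pair F)) r \<theta> x) \<le> A2 * (C * decay x)"
      using A(2) C(2)[where x = x and \<theta> = \<theta>] by (simp add: norm_mult mult_left_mono)
    have 3: "norm (of_real A3 * (slice (snd (ft_pair F)) r \<theta> x / of_real (max (max \<bar>of_int (fst x)\<bar> \<bar>snd x\<bar>) 1))) \<le> A3 * (C * decay x)"
    proof -
      have "norm (slice (snd (ft_pair F)) r \<theta> x / of_real (max (max \<bar>of_int (fst x)\<bar> \<bar>snd x\<bar>) 1)) \<le> norm (slice (snd (ft_pair F)) r \<theta> x) / 1"
        unfolding norm_divide by (intro divide_left_mono) auto
      also have "\<dots> \<le> C * decay x" using C(5) by simp
      finally show ?thesis unfolding norm_mult using A(3) by (simp add: mult_left_mono)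
    qed
    show "wdens q (ft_pair F) r \<theta> x \<le> B * decay x"
      unfolding wdens_def Bx A1_def[symmetric] using C(3)[where x = x and \<theta> = \<theta>] C(4)[where x = x and \<theta> = \<theta>] 1 nnx by linarith
    show "udens q (ft_pair F) r \<theta> x \<le> B * decay x"
      unfolding udens_def Bx A2_def[symmetric] A3_def[symmetric] using 2 3 nnx by linarith
  qed
qed

lemma ft_pair_finite:
  assumes F: "F \<in> test_funs P" and r: "rp P < r"
  shows "W_norm P q (ft_pair F) (r, \<theta>) < \<infinity>" "usq q (ft_pair F) r \<theta> < \<infinity>"
proof -
  obtain C where C: "\<And>x \<theta>. wdens q (ft_pair F) r \<theta> x \<le> C * decay x" "\<And>x \<theta>. udens q (ft_pair F) r \<theta> x \<le> C * decay x"
    by (rule wdens_udens_ft_pair_decay[OF F r]) blast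
  have "norm (complex_of_real (wdens q (ft_pair F) r \<theta> x)) \<le> C * decay x" for x
    using C(1) by (simp add: wdens_nonneg)
  from decay_bound_fin(1)[OF this] show "W_norm P q (ft_pair F) (r, \<theta>) < \<infinity>"
    unfolding W_norm_eq[OF ft_pair_slice_meas[OF F r]] by (simp add: wdens_nonneg)
  have "norm (complex_of_real (udens q (ft_pair F) r \<theta> x)) \<le> C * decay x" for x
    using C(2) by (simp add: udens_nonneg)
  from decay_bound_fin(2)[OF this] show "usq q (ft_pair F) r \<theta> < \<infinity>"
    unfolding usq_def by simp
qed

end

lemma integrable_conv:
  assumes [measurable]: "g1 \<in> borel_measurable ZR" "g2 \<in> borel_measurable ZR"
    and g1: "\<And>x. norm (g1 x :: complex) \<le> C * decay x" and g2: "\<And>x. norm (g2 x :: complex) \<le> D * decay x"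
    and D: "0 \<le> D"
  shows "integrable ZR (\<lambda>y. g1 y * g2 (x - y))"
proof (rule Bochner_Integration.integrable_bound)
  show "integrable ZR (\<lambda>y. D * (C * decay y))" by (intro integrable_mult_right integrable_decay)
  show "AE y in ZR. norm (g1 y * g2 (x - y)) \<le> norm (D * (C * decay y))"
  proof (rule AE_I2)
    fix y
    have "norm (g2 (x - y)) \<le> D * 1"
      using g2[of "x - y"] mult_left_mono[OF decay_bounds(2)[of "x - y"] D] by linarith
    then have "norm (g2 (x - y)) * norm (g1 y) \<le> D * (C * decay y)"
      using g1[of y] D by (intro mult_mono) auto
    then show "norm (g1 y * g2 (x - y)) \<le> norm (D * (C * decay y))"
      unfolding norm_mult real_norm_def by (metis abs_ge_self mult.commute order_trans)
  qed
qed measurable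

lemma conv_eq:
  assumes "integrable ZR (\<lambda>y. slice f r \<theta> y * slice g r \<theta> ((m, \<omega>) - y))"
  shows "conv f g \<omega> m r \<theta> = (\<integral>y. slice f r \<theta> y * slice g r \<theta> ((m, \<omega>) - y) \<partial>ZR)"
  unfolding ZR.integral_fst'[OF assms, symmetric] conv_def by (simp add: slice_def)

lemma slice_ft_measurable: "F \<in> test_funs P \<Longrightarrow> slice (ft F) r \<theta> \<in> borel_measurable ZR"
  unfolding slice_def[abs_def] by (rule ft_measurable)

lemma slice_ft_decay:
  assumes "F \<in> test_funs P"
  obtains C where "0 \<le> C" "\<And>r \<theta> x. norm (slice (ft F) r \<theta> x) \<le> C * decay x"
proof -
  obtain C where C: "0 \<le> C" "\<And>\<omega> m r \<theta>. norm (ft F \<omega> m r \<theta>) \<le> C * decay (m, \<omega>)" by (rule ft_decay[OF assms]) blast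
  show ?thesis
  proof (rule that[OF C(1)])
    show "norm (slice (ft F) r \<theta> x) \<le> C * decay x" for r \<theta> x
      using C(2)[of "snd x" "fst x" r \<theta>] by (simp add: slice_def)
  qed
qed

lemma integrable_conv_ft:
  assumes "E \<in> test_funs P" "F \<in> test_funs P"
  shows "integrable ZR (\<lambda>y. slice (ft E) r \<theta> y * slice (ft F) r \<theta> (x - y))"
proof -
  obtain C where C: "0 \<le> C" "\<And>r \<theta> x. norm (slice (ft E) r \<theta> x) \<le> C * decay x" by (rule slice_ft_decay[OF assms(1)]) blast
  obtain D where D: "0 \<le> D" "\<And>r \<theta> x. norm (slice (ft F) r \<theta> x) \<le> D * decay x" by (rule slice_ft_decay[OF assms(2)]) blast
  show ?thesis
    by (rule integrable_conv[OF slice_ft_measurable[OF assms(1)] slice_ft_measurable[OF assms(2)] C(2) D(2) D(1)])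
qed

lemma conv_ft_eq:
  assumes "E \<in> test_funs P" "F \<in> test_funs P"
  shows "conv (ft E) (ft F) \<omega> m r \<theta> = (\<integral>y. slice (ft E) r \<theta> y * slice (ft F) r \<theta> ((m, \<omega>) - y) \<partial>ZR)"
  by (rule conv_eq[OF integrable_conv_ft[OF assms]])

text \<open>Differentiation under the integral by the product rule; one factor is bounded by its
  constant and the other supplies the integrable \<open>decay\<close>.\<close>

lemma conv_ft_has_vector_derivative:
  assumes E: "E \<in> test_funs P" and F: "F \<in> test_funs P" and r: "0 < r"
  shows "((\<lambda>s. conv (ft E) (ft F) \<omega> m s \<theta>) has_vector_derivative
    (1 / r) *\<^sub>R ((\<integral>y. slice (ft (d_r E)) r \<theta> y * slice (ft F) r \<theta> ((m, \<omega>) - y) \<partial>ZR)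
      + (\<integral>y. slice (ft E) r \<theta> y * slice (ft (d_r F)) r \<theta> ((m, \<omega>) - y) \<partial>ZR))) (at r)"
proof -
  note E' = d_r_test_funs[OF E] and F' = d_r_test_funs[OF F]
  obtain CE where CE: "0 \<le> CE" "\<And>r \<theta> x. norm (slice (ft E) r \<theta> x) \<le> CE * decay x" by (rule slice_ft_decay[OF E]) blast
  obtain CF where CF: "0 \<le> CF" "\<And>r \<theta> x. norm (slice (ft F) r \<theta> x) \<le> CF * decay x" by (rule slice_ft_decay[OF F]) blast
  obtain DE where DE: "0 \<le> DE" "\<And>r \<theta> x. norm (slice (ft (d_r E)) r \<theta> x) \<le> DE * decay x" by (rule slice_ft_decay[OF E']) blast
  obtain DF where DF: "0 \<le> DF" "\<And>r \<theta> x. norm (slice (ft (d_r F)) r \<theta> x) \<le> DF * decay x" by (rule slice_ft_decay[OF F']) blast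
  define x where "x = (m, \<omega>)"
  have s: "0 < s" "1 / s \<le> 2 / r" if "s \<in> ball r (r / 2)" for s
  proof -
    have "r / 2 < s" using that by (auto simp: dist_real_def abs_if split: if_splits)
    then show "0 < s" "1 / s \<le> 2 / r" using r by (auto simp: field_simps)
  qed
  define g where "g s y = (1 / s) *\<^sub>R (slice (ft (d_r E)) s \<theta> y * slice (ft F) s \<theta> (x - y) + slice (ft E) s \<theta> y * slice (ft (d_r F)) s \<theta> (x - y))" for s y
  have "((\<lambda>s. \<integral>y. slice (ft E) s \<theta> y * slice (ft F) s \<theta> (x - y) \<partial>ZR) has_vector_derivative (\<integral>y. g r y \<partial>ZR)) (at r)"
  proof (rule has_vector_derivative_integral[where e = "r / 2" and f' = g])
    show "((\<lambda>s. slice (ft E) s \<theta> y * slice (ft F) s \<theta> (x - y)) has_vector_derivative g s y) (at s)"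
      if "s \<in> ball r (r / 2)" for s y
    proof -
      have "((\<lambda>s. slice (ft E) s \<theta> y) has_vector_derivative (1 / s) *\<^sub>R slice (ft (d_r E)) s \<theta> y) (at s)"
        unfolding slice_def by (rule ft_has_vector_derivative[OF E s(1)[OF that]])
      moreover have "((\<lambda>s. slice (ft F) s \<theta> (x - y)) has_vector_derivative (1 / s) *\<^sub>R slice (ft (d_r F)) s \<theta> (x - y)) (at s)"
        unfolding slice_def by (rule ft_has_vector_derivative[OF F s(1)[OF that]])
      ultimately have "((\<lambda>s. slice (ft E) s \<theta> y * slice (ft F) s \<theta> (x - y)) has_vector_derivative
          slice (ft E) s \<theta> y * ((1 / s) *\<^sub>R slice (ft (d_r F)) s \<theta> (x - y)) + (1 / s) *\<^sub>R slice (ft (d_r E)) s \<theta> y * slice (ft F) s \<theta> (x - y)) (at s)"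
        by (rule has_vector_derivative_mult)
      then show ?thesis by (rule has_vector_derivative_eq_rhs) (simp add: g_def scaleR_conv_of_real algebra_simps)
    qed
    show "norm (g s y) \<le> 2 / r * ((DE * CF + CE * DF) * decay y)" if "s \<in> ball r (r / 2)" for s y
    proof -
      have one: "norm (slice (ft F) s \<theta> (x - y)) \<le> CF" "norm (slice (ft (d_r F)) s \<theta> (x - y)) \<le> DF"
        using CF(2)[of s \<theta> "x - y"] DF(2)[of s \<theta> "x - y"] mult_left_mono[OF decay_bounds(2)[of "x - y"] CF(1)]
          mult_left_mono[OF decay_bounds(2)[of "x - y"] DF(1)] by auto
      have "norm (slice (ft (d_r E)) s \<theta> y * slice (ft F) s \<theta> (x - y) + slice (ft E) s \<theta> y * slice (ft (d_r F)) s \<theta> (x - y))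
          \<le> (DE * decay y) * CF + (CE * decay y) * DF"
        using one CE(1) CE(2)[of s \<theta> y] CF(1) DE(1) DE(2)[of s \<theta> y] DF(1) decay_bounds(1)[of y]
        by (intro order_trans[OF norm_triangle_ineq] add_mono) (auto simp: norm_mult intro!: mult_mono)
      also have "\<dots> = (DE * CF + CE * DF) * decay y" by (simp add: algebra_simps)
      finally have "norm (slice (ft (d_r E)) s \<theta> y * slice (ft F) s \<theta> (x - y) + slice (ft E) s \<theta> y * slice (ft (d_r F)) s \<theta> (x - y)) \<le> (DE * CF + CE * DF) * decay y" .
      moreover have "\<bar>1 / s\<bar> \<le> 2 / r" using s[OF that] by simp
      ultimately show ?thesis unfolding g_def norm_scaleR using r by (intro mult_mono) auto
    qed
    show "integrable ZR (\<lambda>y. 2 / r * ((DE * CF + CE * DF) * decay y))" by (intro integrable_mult_right integrable_decay)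
    show "g r \<in> borel_measurable ZR"
      using slice_ft_measurable[OF E, measurable] slice_ft_measurable[OF F, measurable]
        slice_ft_measurable[OF E', measurable] slice_ft_measurable[OF F', measurable]
      unfolding g_def[abs_def] by measurable
    show "integrable ZR (\<lambda>y. slice (ft E) s \<theta> y * slice (ft F) s \<theta> (x - y))" for s
      by (rule integrable_conv_ft[OF E F])
  qed (use r in simp)
  also have "(\<integral>y. g r y \<partial>ZR) = (1 / r) *\<^sub>R ((\<integral>y. slice (ft (d_r E)) r \<theta> y * slice (ft F) r \<theta> (x - y) \<partial>ZR)
      + (\<integral>y. slice (ft E) r \<theta> y * slice (ft (d_r F)) r \<theta> (x - y) \<partial>ZR))"
    unfolding g_def using integrable_conv_ft[OF E' F] integrable_conv_ft[OF E F'] by simp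
  finally show ?thesis unfolding conv_ft_eq[OF E F] x_def .
qed

context kerr
begin

text \<open>\<open>W0_op\<close> acts on convolutions as a derivation, because \<open>\<omega> - \<omega>\<^sub>r\<close> is linear in \<open>(\<omega>, m)\<close>.\<close>

lemma W0_op_conv:
  assumes E: "E \<in> test_funs P" and F: "F \<in> test_funs P" and r: "rp P < r"
  shows "W0_op P (conv (ft E) (ft F)) \<omega> m r \<theta> = (\<integral>y. slice (snd (ft_pair E)) r \<theta> y * slice (fst (ft_pair F)) r \<theta> ((m, \<omega>) - y)
     + slice (fst (ft_pair E)) r \<theta> y * slice (snd (ft_pair F)) r \<theta> ((m, \<omega>) - y) \<partial>ZR)" (is "?W = ?I")
    and "integrable ZR (\<lambda>y. slice (snd (ft_pair E)) r \<theta> y * slice (fst (ft_pair F)) r \<theta> ((m, \<omega>) - y)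
     + slice (fst (ft_pair E)) r \<theta> y * slice (snd (ft_pair F)) r \<theta> ((m, \<omega>) - y))" (is ?int)
proof -
  have r0: "0 < r" using r rp_pos by simp
  note E' = d_r_test_funs[OF E] and F' = d_r_test_funs[OF F]
  define x where "x = (m, \<omega>)"
  define c where "c = complex_of_real (1 / vel P r)"
  define d where "d = complex_of_real (Delta P r / T r) * of_real (1 / r)"
  define h where "h = complex_of_real (h0 P r)"
  define L where "L y = complex_of_real (snd y - om_r P (fst y) r)" for y :: "int \<times> real"
  define e e1 f f1 where "e = slice (ft E) r \<theta>" and "e1 = slice (ft (d_r E)) r \<theta>"
    and "f = slice (ft F) r \<theta>" and "f1 = slice (ft (d_r F)) r \<theta>"
  have vd: "vector_derivative (\<lambda>s. ft G \<omega> m s \<theta>) (at r) = (1 / r) *\<^sub>R ft (d_r G) \<omega> m r \<theta>"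
    if "G \<in> test_funs P" for G \<omega> m
    by (rule vector_derivative_at[OF ft_has_vector_derivative[OF that r0]])
  have snd_ft_pair: "slice (snd (ft_pair G)) r \<theta> y = c * (d * slice (ft (d_r G)) r \<theta> y - \<i> * (h * L y) * slice (ft G) r \<theta> y)"
    if "G \<in> test_funs P" for G y
    unfolding slice_def ft_pair_def snd_conv W0_op_def Rstar_def vd[OF that]
    by (simp add: c_def d_def h_def L_def scaleR_conv_of_real mult.assoc)
  have fst_ft_pair: "slice (fst (ft_pair G)) r \<theta> = slice (ft G) r \<theta>" for G by (simp add: slice_def ft_pair_def fun_eq_iff)
  have Lx: "L y + L (x - y) = L x" for y
    by (simp add: L_def om_r_def diff_divide_distrib algebra_simps)
  have eq: "slice (snd (ft_pair E)) r \<theta> y * slice (fst (ft_pair F)) r \<theta> (x - y) + slice (fst (ft_pair E)) r \<theta> y * slice (snd (ft_pair F)) r \<theta> (x - y)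
      = c * (d * (e1 y * f (x - y) + e y * f1 (x - y)) - \<i> * (h * L x) * (e y * f (x - y)))" for y
    unfolding snd_ft_pair[OF E] snd_ft_pair[OF F] fst_ft_pair Lx[of y, symmetric] e_def e1_def f_def f1_def
    by (simp add: algebra_simps)
  have i: "integrable ZR (\<lambda>y. e1 y * f (x - y))" "integrable ZR (\<lambda>y. e y * f1 (x - y))" "integrable ZR (\<lambda>y. e y * f (x - y))"
    unfolding e_def e1_def f_def f1_def
    by (rule integrable_conv_ft[OF E' F] integrable_conv_ft[OF E F'] integrable_conv_ft[OF E F])+
  show ?int unfolding x_def[symmetric] eq using i by simp
  have "vector_derivative (\<lambda>s. conv (ft E) (ft F) \<omega> m s \<theta>) (at r) =
      (1 / r) *\<^sub>R ((\<integral>y. e1 y * f (x - y) \<partial>ZR) + (\<integral>y. e y * f1 (x - y) \<partial>ZR))"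
    unfolding e_def e1_def f_def f1_def x_def
    by (rule vector_derivative_at[OF conv_ft_has_vector_derivative[OF E F r0]])
  then have "?W = c * (d * ((\<integral>y. e1 y * f (x - y) \<partial>ZR) + (\<integral>y. e y * f1 (x - y) \<partial>ZR)) - \<i> * (h * L x) * (\<integral>y. e y * f (x - y) \<partial>ZR))"
    unfolding W0_op_def Rstar_def conv_ft_eq[OF E F]
    by (simp add: c_def d_def h_def L_def x_def e_def f_def scaleR_conv_of_real mult.assoc)
  also have "\<dots> = (\<integral>y. c * (d * (e1 y * f (x - y) + e y * f1 (x - y)) - \<i> * (h * L x) * (e y * f (x - y))) \<partial>ZR)"
    using i by simp
  also have "\<dots> = ?I" unfolding x_def[symmetric] by (simp only: eq)
  finally show "?W = ?I" .
qed

text \<open>For test functions integrability holds at every frequency, not just almost everywhere,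
  so that the commutator can be identified pointwise. The bound is taken at the arbitrary value
  \<open>q = 0\<close>.\<close>

lemma kern_ft_pair_integrable:
  assumes E: "E \<in> test_funs P" and F: "F \<in> test_funs P" and r: "rp P < r"
  shows "integrable ZR (kern (ft_pair E) (ft_pair F) r \<theta> x)"
proof -
  obtain C where C: "0 \<le> C" "norm (kern w u r \<theta> x y) \<le> C * (wdens 0 w r \<theta> y * udens 0 u r \<theta> (x - y))" for w u y
    using kern_bound r by (metis atLeastAtMost_iff order_refl zero_le_one)
  obtain D where D: "0 \<le> D" "\<And>x \<theta>. wdens 0 (ft_pair E) r \<theta> x \<le> D * decay x" by (rule wdens_udens_ft_pair_decay[OF E r]) blast
  obtain D' where D': "0 \<le> D'" "\<And>x \<theta>. udens 0 (ft_pair F) r \<theta> x \<le> D' * decay x" by (rule wdens_udens_ft_pair_decay[OF F r]) blast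
  show ?thesis
  proof (rule Bochner_Integration.integrable_bound)
    show "integrable ZR (\<lambda>y. C * (D' * (D * decay y)))" by (intro integrable_mult_right integrable_decay)
    show "kern (ft_pair E) (ft_pair F) r \<theta> x \<in> borel_measurable ZR"
      using measurable_compose[OF measurable_Pair1' kern_measurable[OF ft_pair_slice_meas[OF E r] ft_pair_slice_meas[OF F r]], of x] by simp
    show "AE y in ZR. norm (kern (ft_pair E) (ft_pair F) r \<theta> x y) \<le> norm (C * (D' * (D * decay y)))"
    proof (rule AE_I2)
      fix y
      have "udens 0 (ft_pair F) r \<theta> (x - y) \<le> D'"
        using D'(2)[of \<theta> "x - y"] mult_left_mono[OF decay_bounds(2)[of "x - y"] D'(1)] by simp
      then have "wdens 0 (ft_pair E) r \<theta> y * udens 0 (ft_pair F) r \<theta> (x - y) \<le> (D * decay y) * D'"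
        using D D'(1) decay_bounds(1)[of y] wdens_nonneg udens_nonneg by (intro mult_mono) auto
      then have "C * (wdens 0 (ft_pair E) r \<theta> y * udens 0 (ft_pair F) r \<theta> (x - y)) \<le> C * ((D * decay y) * D')"
        using C(1) by (rule mult_left_mono)
      then have "norm (kern (ft_pair E) (ft_pair F) r \<theta> x y) \<le> C * (D' * (D * decay y))"
        using C(2)[of "ft_pair E" "ft_pair F" y] by (simp add: mult_ac)
      then show "norm (kern (ft_pair E) (ft_pair F) r \<theta> x y) \<le> norm (C * (D' * (D * decay y)))"
        unfolding real_norm_def by linarith
    qed
  qed
qed

lemma commutator_ft_pair:
  assumes E: "E \<in> test_funs P" and F: "F \<in> test_funs P" and r: "rp P < r"
  shows "commutator P (ft E) (ft F) \<omega> m r \<theta> = K0 (ft_pair E) (ft_pair F) \<omega> m r \<theta>"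
proof -
  define x where "x = (m, \<omega>)"
  define A D where "A y = complex_of_real (Aop (snd y) (fst y) r)" and "D y = complex_of_real (Dop (snd y) (fst y) r)" for y :: "int \<times> real"
  define e we f wf where "e = slice (fst (ft_pair E)) r \<theta>" and "we = slice (snd (ft_pair E)) r \<theta>"
    and "f = slice (fst (ft_pair F)) r \<theta>" and "wf = slice (snd (ft_pair F)) r \<theta>"
  have fst_ft_pair: "slice (ft G) r \<theta> = slice (fst (ft_pair G)) r \<theta>" for G by (simp add: slice_def ft_pair_def fun_eq_iff)
  have Wf: "slice (W_op P (ft F)) r \<theta> y = A y * wf y - \<i> * D y * f y" for y
    unfolding slice_def W_op_eq[OF r] by (simp add: A_def D_def f_def wf_def slice_def ft_pair_def)
  have kern: "kern (ft_pair E) (ft_pair F) r \<theta> x y = A x * (we y * f (x - y) + e y * wf (x - y)) - \<i> * D x * (e y * f (x - y))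
      - e y * (A (x - y) * wf (x - y) - \<i> * D (x - y) * f (x - y))" for y
    unfolding kern_def A_def D_def e_def f_def we_def wf_def of_real_diff by (simp add: algebra_simps)
  have i1: "integrable ZR (\<lambda>y. we y * f (x - y) + e y * wf (x - y))"
    unfolding we_def f_def e_def wf_def x_def by (rule W0_op_conv(2)[OF E F r])
  have i2: "integrable ZR (\<lambda>y. e y * f (x - y))"
    unfolding e_def f_def fst_ft_pair[symmetric] by (rule integrable_conv_ft[OF E F])
  have i3: "integrable ZR (\<lambda>y. A x * (we y * f (x - y) + e y * wf (x - y)) - \<i> * D x * (e y * f (x - y)))"
    using i1 i2 by (intro Bochner_Integration.integrable_diff integrable_mult_right)
  \<comment> \<open>The integrand contains the multipliers at the shifted frequency,
    \<open>Dop\<close> being unbounded. Its integrability is read off as that of a difference: the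
    first half of the commutator minus the kernel.\<close>
  have i4: "integrable ZR (\<lambda>y. e y * (A (x - y) * wf (x - y) - \<i> * D (x - y) * f (x - y)))"
    using Bochner_Integration.integrable_diff[OF i3 kern_ft_pair_integrable[OF E F r, of \<theta> x]] by (simp add: kern)
  have "conv (ft E) (W_op P (ft F)) \<omega> m r \<theta> = (\<integral>y. e y * (A (x - y) * wf (x - y) - \<i> * D (x - y) * f (x - y)) \<partial>ZR)"
    using conv_eq[of "ft E" r \<theta> "W_op P (ft F)" m \<omega>] i4 unfolding Wf fst_ft_pair e_def x_def by simp
  moreover have "W_op P (conv (ft E) (ft F)) \<omega> m r \<theta> = A x * (\<integral>y. we y * f (x - y) + e y * wf (x - y) \<partial>ZR) - \<i> * D x * (\<integral>y. e y * f (x - y) \<partial>ZR)"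
    unfolding W_op_eq[OF r] W0_op_conv(1)[OF E F r] conv_ft_eq[OF E F] fst_ft_pair
    by (simp add: A_def D_def x_def e_def f_def we_def wf_def)
  moreover have "\<dots> = (\<integral>y. A x * (we y * f (x - y) + e y * wf (x - y)) - \<i> * D x * (e y * f (x - y)) \<partial>ZR)"
    using i1 i2 by (subst Bochner_Integration.integral_diff) (auto intro!: integrable_mult_right)
  ultimately show ?thesis
    unfolding commutator_def K0_def x_def[symmetric] kern using i3 i4 by (simp only: Bochner_Integration.integral_diff)
qed

section \<open>Measurability in radius and polar angle\<close>

abbreviation RD where "RD \<equiv> restrict_space lborel (dom_rt P)"

lemma dom_rt_sets [measurable]: "dom_rt P \<in> sets lborel"
  unfolding dom_rt_def by (simp add: borel_open open_Times)

lemma space_RD: "space RD = dom_rt P"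
  by (simp add: space_restrict_space)

lemma sigma_finite_RD: "sigma_finite_measure RD"
  by (rule sigma_finite_measure_restrict_space[OF sigma_finite_lborel dom_rt_sets])

lemma meas_fld_compose:
  assumes f: "meas_fld P f" and b: "b \<in> borel_measurable Q" and c: "c \<in> measurable Q (count_space UNIV)" and z: "z \<in> measurable Q RD"
  shows "(\<lambda>p. f (b p) (c p) (fst (z p)) (snd (z p))) \<in> borel_measurable Q"
proof -
  have "(\<lambda>p. (b p, c p, z p)) \<in> measurable Q (lborel \<Otimes>\<^sub>M (count_space UNIV \<Otimes>\<^sub>M RD))"
    using b c z by measurable
  from measurable_compose[OF this f[unfolded meas_fld_def]] show ?thesis by (simp add: split_beta)
qed

lemma meas_fld_slice:
  assumes f: "meas_fld P f" and z: "(r, \<theta>) \<in> dom_rt P"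
  shows "slice f r \<theta> \<in> borel_measurable ZR"
proof -
  have "(\<lambda>_. (r, \<theta>)) \<in> measurable ZR RD" using z by (simp add: space_RD)
  from meas_fld_compose[OF f _ _ this, of snd fst] show ?thesis
    unfolding slice_def[abs_def] by simp
qed

lemma fst_RD: "fst \<in> borel_measurable RD" and snd_RD: "snd \<in> borel_measurable RD"
proof -
  have "fst \<in> borel_measurable (lborel :: (real \<times> real) measure)" "snd \<in> borel_measurable (lborel :: (real \<times> real) measure)"
    unfolding lborel_prod[symmetric] by measurable
  from this[THEN measurable_restrict_space1] show "fst \<in> borel_measurable RD" "snd \<in> borel_measurable RD" .
qed

text \<open>The kernel is jointly measurable in all its variables because each argument of a field
  is a measurable map of them; integrating out the convolution variable preserves this.\<close>

lemma meas_fld_K0: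
  assumes w: "meas_fld P (fst w)" "meas_fld P (snd w)" and u: "meas_fld P (fst u)" "meas_fld P (snd u)"
  shows "meas_fld P (K0 w u)"
proof -
  let ?N = "lborel \<Otimes>\<^sub>M (count_space (UNIV :: int set) \<Otimes>\<^sub>M RD) :: (real \<times> int \<times> real \<times> real) measure"
  let ?Q = "?N \<Otimes>\<^sub>M ZR"
  have om: "(\<lambda>p. fst (fst p)) \<in> borel_measurable ?Q" "(\<lambda>p. snd (snd p)) \<in> borel_measurable ?Q"
    and m: "(\<lambda>p. fst (snd (fst p))) \<in> measurable ?Q (count_space UNIV)" "(\<lambda>p. fst (snd p)) \<in> measurable ?Q (count_space UNIV)"
    and z: "(\<lambda>p. snd (snd (fst p))) \<in> measurable ?Q RD"
    by measurable
  have r: "(\<lambda>p. fst (snd (snd (fst p)))) \<in> borel_measurable ?Q"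
    using measurable_compose[OF z fst_RD] by simp
  have omd: "(\<lambda>p. fst (fst p) - snd (snd p)) \<in> borel_measurable ?Q" using om by measurable
  have md: "(\<lambda>p. fst (snd (fst p)) - fst (snd p)) \<in> measurable ?Q (count_space UNIV)" using m by (rule measurable_diff_count_space)
  note [measurable] = measurable_Aop[OF om(1) m(1) r] measurable_Aop[OF omd md r] measurable_Dop[OF om(1) m(1) r] measurable_Dop[OF omd md r]
    meas_fld_compose[OF w(1) om(2) m(2) z] meas_fld_compose[OF w(2) om(2) m(2) z]
    meas_fld_compose[OF u(1) omd md z] meas_fld_compose[OF u(2) omd md z]
  have "(\<lambda>p. kern w u (fst (snd (snd (fst p)))) (snd (snd (snd (fst p)))) (fst (snd (fst p)), fst (fst p)) (snd p)) \<in> borel_measurable ?Q"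
    unfolding kern_def slice_def fst_conv snd_conv fst_diff snd_diff by measurable
  then have "(\<lambda>(n, y). kern w u (fst (snd (snd n))) (snd (snd (snd n))) (fst (snd n), fst n) y) \<in> borel_measurable ?Q"
    by (simp add: split_beta')
  from ZR.P.borel_measurable_lebesgue_integral[OF this] show ?thesis
    unfolding meas_fld_def K0_def by (simp add: split_beta')
qed

text \<open>Finiteness follows by comparison with a test function within distance 1 at the same
  \<open>(r, \<theta>)\<close>, whose norm is finite.\<close>

lemma W_space_slice:
  assumes w: "w \<in> W_space P q" and z: "(r, \<theta>) \<in> dom_rt P"
  shows "slice_meas w r \<theta>" "W_norm P q w (r, \<theta>) < \<infinity>"
    "\<exists>E. range E \<subseteq> test_funs P \<and> (\<lambda>n::nat. W_norm P q (pair_diff P w (E n)) (r, \<theta>)) \<longlonglongrightarrow> 0"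
proof -
  have r: "rp P < r" using z by (simp add: dom_rt_def)
  show sm: "slice_meas w r \<theta>"
    using w meas_fld_slice[OF _ z] unfolding W_space_def slice_meas_def by auto
  show "\<exists>E. range E \<subseteq> test_funs P \<and> (\<lambda>n::nat. W_norm P q (pair_diff P w (E n)) (r, \<theta>)) \<longlonglongrightarrow> 0"
    using w z unfolding W_space_def by blast
  then obtain E where E: "range E \<subseteq> test_funs P" "(\<lambda>n::nat. W_norm P q (pair_diff P w (E n)) (r, \<theta>)) \<longlonglongrightarrow> 0" by blast
  have "\<forall>\<^sub>F n in sequentially. W_norm P q (pair_diff P w (E n)) (r, \<theta>) < 1"
    using order_tendstoD(2)[OF E(2)] by simp
  then obtain n where n: "W_norm P q (pair_diff P w (E n)) (r, \<theta>) < 1"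
    by (meson eventually_sequentially order_refl)
  have En: "E n \<in> test_funs P" using E(1) by auto
  have "W_norm P q w (r, \<theta>) \<le> W_norm P q (pair_minus w (ft_pair (E n))) (r, \<theta>) + W_norm P q (ft_pair (E n)) (r, \<theta>)"
    by (rule W_norm_triangle[OF sm ft_pair_slice_meas[OF En r]])
  also have "\<dots> < \<infinity>"
    using n ft_pair_finite(1)[OF En r] unfolding pair_diff_eq by (auto simp: ennreal_add_eq_top less_top[symmetric] top_unique intro: less_trans)
  finally show "W_norm P q w (r, \<theta>) < \<infinity>" .
qed

lemma H_space_slice:
  assumes u: "u \<in> H_space P q" and z: "(r, \<theta>) \<in> dom_rt P"
  shows "slice_meas u r \<theta>" "usq q u r \<theta> < \<infinity>"
    "\<exists>F. range F \<subseteq> test_funs P \<and> (\<lambda>n::nat. H_norm P q (pair_diff P u (F n)) (r, \<theta>)) \<longlonglongrightarrow> 0"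
proof -
  have r: "rp P < r" using z by (simp add: dom_rt_def)
  show sm: "slice_meas u r \<theta>"
    using u meas_fld_slice[OF _ z] unfolding H_space_def slice_meas_def by auto
  show "\<exists>F. range F \<subseteq> test_funs P \<and> (\<lambda>n::nat. H_norm P q (pair_diff P u (F n)) (r, \<theta>)) \<longlonglongrightarrow> 0"
    using u z unfolding H_space_def by blast
  then obtain F where F: "range F \<subseteq> test_funs P" "(\<lambda>n::nat. H_norm P q (pair_diff P u (F n)) (r, \<theta>)) \<longlonglongrightarrow> 0" by blast
  have "\<forall>\<^sub>F n in sequentially. H_norm P q (pair_diff P u (F n)) (r, \<theta>) < 1"
    using order_tendstoD(2)[OF F(2)] by simp
  then obtain n where n: "H_norm P q (pair_diff P u (F n)) (r, \<theta>) < 1"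
    by (meson eventually_sequentially order_refl)
  have Fn: "F n \<in> test_funs P" using F(1) by auto
  note sF = ft_pair_slice_meas[OF Fn r, of \<theta>]
  have "usq q (pair_minus u (ft_pair (F n))) r \<theta> \<le> 2 * (H_norm P q (pair_minus u (ft_pair (F n))) (r, \<theta>))\<^sup>2"
    by (rule H_norm_ge[OF slice_meas_pair_minus[OF sm sF]])
  also have "\<dots> < \<infinity>"
    using less_trans[OF n[unfolded pair_diff_eq] ennreal_one_less_top] by (simp add: power2_eq_square ennreal_mult_less_top)
  finally have 1: "usq q (pair_minus u (ft_pair (F n))) r \<theta> < \<infinity>" .
  have "usq q u r \<theta> \<le> 2 * usq q (pair_minus u (ft_pair (F n))) r \<theta> + 2 * usq q (ft_pair (F n)) r \<theta>"
    by (rule usq_triangle(1)[OF sm sF])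
  also have "\<dots> < \<infinity>" using 1 ft_pair_finite(2)[OF Fn r] by (simp add: ennreal_mult_less_top)
  finally show "usq q u r \<theta> < \<infinity>" .
qed

section \<open>The commutator on the closures\<close>

text \<open>On test functions \<open>K0\<close> is the commutator, and \<open>K0_diff_bound\<close>
  makes it continuous along any approximating sequences.\<close>

lemma is_commutator_K0:
  assumes q: "q \<in> {0..1}" and w: "w \<in> W_space P q" and u: "u \<in> H_space P q"
  shows "is_commutator P q w u (K0 w u)"
  unfolding is_commutator_def
proof (intro conjI ballI allI impI, goal_cases)
  case 1
  have "meas_fld P (fst w)" "meas_fld P (snd w)" "meas_fld P (fst u)" "meas_fld P (snd u)"
    using w u unfolding W_space_def H_space_def by auto
  then show ?case by (rule meas_fld_K0)
next
  case (2 z)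
  obtain r \<theta> where zr: "z = (r, \<theta>)" by (cases z)
  have z: "(r, \<theta>) \<in> dom_rt P" using 2 zr by simp
  have r: "rp P < r" using z by (simp add: dom_rt_def)
  note ws = W_space_slice[OF w z] and us = H_space_slice[OF u z]
  obtain C where C: "0 < C" "\<And>q r w u e f \<theta>. q \<in> {0..1} \<Longrightarrow> rp P < r \<Longrightarrow> slice_meas w r \<theta> \<Longrightarrow> slice_meas u r \<theta> \<Longrightarrow>
    slice_meas e r \<theta> \<Longrightarrow> slice_meas f r \<theta> \<Longrightarrow> W_norm P q w (r, \<theta>) < \<infinity> \<Longrightarrow> usq q u r \<theta> < \<infinity> \<Longrightarrow>
    W_norm P q e (r, \<theta>) < \<infinity> \<Longrightarrow> usq q f r \<theta> < \<infinity> \<Longrightarrow>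
    sq_int (\<lambda>x. slice (K0 w u) r \<theta> x - slice (K0 e f) r \<theta> x)
      \<le> ennreal C * ((W_norm P q (pair_minus w e) (r, \<theta>))\<^sup>2 * usq q f r \<theta> + (W_norm P q w (r, \<theta>))\<^sup>2 * usq q (pair_minus u f) r \<theta>)"
    using K0_diff_bound by auto
  show ?case unfolding zr case_prod_conv
  proof (intro allI impI)
    fix E F :: "nat \<Rightarrow> real \<times> (real ^ 3) \<Rightarrow> complex"
    assume EF: "range E \<subseteq> test_funs P \<and> range F \<subseteq> test_funs P \<and>
        (\<lambda>n. W_norm P q (pair_diff P w (E n)) (r, \<theta>)) \<longlonglongrightarrow> 0 \<and>
        (\<lambda>n. H_norm P q (pair_diff P u (F n)) (r, \<theta>)) \<longlonglongrightarrow> 0"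
    have En: "E n \<in> test_funs P" and Fn: "F n \<in> test_funs P" for n using EF by auto
    define \<alpha> \<beta> where "\<alpha> n = W_norm P q (pair_diff P w (E n)) (r, \<theta>)" and "\<beta> n = H_norm P q (pair_diff P u (F n)) (r, \<theta>)" for n
    have \<alpha>\<beta>: "\<alpha> \<longlonglongrightarrow> 0" "\<beta> \<longlonglongrightarrow> 0" using EF by (auto simp: \<alpha>_def[abs_def] \<beta>_def[abs_def])
    have sq: "(\<lambda>n. (f n)\<^sup>2) \<longlonglongrightarrow> 0" if "f \<longlonglongrightarrow> 0" for f :: "nat \<Rightarrow> ennreal"
      using tendsto_mult_ennreal[OF that that] by (simp add: power2_eq_square)
    have sE: "slice_meas (ft_pair (E n)) r \<theta>" and sF: "slice_meas (ft_pair (F n)) r \<theta>" for n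
      using ft_pair_slice_meas[OF En r] ft_pair_slice_meas[OF Fn r] by auto
    \<comment> \<open>\<open>usq\<close> of the approximating function is at most twice that of the
      difference plus twice that of \<open>u\<close>, and the former is at most
      \<open>2 * (\<beta> n)^2\<close>.\<close>
    define g where "g n = ennreal C * ((\<alpha> n)\<^sup>2 * (4 * (\<beta> n)\<^sup>2 + 2 * usq q u r \<theta>) + (W_norm P q w (r, \<theta>))\<^sup>2 * (2 * (\<beta> n)\<^sup>2))" for n
    define S where "S n = sq_int (\<lambda>x. slice (K0 (ft_pair (E n)) (ft_pair (F n))) r \<theta> x - slice (K0 w u) r \<theta> x)" for n
    have Sg: "S n \<le> g n" for n
    proof -
      have 1: "usq q (pair_minus u (ft_pair (F n))) r \<theta> \<le> 2 * (\<beta> n)\<^sup>2"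
        unfolding \<beta>_def pair_diff_eq by (rule H_norm_ge[OF slice_meas_pair_minus[OF us(1) sF]])
      have "usq q (ft_pair (F n)) r \<theta> \<le> 2 * usq q (pair_minus u (ft_pair (F n))) r \<theta> + 2 * usq q u r \<theta>"
        by (rule usq_triangle(2)[OF us(1) sF])
      also have "\<dots> \<le> 2 * (2 * (\<beta> n)\<^sup>2) + 2 * usq q u r \<theta>" using 1 by (intro add_right_mono mult_left_mono) auto
      finally have 2: "usq q (ft_pair (F n)) r \<theta> \<le> 4 * (\<beta> n)\<^sup>2 + 2 * usq q u r \<theta>" by (simp flip: mult.assoc)
      have "S n = sq_int (\<lambda>x. slice (K0 w u) r \<theta> x - slice (K0 (ft_pair (E n)) (ft_pair (F n))) r \<theta> x)"
        unfolding S_def sq_int_def by (simp add: norm_minus_commute)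
      also have "\<dots> \<le> ennreal C * ((W_norm P q (pair_minus w (ft_pair (E n))) (r, \<theta>))\<^sup>2 * usq q (ft_pair (F n)) r \<theta>
          + (W_norm P q w (r, \<theta>))\<^sup>2 * usq q (pair_minus u (ft_pair (F n))) r \<theta>)"
        by (rule C(2)[OF q r ws(1) us(1) sE sF ws(2) us(2) ft_pair_finite(1)[OF En r] ft_pair_finite(2)[OF Fn r]])
      also have "\<dots> \<le> g n"
        unfolding g_def \<alpha>_def pair_diff_eq using 1 2 by (intro mult_left_mono add_mono) auto
      finally show ?thesis .
    qed
    \<comment> \<open>Multiplication in \<open>ennreal\<close> is not continuous at
      \<open>0 * \<infinity>\<close>; finiteness of the norms of \<open>w\<close> and
      \<open>u\<close> excludes that case.\<close>
    have "g \<longlonglongrightarrow> ennreal C * (0 * (4 * 0 + 2 * usq q u r \<theta>) + (W_norm P q w (r, \<theta>))\<^sup>2 * (2 * 0))"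
      unfolding g_def using us(2) ws(2)
      by (intro tendsto_mult_ennreal tendsto_add tendsto_const sq \<alpha>\<beta>) (auto simp: power2_eq_square ennreal_mult_eq_top_iff)
    then have g0: "g \<longlonglongrightarrow> 0" by simp
    have "S \<longlonglongrightarrow> 0"
      by (rule tendsto_sandwich[OF _ _ tendsto_const g0]) (use Sg in auto)
    moreover have "l2L2 (\<lambda>\<omega> m. commutator P (ft (E n)) (ft (F n)) \<omega> m r \<theta> - K0 w u \<omega> m r \<theta>) = ennsqrt (S n)" for n
    proof -
      have "(\<lambda>x. K0 (ft_pair (E n)) (ft_pair (F n)) (snd x) (fst x) r \<theta> - K0 w u (snd x) (fst x) r \<theta>) \<in> borel_measurable ZR"
        using slice_K0_measurable[OF sE[of n] sF[of n]] slice_K0_measurable[OF ws(1) us(1)]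
        unfolding slice_def[abs_def] by (rule borel_measurable_diff)
      from l2L2_eq[OF this] show ?thesis
        unfolding commutator_ft_pair[OF En Fn r] S_def slice_def .
    qed
    ultimately show "(\<lambda>n. l2L2 (\<lambda>\<omega> m. commutator P (ft (E n)) (ft (F n)) \<omega> m r \<theta> - K0 w u \<omega> m r \<theta>)) \<longlonglongrightarrow> 0"
      by (simp add: ennsqrt_tendsto_0)
  qed
qed

text \<open>Membership in the closures supplies approximating sequences, so the defining implication
  is not vacuous, and both representatives are limits of the same commutators.\<close>

lemma is_commutator_unique:
  assumes K: "is_commutator P q w u K" and K': "is_commutator P q w u K'" and q: "q \<in> {0..1}"
    and w: "w \<in> W_space P q" and u: "u \<in> H_space P q" and z: "(r, \<theta>) \<in> dom_rt P"
  shows "sq_int (\<lambda>x. slice K r \<theta> x - slice K' r \<theta> x) = 0"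
proof -
  have r: "rp P < r" using z by (simp add: dom_rt_def)
  obtain E where E: "range E \<subseteq> test_funs P" "(\<lambda>n::nat. W_norm P q (pair_diff P w (E n)) (r, \<theta>)) \<longlonglongrightarrow> 0"
    using W_space_slice(3)[OF w z] by blast
  obtain F where F: "range F \<subseteq> test_funs P" "(\<lambda>n::nat. H_norm P q (pair_diff P u (F n)) (r, \<theta>)) \<longlonglongrightarrow> 0"
    using H_space_slice(3)[OF u z] by blast
  have En: "E n \<in> test_funs P" and Fn: "F n \<in> test_funs P" for n using E F by auto
  have sKn [measurable]: "slice (K0 (ft_pair (E n)) (ft_pair (F n))) r \<theta> \<in> borel_measurable ZR" for n
    by (rule slice_K0_measurable[OF ft_pair_slice_meas[OF En r] ft_pair_slice_meas[OF Fn r]])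
  define S where "S K n = sq_int (\<lambda>x. slice (K0 (ft_pair (E n)) (ft_pair (F n))) r \<theta> x - slice K r \<theta> x)" for K n
  have lim: "S K \<longlonglongrightarrow> 0" and sK: "slice K r \<theta> \<in> borel_measurable ZR" if "is_commutator P q w u K" for K
  proof -
    show sK: "slice K r \<theta> \<in> borel_measurable ZR"
      using that z meas_fld_slice unfolding is_commutator_def by blast
    have "(\<lambda>n. l2L2 (\<lambda>\<omega> m. commutator P (ft (E n)) (ft (F n)) \<omega> m r \<theta> - K \<omega> m r \<theta>)) \<longlonglongrightarrow> 0"
      using that z E F unfolding is_commutator_def by blast
    moreover have "l2L2 (\<lambda>\<omega> m. commutator P (ft (E n)) (ft (F n)) \<omega> m r \<theta> - K \<omega> m r \<theta>) = ennsqrt (S K n)" for n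
    proof -
      have "(\<lambda>x. K0 (ft_pair (E n)) (ft_pair (F n)) (snd x) (fst x) r \<theta> - K (snd x) (fst x) r \<theta>) \<in> borel_measurable ZR"
        using sKn[of n] sK unfolding slice_def[abs_def] by (rule borel_measurable_diff)
      from l2L2_eq[OF this] show ?thesis
        unfolding commutator_ft_pair[OF En Fn r] S_def slice_def .
    qed
    ultimately show "S K \<longlonglongrightarrow> 0" by (simp add: ennsqrt_tendsto_0)
  qed
  note [measurable] = sK[OF K] sK[OF K']
  have "sq_int (\<lambda>x. slice K r \<theta> x - slice K' r \<theta> x) \<le> 2 * S K n + 2 * S K' n" for n
    unfolding S_def
  proof (rule sq_int_add_le)
    show "norm (slice K r \<theta> x - slice K' r \<theta> x) \<le> norm (slice (K0 (ft_pair (E n)) (ft_pair (F n))) r \<theta> x - slice K r \<theta> x)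
        + norm (slice (K0 (ft_pair (E n)) (ft_pair (F n))) r \<theta> x - slice K' r \<theta> x)" for x
      using norm_triangle_ineq4[of "slice (K0 (ft_pair (E n)) (ft_pair (F n))) r \<theta> x - slice K' r \<theta> x" "slice (K0 (ft_pair (E n)) (ft_pair (F n))) r \<theta> x - slice K r \<theta> x"]
      by simp
  qed measurable
  moreover have "(\<lambda>n. 2 * S K n + 2 * S K' n) \<longlonglongrightarrow> 2 * 0 + 2 * 0"
    by (intro tendsto_mult_ennreal tendsto_add tendsto_const lim K K') auto
  ultimately have "sq_int (\<lambda>x. slice K r \<theta> x - slice K' r \<theta> x) \<le> 2 * 0 + 2 * 0"
    by (intro LIMSEQ_le_const) auto
  then show ?thesis by simp
qed

text \<open>Transfers the bound from \<open>K0\<close> to an arbitrary representative, from which it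
  differs only on a null set of frequencies at each \<open>(r, \<theta>)\<close>.\<close>

lemma commutator_slice_bound:
  "\<exists>C>0. \<forall>q\<in>{0..1}. \<forall>u\<in>H_space P q. \<forall>w\<in>W_space P q. \<forall>K r \<theta>. is_commutator P q w u K \<longrightarrow> (r, \<theta>) \<in> dom_rt P \<longrightarrow>
    sq_int (slice K r \<theta>) \<le> ennreal C * ((W_norm P q w (r, \<theta>))\<^sup>2 * usq q u r \<theta>)"
proof -
  obtain C where C: "0 < C" "\<And>q r w u \<theta>. q \<in> {0..1} \<Longrightarrow> rp P < r \<Longrightarrow> slice_meas w r \<theta> \<Longrightarrow> slice_meas u r \<theta> \<Longrightarrow>
    sq_int (slice (K0 w u) r \<theta>) \<le> ennreal C * ((W_norm P q w (r, \<theta>))\<^sup>2 * usq q u r \<theta>)"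
    using K0_bound by auto
  have "sq_int (slice K r \<theta>) \<le> ennreal (2 * C) * ((W_norm P q w (r, \<theta>))\<^sup>2 * usq q u r \<theta>)"
    if q: "q \<in> {0..1}" and u: "u \<in> H_space P q" and w: "w \<in> W_space P q" and K: "is_commutator P q w u K" and z: "(r, \<theta>) \<in> dom_rt P"
    for q u w K r \<theta>
  proof -
    have r: "rp P < r" using z by (simp add: dom_rt_def)
    note ws = W_space_slice(1)[OF w z] and us = H_space_slice(1)[OF u z]
    have [measurable]: "slice K r \<theta> \<in> borel_measurable ZR" "slice (K0 w u) r \<theta> \<in> borel_measurable ZR"
      using K z meas_fld_slice slice_K0_measurable[OF ws us] unfolding is_commutator_def by blast+
    have "sq_int (slice K r \<theta>) \<le> 2 * sq_int (\<lambda>x. slice K r \<theta> x - slice (K0 w u) r \<theta> x) + 2 * sq_int (slice (K0 w u) r \<theta>)"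
    proof (rule sq_int_add_le)
      show "norm (slice K r \<theta> x) \<le> norm (slice K r \<theta> x - slice (K0 w u) r \<theta> x) + norm (slice (K0 w u) r \<theta> x)" for x
        using norm_triangle_ineq[of "slice K r \<theta> x - slice (K0 w u) r \<theta> x" "slice (K0 w u) r \<theta> x"] by simp
    qed measurable
    also have "\<dots> = 2 * sq_int (slice (K0 w u) r \<theta>)"
      using is_commutator_unique[OF K is_commutator_K0[OF q w u] q w u z] by simp
    also have "\<dots> \<le> 2 * (ennreal C * ((W_norm P q w (r, \<theta>))\<^sup>2 * usq q u r \<theta>))"
      by (intro mult_left_mono C(2)[OF q r ws us]) auto
    also have "\<dots> = ennreal (2 * C) * ((W_norm P q w (r, \<theta>))\<^sup>2 * usq q u r \<theta>)"
      using C(1) by (simp add: ennreal_mult mult.assoc)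
    finally show ?thesis .
  qed
  moreover have "0 < 2 * C" using C(1) by simp
  ultimately show ?thesis by blast
qed

text \<open>The weights are merely Lebesgue measurable whereas the integrals are taken over a Borel
  measure; replacing a weight by an almost equal Borel function makes Tonelli's theorem
  available.\<close>

lemma lebesgue_on_AE_borel:
  assumes "f \<in> borel_measurable (lebesgue_on (dom_rt P))"
  obtains g :: "real \<times> real \<Rightarrow> real" where "g \<in> borel_measurable borel" "AE z in RD. f z = g z"
proof -
  have d: "dom_rt P \<in> sets lebesgue" using dom_rt_sets by auto
  have "(\<lambda>z. if z \<in> dom_rt P then f z else 0) \<in> borel_measurable lebesgue"
    using assms by (rule borel_measurable_if_I[OF _ d])
  from completion_ex_borel_measurable_real[OF this]
  obtain g where g: "g \<in> borel_measurable lborel" "AE z in lborel. (if z \<in> dom_rt P then f z else 0) = g z"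
    by (rule bexE)
  have "dom_rt P \<inter> space lborel \<in> sets lborel" using dom_rt_sets by simp
  moreover have "AE z in lborel. z \<in> dom_rt P \<longrightarrow> f z = g z" using g(2) by eventually_elim (simp split: if_splits)
  ultimately have "AE z in RD. f z = g z" by (simp only: AE_restrict_space_iff)
  moreover have "g \<in> borel_measurable borel" using g(1) by simp
  ultimately show ?thesis by (rule that[rotated])
qed

lemma usq_measurable:
  assumes u: "u \<in> H_space P q"
  shows "(\<lambda>z. usq q u (fst z) (snd z)) \<in> borel_measurable RD"
proof -
  let ?Q = "RD \<Otimes>\<^sub>M ZR"
  have mu: "meas_fld P (fst u)" "meas_fld P (snd u)" using u by (auto simp: H_space_def)
  have om: "(\<lambda>p. snd (snd p)) \<in> borel_measurable ?Q" and m: "(\<lambda>p. fst (snd p)) \<in> measurable ?Q (count_space UNIV)"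
    and z: "fst \<in> measurable ?Q RD"
    by measurable
  have r: "(\<lambda>p. fst (fst p)) \<in> borel_measurable ?Q" using measurable_compose[OF z fst_RD] by simp
  note [measurable] = om m r meas_fld_compose[OF mu(1) om m z] meas_fld_compose[OF mu(2) om m z]
  have "(\<lambda>p. ennreal ((udens q u (fst (fst p)) (snd (fst p)) (snd p))\<^sup>2)) \<in> borel_measurable ?Q"
    unfolding udens_def slice_def by measurable
  then have "(\<lambda>(z, x). ennreal ((udens q u (fst z) (snd z) x)\<^sup>2)) \<in> borel_measurable ?Q" by (simp add: split_beta')
  from ZR.P.borel_measurable_nn_integral[OF this] show ?thesis unfolding usq_def .
qed

text \<open>Tonelli moves the frequency integral inside, where the slice bound applies. The norm of
  \<open>w\<close> with its weight is replaced by the supremum pointwise, before integration over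
  \<open>(r, \<theta>)\<close>.\<close>

lemma commutator_integral_bound:
  assumes q: "q \<in> {0..1}" and u: "u \<in> H_space P q" and w: "w \<in> W_space P q" and K: "is_commutator P q w u K"
    and C: "0 < C" and bound: "\<And>r \<theta>. (r, \<theta>) \<in> dom_rt P \<Longrightarrow> sq_int (slice K r \<theta>) \<le> ennreal C * ((W_norm P q w (r, \<theta>))\<^sup>2 * usq q u r \<theta>)"
    and a1: "a1 \<in> borel_measurable (lebesgue_on (dom_rt P))" and a2: "a2 \<in> borel_measurable (lebesgue_on (dom_rt P))"
    and b: "\<forall>z\<in>dom_rt P. 0 \<le> a1 z \<and> 0 \<le> a2 z \<and> b z = a1 z * a2 z"
  shows "(\<integral>\<^sup>+m. \<integral>\<^sup>+\<omega>. \<integral>\<^sup>+z. ennreal ((b z)\<^sup>2 * (norm (K \<omega> m (fst z) (snd z)))\<^sup>2 * sin (snd z)) \<partial>RD \<partial>lborel \<partial>count_space UNIV)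
    \<le> ennreal (2 * C) * (SUP z\<in>dom_rt P. ennreal ((a1 z)\<^sup>2) * (W_norm P q w z)\<^sup>2)
       * (\<integral>\<^sup>+z. ennreal ((a2 z)\<^sup>2 * sin (snd z)) * (H_norm P q u z)\<^sup>2 \<partial>RD)"
proof -
  interpret RD: sigma_finite_measure RD by (rule sigma_finite_RD)
  interpret ZRD: pair_sigma_finite ZR RD by (intro pair_sigma_finite.intro sigma_finite_ZR sigma_finite_RD)
  define S where "S = (SUP z\<in>dom_rt P. ennreal ((a1 z)\<^sup>2) * (W_norm P q w z)\<^sup>2)"
  obtain g1 where g1: "g1 \<in> borel_measurable borel" "AE z in RD. a1 z = g1 z" by (rule lebesgue_on_AE_borel[OF a1])
  obtain g2 where g2: "g2 \<in> borel_measurable borel" "AE z in RD. a2 z = g2 z" by (rule lebesgue_on_AE_borel[OF a2])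
  have gm [measurable]: "g1 \<in> borel_measurable RD" "g2 \<in> borel_measurable RD"
    using g1(1) g2(1) by (auto intro!: measurable_restrict_space1)
  note [measurable] = snd_RD fst_RD usq_measurable[OF u]
  define h where "h z = (g1 z * g2 z)\<^sup>2 * sin (snd z)" for z
  have hm [measurable]: "h \<in> borel_measurable RD" unfolding h_def[abs_def] by measurable
  have Km: "meas_fld P K" using K by (simp add: is_commutator_def)
  have bh: "AE z in RD. b z = g1 z * g2 z"
    using g1(2) g2(2) AE_space by eventually_elim (use b in \<open>auto simp: space_RD\<close>)
  have sin_nn: "0 \<le> sin (snd z)" if "z \<in> dom_rt P" for z
    using that by (cases z) (auto simp: dom_rt_def intro: sin_ge_zero)
  let ?k = "\<lambda>x z. ennreal (h z * (norm (K (snd x) (fst x) (fst z) (snd z)))\<^sup>2)"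
  have km: "case_prod ?k \<in> borel_measurable (ZR \<Otimes>\<^sub>M RD)"
  proof -
    have [measurable]: "(\<lambda>p. K (snd (fst p)) (fst (fst p)) (fst (snd p)) (snd (snd p))) \<in> borel_measurable (ZR \<Otimes>\<^sub>M RD)"
      by (rule meas_fld_compose[OF Km]; measurable)
    show ?thesis unfolding split_beta' by measurable
  qed
  have "(\<integral>\<^sup>+m. \<integral>\<^sup>+\<omega>. \<integral>\<^sup>+z. ennreal ((b z)\<^sup>2 * (norm (K \<omega> m (fst z) (snd z)))\<^sup>2 * sin (snd z)) \<partial>RD \<partial>lborel \<partial>count_space UNIV)
      = (\<integral>\<^sup>+m. \<integral>\<^sup>+\<omega>. \<integral>\<^sup>+z. ?k (m, \<omega>) z \<partial>RD \<partial>lborel \<partial>count_space UNIV)"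
  \<comment> \<open>For each frequency the weight is exchanged for its Borel version, so that the
    integrand becomes jointly measurable.\<close>
  proof (rule nn_integral_cong, rule nn_integral_cong, rule nn_integral_cong_AE)
    fix m \<omega>
    show "AE z in RD. ennreal ((b z)\<^sup>2 * (norm (K \<omega> m (fst z) (snd z)))\<^sup>2 * sin (snd z)) = ?k (m, \<omega>) z"
      using bh by eventually_elim (simp add: h_def mult_ac)
  qed
  also have "\<dots> = (\<integral>\<^sup>+x. \<integral>\<^sup>+z. ?k x z \<partial>RD \<partial>ZR)"
    by (rule nn_integral_ZR[where f = "\<lambda>x. \<integral>\<^sup>+z. ?k x z \<partial>RD"]) (rule RD.borel_measurable_nn_integral[OF km])
  also have "\<dots> = (\<integral>\<^sup>+z. \<integral>\<^sup>+x. ?k x z \<partial>ZR \<partial>RD)"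
    by (rule ZRD.Fubini'[OF km, symmetric])
  \<comment> \<open>The measurable quantity \<open>usq / 2\<close> stands in for the square of
    \<open>H_norm\<close> until the constant has been pulled out of the integral.\<close>
  also have "\<dots> \<le> (\<integral>\<^sup>+z. (ennreal (2 * C) * S) * (ennreal ((g2 z)\<^sup>2 * sin (snd z)) * (usq q u (fst z) (snd z) / 2)) \<partial>RD)"
  proof (rule nn_integral_mono_AE)
    show "AE z in RD. (\<integral>\<^sup>+x. ?k x z \<partial>ZR) \<le> (ennreal (2 * C) * S) * (ennreal ((g2 z)\<^sup>2 * sin (snd z)) * (usq q u (fst z) (snd z) / 2))"
      using g1(2) g2(2) AE_space
    proof eventually_elim
      fix z assume g: "a1 z = g1 z" "a2 z = g2 z" and "z \<in> space RD"
      then have z: "z \<in> dom_rt P" by (simp add: space_RD)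
      then have z': "(fst z, snd z) \<in> dom_rt P" by simp
      have hz: "0 \<le> h z" using sin_nn[OF z] by (simp add: h_def)
      have [measurable]: "slice K (fst z) (snd z) \<in> borel_measurable ZR" by (rule meas_fld_slice[OF Km z'])
      have "(\<integral>\<^sup>+x. ?k x z \<partial>ZR) = (\<integral>\<^sup>+x. ennreal (h z) * ennreal ((norm (slice K (fst z) (snd z) x))\<^sup>2) \<partial>ZR)"
        using hz by (simp add: ennreal_mult slice_def)
      also have "\<dots> = ennreal (h z) * sq_int (slice K (fst z) (snd z))"
        unfolding sq_int_def by (rule nn_integral_cmult) measurable
      also have "\<dots> \<le> ennreal (h z) * (ennreal C * ((W_norm P q w z)\<^sup>2 * usq q u (fst z) (snd z)))"
        using bound[OF z'] by (intro mult_left_mono) auto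
      also have "ennreal (h z) = ennreal ((a1 z)\<^sup>2) * ennreal ((g2 z)\<^sup>2 * sin (snd z))"
        using sin_nn[OF z] g by (simp add: h_def power_mult_distrib mult.assoc flip: ennreal_mult)
      also have "ennreal ((a1 z)\<^sup>2) * ennreal ((g2 z)\<^sup>2 * sin (snd z)) * (ennreal C * ((W_norm P q w z)\<^sup>2 * usq q u (fst z) (snd z)))
          = ennreal C * (ennreal ((a1 z)\<^sup>2) * (W_norm P q w z)\<^sup>2) * (ennreal ((g2 z)\<^sup>2 * sin (snd z)) * usq q u (fst z) (snd z))"
        by (simp only: mult_ac)
      also have "\<dots> \<le> ennreal C * S * (ennreal ((g2 z)\<^sup>2 * sin (snd z)) * usq q u (fst z) (snd z))"
        unfolding S_def using z by (intro mult_right_mono mult_left_mono SUP_upper) auto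
      also have "usq q u (fst z) (snd z) = 2 * (usq q u (fst z) (snd z) / 2)"
        using ennreal_mult_divide_eq[of 2 "usq q u (fst z) (snd z)"] by (simp add: ennreal_times_divide mult.commute)
      also have "ennreal C * S * (ennreal ((g2 z)\<^sup>2 * sin (snd z)) * (2 * (usq q u (fst z) (snd z) / 2)))
          = (ennreal (2 * C) * S) * (ennreal ((g2 z)\<^sup>2 * sin (snd z)) * (usq q u (fst z) (snd z) / 2))"
        using C by (simp add: ennreal_mult mult_ac)
      finally show "(\<integral>\<^sup>+x. ?k x z \<partial>ZR) \<le> (ennreal (2 * C) * S) * (ennreal ((g2 z)\<^sup>2 * sin (snd z)) * (usq q u (fst z) (snd z) / 2))" .
    qed
  qed
  also have "\<dots> = (ennreal (2 * C) * S) * (\<integral>\<^sup>+z. ennreal ((g2 z)\<^sup>2 * sin (snd z)) * (usq q u (fst z) (snd z) / 2) \<partial>RD)"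
    by (rule nn_integral_cmult) measurable
  also have "\<dots> \<le> (ennreal (2 * C) * S) * (\<integral>\<^sup>+z. ennreal ((a2 z)\<^sup>2 * sin (snd z)) * (H_norm P q u z)\<^sup>2 \<partial>RD)"
  proof (rule mult_left_mono, rule nn_integral_mono_AE)
    show "AE z in RD. ennreal ((g2 z)\<^sup>2 * sin (snd z)) * (usq q u (fst z) (snd z) / 2) \<le> ennreal ((a2 z)\<^sup>2 * sin (snd z)) * (H_norm P q u z)\<^sup>2"
      using g2(2) AE_space
    proof eventually_elim
      fix z assume g: "a2 z = g2 z" and "z \<in> space RD"
      then have z: "(fst z, snd z) \<in> dom_rt P" by (simp add: space_RD)
      have "usq q u (fst z) (snd z) \<le> 2 * (H_norm P q u z)\<^sup>2"
        using H_norm_ge[OF H_space_slice(1)[OF u z]] by simp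
      then have "usq q u (fst z) (snd z) / 2 \<le> 2 * (H_norm P q u z)\<^sup>2 / 2" by (rule divide_right_mono_ennreal)
      also have "\<dots> = (H_norm P q u z)\<^sup>2"
        using ennreal_mult_divide_eq[of 2 "(H_norm P q u z)\<^sup>2"] by (simp add: mult.commute)
      finally show "ennreal ((g2 z)\<^sup>2 * sin (snd z)) * (usq q u (fst z) (snd z) / 2) \<le> ennreal ((a2 z)\<^sup>2 * sin (snd z)) * (H_norm P q u z)\<^sup>2"
        unfolding g by (intro mult_left_mono) auto
    qed
  qed simp
  finally show ?thesis unfolding S_def .
qed

end

theorem proposition6p1:
  fixes P :: kerr_data
  assumes "kerr_setup P"
  shows "\<exists>C::real. 0 < C \<and>
    (\<forall>q\<in>{0..1}. \<forall>u\<in>H_space P q. \<forall>w\<in>W_space P q.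
      (\<exists>K. is_commutator P q w u K) \<and>
      (\<forall>K (a :: real \<times> real \<Rightarrow> real) a1 a2.
         is_commutator P q w u K \<longrightarrow>
         a1 \<in> borel_measurable (lebesgue_on (dom_rt P)) \<longrightarrow>
         a2 \<in> borel_measurable (lebesgue_on (dom_rt P)) \<longrightarrow>
         (\<forall>z\<in>dom_rt P. 0 \<le> a1 z \<and> 0 \<le> a2 z \<and> a z = a1 z * a2 z) \<longrightarrow>
         (\<integral>\<^sup>+m. \<integral>\<^sup>+\<omega>. \<integral>\<^sup>+z.
             ennreal ((a z)\<^sup>2 * (norm (K \<omega> m (fst z) (snd z)))\<^sup>2 * sin (snd z))
             \<partial>restrict_space lborel (dom_rt P) \<partial>lborel \<partial>count_space UNIV)
         \<le> ennreal C
            * (SUP z\<in>dom_rt P. ennreal ((a1 z)\<^sup>2) * (W_norm P q w z)\<^sup>2)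
            * (\<integral>\<^sup>+z.
                ennreal ((a2 z)\<^sup>2 * sin (snd z)) * (H_norm P q u z)\<^sup>2
                \<partial>restrict_space lborel (dom_rt P))))"
proof -
  interpret kerr P by (rule kerr.intro) fact
  obtain C where C: "0 < C" "\<And>q u w K r \<theta>. q \<in> {0..1} \<Longrightarrow> u \<in> H_space P q \<Longrightarrow> w \<in> W_space P q \<Longrightarrow>
    is_commutator P q w u K \<Longrightarrow> (r, \<theta>) \<in> dom_rt P \<Longrightarrow>
    sq_int (slice K r \<theta>) \<le> ennreal C * ((W_norm P q w (r, \<theta>))\<^sup>2 * usq q u r \<theta>)"
    using commutator_slice_bound by auto
  show ?thesis
  \<comment> \<open>The factor 2 comes from \<open>H_norm_ge\<close>.\<close>
  proof (intro exI[of _ "2 * C"] conjI ballI allI impI)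
    show "0 < 2 * C" using C(1) by simp
  next
    fix q u w assume *: "q \<in> {0..1}" "u \<in> H_space P q" "w \<in> W_space P q"
    show "\<exists>K. is_commutator P q w u K" using is_commutator_K0[OF *(1,3,2)] by blast
  next
    fix q u w K and b a1 a2 :: "real \<times> real \<Rightarrow> real"
    assume *: "q \<in> {0..1}" "u \<in> H_space P q" "w \<in> W_space P q" "is_commutator P q w u K"
      and a: "a1 \<in> borel_measurable (lebesgue_on (dom_rt P))" "a2 \<in> borel_measurable (lebesgue_on (dom_rt P))"
        "\<forall>z\<in>dom_rt P. 0 \<le> a1 z \<and> 0 \<le> a2 z \<and> b z = a1 z * a2 z"
    show "(\<integral>\<^sup>+m. \<integral>\<^sup>+\<omega>. \<integral>\<^sup>+z. ennreal ((b z)\<^sup>2 * (norm (K \<omega> m (fst z) (snd z)))\<^sup>2 * sin (snd z)) \<partial>RD \<partial>lborel \<partial>count_space UNIV)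
      \<le> ennreal (2 * C) * (SUP z\<in>dom_rt P. ennreal ((a1 z)\<^sup>2) * (W_norm P q w z)\<^sup>2)
       * (\<integral>\<^sup>+z. ennreal ((a2 z)\<^sup>2 * sin (snd z)) * (H_norm P q u z)\<^sup>2 \<partial>RD)"
      by (rule commutator_integral_bound[OF * C(1) C(2)[OF *] a])
  qed
qed

end
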